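(* Let the dynamical conductances $b_t(x)$ satisfy the standing assumption in the context and $\mathbb E[b_0(0)]<\infty$, $\mathbb E[b_0(0)^{-1}]<\infty$. For $\epsilon>0$ let $\phi_\epsilon(f):=\mathbb E(\varphi_\epsilon f)$, $f\in L^\infty(\mathbb P)$, with $\varphi_\epsilon$ as in the context. Then for each $\epsilon>0$, the linear functional $\phi_\epsilon$ extends to a continuous linear functional on $$\mathcal H:=\bigl\{f\in L^0(\mathbb P)\colon\mathbb E(b_0(0)^{-1}f^2)<\infty\bigr\}$$ with norm bounded by $[\mathbb E(b_0(0))]^{1/2}$ regardless of $\epsilon>0$. In particular, weak sequential limits of $\phi_\epsilon$ as $\epsilon\downarrow0$ exist and take the form $f\mapsto\mathbb E(\varphi f)$ for some $\varphi\in L^0(\mathbb P)$ satisfying $$\varphi\ge0,\quad\mathbb E(\varphi)=1\quad\text{and}\quad\mathbb E(b_0(0)\varphi^2)\le\mathbb E(b_0(0)).$$ In addition, for each $t>0$ we have $$\varphi=\sum_{x\in\mathbb Z}\varphi\circ\tau_{t,x}\,K(t,x;0,0),\quad\mathbb P\text{-a.s.}$$ In particular, $\varphi$ admits a version such that $\mathbb P(\varphi>0)=1$ and that, on a set of full $\mathbb P$-measure, $t\mapsto\varphi\circ\tau_{t,x}$ is continuous and weakly differentiable with $$\frac{\partial}{\partial t}\varphi\circ\tau_{t,x}+(\mathcal L^+\varphi)\circ\tau_{t,x}=0,\quad t\in\mathbb R,\ x\in\mathbb Z,$$ where $\mathcal L^+f:=b_0(1)f\circ\tau_{0,1}+b_0(-1)f\circ\tau_{0,-1}-2b_0(0)f$.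 The measure $\mathbb Q(da):=\varphi(a)\mathbb P(da)$ is stationary and ergodic for the induced Markov chain $t\mapsto\tau_{-t,Y_t}(a)$ on $\Omega$.
   Context: Standing assumption. $(\Omega,\mathcal F,\mathbb P)$ is a probability space with expectation $\mathbb E$; $L^0(\mathbb P)$ is the set of equivalence classes of measurable functions on it, and $\mathcal H$ carries the norm $[\mathbb E(b_0(0)^{-1}f^2)]^{1/2}$. For each $t\in\mathbb R$, $x\in\mathbb Z$, the conductance $b_t(x)$ is a function $\Omega\to(0,\infty)$; for each $x$ the map $(t,\omega)\mapsto b_t(x)$ is $\mathcal B(\mathbb R)\otimes\mathcal F$-measurable and locally Lebesgue integrable in $t$. There are space-time shifts $\tau_{t,x}\colon\Omega\to\Omega$, $t\in\mathbb R$, $x\in\mathbb Z$ (a jointly measurable action of $\mathbb R\times\mathbb Z$), with $b_s(y)\circ\tau_{t,x}=b_{s+t}(y+x)$. $\mathbb P$ is invariant and ergodic with respect to $\{\tau_{t,x}\}$. For a random variable $f$, $f\circ\tau_{t,x}$ denotes $\omega\mapsto f(\tau_{t,x}\omega)$. Dual walk kernel. For reals $t\le s$ and $x,y\in\mathbb Z$, set $K_0:=0$ and inductively $$K_{n+1}(s,x;t,y):=e^{-\int_t^s2b_u(x)du}\delta_{x,y}+\int_t^sdr\,e^{-\int_r^s2b_u(x)du}\,b_r(x)\sum_{z=\pm1}K_n(r,x+z;t,y).$$ $K_n$ is non-decreasing in $n$ with values in $[0,1]$; $K:=\lim_{n\to\infty}K_n$. For $\mathbb P$-a.e. environment $K(0,x;-t,\cdot)$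 is the transition probability $P^x_a(Y_t=\cdot)$ of the dual random walk $Y$, the non-explosive Markov chain on $\mathbb Z$ which at time $t$ jumps from $x$ to each of $x\pm1$ at rate $b_{-t}(x)$. Define $$\varphi_\epsilon:=\epsilon\int_0^\infty dt\,e^{-\epsilon t}\sum_{y\in\mathbb Z}K(t,y;0,0),\quad\epsilon>0,$$ which satisfies $\varphi_\epsilon\ge0$ and $\mathbb E\varphi_\epsilon=1$. Weak sequential limits: limits along sequences $\epsilon_k\downarrow0$ with $\phi_{\epsilon_k}(f)$ converging for every $f\in\mathcal H$. Weakly differentiable with the stated derivative means the equation holds in time-integrated form. The induced chain $t\mapsto\tau_{-t,Y_t}(a)$ has $Y_0=0$ and moves in time $t\ge0$ from $a\in\Omega$ to $\tau_{-t,y}(a)$ with probability $K(0,0;-t,y)$ (evaluated at $a$). Ergodic means: every measurable $A\subseteq\Omega$ such that for $\mathbb Q$-a.e. $a\in A$ and each $t>0$ one has $\tau_{-t,Y_t}(a)\in A$ for $P^0_a$-a.e. sample of $Y$ satisfies $\mathbb Q(A)\in\{0,1\}$. *)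

theory Defs
  imports "HOL-Probability.Probability"
begin

text \<open>
  Random variables on the environment space carry the environment \<open>\<omega>\<close> as their last argument:
  \<open>b t x \<omega>\<close> is the conductance $b_t(x)$, and \<open>\<tau> t x\<close> is the space-time shift. The space coordinate
  is of type \<^typ>\<open>int\<close>, so joint measurability in it amounts to measurability for each fixed value.
\<close>

locale dynamical_environment = prob_space M
  for M :: "'a measure" +
  fixes b :: "real \<Rightarrow> int \<Rightarrow> 'a \<Rightarrow> real"
    and \<tau> :: "real \<Rightarrow> int \<Rightarrow> 'a \<Rightarrow> 'a"
  assumes conductance_pos: "\<And>t x \<omega>. \<omega> \<in> space M \<Longrightarrow> b t x \<omega> > 0"
    and conductance_measurable: "\<And>x. (\<lambda>(t, \<omega>). b t x \<omega>) \<in> borel_measurable (borel \<Otimes>\<^sub>M M)"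
    and conductance_locally_integrable:
      "\<And>x \<omega> s t. \<omega> \<in> space M \<Longrightarrow> set_integrable lborel {s..t} (\<lambda>u. b u x \<omega>)"
    and shift_measurable: "\<And>x. (\<lambda>(t, \<omega>). \<tau> t x \<omega>) \<in> measurable (borel \<Otimes>\<^sub>M M) M"
    and shift_zero: "\<And>\<omega>. \<omega> \<in> space M \<Longrightarrow> \<tau> 0 0 \<omega> = \<omega>"
    and shift_add: "\<And>s t x y \<omega>. \<omega> \<in> space M \<Longrightarrow> \<tau> s y (\<tau> t x \<omega>) = \<tau> (s + t) (y + x) \<omega>"
    and conductance_shift: "\<And>s t x y \<omega>. \<omega> \<in> space M \<Longrightarrow> b s y (\<tau> t x \<omega>) = b (s + t) (y + x) \<omega>"
    and shift_invariant: "\<And>t x. distr M M (\<tau> t x) = M"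
    and shift_ergodic: "\<And>A. A \<in> sets M \<Longrightarrow> (\<And>t x. \<tau> t x -` A \<inter> space M = A) \<Longrightarrow> measure M A \<in> {0, 1}"

text \<open>\<open>dual_kernel b s x t y\<close> is $K(s,x;t,y)$; it is only meaningful for \<open>t \<le> s\<close>.\<close>

primrec dual_kernel_n ::
  "(real \<Rightarrow> int \<Rightarrow> 'a \<Rightarrow> real) \<Rightarrow> nat \<Rightarrow> real \<Rightarrow> int \<Rightarrow> real \<Rightarrow> int \<Rightarrow> 'a \<Rightarrow> real" where
  "dual_kernel_n b 0 s x t y \<omega> = 0"
| "dual_kernel_n b (Suc n) s x t y \<omega> =
     exp (- (LINT u:{t..s}|lborel. 2 * b u x \<omega>)) * (if x = y then 1 else 0)
     + (LINT r:{t..s}|lborel. exp (- (LINT u:{r..s}|lborel. 2 * b u x \<omega>)) * b r x \<omega>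
          * (\<Sum>z\<in>{1, -1}. dual_kernel_n b n r (x + z) t y \<omega>))"

definition dual_kernel ::
  "(real \<Rightarrow> int \<Rightarrow> 'a \<Rightarrow> real) \<Rightarrow> real \<Rightarrow> int \<Rightarrow> real \<Rightarrow> int \<Rightarrow> 'a \<Rightarrow> real" where
  "dual_kernel b s x t y \<omega> = lim (\<lambda>n. dual_kernel_n b n s x t y \<omega>)"

text \<open>
  The integral and the sum are evaluated in \<^typ>\<open>ennreal\<close>, where they always make sense; only
  afterwards is the (almost surely finite) value converted to a real number.
\<close>

definition varphi_eps :: "(real \<Rightarrow> int \<Rightarrow> 'a \<Rightarrow> real) \<Rightarrow> real \<Rightarrow> 'a \<Rightarrow> real" where
  "varphi_eps b \<epsilon> \<omega> =
     enn2real (ennreal \<epsilon> * (\<integral>\<^sup>+ t\<in>{0..}. ennreal (exp (- \<epsilon> * t))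
                 * (\<Sum>\<^sub>\<infinity>y\<in>UNIV. ennreal (dual_kernel b t y 0 0 \<omega>)) \<partial>lborel))"

text \<open>
  Elements of $L^\infty$ and of the weighted $L^2$ space $\mathcal H$ are represented by measurable
  functions. A linear functional that is bounded with respect to the seminorm \<open>H_norm\<close> takes
  the same value on almost surely equal functions.
\<close>

definition L_infty :: "'a measure \<Rightarrow> ('a \<Rightarrow> real) set" where
  "L_infty M = {f \<in> borel_measurable M. \<exists>C. AE \<omega> in M. \<bar>f \<omega>\<bar> \<le> C}"

definition H_space :: "'a measure \<Rightarrow> (real \<Rightarrow> int \<Rightarrow> 'a \<Rightarrow> real) \<Rightarrow> ('a \<Rightarrow> real) set" where
  "H_space M b = {f \<in> borel_measurable M. integrable M (\<lambda>\<omega>. inverse (b 0 0 \<omega>) * (f \<omega>)\<^sup>2)}"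

definition H_norm :: "'a measure \<Rightarrow> (real \<Rightarrow> int \<Rightarrow> 'a \<Rightarrow> real) \<Rightarrow> ('a \<Rightarrow> real) \<Rightarrow> real" where
  "H_norm M b f = sqrt (LINT \<omega>|M. inverse (b 0 0 \<omega>) * (f \<omega>)\<^sup>2)"

definition continuous_linear_functional_H ::
  "'a measure \<Rightarrow> (real \<Rightarrow> int \<Rightarrow> 'a \<Rightarrow> real) \<Rightarrow> (('a \<Rightarrow> real) \<Rightarrow> real) \<Rightarrow> bool" where
  "continuous_linear_functional_H M b \<Phi> \<longleftrightarrow>
     (\<forall>f\<in>H_space M b. \<forall>g\<in>H_space M b. \<Phi> (\<lambda>\<omega>. f \<omega> + g \<omega>) = \<Phi> f + \<Phi> g) \<and>
     (\<forall>f\<in>H_space M b. \<forall>c. \<Phi> (\<lambda>\<omega>. c * f \<omega>) = c * \<Phi> f) \<and>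
     (\<exists>C. \<forall>f\<in>H_space M b. \<bar>\<Phi> f\<bar> \<le> C * H_norm M b f)"

definition extends_phi_eps ::
  "'a measure \<Rightarrow> (real \<Rightarrow> int \<Rightarrow> 'a \<Rightarrow> real) \<Rightarrow> real \<Rightarrow> (('a \<Rightarrow> real) \<Rightarrow> real) \<Rightarrow> bool" where
  "extends_phi_eps M b \<epsilon> \<Phi> \<longleftrightarrow>
     L_infty M \<subseteq> H_space M b \<and>
     (\<forall>f\<in>L_infty M. integrable M (\<lambda>\<omega>. varphi_eps b \<epsilon> \<omega> * f \<omega>) \<and>
        \<Phi> f = (LINT \<omega>|M. varphi_eps b \<epsilon> \<omega> * f \<omega>))"

definition decreases_to_0 :: "(nat \<Rightarrow> real) \<Rightarrow> bool" where
  "decreases_to_0 e \<longleftrightarrow> (\<forall>k. e k > 0) \<and> decseq e \<and> e \<longlonglongrightarrow> 0"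

definition L_plus ::
  "(real \<Rightarrow> int \<Rightarrow> 'a \<Rightarrow> real) \<Rightarrow> (real \<Rightarrow> int \<Rightarrow> 'a \<Rightarrow> 'a) \<Rightarrow> ('a \<Rightarrow> real) \<Rightarrow> 'a \<Rightarrow> real" where
  "L_plus b \<tau> f \<omega> =
     b 0 1 \<omega> * f (\<tau> 0 1 \<omega>) + b 0 (-1) \<omega> * f (\<tau> 0 (-1) \<omega>) - 2 * b 0 0 \<omega> * f \<omega>"

text \<open>The law of $Y_t$ under $P^0_a$, that is, $y \mapsto K(0,0;-t,y)$ evaluated at \<open>a\<close>.\<close>

definition dual_walk_law :: "(real \<Rightarrow> int \<Rightarrow> 'a \<Rightarrow> real) \<Rightarrow> real \<Rightarrow> 'a \<Rightarrow> int measure" where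
  "dual_walk_law b t a = density (count_space UNIV) (\<lambda>y. ennreal (dual_kernel b 0 0 (- t) y a))"

definition induced_kernel ::
  "'a measure \<Rightarrow> (real \<Rightarrow> int \<Rightarrow> 'a \<Rightarrow> real) \<Rightarrow> (real \<Rightarrow> int \<Rightarrow> 'a \<Rightarrow> 'a) \<Rightarrow> real \<Rightarrow> 'a \<Rightarrow> 'a measure" where
  "induced_kernel M b \<tau> t a = distr (dual_walk_law b t a) M (\<lambda>y. \<tau> (- t) y a)"

definition induced_stationary ::
  "'a measure \<Rightarrow> (real \<Rightarrow> int \<Rightarrow> 'a \<Rightarrow> real) \<Rightarrow> (real \<Rightarrow> int \<Rightarrow> 'a \<Rightarrow> 'a) \<Rightarrow> 'a measure \<Rightarrow> bool" where
  "induced_stationary M b \<tau> Q \<longleftrightarrow>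
     (\<forall>t\<ge>0. \<forall>A\<in>sets M. (\<integral>\<^sup>+ a. emeasure (induced_kernel M b \<tau> t a) A \<partial>Q) = emeasure Q A)"

definition induced_ergodic ::
  "'a measure \<Rightarrow> (real \<Rightarrow> int \<Rightarrow> 'a \<Rightarrow> real) \<Rightarrow> (real \<Rightarrow> int \<Rightarrow> 'a \<Rightarrow> 'a) \<Rightarrow> 'a measure \<Rightarrow> bool" where
  "induced_ergodic M b \<tau> Q \<longleftrightarrow>
     (\<forall>A\<in>sets M.
        (AE a in Q. a \<in> A \<longrightarrow> (\<forall>t>0. AE y in dual_walk_law b t a. \<tau> (- t) y a \<in> A)) \<longrightarrow>
        measure Q A \<in> {0, 1})"

end

theory Submission
  imports Defs
begin

text \<open>
  Why the theorem is true. As a function of \<open>(s, x)\<close>, the kernel $K(s,x;t,y)$ solves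
  $\partial_s K = b_s(x)\,\Delta K$ with $\Delta$ the discrete Laplacian. The adjoint equation for functions
  $h(s,x)$ is $\partial_s h + \Delta(bh) = 0$, and integrating $h$ against $K$ along time gives
  $h(t,y) = \sum_x h(s,x) K(s,x;t,y)$. So the density $\varphi$ has to be a stationary field
  whose space-time shifts solve the adjoint equation, and $\varphi_\epsilon$ solves the same equation with the killing
  term $\epsilon(h-1)$ on the right-hand side.

  In dimension one the adjoint equation with killing is the spatial difference of an equation in divergence form. If
  $\partial_t\chi = \epsilon\chi - \nabla(b\,(1+\nabla\chi))$, then $h = 1 + \nabla\chi$ is such a solution: $b$ is seen as a
  conductance on edges, $\chi$ is the corrector, and $h$ is the gradient of the (killed) harmonic coordinate. Testing the
  corrector equation with $\chi$ removes the time derivative, because the law of the environment is stationary, and leaves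
  $E(b h (h-1)) \le 0$, hence $E(b h^2) \le E(b)$. This is the bound on the norm of $\phi_\epsilon$.

  For conductances bounded by a constant, $\chi$ is the fixed point of a contraction in the supremum norm
  (\<open>corrector_fixed_point\<close>, \<open>gradient_energy\<close>), and $h \ge \varphi_\epsilon$ follows from a duality inequality between
  nonnegative solutions of the adjoint equation and the Picard iterates of $K$ (\<open>duality_inequality\<close>). For general
  conductances, the gradients $h_N$ of the environments truncated at $N$ satisfy $\varphi_\epsilon \le \liminf_N h_N$. All these
  functions have expectation 1; for $\varphi_\epsilon$ this is the absence of explosion, which holds in every single
  environment by a maximum principle with the supersolution $|x| + \int 2 b_u(0)\,du$ (\<open>K_mass_lower_bound\<close>). Equality of the
  expectations turns the inequality into convergence in $L^1$ (\<open>approx_tendsto_L1\<close>), and the energy bound and the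
  equation in weak form pass to $\varphi_\epsilon$ (\<open>varphi_eps_energy\<close>, \<open>varphi_eps_weak_equation\<close>).

  Bounded sequences in the weighted $L^2$ space have weakly convergent subsequences
  (\<open>weakly_convergent_subsequence\<close>), the limits are given by densities by the Radon-Nikodym theorem
  (\<open>functional_density\<close>), and the limit $\varphi$ solves the weak equation without killing (\<open>weak_limit_equation\<close>).
  The weak equation says that $\varphi\circ\tau_{t,x}$ agrees for almost every $t$ with an indefinite integral, and averages over
  short time intervals select the continuous version (\<open>\<psi>_primitive\<close>). The duality inequality for this version gives
  $\sum_x \varphi\circ\tau_{t,x} K(t,x;0,0) \le \varphi$; both sides have expectation 1, so they agree
  (\<open>column_average_eq\<close>), and moving the shift to the test function turns this into stationarity. Finally an event that the
  dual walk cannot leave is almost surely invariant under all shifts, hence trivial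
  (\<open>forward_invariant_trivial\<close>); this gives ergodicity and, applied to the event that $\varphi$ is positive, positivity.
\<close>

section \<open>Absolutely continuous functions\<close>

text \<open>
  Conductances are only integrable in time, so differential equations in time are read in integrated form:
  \<open>F\<close> is absolutely continuous on \<open>{t..}\<close> and has density \<open>f\<close>. The left end
  point is fixed because the kernel solves its equation only after its starting time.
\<close>

definition primitive_from :: "real \<Rightarrow> (real \<Rightarrow> real) \<Rightarrow> (real \<Rightarrow> real) \<Rightarrow> bool" where
  "primitive_from t F f \<longleftrightarrow>
     (\<forall>s\<ge>t. set_integrable lborel {t..s} f \<and> F s = F t + (LINT r:{t..s}|lborel. f r))"

lemma primitive_fromI:
  assumes "\<And>s. s \<ge> t \<Longrightarrow> set_integrable lborel {t..s} f"
    and "\<And>s. s \<ge> t \<Longrightarrow> F s = F t + (LINT r:{t..s}|lborel. f r)"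
  shows "primitive_from t F f"
  using assms unfolding primitive_from_def by blast

lemma primitive_from_eq:
  assumes "primitive_from t F f" "t \<le> s"
  shows "F s = F t + (LINT r:{t..s}|lborel. f r)"
  using assms unfolding primitive_from_def by blast

lemma primitive_from_integrable:
  assumes "primitive_from t F f" "t \<le> r"
  shows "set_integrable lborel {r..s} f"
proof -
  have "set_integrable lborel {t..max t s} f"
    using assms unfolding primitive_from_def by (meson max.cobounded1)
  then show ?thesis
    by (rule set_integrable_subset) (use assms in auto)
qed

lemma set_integral_split:
  fixes f :: "real \<Rightarrow> real"
  assumes "set_integrable lborel {t..s} f" "t \<le> r" "r \<le> s"
  shows "(LINT u:{t..s}|lborel. f u) = (LINT u:{t..r}|lborel. f u) + (LINT u:{r..s}|lborel. f u)"
proof -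
  have 1: "set_integrable lborel {t..r} f" "set_integrable lborel {r..s} f"
    by (rule set_integrable_subset[OF assms(1)]; use assms in auto)+
  have un: "{t..r} \<union> {r..s} = {t..s}" using assms by auto
  have "AE u in lborel. \<not> (u \<in> {t..r} \<and> u \<in> {r..s})"
    using AE_lborel_singleton[of r] by eventually_elim auto
  then have "(LINT u:{t..r} \<union> {r..s}|lborel. f u) = (LINT u:{t..r}|lborel. f u) + (LINT u:{r..s}|lborel. f u)"
    by (rule set_integral_Un_AE[OF _ _ _ 1]) simp_all
  then show ?thesis by (simp only: un)
qed

lemma primitive_from_diff:
  assumes "primitive_from t F f" "t \<le> r" "r \<le> s"
  shows "F s - F r = (LINT u:{r..s}|lborel. f u)"
proof -
  have "F s = F t + (LINT u:{t..s}|lborel. f u)" "F r = F t + (LINT u:{t..r}|lborel. f u)"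
    using assms by (auto intro!: primitive_from_eq)
  then show ?thesis
    using set_integral_split[OF primitive_from_integrable[OF assms(1) order_refl] assms(2,3)]
    by simp
qed

lemma primitive_from_later:
  assumes "primitive_from t F f" "t \<le> r"
  shows "primitive_from r F f"
proof (rule primitive_fromI)
  fix s assume "r \<le> s"
  show "set_integrable lborel {r..s} f"
    using primitive_from_integrable[OF assms] .
  show "F s = F r + (LINT r:{r..s}|lborel. f r)"
    using primitive_from_diff[OF assms \<open>r \<le> s\<close>] by simp
qed

lemma indefinite_integral_continuous:
  fixes f :: "real \<Rightarrow> real"
  assumes "set_integrable lborel {t..s} f"
  shows "continuous_on {t..s} (\<lambda>r. LINT u:{t..r}|lborel. f u)"
proof -
  have "f integrable_on {t..s}"
    using set_borel_integral_eq_integral(1)[OF assms] .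
  then have "continuous_on {t..s} (\<lambda>r. integral {t..r} f)"
    by (rule indefinite_integral_continuous_1)
  moreover have "integral {t..r} f = (LINT u:{t..r}|lborel. f u)" if "r \<in> {t..s}" for r
    using set_borel_integral_eq_integral(2)[OF set_integrable_subset[OF assms, of "{t..r}"]] that
    by auto
  ultimately show ?thesis
    using continuous_on_cong[OF refl, of "{t..s}"] by (metis (no_types, lifting))
qed

lemma primitive_from_continuous_on:
  assumes "primitive_from t F f"
  shows "continuous_on {t..s} F"
proof -
  have "continuous_on {t..s} (\<lambda>r. F t + (LINT u:{t..r}|lborel. f u))"
    by (intro continuous_intros indefinite_integral_continuous primitive_from_integrable[OF assms]) auto
  moreover have "F t + (LINT u:{t..r}|lborel. f u) = F r" if "r \<in> {t..s}" for r
    using primitive_from_eq[OF assms, of r] that by simp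
  ultimately show ?thesis
    using continuous_on_cong[OF refl, of "{t..s}"] by (metis (no_types, lifting))
qed

lemma set_integrable_times_continuous:
  fixes f g :: "real \<Rightarrow> real"
  assumes f: "set_integrable lborel {t..s} f" and g: "continuous_on {t..s} g"
  shows "set_integrable lborel {t..s} (\<lambda>r. f r * g r)"
proof -
  have "compact (g ` {t..s})"
    by (intro compact_continuous_image g) auto
  then obtain C where C: "\<And>r. r \<in> {t..s} \<Longrightarrow> \<bar>g r\<bar> \<le> C"
    using compact_imp_bounded bounded_iff by (metis image_eqI real_norm_def)
  have m: "(\<lambda>r. indicator {t..s} r * g r) \<in> borel_measurable borel"
    using borel_measurable_continuous_on_indicator[OF _ g] by simp
  show ?thesis
  proof (rule set_integrable_bound[where f = "\<lambda>r. C * f r"])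
    show "set_integrable lborel {t..s} (\<lambda>r. C * f r)" using f by simp
    have "(\<lambda>r. indicator {t..s} r *\<^sub>R f r) \<in> borel_measurable lborel"
      using f unfolding set_integrable_def by (rule borel_measurable_integrable)
    then have "(\<lambda>r. (indicator {t..s} r *\<^sub>R f r) * (indicator {t..s} r * g r)) \<in> borel_measurable lborel"
      by (rule borel_measurable_times) (use m in simp)
    moreover have "(\<lambda>r. (indicator {t..s} r *\<^sub>R f r) * (indicator {t..s} r * g r))
        = (\<lambda>r. indicator {t..s} r *\<^sub>R (f r * g r))"
      by (auto simp: indicator_def)
    ultimately show "set_borel_measurable lborel {t..s} (\<lambda>r. f r * g r)"
      unfolding set_borel_measurable_def by simp
    have "\<bar>f r * g r\<bar> \<le> \<bar>C * f r\<bar>" if "r \<in> {t..s}" for r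
      using mult_right_mono[of "\<bar>g r\<bar>" "\<bar>C\<bar>" "\<bar>f r\<bar>"] C[OF that]
      by (simp add: abs_mult mult.commute)
    then show "AE x in lborel. x \<in> {t..s} \<longrightarrow> norm (f x * g x) \<le> norm (C * f x)" by auto
  qed
qed

lemma primitive_from_const: "primitive_from t (\<lambda>s. c) (\<lambda>s. 0)"
  by (auto simp: primitive_from_def set_integrable_def)

lemma primitive_from_add:
  assumes "primitive_from t F f" "primitive_from t G g"
  shows "primitive_from t (\<lambda>s. F s + G s) (\<lambda>s. f s + g s)"
proof (rule primitive_fromI)
  fix s assume s: "t \<le> s"
  have i: "set_integrable lborel {t..s} f" "set_integrable lborel {t..s} g"
    using assms by (auto intro: primitive_from_integrable)
  show "set_integrable lborel {t..s} (\<lambda>s. f s + g s)"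
    using i by simp
  show "F s + G s = F t + G t + (LINT r:{t..s}|lborel. f r + g r)"
    using primitive_from_eq[OF assms(1) s] primitive_from_eq[OF assms(2) s] set_integral_add(2)[OF i]
    by linarith
qed

lemma primitive_from_cmult:
  assumes "primitive_from t F f"
  shows "primitive_from t (\<lambda>s. c * F s) (\<lambda>s. c * f s)"
proof (rule primitive_fromI)
  fix s assume s: "t \<le> s"
  show "set_integrable lborel {t..s} (\<lambda>s. c * f s)"
    using primitive_from_integrable[OF assms] by simp
  have "F s = F t + (LINT r:{t..s}|lborel. f r)"
    by (rule primitive_from_eq[OF assms s])
  then show "c * F s = c * F t + (LINT r:{t..s}|lborel. c * f r)"
    by (metis distrib_left set_integral_mult_right)
qed

lemma primitive_from_minus:
  assumes "primitive_from t F f" "primitive_from t G g"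
  shows "primitive_from t (\<lambda>s. F s - G s) (\<lambda>s. f s - g s)"
  using primitive_from_add[OF assms(1) primitive_from_cmult[OF assms(2), of "-1"]] by simp

lemma primitive_from_sum:
  assumes "finite A" "\<And>i. i \<in> A \<Longrightarrow> primitive_from t (F i) (f i)"
  shows "primitive_from t (\<lambda>s. \<Sum>i\<in>A. F i s) (\<lambda>s. \<Sum>i\<in>A. f i s)"
  using assms
  by (induction A rule: finite_induct) (auto intro: primitive_from_const primitive_from_add)

lemma primitive_from_cong:
  assumes "primitive_from t F f"
    and "\<And>s. s \<ge> t \<Longrightarrow> F s = G s" "\<And>s. s \<ge> t \<Longrightarrow> f s = g s"
  shows "primitive_from t G g"
proof (rule primitive_fromI)
  fix s assume s: "t \<le> s"
  have "set_integrable lborel {t..s} f" "F s = F t + (LINT r:{t..s}|lborel. f r)"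
    using primitive_from_integrable[OF assms(1)] primitive_from_eq[OF assms(1) s] by blast+
  moreover have "(LINT r:{t..s}|lborel. f r) = (LINT r:{t..s}|lborel. g r)"
    by (rule set_lebesgue_integral_cong) (use assms(3) in auto)
  moreover have "set_integrable lborel {t..s} f = set_integrable lborel {t..s} g"
    by (rule set_integrable_cong) (use assms(3) in auto)
  ultimately show "set_integrable lborel {t..s} g" "G s = G t + (LINT r:{t..s}|lborel. g r)"
    using assms(2)[OF s] assms(2)[of t] by (blast, metis order_refl)
qed

lemma primitive_from_indefinite:
  assumes "\<And>s. s \<ge> t \<Longrightarrow> set_integrable lborel {t..s} f"
  shows "primitive_from t (\<lambda>s. c + (LINT r:{t..s}|lborel. f r)) f"
proof -
  have "(LINT r:{t..t}|lborel. f r) = 0"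
    using set_integral_split[OF assms[of t], of t] by simp
  then show ?thesis
    using assms by (auto simp: primitive_from_def)
qed

text \<open>
  The product rule is Fubini's theorem: the integral of \<open>f u * g v\<close> over the square \<open>{t..s}
  \<times> {t..s}\<close> is the sum of the integrals over the two triangles below and above the diagonal.
\<close>

lemma primitive_from_mult:
  assumes F: "primitive_from t F f" and G: "primitive_from t G g"
  shows "primitive_from t (\<lambda>s. F s * G s) (\<lambda>s. f s * G s + F s * g s)"
proof (rule primitive_fromI)
  fix s assume s: "t \<le> s"
  have if1: "set_integrable lborel {t..s} f" and ig1: "set_integrable lborel {t..s} g"
    using primitive_from_integrable[OF F] primitive_from_integrable[OF G] by auto
  have ifG: "set_integrable lborel {t..s} (\<lambda>r. f r * G r)"
    using set_integrable_times_continuous[OF if1 primitive_from_continuous_on[OF G]] .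
  have iFg: "set_integrable lborel {t..s} (\<lambda>r. F r * g r)"
    using set_integrable_times_continuous[OF ig1 primitive_from_continuous_on[OF F]]
    by (simp add: mult.commute)
  show "set_integrable lborel {t..s} (\<lambda>r. f r * G r + F r * g r)"
    using ifG iFg by simp
  define f' where "f' r = indicator {t..s} r * f r" for r
  define g' where "g' r = indicator {t..s} r * g r" for r
  have f': "integrable lborel f'" and g': "integrable lborel g'"
    using if1 ig1 by (simp_all add: set_integrable_def f'_def[abs_def] g'_def[abs_def])
  have meas: "f' \<in> borel_measurable borel" "g' \<in> borel_measurable borel"
    using f' g' by auto
  have If: "integral\<^sup>L lborel f' = F s - F t" and Ig: "integral\<^sup>L lborel g' = G s - G t"
    using primitive_from_diff[OF F order_refl s] primitive_from_diff[OF G order_refl s]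
    by (simp_all add: set_lebesgue_integral_def f'_def[abs_def] g'_def[abs_def])
  have prod: "integrable (lborel \<Otimes>\<^sub>M lborel) (\<lambda>(u, v). f' u * g' v)"
    by (rule lborel_pair.Fubini_integrable) (use f' g' in \<open>auto simp: abs_mult\<close>)
  have int1: "integrable (lborel \<Otimes>\<^sub>M lborel) (\<lambda>(u, v). f' u * (g' v * indicator {..u} v))"
    by (rule Bochner_Integration.integrable_bound[OF prod])
       (use meas in \<open>auto simp: split_beta' indicator_def abs_mult\<close>)
  have int2: "integrable (lborel \<Otimes>\<^sub>M lborel) (\<lambda>(u, v). f' u * (g' v * indicator {u<..} v))"
    by (rule Bochner_Integration.integrable_bound[OF prod])
       (use meas in \<open>auto simp: split_beta' indicator_def abs_mult\<close>)
  \<comment> \<open>Integrating out one variable over a triangle reproduces the increments of \<open>G\<close> and of \<open>F\<close>.\<close>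
  have inner1: "(LINT v|lborel. f' u * (g' v * indicator {..u} v)) = f' u * (G u - G t)" for u
  proof (cases "u \<in> {t..s}")
    case True
    have "(LINT v|lborel. g' v * indicator {..u} v) = (LINT v:{t..u}|lborel. g v)"
      unfolding set_lebesgue_integral_def g'_def
      by (rule Bochner_Integration.integral_cong) (use True in \<open>auto simp: indicator_def\<close>)
    then show ?thesis
      using primitive_from_diff[OF G order_refl, of u] True by simp
  qed (simp add: f'_def)
  have inner2: "(LINT u|lborel. f' u * (g' v * indicator {u<..} v)) = (F v - F t) * g' v" for v
  proof (cases "v \<in> {t..s}")
    case True
    have "(LINT u|lborel. f' u * indicator {u<..} v) = (LINT u:{t..v}|lborel. f u)"
      unfolding set_lebesgue_integral_def
    proof (rule integral_cong_AE)
      show "(\<lambda>u. f' u * indicator {u<..} v) \<in> borel_measurable lborel"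
        using meas(1) by (simp add: indicator_def)
      have "set_integrable lborel {t..v} f"
        by (rule set_integrable_subset[OF if1]) (use True in auto)
      then show "(\<lambda>u. indicator {t..v} u *\<^sub>R f u) \<in> borel_measurable lborel"
        unfolding set_integrable_def by (rule borel_measurable_integrable)
      show "AE u in lborel. f' u * indicator {u<..} v = indicator {t..v} u *\<^sub>R f u"
        using AE_lborel_singleton[of v]
      proof eventually_elim
        case (elim u)
        then show ?case using True by (auto simp: f'_def indicator_def)
      qed
    qed
    moreover have "(LINT u|lborel. f' u * (g' v * indicator {u<..} v))
        = (LINT u|lborel. f' u * indicator {u<..} v) * g' v"
      by (subst integral_mult_left_zero[symmetric]) (simp add: mult_ac)
    ultimately show ?thesis
      using primitive_from_diff[OF F order_refl, of v] True by simp
  qed (simp add: g'_def)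
  have "(LINT r:{t..s}|lborel. f r * G r + F r * g r)
      = (LINT r:{t..s}|lborel. f r * G r) + (LINT r:{t..s}|lborel. F r * g r)"
    using ifG iFg by simp
  also have "(LINT r:{t..s}|lborel. f r * G r) = (LINT r|lborel. f' r * G r)"
    unfolding set_lebesgue_integral_def f'_def by (simp add: mult_ac)
  also have "\<dots> = (LINT r|lborel. f' r * (G r - G t) + f' r * G t)"
    by (simp add: algebra_simps)
  also have "\<dots> = (LINT r|lborel. f' r * (G r - G t)) + (F s - F t) * G t"
  proof -
    have "integrable lborel (\<lambda>r. f' r * (G r - G t))"
      using lborel_pair.integrable_fst'[OF int1] by (simp only: inner1 prod.case)
    then show ?thesis using f' If by simp
  qed
  also have "(LINT r|lborel. f' r * (G r - G t)) = (LINT p|(lborel \<Otimes>\<^sub>M lborel). (case p of (u, v) \<Rightarrow> f' u * (g' v * indicator {..u} v)))"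
    using lborel_pair.integral_fst'[OF int1] by (simp only: inner1 prod.case)
  also have "(LINT r:{t..s}|lborel. F r * g r) = (LINT r|lborel. F r * g' r)"
    unfolding set_lebesgue_integral_def g'_def by (simp add: mult_ac)
  also have "\<dots> = (LINT r|lborel. (F r - F t) * g' r + F t * g' r)"
    by (simp add: algebra_simps)
  also have "\<dots> = (LINT r|lborel. (F r - F t) * g' r) + F t * (G s - G t)"
  proof -
    have "integrable lborel (\<lambda>r. (F r - F t) * g' r)"
      using lborel_pair.integrable_snd[OF int2] by (simp only: inner2 prod.case)
    then show ?thesis using g' Ig by simp
  qed
  also have "(LINT r|lborel. (F r - F t) * g' r) = (LINT p|(lborel \<Otimes>\<^sub>M lborel). (case p of (u, v) \<Rightarrow> f' u * (g' v * indicator {u<..} v)))"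
    using lborel_pair.integral_snd[OF int2] by (simp only: inner2 prod.case)
  also have "(LINT p|(lborel \<Otimes>\<^sub>M lborel). (case p of (u, v) \<Rightarrow> f' u * (g' v * indicator {..u} v))) + (F s - F t) * G t +
     ((LINT p|(lborel \<Otimes>\<^sub>M lborel). (case p of (u, v) \<Rightarrow> f' u * (g' v * indicator {u<..} v))) + F t * (G s - G t))
    = (LINT p|(lborel \<Otimes>\<^sub>M lborel). (case p of (u, v) \<Rightarrow> f' u * (g' v * indicator {..u} v)) + (case p of (u, v) \<Rightarrow> f' u * (g' v * indicator {u<..} v)))
       + (F s - F t) * G t + F t * (G s - G t)"
    using int1 int2 by simp
  also have "(LINT p|(lborel \<Otimes>\<^sub>M lborel). (case p of (u, v) \<Rightarrow> f' u * (g' v * indicator {..u} v)) + (case p of (u, v) \<Rightarrow> f' u * (g' v * indicator {u<..} v)))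
     = (LINT p|(lborel \<Otimes>\<^sub>M lborel). (case p of (u, v) \<Rightarrow> f' u * g' v))"
    by (rule Bochner_Integration.integral_cong) (auto simp: indicator_def)
  also have "\<dots> = (F s - F t) * (G s - G t)"
    using lborel_pair.integral_fst'[OF prod] If Ig by simp
  finally show "F s * G s = F t * G t + (LINT r:{t..s}|lborel. f r * G r + F r * g r)"
    by (simp add: algebra_simps)
qed

lemma set_integral_dominated_convergence:
  fixes f :: "nat \<Rightarrow> real \<Rightarrow> real"
  assumes "set_integrable lborel {t..s} w"
    and "\<And>n. set_integrable lborel {t..s} (f n)"
    and "\<And>n r. r \<in> {t..s} \<Longrightarrow> \<bar>f n r\<bar> \<le> w r"
    and "\<And>r. r \<in> {t..s} \<Longrightarrow> (\<lambda>n. f n r) \<longlonglongrightarrow> g r"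
  shows "set_integrable lborel {t..s} g"
    and "(\<lambda>n. LINT r:{t..s}|lborel. f n r) \<longlonglongrightarrow> (LINT r:{t..s}|lborel. g r)"
proof -
  have c: "\<And>n. (\<lambda>x. indicator {t..s} x *\<^sub>R f n x) \<in> borel_measurable lborel"
    using assms(2) by (auto simp: set_integrable_def)
  have l: "(\<lambda>n. indicator {t..s} x *\<^sub>R f n x) \<longlonglongrightarrow> indicator {t..s} x *\<^sub>R g x" for x
    using assms(4)[of x] by (auto simp: indicator_def)
  have m: "(\<lambda>x. indicator {t..s} x *\<^sub>R g x) \<in> borel_measurable lborel"
    by (rule borel_measurable_LIMSEQ_real[OF l c])
  have b: "\<And>n. AE x in lborel. norm (indicator {t..s} x *\<^sub>R f n x) \<le> indicator {t..s} x *\<^sub>R w x"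
    using assms(3) by (auto simp: indicator_def)
  show "set_integrable lborel {t..s} g"
    unfolding set_integrable_def
    by (rule integrable_dominated_convergence[OF m c assms(1)[unfolded set_integrable_def] AE_I2[OF l] b])
  show "(\<lambda>n. LINT r:{t..s}|lborel. f n r) \<longlonglongrightarrow> (LINT r:{t..s}|lborel. g r)"
    unfolding set_lebesgue_integral_def
    by (rule integral_dominated_convergence[OF m c assms(1)[unfolded set_integrable_def] AE_I2[OF l] b])
qed

text \<open>
  The chain rule for the exponential is obtained from the product rule applied to the Taylor polynomials; the limit is
  taken under the integral by dominated convergence, since \<open>B\<close> is bounded on compact intervals.
\<close>

lemma primitive_from_exp:
  assumes B: "primitive_from t B \<beta>"
  shows "primitive_from t (\<lambda>s. exp (B s)) (\<lambda>s. \<beta> s * exp (B s))"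
proof (rule primitive_fromI)
  fix s assume s: "t \<le> s"
  define E where "E n r = (\<Sum>k<n. B r ^ k / fact k)" for n r
  have pow: "primitive_from t (\<lambda>r. B r ^ Suc k / fact (Suc k)) (\<lambda>r. \<beta> r * (B r ^ k / fact k))" for k
  proof (induction k)
    case 0
    then show ?case using B by simp
  next
    case (Suc k)
    have "primitive_from t (\<lambda>r. 1 / real (k + 2) * (B r * (B r ^ Suc k / fact (Suc k))))
       (\<lambda>r. 1 / real (k + 2) * (\<beta> r * (B r ^ Suc k / fact (Suc k)) + B r * (\<beta> r * (B r ^ k / fact k))))"
      by (intro primitive_from_cmult primitive_from_mult B Suc)
    then show ?case
    proof (rule primitive_from_cong)
      fix r
      show "1 / real (k + 2) * (B r * (B r ^ Suc k / fact (Suc k))) = B r ^ Suc (Suc k) / fact (Suc (Suc k))"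
        by (simp add: field_simps)
      have "B r * (\<beta> r * (B r ^ k / fact k)) = real (Suc k) * (\<beta> r * (B r ^ Suc k / fact (Suc k)))"
        by (simp add: field_simps del: of_nat_Suc)
      moreover have "x + real (Suc k) * x = real (k + 2) * x" for x
        by (simp add: algebra_simps)
      ultimately have "\<beta> r * (B r ^ Suc k / fact (Suc k)) + B r * (\<beta> r * (B r ^ k / fact k))
        = real (k + 2) * (\<beta> r * (B r ^ Suc k / fact (Suc k)))"
        by (simp only:)
      then show "1 / real (k + 2) * (\<beta> r * (B r ^ Suc k / fact (Suc k)) + B r * (\<beta> r * (B r ^ k / fact k)))
        = \<beta> r * (B r ^ Suc k / fact (Suc k))"
        by simp
    qed
  qed
  have prim: "primitive_from t (E (Suc n)) (\<lambda>r. \<beta> r * E n r)" for n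
  proof -
    have "primitive_from t (\<lambda>r. 1 + (\<Sum>k<n. B r ^ Suc k / fact (Suc k))) (\<lambda>r. 0 + (\<Sum>k<n. \<beta> r * (B r ^ k / fact k)))"
      by (intro primitive_from_add primitive_from_const primitive_from_sum pow) auto
    then show ?thesis
      by (rule primitive_from_cong) (simp_all add: E_def sum.lessThan_Suc_shift sum_distrib_left del: sum.lessThan_Suc)
  qed
  have lim: "(\<lambda>n. E n r) \<longlonglongrightarrow> exp (B r)" for r
    using exp_converges[of "B r"] by (simp add: E_def sums_def divide_inverse mult.commute scaleR_conv_of_real)
  have "compact (B ` {t..s})"
    by (intro compact_continuous_image primitive_from_continuous_on[OF B]) auto
  then obtain C where C: "\<And>r. r \<in> {t..s} \<Longrightarrow> \<bar>B r\<bar> \<le> C"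
    using compact_imp_bounded bounded_iff by (metis image_eqI real_norm_def)
  have Ebound: "\<bar>E n r\<bar> \<le> exp C" if "r \<in> {t..s}" for n r
  proof -
    have "\<bar>E n r\<bar> \<le> (\<Sum>k<n. \<bar>B r\<bar> ^ k / fact k)"
      unfolding E_def by (rule order_trans[OF sum_abs]) (simp add: abs_divide power_abs)
    also have "\<dots> \<le> (\<Sum>k. \<bar>B r\<bar> ^ k / fact k)"
      using summable_exp[of "\<bar>B r\<bar>"] by (intro sum_le_suminf) (auto simp: divide_inverse mult.commute)
    also have "\<dots> = exp \<bar>B r\<bar>"
      by (simp add: exp_def divide_inverse mult.commute scaleR_conv_of_real)
    also have "\<dots> \<le> exp C" using C[OF that] by simp
    finally show ?thesis .
  qed
  have ib: "set_integrable lborel {t..s} \<beta>"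
    using primitive_from_integrable[OF B] by auto
  have 1: "set_integrable lborel {t..s} (\<lambda>r. \<bar>\<beta> r\<bar> * exp C)"
    using set_integrable_abs[OF ib] by simp
  have 2: "\<And>n. set_integrable lborel {t..s} (\<lambda>r. \<beta> r * E n r)"
    using primitive_from_integrable[OF prim] by auto
  have 3: "\<And>n r. r \<in> {t..s} \<Longrightarrow> \<bar>\<beta> r * E n r\<bar> \<le> \<bar>\<beta> r\<bar> * exp C"
    using Ebound by (simp add: abs_mult mult_left_mono)
  have 4: "\<And>r. r \<in> {t..s} \<Longrightarrow> (\<lambda>n. \<beta> r * E n r) \<longlonglongrightarrow> \<beta> r * exp (B r)"
    by (intro tendsto_intros lim)
  show "set_integrable lborel {t..s} (\<lambda>s. \<beta> s * exp (B s))"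
    by (rule set_integral_dominated_convergence(1)[OF 1 2 3 4])
  have "(\<lambda>n. E (Suc n) t + (LINT r:{t..s}|lborel. \<beta> r * E n r)) \<longlonglongrightarrow> exp (B t) + (LINT r:{t..s}|lborel. \<beta> r * exp (B r))"
    by (intro tendsto_intros set_integral_dominated_convergence(2)[OF 1 2 3 4] LIMSEQ_Suc[OF lim])
  moreover have "(\<lambda>n. E (Suc n) t + (LINT r:{t..s}|lborel. \<beta> r * E n r)) = (\<lambda>n. E (Suc n) s)"
    using primitive_from_diff[OF prim order_refl s] by (auto simp: algebra_simps)
  ultimately show "exp (B s) = exp (B t) + (LINT r:{t..s}|lborel. \<beta> r * exp (B r))"
    using LIMSEQ_unique LIMSEQ_Suc[OF lim[of s]] by metis
qed

section \<open>Variation of constants\<close>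

text \<open>
  The Picard iterates of the kernel are given by Duhamel's formula. Since
  \<open>\<integral>\<^bsub>r\<^esub>\<^bsup>s\<^esup> \<beta>\<close> is a difference of two values of one primitive
  \<open>B\<close>, the formula is a product of \<open>exp (- B s)\<close> with an indefinite integral, and the
  product rule gives the linear equation with coefficient \<open>- \<beta>\<close> and source \<open>f\<close>.
\<close>

lemma duhamel_primitive:
  assumes \<beta>: "\<And>s. set_integrable lborel {t..s} \<beta>"
    and f: "\<And>s. set_integrable lborel {t..s} f"
  shows "primitive_from t
      (\<lambda>s. exp (- (LINT u:{t..s}|lborel. \<beta> u)) * c + (LINT r:{t..s}|lborel. exp (- (LINT u:{r..s}|lborel. \<beta> u)) * f r))
      (\<lambda>s. f s - \<beta> s * (exp (- (LINT u:{t..s}|lborel. \<beta> u)) * c + (LINT r:{t..s}|lborel. exp (- (LINT u:{r..s}|lborel. \<beta> u)) * f r)))"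
proof -
  define B where "B s = (LINT u:{t..s}|lborel. \<beta> u)" for s
  have B: "primitive_from t B \<beta>"
    using primitive_from_indefinite[of t \<beta> 0] \<beta> by (simp add: B_def[abs_def])
  have mB: "primitive_from t (\<lambda>s. - B s) (\<lambda>s. - \<beta> s)"
    using primitive_from_cmult[OF B, of "-1"] by simp
  have expB: "primitive_from t (\<lambda>s. exp (- B s)) (\<lambda>s. - \<beta> s * exp (- B s))"
    by (rule primitive_from_exp[OF mB])
  have cexp: "continuous_on {t..s} (\<lambda>r. exp (B r))" for s
    by (intro continuous_intros primitive_from_continuous_on[OF B])
  have fe: "set_integrable lborel {t..s} (\<lambda>r. f r * exp (B r))" for s
    by (rule set_integrable_times_continuous[OF f cexp])
  have I: "primitive_from t (\<lambda>s. c + (LINT r:{t..s}|lborel. f r * exp (B r))) (\<lambda>r. f r * exp (B r))"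
    by (rule primitive_from_indefinite[OF fe])
  have key: "exp (- (LINT u:{t..s}|lborel. \<beta> u)) * c + (LINT r:{t..s}|lborel. exp (- (LINT u:{r..s}|lborel. \<beta> u)) * f r)
     = exp (- B s) * (c + (LINT r:{t..s}|lborel. f r * exp (B r)))" for s
  proof -
    have "(LINT r:{t..s}|lborel. exp (- (LINT u:{r..s}|lborel. \<beta> u)) * f r) =
       (LINT r:{t..s}|lborel. exp (- B s) * (f r * exp (B r)))"
    proof (rule set_lebesgue_integral_cong)
      show "\<forall>r. r \<in> {t..s} \<longrightarrow> exp (- (LINT u:{r..s}|lborel. \<beta> u)) * f r = exp (- B s) * (f r * exp (B r))"
      proof (intro allI impI)
        fix r assume "r \<in> {t..s}"
        then have "(LINT u:{r..s}|lborel. \<beta> u) = B s - B r"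
          using primitive_from_diff[OF B, of r s] by auto
        then show "exp (- (LINT u:{r..s}|lborel. \<beta> u)) * f r = exp (- B s) * (f r * exp (B r))"
          by (simp add: exp_add[symmetric])
      qed
    qed simp
    then show ?thesis by (simp only: set_integral_mult_right distrib_left) (simp add: B_def)
  qed
  show ?thesis
    unfolding key
    by (rule primitive_from_cong[OF primitive_from_mult[OF expB I]])
       (auto simp: algebra_simps exp_minus field_simps)
qed

text \<open>
  Comparison for scalar linear equations: multiplication with the integrating factor \<open>exp (\<integral>
  \<beta>)\<close> removes the zero order term, so that the difference of the two solutions becomes the integral of a
  nonnegative function. Nonnegativity, monotonicity and the upper bound of the iterates are all instances.
\<close>

lemma duhamel_mono:
  assumes \<beta>: "\<And>s. set_integrable lborel {t..s} \<beta>"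
    and M: "primitive_from t M (\<lambda>s. f s - \<beta> s * M s)"
    and N: "primitive_from t N (\<lambda>s. g s - \<beta> s * N s)"
    and le: "M t \<le> N t" "\<And>r. t \<le> r \<Longrightarrow> r \<le> s \<Longrightarrow> f r \<le> g r"
    and s: "t \<le> s"
  shows "M s \<le> N s"
proof -
  have B: "primitive_from t (\<lambda>s. exp (0 + (LINT u:{t..s}|lborel. \<beta> u))) (\<lambda>s. \<beta> s * exp (0 + (LINT u:{t..s}|lborel. \<beta> u)))"
    by (intro primitive_from_exp primitive_from_indefinite \<beta>)
  define e where "e s = exp (0 + (LINT u:{t..s}|lborel. \<beta> u))" for s
  have "primitive_from t (\<lambda>s. e s * (N s - M s)) (\<lambda>s. (\<beta> s * e s) * (N s - M s) + e s * ((g s - \<beta> s * N s) - (f s - \<beta> s * M s)))"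
    unfolding e_def by (intro primitive_from_mult primitive_from_minus B M N)
  then have P: "primitive_from t (\<lambda>s. e s * (N s - M s)) (\<lambda>s. e s * (g s - f s))"
    by (rule primitive_from_cong) (auto simp: algebra_simps)
  have "0 \<le> (LINT r:{t..s}|lborel. e r * (g r - f r))"
    unfolding set_lebesgue_integral_def
    by (rule Bochner_Integration.integral_nonneg) (use le(2) in \<open>auto simp: e_def indicator_def\<close>)
  moreover have "0 \<le> e t * (N t - M t)" using le(1) by (simp add: e_def)
  ultimately have "0 \<le> e s * (N s - M s)"
    using primitive_from_eq[OF P s] by simp
  moreover have "e s > 0" by (simp add: e_def)
  ultimately show ?thesis by (simp add: zero_le_mult_iff)
qed

text \<open>
  On \<open>{t..s}\<close> the exponential is a continuous function of \<open>r\<close>, because the inner integral is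
  a difference of two integrals that start at \<open>t\<close>.
\<close>

lemma duhamel_integrable:
  fixes f \<beta> :: "real \<Rightarrow> real"
  assumes \<beta>: "\<And>t s. set_integrable lborel {t..s} \<beta>" and f: "set_integrable lborel {t..s} f"
  shows "set_integrable lborel {t..s} (\<lambda>r. exp (- (LINT u:{r..s}|lborel. \<beta> u)) * f r)"
proof -
  have e: "continuous_on {t..s} (\<lambda>r. exp (- ((LINT u:{t..s}|lborel. \<beta> u) - (LINT u:{t..r}|lborel. \<beta> u))))"
    by (intro continuous_intros indefinite_integral_continuous \<beta>)
  have "set_integrable lborel {t..s} (\<lambda>r. f r * exp (- ((LINT u:{t..s}|lborel. \<beta> u) - (LINT u:{t..r}|lborel. \<beta> u))))"
    by (intro set_integrable_times_continuous f e)
  also have "?this \<longleftrightarrow> ?thesis"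
  proof (rule set_integrable_cong)
    fix r assume "r \<in> {t..s}"
    then have "(LINT u:{t..s}|lborel. \<beta> u) - (LINT u:{t..r}|lborel. \<beta> u) = (LINT u:{r..s}|lborel. \<beta> u)"
      using set_integral_split[OF \<beta>, of t r s] by simp
    then show "f r * exp (- ((LINT u:{t..s}|lborel. \<beta> u) - (LINT u:{t..r}|lborel. \<beta> u))) = exp (- (LINT u:{r..s}|lborel. \<beta> u)) * f r"
      by (simp only: mult.commute)
  qed simp_all
  finally show ?thesis .
qed

section \<open>The dual kernel in a fixed environment\<close>

locale conductance_path =
  fixes b :: "real \<Rightarrow> int \<Rightarrow> 'a \<Rightarrow> real" and \<omega> :: 'a
  assumes b_pos: "\<And>u x. 0 < b u x \<omega>"
    and b_integrable: "\<And>x s t. set_integrable lborel {s..t} (\<lambda>u. b u x \<omega>)"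
begin

abbreviation Kn :: "nat \<Rightarrow> real \<Rightarrow> int \<Rightarrow> real \<Rightarrow> int \<Rightarrow> real" where
  "Kn n s x t y \<equiv> dual_kernel_n b n s x t y \<omega>"

abbreviation K :: "real \<Rightarrow> int \<Rightarrow> real \<Rightarrow> int \<Rightarrow> real" where
  "K s x t y \<equiv> dual_kernel b s x t y \<omega>"

lemma b_nonneg: "0 \<le> b u x \<omega>"
  using b_pos less_imp_le by auto

lemma b2_integrable: "set_integrable lborel {s..t} (\<lambda>u. 2 * b u x \<omega>)"
  using b_integrable by simp

lemma Kn_Suc:
  "Kn (Suc n) s x t y = exp (- (LINT u:{t..s}|lborel. 2 * b u x \<omega>)) * (if x = y then 1 else 0)
     + (LINT r:{t..s}|lborel. exp (- (LINT u:{r..s}|lborel. 2 * b u x \<omega>)) *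
          (b r x \<omega> * (Kn n r (x + 1) t y + Kn n r (x - 1) t y)))"
  by (simp add: mult.assoc)

lemma Kn_primitive_aux:
  assumes "\<And>x s. continuous_on {t..s} (\<lambda>r. Kn n r x t y)"
  shows "primitive_from t (\<lambda>s. Kn (Suc n) s x t y)
    (\<lambda>s. b s x \<omega> * (Kn n s (x + 1) t y + Kn n s (x - 1) t y) - 2 * b s x \<omega> * Kn (Suc n) s x t y)"
  unfolding Kn_Suc
  by (intro duhamel_primitive b2_integrable set_integrable_times_continuous b_integrable
      continuous_intros assms)

lemma Kn_continuous: "continuous_on {t..s} (\<lambda>r. Kn n r x t y)"
proof (induction n arbitrary: x s)
  case (Suc n)
  show ?case
    by (rule primitive_from_continuous_on[OF Kn_primitive_aux[OF Suc]])
qed simp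

lemmas Kn_primitive = Kn_primitive_aux[OF Kn_continuous]

lemma Kn_Suc_start: "Kn (Suc n) t x t y = (if x = y then 1 else 0)"
proof -
  have *: "(LINT r:{t..t}|lborel. f r) = 0" for f :: "real \<Rightarrow> real"
    unfolding set_lebesgue_integral_def
    by (rule integral_eq_zero_AE) (use AE_lborel_singleton[of t] in eventually_elim, auto)
  show ?thesis by (simp only: dual_kernel_n.simps *) simp
qed

lemma Kn_nonneg: "t \<le> s \<Longrightarrow> 0 \<le> Kn n s x t y"
proof (induction n arbitrary: s x)
  case (Suc n)
  show ?case
  proof (rule duhamel_mono[OF b2_integrable _ Kn_primitive _ _ Suc.prems])
    show "primitive_from t (\<lambda>s. 0) (\<lambda>s. 0 - 2 * b s x \<omega> * 0)"
      using primitive_from_const by simp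
  qed (use Suc.IH b_nonneg in \<open>auto simp del: dual_kernel_n.simps simp: Kn_Suc_start intro!: mult_nonneg_nonneg add_nonneg_nonneg\<close>)
qed simp

lemma Kn_mono_Suc: "t \<le> s \<Longrightarrow> Kn n s x t y \<le> Kn (Suc n) s x t y"
proof (induction n arbitrary: s x)
  case 0
  show ?case using Kn_nonneg[OF 0, of "Suc 0"] by simp
next
  case (Suc n)
  show ?case
    by (rule duhamel_mono[OF b2_integrable Kn_primitive Kn_primitive _ _ Suc.prems])
      (use Suc.IH b_nonneg in \<open>auto simp del: dual_kernel_n.simps simp: Kn_Suc_start intro!: mult_left_mono add_mono\<close>)
qed

lemma Kn_mono: "t \<le> s \<Longrightarrow> m \<le> n \<Longrightarrow> Kn m s x t y \<le> Kn n s x t y"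
  by (rule lift_Suc_mono_le[of "\<lambda>n. Kn n s x t y"]) (use Kn_mono_Suc in auto)

text \<open>
  Summation over the end points gives a solution of the same iteration with the source replaced by an indicator; it is
  compared with the constant 1, which solves \<open>1' = 2 * b - 2 * b * 1\<close>.
\<close>

lemma Kn_sum_le_1:
  assumes "finite Y" "t \<le> s"
  shows "(\<Sum>y\<in>Y. Kn n s x t y) \<le> 1"
  using assms(2)
proof (induction n arbitrary: s x)
  case (Suc n)
  have "primitive_from t (\<lambda>s. \<Sum>y\<in>Y. Kn (Suc n) s x t y)
    (\<lambda>s. \<Sum>y\<in>Y. b s x \<omega> * (Kn n s (x + 1) t y + Kn n s (x - 1) t y) - 2 * b s x \<omega> * Kn (Suc n) s x t y)"
    by (intro primitive_from_sum Kn_primitive assms(1))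
  then have M: "primitive_from t (\<lambda>s. \<Sum>y\<in>Y. Kn (Suc n) s x t y)
    (\<lambda>s. b s x \<omega> * ((\<Sum>y\<in>Y. Kn n s (x + 1) t y) + (\<Sum>y\<in>Y. Kn n s (x - 1) t y)) - 2 * b s x \<omega> * (\<Sum>y\<in>Y. Kn (Suc n) s x t y))"
    by (rule primitive_from_cong)
      (auto simp: sum_subtractf sum_distrib_left sum.distrib distrib_left simp del: dual_kernel_n.simps)
  show ?case
  proof (rule duhamel_mono[OF b2_integrable M _ _ _ Suc.prems])
    show "primitive_from t (\<lambda>s. 1) (\<lambda>s. 2 * b s x \<omega> - 2 * b s x \<omega> * 1)"
      using primitive_from_const by simp
    show "(\<Sum>y\<in>Y. Kn (Suc n) t x t y) \<le> 1"
      using assms(1) by (simp add: Kn_Suc_start del: dual_kernel_n.simps)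
    fix r assume "t \<le> r"
    then show "b r x \<omega> * ((\<Sum>y\<in>Y. Kn n r (x + 1) t y) + (\<Sum>y\<in>Y. Kn n r (x - 1) t y)) \<le> 2 * b r x \<omega>"
      using mult_left_mono[OF add_mono[OF Suc.IH Suc.IH], of r r "b r x \<omega>" "x + 1" "x - 1"] b_pos[of r x]
      by simp
  qed
qed simp

lemma Kn_le_1: "t \<le> s \<Longrightarrow> Kn n s x t y \<le> 1"
  using Kn_sum_le_1[of "{y}"] by simp

text \<open>
  The \<open>n\<close>-th iterate counts only paths with fewer than \<open>n\<close> jumps. Sums of iterates over
  space are therefore finite, which is why the duality inequality below is proved for the iterates and not for their
  limit.
\<close>

lemma Kn_support: "int n \<le> \<bar>x - y\<bar> \<Longrightarrow> Kn n s x t y = 0"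
proof (induction n arbitrary: s x)
  case (Suc n)
  have "Kn n r (x + 1) t y = 0" "Kn n r (x - 1) t y = 0" for r
    by (rule Suc.IH; use Suc.prems in auto)+
  moreover have "x \<noteq> y" using Suc.prems by auto
  ultimately show ?case unfolding Kn_Suc by simp
qed simp

lemma Kn_tendsto_K: assumes "t \<le> s" shows "(\<lambda>n. Kn n s x t y) \<longlonglongrightarrow> K s x t y"
proof -
  have "convergent (\<lambda>n. Kn n s x t y)"
    by (rule Bseq_mono_convergent)
      (use Kn_le_1 Kn_nonneg Kn_mono assms in \<open>auto intro!: BseqI'[where K=1] simp: abs_le_iff\<close>)
  then show ?thesis
    by (simp add: convergent_LIMSEQ_iff dual_kernel_def)
qed

lemma Kn_le_K: "t \<le> s \<Longrightarrow> Kn n s x t y \<le> K s x t y"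
  using incseq_le[OF _ Kn_tendsto_K] Kn_mono by (auto simp: incseq_def)

lemma K_nonneg: "t \<le> s \<Longrightarrow> 0 \<le> K s x t y"
  using Kn_le_K[of t s 0] by simp

lemma K_sum_le_1: "finite Y \<Longrightarrow> t \<le> s \<Longrightarrow> (\<Sum>y\<in>Y. K s x t y) \<le> 1"
  by (rule LIMSEQ_le_const2[OF tendsto_sum[OF Kn_tendsto_K]]) (auto intro: Kn_sum_le_1)

lemma K_start: "K t x t y = (if x = y then 1 else 0)"
proof -
  have "(\<lambda>n. Kn (Suc n) t x t y) \<longlonglongrightarrow> K t x t y"
    by (rule LIMSEQ_Suc[OF Kn_tendsto_K]) simp
  then show ?thesis
    unfolding Kn_Suc_start by (simp add: LIMSEQ_const_iff)
qed

text \<open>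
  The limit of the iterates inherits the equation by dominated convergence in the integrated equation of the iterates.
\<close>

lemma K_primitive:
  "primitive_from t (\<lambda>s. K s x t y)
     (\<lambda>s. b s x \<omega> * (K s (x + 1) t y + K s (x - 1) t y) - 2 * b s x \<omega> * K s x t y)"
proof (rule primitive_fromI)
  fix s assume s: "t \<le> s"
  define f where "f n r = b r x \<omega> * (Kn n r (x + 1) t y + Kn n r (x - 1) t y) - 2 * b r x \<omega> * Kn (Suc n) r x t y" for n r
  have 1: "set_integrable lborel {t..s} (\<lambda>r. 4 * b r x \<omega>)"
    using b_integrable by simp
  have 2: "set_integrable lborel {t..s} (f n)" for n
    using primitive_from_integrable[OF Kn_primitive order_refl] by (simp add: f_def[abs_def])
  have 3: "\<bar>f n r\<bar> \<le> 4 * b r x \<omega>" if "r \<in> {t..s}" for n r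
  proof -
    have "\<bar>f n r\<bar> = b r x \<omega> * \<bar>Kn n r (x + 1) t y + Kn n r (x - 1) t y - 2 * Kn (Suc n) r x t y\<bar>"
    proof -
      have "f n r = b r x \<omega> * (Kn n r (x + 1) t y + Kn n r (x - 1) t y - 2 * Kn (Suc n) r x t y)"
        by (simp only: f_def right_diff_distrib mult_ac)
      then show ?thesis using b_nonneg by (simp only: abs_mult abs_of_nonneg)
    qed
    also have "\<dots> \<le> b r x \<omega> * 4"
    proof (rule mult_left_mono)
      have k: "0 \<le> Kn n r z t y \<and> Kn n r z t y \<le> 1" for n z
        using Kn_nonneg Kn_le_1 that by auto
      show "\<bar>Kn n r (x + 1) t y + Kn n r (x - 1) t y - 2 * Kn (Suc n) r x t y\<bar> \<le> 4"
        using k[of n "x+1"] k[of n "x-1"] k[of "Suc n" x] unfolding abs_le_iff by linarith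
    qed (use b_pos less_imp_le in auto)
    finally show ?thesis by simp
  qed
  have 4: "(\<lambda>n. f n r) \<longlonglongrightarrow> b r x \<omega> * (K r (x + 1) t y + K r (x - 1) t y) - 2 * b r x \<omega> * K r x t y"
    if "r \<in> {t..s}" for r
    unfolding f_def by (intro tendsto_intros Kn_tendsto_K LIMSEQ_Suc[OF Kn_tendsto_K]) (use that in auto)
  note dc = set_integral_dominated_convergence[OF 1 2 3 4]
  show "set_integrable lborel {t..s} (\<lambda>s. b s x \<omega> * (K s (x + 1) t y + K s (x - 1) t y) - 2 * b s x \<omega> * K s x t y)"
    by (rule dc(1))
  have "(\<lambda>n. Kn (Suc n) t x t y + (LINT r:{t..s}|lborel. f n r)) \<longlonglongrightarrow> K t x t y + (LINT r:{t..s}|lborel. b r x \<omega> * (K r (x + 1) t y + K r (x - 1) t y) - 2 * b r x \<omega> * K r x t y)"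
    by (intro tendsto_intros LIMSEQ_Suc[OF Kn_tendsto_K] dc(2)) auto
  moreover have "Kn (Suc n) t x t y + (LINT r:{t..s}|lborel. f n r) = Kn (Suc n) s x t y" for n
    unfolding f_def by (rule primitive_from_eq[OF Kn_primitive s, symmetric])
  ultimately have "(\<lambda>n. Kn (Suc n) s x t y) \<longlonglongrightarrow> K t x t y + (LINT r:{t..s}|lborel. b r x \<omega> * (K r (x + 1) t y + K r (x - 1) t y) - 2 * b r x \<omega> * K r x t y)"
    by (simp only:)
  then show "K s x t y = K t x t y + (LINT r:{t..s}|lborel. b r x \<omega> * (K r (x + 1) t y + K r (x - 1) t y) - 2 * b r x \<omega> * K r x t y)"
    by (rule LIMSEQ_unique[OF LIMSEQ_Suc[OF Kn_tendsto_K[OF s]]])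
qed

text \<open>
  If \<open>w \<le> D\<close> everywhere, then inside the box the comparison function \<open>D * (1 - exp (-
  \<integral> 2 * b))\<close> improves the bound to \<open>D * q\<close>, where \<open>q < 1\<close> can be chosen
  uniformly because the box is finite. Iterating this brings the bound down to 0.
\<close>

lemma maximum_principle:
  fixes w :: "int \<Rightarrow> real \<Rightarrow> real"
  assumes w: "\<And>x. \<bar>x\<bar> < R \<Longrightarrow> primitive_from t (w x) (\<lambda>s. (b s x \<omega> * (w (x + 1) s + w (x - 1) s) - g x s) - 2 * b s x \<omega> * w x s)"
    and g: "\<And>x s. t \<le> s \<Longrightarrow> 0 \<le> g x s"
    and start: "\<And>x. \<bar>x\<bar> < R \<Longrightarrow> w x t \<le> 0"
    and boundary: "\<And>x s. R \<le> \<bar>x\<bar> \<Longrightarrow> t \<le> s \<Longrightarrow> w x s \<le> 0"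
    and bounded: "\<And>x s. t \<le> s \<Longrightarrow> w x s \<le> C"
    and s: "t \<le> s"
  shows "w x s \<le> 0"
proof -
  define I where "I = (\<Sum>x\<in>{-R..R}. LINT u:{t..s}|lborel. 2 * b u x \<omega>)"
  have int_nonneg: "0 \<le> (LINT u:{r..r'}|lborel. 2 * b u x \<omega>)" for x r r'
    unfolding set_lebesgue_integral_def
    by (rule Bochner_Integration.integral_nonneg) (use b_pos less_imp_le in \<open>auto simp: indicator_def\<close>)
  \<comment> \<open>One rate \<open>I\<close> serves all sites of the box.\<close>
  have I: "(LINT u:{t..r}|lborel. 2 * b u x \<omega>) \<le> I" if "\<bar>x\<bar> < R" "t \<le> r" "r \<le> s" for x r
  proof -
    have "(LINT u:{t..r}|lborel. 2 * b u x \<omega>) \<le> (LINT u:{t..s}|lborel. 2 * b u x \<omega>)"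
      using set_integral_split[OF b2_integrable that(2,3), of x] int_nonneg[of r s x] by linarith
    also have "\<dots> \<le> I"
      unfolding I_def by (rule member_le_sum) (use that int_nonneg in auto)
    finally show ?thesis .
  qed
  have I0: "0 \<le> I" unfolding I_def by (intro sum_nonneg int_nonneg)
  define q where "q = 1 - exp (- I)"
  have q: "0 \<le> q" "q < 1" using I0 by (auto simp: q_def)
  have step: "w x r \<le> D * q" if D: "0 \<le> D" "\<And>x r. t \<le> r \<Longrightarrow> r \<le> s \<Longrightarrow> w x r \<le> D" and r: "t \<le> r" "r \<le> s" for D x r
  proof (cases "\<bar>x\<bar> < R")
    case False
    then show ?thesis using boundary[of x r] r D(1) q(1)
      by (smt (verit) mult_nonneg_nonneg)
  next
    case True
    define e where "e r = exp (- 1 * (0 + (LINT u:{t..r}|lborel. 2 * b u x \<omega>)))" for r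
    have e: "primitive_from t e (\<lambda>r. (- 1 * (2 * b r x \<omega>)) * e r)"
      unfolding e_def by (intro primitive_from_exp primitive_from_cmult primitive_from_indefinite b2_integrable)
    have "primitive_from t (\<lambda>r. D * (1 - e r)) (\<lambda>r. D * (0 - (- 1 * (2 * b r x \<omega>)) * e r))"
      by (intro primitive_from_cmult primitive_from_minus primitive_from_const e)
    then have N: "primitive_from t (\<lambda>r. D * (1 - e r)) (\<lambda>r. D * (2 * b r x \<omega>) - 2 * b r x \<omega> * (D * (1 - e r)))"
      by (rule primitive_from_cong) (auto simp: algebra_simps)
    have "w x r \<le> D * (1 - e r)"
    proof (rule duhamel_mono[OF b2_integrable w[OF True] N _ _ r(1)])
      have "e t \<le> 1" using int_nonneg[of t t x] by (simp only: e_def) simp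
      then have "0 \<le> D * (1 - e t)" using D(1) by simp
      then show "w x t \<le> D * (1 - e t)" using start[OF True] by linarith
      fix v assume v: "t \<le> v" "v \<le> r"
      have "w (x + 1) v + w (x - 1) v \<le> D + D"
        by (intro add_mono D(2)) (use v r in auto)
      then have "b v x \<omega> * (w (x + 1) v + w (x - 1) v) \<le> b v x \<omega> * (D + D)"
        by (rule mult_left_mono) (use b_pos less_imp_le in auto)
      then show "b v x \<omega> * (w (x + 1) v + w (x - 1) v) - g x v \<le> D * (2 * b v x \<omega>)"
        using g[OF v(1), of x] by (simp add: algebra_simps)
    qed
    also have "\<dots> \<le> D * q"
      using I[OF True r] D(1) by (intro mult_left_mono) (auto simp: q_def e_def)
    finally show ?thesis .
  qed
  have iter: "w x r \<le> max C 0 * q ^ n" if r: "t \<le> r" "r \<le> s" for x r n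
    using r
  proof (induction n arbitrary: x r)
    case 0
    then show ?case using bounded[of r x] by simp
  next
    case (Suc n)
    have "w x r \<le> (max C 0 * q ^ n) * q"
      by (rule step) (use Suc q in auto)
    then show ?case by (simp add: mult_ac)
  qed
  have "(\<lambda>n. max C 0 * q ^ n) \<longlonglongrightarrow> max C 0 * 0"
    by (intro tendsto_intros LIMSEQ_realpow_zero q)
  then show ?thesis
    using iter[OF s order_refl] by (intro LIMSEQ_le_const[of "\<lambda>n. max C 0 * q ^ n"]) auto
qed

text \<open>
  The jumps of the walk are symmetric, so a walk with infinitely many jumps would visit the origin infinitely often,
  and the local integrability of the rate at the origin prevents this in bounded time; this is why the walk does not
  explode. Analytically, \<open>\<bar>x\<bar> + \<integral> 2 * b u 0\<close> is a supersolution of the equation: the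
  Laplacian of \<open>\<bar>x\<bar>\<close> is \<open>2\<close> at the origin and vanishes elsewhere. Divided by
  \<open>R\<close> it dominates the mass lost outside \<open>{-R..R}\<close>, on the boundary of the box trivially and
  inside by the maximum principle.
\<close>

lemma K_mass_lower_bound:
  assumes R: "0 < R" and s: "t \<le> s"
  shows "1 - (\<bar>real_of_int x\<bar> + (LINT u:{t..s}|lborel. 2 * b u 0 \<omega>)) / real_of_int R \<le> (\<Sum>y\<in>{-R..R}. K s x t y)"
proof -
  define J where "J s = 0 + (LINT u:{t..s}|lborel. 2 * b u 0 \<omega>)" for s
  have J: "primitive_from t J (\<lambda>u. 2 * b u 0 \<omega>)"
    unfolding J_def by (intro primitive_from_indefinite b2_integrable)
  have J0: "0 \<le> J s" for s
    unfolding J_def set_lebesgue_integral_def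
    by (intro add_nonneg_nonneg Bochner_Integration.integral_nonneg) (use b_pos less_imp_le in \<open>auto simp: indicator_def\<close>)
  define \<delta> where "\<delta> = 1 / real_of_int R"
  have \<delta>: "0 < \<delta>" "\<delta> * real_of_int R = 1" using R by (auto simp: \<delta>_def)
  define m where "m x s = (\<Sum>y\<in>{-R..R}. K s x t y)" for x s
  define w where "w x s = 1 - m x s - \<delta> * (\<bar>real_of_int x\<bar> + J s)" for x s
  define g where "g x s = (if x = 0 then 0 else \<delta> * (2 * b s 0 \<omega>))" for x :: int and s
  have m0: "0 \<le> m x s" if "t \<le> s" for x s
    unfolding m_def by (intro sum_nonneg K_nonneg that)
  have "primitive_from t (m x) (\<lambda>s. \<Sum>y\<in>{-R..R}. b s x \<omega> * (K s (x + 1) t y + K s (x - 1) t y) - 2 * b s x \<omega> * K s x t y)" for x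
    unfolding m_def by (intro primitive_from_sum K_primitive) auto
  then have m: "primitive_from t (m x) (\<lambda>s. b s x \<omega> * (m (x + 1) s + m (x - 1) s) - 2 * b s x \<omega> * m x s)" for x
    by (rule primitive_from_cong) (auto simp: m_def sum_subtractf sum_distrib_left sum.distrib distrib_left)
  have "w x s \<le> 0"
  proof (rule maximum_principle[where R = R and t = t and g = g and C = 1, OF _ _ _ _ _ s])
    fix x :: int assume x: "\<bar>x\<bar> < R"
    have "primitive_from t (w x) (\<lambda>s. 0 - (b s x \<omega> * (m (x + 1) s + m (x - 1) s) - 2 * b s x \<omega> * m x s) - \<delta> * (0 + 2 * b s 0 \<omega>))"
      unfolding w_def by (intro primitive_from_minus primitive_from_const primitive_from_cmult primitive_from_add m J)
    then show "primitive_from t (w x) (\<lambda>s. b s x \<omega> * (w (x + 1) s + w (x - 1) s) - g x s - 2 * b s x \<omega> * w x s)"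
    proof (rule primitive_from_cong)
      fix s assume "t \<le> s"
      \<comment> \<open>The Laplacian of the absolute value is concentrated at the origin.\<close>
      have a: "\<bar>real_of_int (x + 1)\<bar> + \<bar>real_of_int (x - 1)\<bar> = 2 * \<bar>real_of_int x\<bar> + (if x = 0 then 2 else 0)"
        by auto
      have "w (x + 1) s + w (x - 1) s - 2 * w x s = 2 * m x s - (m (x + 1) s + m (x - 1) s)
          - \<delta> * ((\<bar>real_of_int (x + 1)\<bar> + \<bar>real_of_int (x - 1)\<bar>) - 2 * \<bar>real_of_int x\<bar>)"
        unfolding w_def by (simp only: algebra_simps)
      also have "\<dots> = 2 * m x s - (m (x + 1) s + m (x - 1) s) - \<delta> * (if x = 0 then 2 else 0)"
        unfolding a by simp
      finally have "b s x \<omega> * (w (x + 1) s + w (x - 1) s - 2 * w x s) = b s x \<omega> * (2 * m x s - (m (x + 1) s + m (x - 1) s) - \<delta> * (if x = 0 then 2 else 0))"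
        by simp
      then show "0 - (b s x \<omega> * (m (x + 1) s + m (x - 1) s) - 2 * b s x \<omega> * m x s) - \<delta> * (0 + 2 * b s 0 \<omega>) =
          b s x \<omega> * (w (x + 1) s + w (x - 1) s) - g x s - 2 * b s x \<omega> * w x s"
        by (cases "x = 0") (simp_all add: g_def algebra_simps)
    qed simp
    have "m x t = 1"
    proof -
      have "x \<in> {-R..R}" using x unfolding atLeastAtMost_iff by linarith
      then show ?thesis unfolding m_def K_start by simp
    qed
    then show "w x t \<le> 0"
      using J0[of t] \<delta> by (simp add: w_def)
  next
    fix x s assume "t \<le> s"
    show "0 \<le> g x s" using \<delta> b_pos[of s 0] by (simp add: g_def)
    have "0 \<le> \<delta> * (\<bar>real_of_int x\<bar> + J s)" using \<delta> J0[of s] by simp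
    then show "w x s \<le> 1" using m0[OF \<open>t \<le> s\<close>, of x] unfolding w_def by linarith
    assume "R \<le> \<bar>x\<bar>"
    then have "real_of_int R \<le> \<bar>real_of_int x\<bar> + J s" using J0[of s] by linarith
    then have "\<delta> * real_of_int R \<le> \<delta> * (\<bar>real_of_int x\<bar> + J s)"
      by (rule mult_left_mono) (use \<delta>(1) in simp)
    then have "1 \<le> \<delta> * (\<bar>real_of_int x\<bar> + J s)" unfolding \<delta>(2) .
    then show "w x s \<le> 0" using m0[OF \<open>t \<le> s\<close>, of x] unfolding w_def by linarith
  qed
  moreover have "\<delta> * (\<bar>real_of_int x\<bar> + J s) = (\<bar>real_of_int x\<bar> + (LINT u:{t..s}|lborel. 2 * b u 0 \<omega>)) / real_of_int R"
    unfolding \<delta>_def J_def by simp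
  ultimately show ?thesis
    unfolding w_def m_def by linarith
qed

text \<open>
  For neighbouring or equal points already the second iterate is positive, being the integral of a positive function;
  this is all the irreducibility that the ergodicity argument needs.
\<close>

lemma K_positive:
  assumes s: "t < s" and xy: "\<bar>x - y\<bar> \<le> 1"
  shows "0 < K s x t y"
proof -
  have K1: "0 < Kn (Suc 0) r y t y" for r by simp
  have "0 < Kn (Suc (Suc 0)) s x t y"
  proof (cases "x = y")
    case True
    have "0 < Kn (Suc 0) s y t y" by (rule K1)
    also have "\<dots> \<le> Kn (Suc (Suc 0)) s y t y" using s by (intro Kn_mono_Suc) auto
    finally show ?thesis by (simp only: True)
  next
    case False
    define f where "f r = exp (- (LINT u:{r..s}|lborel. 2 * b u x \<omega>)) *
          (b r x \<omega> * (Kn (Suc 0) r (x + 1) t y + Kn (Suc 0) r (x - 1) t y))" for r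
    have fpos: "0 < f r" if "t \<le> r" for r
    proof -
      have "y = x + 1 \<or> y = x - 1" using False xy by auto
      then have "0 < Kn (Suc 0) r (x + 1) t y + Kn (Suc 0) r (x - 1) t y"
        using K1[of r] Kn_nonneg[OF that, of "Suc 0" "x + 1" y] Kn_nonneg[OF that, of "Suc 0" "x - 1" y]
        by (metis add_nonneg_pos add_pos_nonneg)
      then show ?thesis unfolding f_def using b_pos[of r x] by (intro mult_pos_pos) auto
    qed
    have Keq: "Kn (Suc (Suc 0)) s x t y = (LINT r:{t..s}|lborel. f r)"
      unfolding Kn_Suc[of "Suc 0"] f_def using False by simp
    have "set_integrable lborel {t..s} f"
      unfolding f_def
      by (intro duhamel_integrable b2_integrable set_integrable_times_continuous b_integrable continuous_on_add Kn_continuous)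
    then have fi: "integrable lborel (\<lambda>r. indicator {t..s} r *\<^sub>R f r)"
      by (simp add: set_integrable_def)
    have nn: "AE r in lborel. 0 \<le> indicator {t..s} r *\<^sub>R f r"
      using fpos less_imp_le by (auto simp: indicator_def)
    have "(LINT r:{t..s}|lborel. f r) \<noteq> 0"
    proof
      assume "(LINT r:{t..s}|lborel. f r) = 0"
      then have "AE r in lborel. indicator {t..s} r *\<^sub>R f r = 0"
        using integral_nonneg_eq_0_iff_AE[OF fi nn] by (simp add: set_lebesgue_integral_def)
      then have "AE r in lborel. r \<notin> {t..s}"
      proof eventually_elim
        case (elim r)
        then show ?case using fpos[of r] by (auto simp: indicator_def split: if_splits)
      qed
      then have "emeasure lborel {t..s} = 0"
        using AE_iff_measurable[of "{t..s}" lborel "\<lambda>r. r \<notin> {t..s}"] by (simp add: Collect_mem_eq[of "{t..s}", unfolded atLeastAtMost_iff])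
      then show False using s by simp
    qed
    moreover have "0 \<le> (LINT r:{t..s}|lborel. f r)"
      unfolding set_lebesgue_integral_def by (rule integral_nonneg_AE[OF nn])
    ultimately show ?thesis using Keq by linarith
  qed
  then show ?thesis using Kn_le_K[of t s "Suc (Suc 0)" x y] s by linarith
qed

text \<open>
  Summation by parts: a sum over a box may be shifted when one factor vanishes near the boundary of the box.
\<close>

lemma sum_shift_box:
  fixes a k :: "int \<Rightarrow> real"
  assumes "\<And>x. m \<le> \<bar>x - y\<bar> \<Longrightarrow> k x = 0" "\<bar>d\<bar> \<le> 1"
  shows "(\<Sum>x\<in>{y-m..y+m}. a (x + d) * k x) = (\<Sum>x\<in>{y-m..y+m}. a x * k (x - d))"
proof (rule sum.reindex_bij_witness_not_neutral[where i = "\<lambda>x. x - d" and j = "\<lambda>x. x + d"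
      and S' = "{x\<in>{y-m..y+m}. k x = 0}" and T' = "{x\<in>{y-m..y+m}. k (x - d) = 0}"])
  fix x assume x: "x \<in> {y-m..y+m} - {x\<in>{y-m..y+m}. k x = 0}"
  then have "\<not> m \<le> \<bar>x - y\<bar>" using assms(1) by auto
  then show "x + d \<in> {y-m..y+m} - {x\<in>{y-m..y+m}. k (x - d) = 0}" using x assms(2) by auto
next
  fix x assume x: "x \<in> {y-m..y+m} - {x\<in>{y-m..y+m}. k (x - d) = 0}"
  then have "\<not> m \<le> \<bar>(x - d) - y\<bar>" using assms(1) by auto
  then show "x - d \<in> {y-m..y+m} - {x\<in>{y-m..y+m}. k x = 0}" using x assms(2) by auto
qed (auto intro: finite_subset[of _ "{y-m..y+m}"])

text \<open>
  The time derivative of \<open>\<Sum>x. h x s * K s x\<close> vanishes up to the source, because the two equations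
  are adjoint to each other. For the iterates the right-hand side contains the previous iterate, so the cancellation
  is incomplete, but the error has a sign since the iterates increase and \<open>h\<close> is nonnegative. The sum
  starts at \<open>h y t\<close> by the initial condition of the kernel.
\<close>

lemma duality_inequality:
  fixes h :: "int \<Rightarrow> real \<Rightarrow> real"
  assumes h: "\<And>x. primitive_from t (h x)
      (\<lambda>s. - g s - (b s (x + 1) \<omega> * h (x + 1) s + b s (x - 1) \<omega> * h (x - 1) s - 2 * b s x \<omega> * h x s))"
    and g: "\<And>s. set_integrable lborel {t..s} g"
    and h0: "\<And>x s. t \<le> s \<Longrightarrow> 0 \<le> h x s"
    and s: "t \<le> s" and m: "int (Suc n) \<le> m"
  shows "(\<Sum>x\<in>{y-m..y+m}. h x s * Kn n s x t y) + (LINT r:{t..s}|lborel. g r * (\<Sum>x\<in>{y-m..y+m}. Kn n r x t y)) \<le> h y t"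
proof (cases n)
  case 0
  then show ?thesis using h0[of t y] by simp
next
  case (Suc k)
  let ?B = "{y-m..y+m}"
  define L where "L s x = b s (x + 1) \<omega> * h (x + 1) s + b s (x - 1) \<omega> * h (x - 1) s - 2 * b s x \<omega> * h x s" for s x
  define k' where "k' s x = b s x \<omega> * (Kn k s (x + 1) t y + Kn k s (x - 1) t y) - 2 * b s x \<omega> * Kn (Suc k) s x t y" for s x
  have P: "primitive_from t (\<lambda>s. \<Sum>x\<in>?B. h x s * Kn (Suc k) s x t y)
     (\<lambda>s. \<Sum>x\<in>?B. (- g s - L s x) * Kn (Suc k) s x t y + h x s * k' s x)"
    unfolding L_def k'_def by (intro primitive_from_sum primitive_from_mult h Kn_primitive) auto
  have le: "(\<Sum>x\<in>?B. (- g r - L r x) * Kn (Suc k) r x t y + h x r * k' r x) \<le> - (g r * (\<Sum>x\<in>?B. Kn (Suc k) r x t y))"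
    if r: "t \<le> r" for r
  proof -
    define a where "a x = b r x \<omega> * h x r" for x
    define u where "u x = Kn (Suc k) r x t y" for x
    define v where "v x = Kn k r x t y" for x
    have a0: "0 \<le> a x" for x using b_pos[of r x] h0[OF r, of x] by (simp add: a_def)
    have vu: "v x \<le> u x" for x unfolding u_def v_def by (rule Kn_mono_Suc[OF r])
    have us: "u x = 0" if "m \<le> \<bar>x - y\<bar>" for x
      unfolding u_def by (rule Kn_support) (use that m Suc in auto)
    have "(\<Sum>x\<in>?B. (- g r - L r x) * u x + h x r * k' r x)
       = (\<Sum>x\<in>?B. - (g r * u x) - a (x + 1) * u x - a (x + (-1)) * u x + a x * v (x + 1) + a x * v (x - 1))"
      by (rule sum.cong) (auto simp: L_def k'_def a_def u_def v_def algebra_simps simp del: dual_kernel_n.simps)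
    also have "\<dots> = - (g r * (\<Sum>x\<in>?B. u x)) - (\<Sum>x\<in>?B. a (x + 1) * u x) - (\<Sum>x\<in>?B. a (x + (-1)) * u x)
       + (\<Sum>x\<in>?B. a x * v (x + 1)) + (\<Sum>x\<in>?B. a x * v (x - 1))"
      by (simp only: sum.distrib sum_subtractf sum_negf sum_distrib_left)
    also have "(\<Sum>x\<in>?B. a (x + 1) * u x) = (\<Sum>x\<in>?B. a x * u (x - 1))"
      by (rule sum_shift_box[OF us]) auto
    also have "(\<Sum>x\<in>?B. a (x + (-1)) * u x) = (\<Sum>x\<in>?B. a x * u (x - (-1)))"
      by (rule sum_shift_box[OF us]) auto
    also have "\<dots> = (\<Sum>x\<in>?B. a x * u (x + 1))" by simp
    also have "- (g r * (\<Sum>x\<in>?B. u x)) - (\<Sum>x\<in>?B. a x * u (x - 1)) - (\<Sum>x\<in>?B. a x * u (x + 1))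
       + (\<Sum>x\<in>?B. a x * v (x + 1)) + (\<Sum>x\<in>?B. a x * v (x - 1)) \<le> - (g r * (\<Sum>x\<in>?B. u x))"
      using sum_mono[of ?B "\<lambda>x. a x * v (x + 1)" "\<lambda>x. a x * u (x + 1)"]
        sum_mono[of ?B "\<lambda>x. a x * v (x - 1)" "\<lambda>x. a x * u (x - 1)"] mult_left_mono[OF vu a0]
      by smt
    finally show ?thesis by (simp only: u_def)
  qed
  have gK: "set_integrable lborel {t..s} (\<lambda>r. g r * (\<Sum>x\<in>?B. Kn (Suc k) r x t y))"
    by (intro set_integrable_times_continuous g continuous_on_sum Kn_continuous)
  have "(\<Sum>x\<in>?B. h x s * Kn (Suc k) s x t y) - (\<Sum>x\<in>?B. h x t * Kn (Suc k) t x t y)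
     = (LINT r:{t..s}|lborel. \<Sum>x\<in>?B. (- g r - L r x) * Kn (Suc k) r x t y + h x r * k' r x)"
    by (rule primitive_from_diff[OF P order_refl s])
  also have "\<dots> \<le> (LINT r:{t..s}|lborel. - 1 * (g r * (\<Sum>x\<in>?B. Kn (Suc k) r x t y)))"
  proof (rule set_integral_mono)
    show "set_integrable lborel {t..s} (\<lambda>r. \<Sum>x\<in>?B. (- g r - L r x) * Kn (Suc k) r x t y + h x r * k' r x)"
      by (rule primitive_from_integrable[OF P order_refl])
    show "set_integrable lborel {t..s} (\<lambda>r. - 1 * (g r * (\<Sum>x\<in>?B. Kn (Suc k) r x t y)))"
      using gK by (rule set_integrable_mult_right)
    fix r assume "r \<in> {t..s}"
    then show "(\<Sum>x\<in>?B. (- g r - L r x) * Kn (Suc k) r x t y + h x r * k' r x) \<le> - 1 * (g r * (\<Sum>x\<in>?B. Kn (Suc k) r x t y))"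
      using le[of r] by (simp only: atLeastAtMost_iff mult_minus1)
  qed
  also have "(\<Sum>x\<in>?B. h x t * Kn (Suc k) t x t y) = h y t"
  proof -
    have "(\<Sum>x\<in>?B. h x t * Kn (Suc k) t x t y) = (\<Sum>x\<in>?B. if x = y then h x t else 0)"
      by (rule sum.cong) (auto simp: Kn_Suc_start simp del: dual_kernel_n.simps)
    then show ?thesis using m by simp
  qed
  finally have "(\<Sum>x\<in>?B. h x s * Kn (Suc k) s x t y) - h y t \<le> - (LINT r:{t..s}|lborel. g r * (\<Sum>x\<in>?B. Kn (Suc k) r x t y))"
    unfolding set_integral_mult_right unfolding mult_minus1 .
  moreover have "a + i \<le> c" if "a - c \<le> - i" for a c i :: real using that by simp
  ultimately show ?thesis
    unfolding Suc by blast
qed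

end

section \<open>Sums over the integers and integrals over a half-line\<close>

text \<open>
  Symmetric boxes exhaust the integers. All sums over space are written as integrals over the counting measure, where
  the theorems of Tonelli and of monotone convergence are available.
\<close>

lemma nn_integral_int_SUP:
  fixes f :: "int \<Rightarrow> ennreal"
  shows "(\<integral>\<^sup>+x. f x \<partial>count_space UNIV) = (SUP n::nat. \<Sum>x\<in>{-int n..int n}. f x)"
proof -
  have lim: "(SUP n::nat. f x * indicator {-int n..int n} x) = f x" for x
  proof (rule antisym)
    show "(SUP n::nat. f x * indicator {-int n..int n} x) \<le> f x"
      by (rule SUP_least) (auto simp: indicator_def)
    show "f x \<le> (SUP n::nat. f x * indicator {-int n..int n} x)"
      by (rule SUP_upper2[of "nat \<bar>x\<bar>"]) (auto simp: indicator_def)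
  qed
  have "(\<integral>\<^sup>+x. f x \<partial>count_space UNIV) = (\<integral>\<^sup>+x. (SUP n::nat. f x * indicator {-int n..int n} x) \<partial>count_space UNIV)"
    unfolding lim ..
  also have "\<dots> = (SUP n::nat. \<integral>\<^sup>+x. f x * indicator {-int n..int n} x \<partial>count_space UNIV)"
    by (rule nn_integral_monotone_convergence_SUP) (auto simp: incseq_def le_fun_def indicator_def)
  also have "(\<lambda>n::nat. \<integral>\<^sup>+x. f x * indicator {-int n..int n} x \<partial>count_space UNIV) = (\<lambda>n. \<Sum>x\<in>{-int n..int n}. f x)"
  proof
    fix n :: nat
    have "(\<integral>\<^sup>+x. f x * indicator {-int n..int n} x \<partial>count_space UNIV) = (\<Sum>x\<in>{-int n..int n}. f x * indicator {-int n..int n} x)"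
      by (rule nn_integral_count_space') auto
    then show "(\<integral>\<^sup>+x. f x * indicator {-int n..int n} x \<partial>count_space UNIV) = (\<Sum>x\<in>{-int n..int n}. f x)"
      by simp
  qed
  finally show ?thesis .
qed

lemma infsum_int_nn_integral:
  fixes f :: "int \<Rightarrow> ennreal"
  shows "(\<Sum>\<^sub>\<infinity>x\<in>UNIV. f x) = (\<integral>\<^sup>+x. f x \<partial>count_space UNIV)"
proof -
  have "(\<Sum>\<^sub>\<infinity>x\<in>UNIV. f x) = (SUP F\<in>{F. finite F \<and> F \<subseteq> UNIV}. sum f F)"
    by (rule nonneg_infsum_complete) simp
  also have "\<dots> = (SUP n::nat. \<Sum>x\<in>{-int n..int n}. f x)"
  proof (rule antisym; rule SUP_least)
    fix F :: "int set" assume "F \<in> {F. finite F \<and> F \<subseteq> UNIV}"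
    then have F: "finite F" by simp
    then obtain n where n: "\<And>x. x \<in> F \<Longrightarrow> nat \<bar>x\<bar> \<le> n"
      using finite_nat_set_iff_bounded_le[of "(\<lambda>x. nat \<bar>x\<bar>) ` F"] by auto
    have "F \<subseteq> {-int n..int n}" using n by fastforce
    then have "sum f F \<le> (\<Sum>x\<in>{-int n..int n}. f x)" by (intro sum_mono2) auto
    then show "sum f F \<le> (SUP n::nat. \<Sum>x\<in>{-int n..int n}. f x)"
      by (rule SUP_upper2[OF UNIV_I])
  next
    fix n :: nat
    show "(\<Sum>x\<in>{-int n..int n}. f x) \<le> (SUP F\<in>{F. finite F \<and> F \<subseteq> UNIV}. sum f F)"
      by (rule SUP_upper) auto
  qed
  finally show ?thesis unfolding nn_integral_int_SUP .
qed

lemma has_sum_of_nn_integral_int: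
  fixes f :: "int \<Rightarrow> real"
  assumes f: "\<And>x. 0 \<le> f x" and s: "0 \<le> s"
    and eq: "(\<integral>\<^sup>+x. ennreal (f x) \<partial>count_space UNIV) = ennreal s"
  shows "(f has_sum s) UNIV"
proof -
  have "((\<lambda>x. ennreal (f x)) has_sum ennreal s) UNIV"
    using has_sum_infsum[OF nonneg_summable_on_complete[of UNIV "\<lambda>x. ennreal (f x)"]]
    unfolding infsum_int_nn_integral eq by simp
  moreover have "sum (\<lambda>x. ennreal (f x)) = (\<lambda>F. ennreal (sum f F))"
    by (rule ext) (rule sum_ennreal, rule f)
  ultimately have "((\<lambda>F. ennreal (sum f F)) \<longlongrightarrow> ennreal s) (finite_subsets_at_top UNIV)"
    unfolding has_sum_def by (simp only:)
  then show ?thesis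
    unfolding has_sum_def by (rule tendsto_ennrealD) (auto simp: s f sum_nonneg)
qed

lemma nn_integral_int_minus:
  fixes f :: "int \<Rightarrow> ennreal"
  shows "(\<integral>\<^sup>+x. f (- x) \<partial>count_space UNIV) = (\<integral>\<^sup>+x. f x \<partial>count_space UNIV)"
proof -
  have "bij_betw uminus (UNIV :: int set) UNIV"
    by (intro bij_betwI[where g = uminus]) auto
  from nn_integral_count_compose_bij[OF this, of f] show ?thesis by simp
qed

lemma set_integral_time_shift:
  fixes f :: "real \<Rightarrow> real"
  shows "(LINT u:{t + r..s + r}|lborel. f u) = (LINT u:{t..s}|lborel. f (u + r))"
proof -
  have "(LINT u:{t + r..s + r}|lborel. f u) = (LINT u|lborel. indicator {t + r..s + r} (r + 1 * u) *\<^sub>R f (r + 1 * u))"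
    unfolding set_lebesgue_integral_def
    by (subst lborel_integral_real_affine[where c = 1 and t = r]) auto
  also have "\<dots> = (LINT u:{t..s}|lborel. f (u + r))"
    unfolding set_lebesgue_integral_def
    by (rule Bochner_Integration.integral_cong) (auto simp: indicator_def add.commute)
  finally show ?thesis .
qed

lemma borel_measurable_set_integral_Icc:
  fixes f :: "'p \<Rightarrow> real \<Rightarrow> real"
  assumes [measurable]: "(\<lambda>(p, v). f p v) \<in> borel_measurable (N \<Otimes>\<^sub>M borel)"
    "l \<in> borel_measurable N" "u \<in> borel_measurable N"
  shows "(\<lambda>p. LINT v:{l p..u p}|lborel. f p v) \<in> borel_measurable N"
proof -
  have "(\<lambda>(p, v). indicator {l p..u p} v *\<^sub>R f p v) \<in> borel_measurable (N \<Otimes>\<^sub>M lborel)"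
    unfolding indicator_def atLeastAtMost_iff by measurable
  then show ?thesis
    unfolding set_lebesgue_integral_def by (rule lborel.borel_measurable_lebesgue_integral)
qed

lemma nn_integral_exp_half_line:
  assumes "0 < \<epsilon>"
  shows "(\<integral>\<^sup>+t. ennreal (exp (- \<epsilon> * t)) * indicator {0..} t \<partial>lborel) = ennreal (1 / (\<epsilon>::real))"
proof -
  have "(\<integral>\<^sup>+t. ennreal (exp (- \<epsilon> * t)) * indicator {0..} t \<partial>lborel) = ennreal (0 - (- exp (- \<epsilon> * 0) / \<epsilon>))"
  proof (rule nn_integral_FTC_atLeast)
    fix x :: real assume "0 \<le> x"
    show "((\<lambda>x. - exp (- \<epsilon> * x) / \<epsilon>) has_real_derivative exp (- \<epsilon> * x)) (at x)"
      using assms by (auto intro!: derivative_eq_intros)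
    show "0 \<le> exp (- \<epsilon> * x)" by simp
  next
    have "((\<lambda>x. - exp (- (\<epsilon> * x)) / \<epsilon>) \<longlongrightarrow> - 0 / \<epsilon>) at_top"
      using assms
      by (intro tendsto_intros filterlim_compose[OF exp_at_bot] filterlim_compose[OF filterlim_uminus_at_bot_at_top]
          filterlim_tendsto_pos_mult_at_top[OF tendsto_const] filterlim_ident) auto
    then show "((\<lambda>x. - exp (- \<epsilon> * x) / \<epsilon>) \<longlongrightarrow> 0) at_top" by simp
  qed simp
  then show ?thesis by simp
qed

section \<open>Conservation of mass and truncation\<close>

context conductance_path
begin

text \<open>
  The lower bound for the mass in a box tends to 1 when the box grows.
\<close>

lemma K_total_mass:
  assumes s: "t \<le> s"
  shows "(\<integral>\<^sup>+y. ennreal (K s x t y) \<partial>count_space UNIV) = 1"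
  unfolding nn_integral_int_SUP
proof (rule antisym)
  have sum: "(\<Sum>y\<in>A. ennreal (K s x t y)) = ennreal (\<Sum>y\<in>A. K s x t y)" for A :: "int set"
    by (rule sum_ennreal) (use K_nonneg[OF s] in auto)
  show "(SUP n::nat. \<Sum>y\<in>{-int n..int n}. ennreal (K s x t y)) \<le> 1"
    unfolding sum by (rule SUP_least) (use K_sum_le_1[OF _ s] in \<open>auto simp: ennreal_le_1\<close>)
  define C where "C = \<bar>real_of_int x\<bar> + (LINT u:{t..s}|lborel. 2 * b u 0 \<omega>)"
  have "(\<lambda>n. 1 - C / real (Suc n)) \<longlonglongrightarrow> 1 - 0"
    by (intro tendsto_intros LIMSEQ_Suc[OF lim_const_over_n])
  then have "(\<lambda>n. ennreal (1 - C / real (Suc n))) \<longlonglongrightarrow> ennreal 1"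
    by (intro tendsto_ennrealI) simp
  moreover have "ennreal (1 - C / real (Suc n)) \<le> (SUP n::nat. \<Sum>y\<in>{-int n..int n}. ennreal (K s x t y))" for n
  proof (rule SUP_upper2[of "Suc n"])
    show "Suc n \<in> UNIV" by simp
    show "ennreal (1 - C / real (Suc n)) \<le> (\<Sum>y\<in>{-int (Suc n)..int (Suc n)}. ennreal (K s x t y))"
      unfolding sum C_def using K_mass_lower_bound[of "int (Suc n)" t s x] s
      by (intro ennreal_leI) simp
  qed
  ultimately show "1 \<le> (SUP n::nat. \<Sum>y\<in>{-int n..int n}. ennreal (K s x t y))"
    using LIMSEQ_le_const2 by (metis (no_types, lifting) ennreal_1)
qed

lemma truncation_path: "0 < N \<Longrightarrow> conductance_path (\<lambda>t x \<omega>. min (b t x \<omega>) N) \<omega>"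
proof
  fix x s t assume N: "0 < N"
  show "0 < min (b t x \<omega>) N" using N b_pos by simp
  have m: "(\<lambda>u. indicator {s..t} u *\<^sub>R b u x \<omega>) \<in> borel_measurable lborel"
    using b_integrable[of s t x] by (simp add: set_integrable_def)
  have "(\<lambda>u. min (indicator {s..t} u *\<^sub>R b u x \<omega>) (indicator {s..t} u * N)) \<in> borel_measurable lborel"
    by (intro borel_measurable_min m) simp
  also have "(\<lambda>u. min (indicator {s..t} u *\<^sub>R b u x \<omega>) (indicator {s..t} u * N)) = (\<lambda>u. indicator {s..t} u *\<^sub>R min (b u x \<omega>) N)"
    by (auto simp: indicator_def)
  finally have mm: "set_borel_measurable lborel {s..t} (\<lambda>u. min (b u x \<omega>) N)"
    by (simp add: set_borel_measurable_def)
  show "set_integrable lborel {s..t} (\<lambda>u. min (b u x \<omega>) N)"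
    by (rule set_integrable_bound[OF b_integrable[of s t x] mm])
       (use N b_nonneg in auto)
qed

text \<open>
  Only finitely many conductances enter an iterate, and each of them is integrable in time, so the truncation can be
  removed by dominated convergence, one iteration after the other.
\<close>

lemma Kn_truncation_limit:
  assumes "t \<le> s"
  shows "(\<lambda>N. dual_kernel_n (\<lambda>t x \<omega>. min (b t x \<omega>) (real (Suc N))) n s x t y \<omega>) \<longlonglongrightarrow> Kn n s x t y"
  using assms
proof (induction n arbitrary: s x)
  case (Suc n)
  define c where "c N = (\<lambda>t x \<omega>. min (b t x \<omega>) (real (Suc N)))" for N
  interpret c: conductance_path "c N" \<omega> for N
    unfolding c_def by (rule truncation_path) simp
  have cb: "0 \<le> c N u x \<omega>" "c N u x \<omega> \<le> b u x \<omega>" for N u x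
    using c.b_nonneg by (auto simp: c_def)
  have clim: "(\<lambda>N. c N u x \<omega>) \<longlonglongrightarrow> b u x \<omega>" for u x
  proof (rule tendsto_eventually)
    obtain k where "b u x \<omega> \<le> real k" using real_arch_simple by blast
    then show "\<forall>\<^sub>F N in sequentially. c N u x \<omega> = b u x \<omega>"
      by (intro eventually_sequentiallyI[of k]) (auto simp: c_def)
  qed
  have cint: "(\<lambda>N. LINT u:{r..r'}|lborel. 2 * c N u x \<omega>) \<longlonglongrightarrow> (LINT u:{r..r'}|lborel. 2 * b u x \<omega>)" for r r'
    by (rule set_integral_dominated_convergence(2)[OF b2_integrable c.b2_integrable])
       (use cb in \<open>auto intro!: tendsto_intros clim simp: abs_mult\<close>)
  define F where "F N r = exp (- (LINT u:{r..s}|lborel. 2 * c N u x \<omega>)) *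
      (c N r x \<omega> * (dual_kernel_n (c N) n r (x + 1) t y \<omega> + dual_kernel_n (c N) n r (x - 1) t y \<omega>))" for N r
  have Flim: "(\<lambda>N. LINT r:{t..s}|lborel. F N r) \<longlonglongrightarrow> (LINT r:{t..s}|lborel. exp (- (LINT u:{r..s}|lborel. 2 * b u x \<omega>)) *
          (b r x \<omega> * (Kn n r (x + 1) t y + Kn n r (x - 1) t y)))"
  proof (rule set_integral_dominated_convergence(2)[OF b2_integrable])
    fix N
    show "set_integrable lborel {t..s} (F N)"
      unfolding F_def by (intro duhamel_integrable c.b2_integrable set_integrable_times_continuous
          c.b_integrable continuous_on_add c.Kn_continuous)
    fix r assume r: "r \<in> {t..s}"
    have k: "0 \<le> dual_kernel_n (c N) n r z t y \<omega>" "dual_kernel_n (c N) n r z t y \<omega> \<le> 1" for z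
      using c.Kn_nonneg c.Kn_le_1 r by auto
    have i: "0 \<le> (LINT u:{r..s}|lborel. 2 * c N u x \<omega>)"
      unfolding set_lebesgue_integral_def
      by (rule Bochner_Integration.integral_nonneg) (use cb in \<open>auto simp: indicator_def\<close>)
    have "c N r x \<omega> * (dual_kernel_n (c N) n r (x + 1) t y \<omega> + dual_kernel_n (c N) n r (x - 1) t y \<omega>) \<le> b r x \<omega> * 2"
      using k[of "x + 1"] k[of "x - 1"] cb[of N r x] by (intro mult_mono) auto
    moreover have "0 \<le> c N r x \<omega> * (dual_kernel_n (c N) n r (x + 1) t y \<omega> + dual_kernel_n (c N) n r (x - 1) t y \<omega>)"
      using k cb by auto
    moreover have "exp (- (LINT u:{r..s}|lborel. 2 * c N u x \<omega>)) \<le> 1" using i by (simp only: exp_le_one_iff neg_le_0_iff_le)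
    ultimately have "F N r \<le> 1 * (b r x \<omega> * 2) \<and> 0 \<le> F N r"
      unfolding F_def by (metis exp_ge_zero mult_mono mult_nonneg_nonneg zero_le_one)
    then show "\<bar>F N r\<bar> \<le> 2 * b r x \<omega>" by simp
  next
    fix r assume r: "r \<in> {t..s}"
    then show "(\<lambda>N. F N r) \<longlonglongrightarrow> exp (- (LINT u:{r..s}|lborel. 2 * b u x \<omega>)) *
          (b r x \<omega> * (Kn n r (x + 1) t y + Kn n r (x - 1) t y))"
      unfolding F_def using Suc.IH[of r] r by (intro tendsto_intros cint clim) (auto simp: c_def)
  qed
  have "(\<lambda>N. exp (- (LINT u:{t..s}|lborel. 2 * c N u x \<omega>)) * (if x = y then 1 else 0) + (LINT r:{t..s}|lborel. F N r))
     \<longlonglongrightarrow> Kn (Suc n) s x t y"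
    unfolding Kn_Suc by (intro tendsto_intros cint Flim)
  then show ?case
    unfolding F_def c.Kn_Suc[symmetric] unfolding c_def .
qed simp

end

section \<open>Shifts of the environment\<close>

context dynamical_environment
begin

lemma path: "\<omega> \<in> space M \<Longrightarrow> conductance_path b \<omega>"
  by standard (use conductance_pos conductance_locally_integrable in auto)

lemma measurable_shift [measurable]: "\<tau> t x \<in> measurable M M"
proof -
  have "(\<lambda>\<omega>. (case (t, \<omega>) of (t, \<omega>) \<Rightarrow> \<tau> t x \<omega>)) \<in> measurable M M"
    by (rule measurable_compose[OF measurable_Pair1' shift_measurable]) simp
  then show ?thesis by simp
qed

lemma shift_in_space: "\<omega> \<in> space M \<Longrightarrow> \<tau> t x \<omega> \<in> space M"
  using measurable_space[OF measurable_shift] .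

lemma measurable_shift_pair [measurable (raw)]:
  assumes "s \<in> borel_measurable N" "w \<in> measurable N M"
  shows "(\<lambda>p. \<tau> (s p) x (w p)) \<in> measurable N M"
proof -
  have "(\<lambda>p. (s p, w p)) \<in> measurable N (borel \<Otimes>\<^sub>M M)" using assms by simp
  from measurable_compose[OF this shift_measurable] show ?thesis by simp
qed

lemma measurable_conductance [measurable (raw)]:
  assumes "s \<in> borel_measurable N" "w \<in> measurable N M"
  shows "(\<lambda>p. b (s p) x (w p)) \<in> borel_measurable N"
proof -
  have "(\<lambda>p. (s p, w p)) \<in> measurable N (borel \<Otimes>\<^sub>M M)" using assms by simp
  from measurable_compose[OF this conductance_measurable] show ?thesis by simp
qed

lemma nn_integral_shift:
  assumes "f \<in> borel_measurable M"
  shows "(\<integral>\<^sup>+\<omega>. f (\<tau> t x \<omega>) \<partial>M) = (\<integral>\<^sup>+\<omega>. f \<omega> \<partial>M)"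
  using nn_integral_distr[OF measurable_shift, of f "t" x] assms by (simp add: shift_invariant)

lemma integrable_shift:
  fixes f :: "'a \<Rightarrow> real"
  assumes "integrable M f"
  shows "integrable M (\<lambda>\<omega>. f (\<tau> t x \<omega>))"
  using integrable_distr[OF measurable_shift[of t x], of f] assms by (simp add: shift_invariant)

lemma integral_shift:
  fixes f :: "'a \<Rightarrow> real"
  assumes "f \<in> borel_measurable M"
  shows "(LINT \<omega>|M. f (\<tau> t x \<omega>)) = (LINT \<omega>|M. f \<omega>)"
  using integral_distr[OF measurable_shift[of t x], of f] assms by (simp add: shift_invariant)

lemma AE_shift:
  assumes "AE \<omega> in M. P \<omega>"
  shows "AE \<omega> in M. P (\<tau> t x \<omega>)"
  by (rule AE_distrD[OF measurable_shift]) (simp only: shift_invariant assms)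

lemma dual_kernel_n_shift:
  assumes \<omega>: "\<omega> \<in> space M"
  shows "dual_kernel_n b n s x t y (\<tau> r z \<omega>) = dual_kernel_n b n (s + r) (x + z) (t + r) (y + z) \<omega>"
proof (induction n arbitrary: s x)
  case (Suc n)
  interpret p: conductance_path b \<omega> by (rule path[OF \<omega>])
  interpret q: conductance_path b "\<tau> r z \<omega>" by (rule path[OF shift_in_space[OF \<omega>]])
  have e: "(LINT u:{l + r..s + r}|lborel. 2 * b u (x + z) \<omega>) = (LINT u:{l..s}|lborel. 2 * b u x (\<tau> r z \<omega>))" for l
    unfolding set_integral_time_shift by (simp add: conductance_shift[OF \<omega>])
  show ?case
    unfolding q.Kn_Suc p.Kn_Suc unfolding set_integral_time_shift[of t r s] e Suc
    by (simp add: conductance_shift[OF \<omega>] set_integral_time_shift algebra_simps)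
qed simp

lemma dual_kernel_shift:
  assumes \<omega>: "\<omega> \<in> space M"
  shows "dual_kernel b s x t y (\<tau> r z \<omega>) = dual_kernel b (s + r) (x + z) (t + r) (y + z) \<omega>"
  unfolding dual_kernel_def dual_kernel_n_shift[OF \<omega>] ..

text \<open>
  Joint measurability in time and environment is proved along the iteration: integrals over intervals with measurable
  end points are measurable in the parameters.
\<close>

lemma measurable_dual_kernel_n:
  "(\<lambda>(s, \<omega>). dual_kernel_n b n s x t y \<omega>) \<in> borel_measurable (borel \<Otimes>\<^sub>M M)"
proof (induction n arbitrary: x)
  case (Suc n)
  note [measurable] = Suc[of "x + 1"] Suc[of "x - 1"]
  have [measurable]: "(\<lambda>p. LINT u:{t..fst p}|lborel. 2 * b u x (snd p)) \<in> borel_measurable (borel \<Otimes>\<^sub>M M)"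
    by (rule borel_measurable_set_integral_Icc) measurable
  have [measurable]: "(\<lambda>q. LINT u:{snd q..fst (fst q)}|lborel. 2 * b u x (snd (fst q))) \<in> borel_measurable ((borel \<Otimes>\<^sub>M M) \<Otimes>\<^sub>M borel)"
    by (rule borel_measurable_set_integral_Icc) measurable
  have k: "(\<lambda>q. dual_kernel_n b n (snd q) z t y (snd (fst q))) \<in> borel_measurable ((borel \<Otimes>\<^sub>M M) \<Otimes>\<^sub>M borel)" for z
    using measurable_compose[OF _ Suc[of z], of "\<lambda>q. (snd q, snd (fst q))" "(borel \<Otimes>\<^sub>M M) \<Otimes>\<^sub>M borel"] by simp
  note [measurable] = k[of "x + 1"] k[of "x - 1"]
  have [measurable]: "(\<lambda>p. LINT r:{t..fst p}|lborel. exp (- (LINT u:{r..fst p}|lborel. 2 * b u x (snd p))) *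
          (b r x (snd p) * (dual_kernel_n b n r (x + 1) t y (snd p) + dual_kernel_n b n r (x - 1) t y (snd p))))
       \<in> borel_measurable (borel \<Otimes>\<^sub>M M)"
    by (rule borel_measurable_set_integral_Icc) (unfold split_beta', measurable)
  have "(\<lambda>p. exp (- (LINT u:{t..fst p}|lborel. 2 * b u x (snd p))) * (if x = y then 1 else 0)
     + (LINT r:{t..fst p}|lborel. exp (- (LINT u:{r..fst p}|lborel. 2 * b u x (snd p))) *
          (b r x (snd p) * (dual_kernel_n b n r (x + 1) t y (snd p) + dual_kernel_n b n r (x - 1) t y (snd p)))))
       \<in> borel_measurable (borel \<Otimes>\<^sub>M M)"
    by measurable
  then show ?case
    by (simp add: split_beta' mult.assoc)
qed (simp add: split_beta')

lemma measurable_dual_kernel_pair: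
  "(\<lambda>(s, \<omega>). dual_kernel b s x t y \<omega>) \<in> borel_measurable (borel \<Otimes>\<^sub>M M)"
  unfolding dual_kernel_def split_beta'
  by (rule borel_measurable_lim_metric) (use measurable_dual_kernel_n in \<open>simp add: split_beta'\<close>)

lemma measurable_dual_kernel [measurable]:
  "(\<lambda>\<omega>. dual_kernel b s x t y \<omega>) \<in> borel_measurable M"
  using measurable_compose[OF measurable_Pair1' measurable_dual_kernel_pair, of s] by simp

lemma measurable_dual_kernel_raw [measurable (raw)]:
  assumes "s \<in> borel_measurable N" "w \<in> measurable N M"
  shows "(\<lambda>p. dual_kernel b (s p) x t y (w p)) \<in> borel_measurable N"
proof -
  have "(\<lambda>p. (s p, w p)) \<in> measurable N (borel \<Otimes>\<^sub>M M)" using assms by simp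
  from measurable_compose[OF this measurable_dual_kernel_pair] show ?thesis by simp
qed

lemma truncated_environment:
  assumes "0 < N"
  shows "dynamical_environment M (\<lambda>t x \<omega>. min (b t x \<omega>) N) \<tau>"
proof
  fix x :: int
  show "(\<lambda>(t, \<omega>). min (b t x \<omega>) N) \<in> borel_measurable (borel \<Otimes>\<^sub>M M)"
    by (simp add: split_beta')
  show "(\<lambda>(t, \<omega>). \<tau> t x \<omega>) \<in> measurable (borel \<Otimes>\<^sub>M M) M" by (rule shift_measurable)
next
  fix \<omega> s t x assume "\<omega> \<in> space M"
  then interpret conductance_path b \<omega> by (rule path)
  interpret c: conductance_path "\<lambda>t x \<omega>. min (b t x \<omega>) N" \<omega> by (rule truncation_path[OF assms])
  show "0 < min (b t x \<omega>) N" by (rule c.b_pos)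
  show "set_integrable lborel {s..t} (\<lambda>u. min (b u x \<omega>) N)" by (rule c.b_integrable)
qed (use shift_ergodic in \<open>auto simp: shift_zero shift_add conductance_shift shift_invariant\<close>)

text \<open>
  Shifting the environment by \<open>(- t, - x)\<close> moves the end point of the kernel to the origin. So averaging
  over the columns of the kernel is adjoint to the transition operator of the induced chain.
\<close>

lemma dual_kernel_duality:
  fixes f g :: "'a \<Rightarrow> ennreal"
  assumes [measurable]: "f \<in> borel_measurable M" "g \<in> borel_measurable M"
  shows "(\<integral>\<^sup>+\<omega>. (\<integral>\<^sup>+x. g (\<tau> t x \<omega>) * ennreal (dual_kernel b t x 0 0 \<omega>) \<partial>count_space UNIV) * f \<omega> \<partial>M)
     = (\<integral>\<^sup>+\<omega>. g \<omega> * (\<integral>\<^sup>+y. ennreal (dual_kernel b 0 0 (- t) y \<omega>) * f (\<tau> (- t) y \<omega>) \<partial>count_space UNIV) \<partial>M)"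
proof -
  have "(\<integral>\<^sup>+\<omega>. (\<integral>\<^sup>+x. g (\<tau> t x \<omega>) * ennreal (dual_kernel b t x 0 0 \<omega>) \<partial>count_space UNIV) * f \<omega> \<partial>M)
     = (\<integral>\<^sup>+\<omega>. (\<integral>\<^sup>+x. g (\<tau> t x \<omega>) * ennreal (dual_kernel b t x 0 0 \<omega>) * f \<omega> \<partial>count_space UNIV) \<partial>M)"
    by (simp add: nn_integral_multc)
  also have "\<dots> = (\<integral>\<^sup>+x. (\<integral>\<^sup>+\<omega>. g (\<tau> t x \<omega>) * ennreal (dual_kernel b t x 0 0 \<omega>) * f \<omega> \<partial>M) \<partial>count_space UNIV)"
    by (rule nn_integral_count_space_nn_integral) auto
  also have "\<dots> = (\<integral>\<^sup>+x. (\<integral>\<^sup>+\<omega>. g \<omega> * (ennreal (dual_kernel b 0 0 (- t) (- x) \<omega>) * f (\<tau> (- t) (- x) \<omega>)) \<partial>M) \<partial>count_space UNIV)"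
  proof (rule nn_integral_cong)
    fix x
    have "(\<integral>\<^sup>+\<omega>. g (\<tau> t x \<omega>) * ennreal (dual_kernel b t x 0 0 \<omega>) * f \<omega> \<partial>M)
      = (\<integral>\<^sup>+\<omega>. g (\<tau> t x (\<tau> (- t) (- x) \<omega>)) * ennreal (dual_kernel b t x 0 0 (\<tau> (- t) (- x) \<omega>)) * f (\<tau> (- t) (- x) \<omega>) \<partial>M)"
      by (rule nn_integral_shift[symmetric]) measurable
    also have "\<dots> = (\<integral>\<^sup>+\<omega>. g \<omega> * (ennreal (dual_kernel b 0 0 (- t) (- x) \<omega>) * f (\<tau> (- t) (- x) \<omega>)) \<partial>M)"
      by (rule nn_integral_cong) (simp add: dual_kernel_shift shift_add shift_zero mult.assoc)
    finally show "(\<integral>\<^sup>+\<omega>. g (\<tau> t x \<omega>) * ennreal (dual_kernel b t x 0 0 \<omega>) * f \<omega> \<partial>M) = \<dots>" .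
  qed
  also have "\<dots> = (\<integral>\<^sup>+y. (\<integral>\<^sup>+\<omega>. g \<omega> * (ennreal (dual_kernel b 0 0 (- t) y \<omega>) * f (\<tau> (- t) y \<omega>)) \<partial>M) \<partial>count_space UNIV)"
    by (rule nn_integral_int_minus[of "\<lambda>y. \<integral>\<^sup>+\<omega>. g \<omega> * (ennreal (dual_kernel b 0 0 (- t) y \<omega>) * f (\<tau> (- t) y \<omega>)) \<partial>M"])
  also have "\<dots> = (\<integral>\<^sup>+\<omega>. (\<integral>\<^sup>+y. g \<omega> * (ennreal (dual_kernel b 0 0 (- t) y \<omega>) * f (\<tau> (- t) y \<omega>)) \<partial>count_space UNIV) \<partial>M)"
    by (rule nn_integral_count_space_nn_integral[symmetric]) auto
  also have "\<dots> = (\<integral>\<^sup>+\<omega>. g \<omega> * (\<integral>\<^sup>+y. ennreal (dual_kernel b 0 0 (- t) y \<omega>) * f (\<tau> (- t) y \<omega>) \<partial>count_space UNIV) \<partial>M)"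
    by (simp add: nn_integral_cmult)
  finally show ?thesis .
qed

lemma measurable_nn_integral_int [measurable (raw)]:
  fixes f :: "'b \<Rightarrow> int \<Rightarrow> ennreal"
  assumes [measurable]: "\<And>x. (\<lambda>p. f p x) \<in> borel_measurable N"
  shows "(\<lambda>p. \<integral>\<^sup>+x. f p x \<partial>count_space UNIV) \<in> borel_measurable N"
  unfolding nn_integral_int_SUP by measurable

text \<open>
  The function \<open>varphi_eps b \<epsilon>\<close> before the conversion to a real number; the value may be
  infinite on a null set.
\<close>

definition resolvent_density :: "real \<Rightarrow> 'a \<Rightarrow> ennreal" where
  "resolvent_density \<epsilon> \<omega> = ennreal \<epsilon> * (\<integral>\<^sup>+t. ennreal (exp (- \<epsilon> * t)) *
     (\<integral>\<^sup>+x. ennreal (dual_kernel b t x 0 0 \<omega>) \<partial>count_space UNIV) * indicator {0..} t \<partial>lborel)"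

lemma varphi_eps_eq: "varphi_eps b \<epsilon> \<omega> = enn2real (resolvent_density \<epsilon> \<omega>)"
  unfolding varphi_eps_def resolvent_density_def infsum_int_nn_integral ..

lemma measurable_resolvent_density [measurable]: "resolvent_density \<epsilon> \<in> borel_measurable M"
proof -
  have "(\<lambda>\<omega>. \<integral>\<^sup>+t. ennreal (exp (- \<epsilon> * t)) *
     (\<integral>\<^sup>+x. ennreal (dual_kernel b t x 0 0 \<omega>) \<partial>count_space UNIV) * indicator {0..} t \<partial>lborel) \<in> borel_measurable M"
    by measurable
  then show ?thesis unfolding resolvent_density_def[abs_def] by measurable
qed

lemma measurable_varphi_eps [measurable]: "varphi_eps b \<epsilon> \<in> borel_measurable M"
  unfolding varphi_eps_eq[abs_def] by measurable

text \<open>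
  By duality with the constant function the expected column sum is the expected row sum, which is 1 because the dual
  walk does not explode.
\<close>

lemma expected_column_sum:
  assumes t: "0 \<le> t"
  shows "(\<integral>\<^sup>+\<omega>. (\<integral>\<^sup>+x. ennreal (dual_kernel b t x 0 0 \<omega>) \<partial>count_space UNIV) \<partial>M) = 1"
proof -
  have "(\<integral>\<^sup>+\<omega>. (\<integral>\<^sup>+x. ennreal (dual_kernel b t x 0 0 \<omega>) \<partial>count_space UNIV) \<partial>M)
     = (\<integral>\<^sup>+\<omega>. (\<integral>\<^sup>+y. ennreal (dual_kernel b 0 0 (- t) y \<omega>) \<partial>count_space UNIV) \<partial>M)"
    using dual_kernel_duality[of "\<lambda>_. 1" "\<lambda>_. 1" t] by simp
  also have "\<dots> = (\<integral>\<^sup>+\<omega>. 1 \<partial>M)"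
  proof (rule nn_integral_cong)
    fix \<omega> assume "\<omega> \<in> space M"
    then interpret conductance_path b \<omega> by (rule path)
    show "(\<integral>\<^sup>+y. ennreal (dual_kernel b 0 0 (- t) y \<omega>) \<partial>count_space UNIV) = 1"
      by (rule K_total_mass) (use t in simp)
  qed
  also have "\<dots> = 1" by (simp add: emeasure_space_1)
  finally show ?thesis .
qed

lemma expected_resolvent_density:
  assumes \<epsilon>: "0 < \<epsilon>"
  shows "(\<integral>\<^sup>+\<omega>. resolvent_density \<epsilon> \<omega> \<partial>M) = 1"
proof -
  interpret pair_sigma_finite M lborel ..
  have "(\<integral>\<^sup>+\<omega>. resolvent_density \<epsilon> \<omega> \<partial>M) = ennreal \<epsilon> * (\<integral>\<^sup>+\<omega>. (\<integral>\<^sup>+t. ennreal (exp (- \<epsilon> * t)) *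
     (\<integral>\<^sup>+x. ennreal (dual_kernel b t x 0 0 \<omega>) \<partial>count_space UNIV) * indicator {0..} t \<partial>lborel) \<partial>M)"
    unfolding resolvent_density_def by (rule nn_integral_cmult) measurable
  also have "(\<integral>\<^sup>+\<omega>. (\<integral>\<^sup>+t. ennreal (exp (- \<epsilon> * t)) *
     (\<integral>\<^sup>+x. ennreal (dual_kernel b t x 0 0 \<omega>) \<partial>count_space UNIV) * indicator {0..} t \<partial>lborel) \<partial>M)
    = (\<integral>\<^sup>+t. (\<integral>\<^sup>+\<omega>. ennreal (exp (- \<epsilon> * t)) *
     (\<integral>\<^sup>+x. ennreal (dual_kernel b t x 0 0 \<omega>) \<partial>count_space UNIV) * indicator {0..} t \<partial>M) \<partial>lborel)"
    by (rule Fubini'[symmetric]) measurable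
  also have "\<dots> = (\<integral>\<^sup>+t. ennreal (exp (- \<epsilon> * t)) * indicator {0..} t \<partial>lborel)"
  proof (rule nn_integral_cong)
    fix t :: real
    have "(\<integral>\<^sup>+\<omega>. ennreal (exp (- \<epsilon> * t)) *
        (\<integral>\<^sup>+x. ennreal (dual_kernel b t x 0 0 \<omega>) \<partial>count_space UNIV) * indicator {0..} t \<partial>M)
      = ennreal (exp (- \<epsilon> * t)) * (\<integral>\<^sup>+\<omega>. (\<integral>\<^sup>+x. ennreal (dual_kernel b t x 0 0 \<omega>) \<partial>count_space UNIV) \<partial>M) * indicator {0..} t"
      by (simp add: nn_integral_cmult nn_integral_multc)
    then show "(\<integral>\<^sup>+\<omega>. ennreal (exp (- \<epsilon> * t)) *
        (\<integral>\<^sup>+x. ennreal (dual_kernel b t x 0 0 \<omega>) \<partial>count_space UNIV) * indicator {0..} t \<partial>M)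
      = ennreal (exp (- \<epsilon> * t)) * indicator {0..} t"
      by (cases "0 \<le> t") (auto simp: expected_column_sum)
  qed
  also have "\<dots> = ennreal (1 / \<epsilon>)" by (rule nn_integral_exp_half_line[OF \<epsilon>])
  finally show ?thesis using \<epsilon> by (simp flip: ennreal_mult')
qed

lemma resolvent_density_AE:
  assumes "0 < \<epsilon>"
  shows "AE \<omega> in M. ennreal (varphi_eps b \<epsilon> \<omega>) = resolvent_density \<epsilon> \<omega>"
proof -
  have "AE \<omega> in M. resolvent_density \<epsilon> \<omega> \<noteq> \<infinity>"
    by (rule nn_integral_PInf_AE) (simp_all add: expected_resolvent_density[OF assms])
  then show ?thesis
    by eventually_elim (simp add: varphi_eps_eq less_top)
qed

lemma varphi_eps_nonneg: "0 \<le> varphi_eps b \<epsilon> \<omega>"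
  by (simp add: varphi_eps_eq)

lemma integral_varphi_eps:
  assumes "0 < \<epsilon>"
  shows "integrable M (varphi_eps b \<epsilon>)" "(LINT \<omega>|M. varphi_eps b \<epsilon> \<omega>) = 1"
proof -
  have nn: "(\<integral>\<^sup>+\<omega>. ennreal (varphi_eps b \<epsilon> \<omega>) \<partial>M) = ennreal 1"
    using nn_integral_cong_AE[OF resolvent_density_AE[OF assms]] expected_resolvent_density[OF assms] by simp
  have "has_bochner_integral M (varphi_eps b \<epsilon>) 1"
    by (rule has_bochner_integral_nn_integral[OF _ _ _ nn]) (auto simp: varphi_eps_nonneg)
  then show "integrable M (varphi_eps b \<epsilon>)" "(LINT \<omega>|M. varphi_eps b \<epsilon> \<omega>) = 1"
    by (auto simp: has_bochner_integral_iff)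
qed

end

section \<open>Laplace transforms of bounded functions\<close>

definition laplace :: "real \<Rightarrow> (real \<Rightarrow> real) \<Rightarrow> real" where
  "laplace l g = (LINT s:{0..}|lborel. exp (- l * s) * g s)"

lemma set_integrable_const_Icc: "set_integrable lborel {t..s::real} (\<lambda>_. c::real)"
proof -
  have "integrable lborel (indicator {t..s} :: real \<Rightarrow> real)"
    by (rule integrable_real_indicator) (auto simp: emeasure_lborel_Icc_eq)
  then show ?thesis by (simp add: set_integrable_def)
qed

lemma exp_half_line:
  fixes l :: real
  assumes "0 < l"
  shows "set_integrable lborel {0..} (\<lambda>s. exp (- l * s))" "(LINT s:{0..}|lborel. exp (- l * s)) = 1 / l"
proof -
  have "(\<integral>\<^sup>+s. ennreal (indicator {0..} s * exp (- l * s)) \<partial>lborel) = ennreal (1 / l :: real)"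
    unfolding nn_integral_exp_half_line[OF assms, symmetric]
    by (rule nn_integral_cong) (auto simp: indicator_def)
  then have "has_bochner_integral lborel (\<lambda>s. indicator {0..} s * exp (- l * s)) (1 / l)"
    by (intro has_bochner_integral_nn_integral) (use assms in auto)
  then show "set_integrable lborel {0..} (\<lambda>s. exp (- l * s))" "(LINT s:{0..}|lborel. exp (- l * s)) = 1 / l"
    by (auto simp: has_bochner_integral_iff set_integrable_def set_lebesgue_integral_def)
qed

context
  fixes l :: real
  assumes l: "0 < l"
begin

lemma laplace_integrable:
  assumes [measurable]: "g \<in> borel_measurable borel" and bd: "\<And>s. \<bar>g s\<bar> \<le> C"
  shows "set_integrable lborel {0..} (\<lambda>s. exp (- l * s) * g s)"
proof (rule set_integrable_bound[where f = "\<lambda>s. C * exp (- l * s)"])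
  show "set_integrable lborel {0..} (\<lambda>s. C * exp (- l * s))"
    using exp_half_line[OF l] by simp
  show "set_borel_measurable lborel {0..} (\<lambda>s. exp (- l * s) * g s)"
    unfolding set_borel_measurable_def by measurable
  have "\<bar>exp (- l * s) * g s\<bar> \<le> \<bar>C * exp (- l * s)\<bar>" for s
    using mult_right_mono[of "\<bar>g s\<bar>" "\<bar>C\<bar>" "exp (- l * s)"] bd[of s]
    by (simp add: abs_mult mult.commute)
  then show "AE s in lborel. s \<in> {0..} \<longrightarrow> norm (exp (- l * s) * g s) \<le> norm (C * exp (- l * s))"
    by auto
qed

lemma laplace_const: "laplace l (\<lambda>s. c) = c / l"
  unfolding laplace_def using exp_half_line(2)[OF l] by simp

lemma laplace_add:
  assumes "g \<in> borel_measurable borel" "\<And>s. \<bar>g s\<bar> \<le> C" "g' \<in> borel_measurable borel" "\<And>s. \<bar>g' s\<bar> \<le> C'"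
  shows "laplace l (\<lambda>s. g s + g' s) = laplace l g + laplace l g'"
  unfolding laplace_def distrib_left
  by (rule set_integral_add(2)[OF laplace_integrable[OF assms(1,2)] laplace_integrable[OF assms(3,4)]])

lemma laplace_diff:
  assumes "g \<in> borel_measurable borel" "\<And>s. \<bar>g s\<bar> \<le> C" "g' \<in> borel_measurable borel" "\<And>s. \<bar>g' s\<bar> \<le> C'"
  shows "laplace l (\<lambda>s. g s - g' s) = laplace l g - laplace l g'"
  unfolding laplace_def right_diff_distrib
  by (rule set_integral_diff(2)[OF laplace_integrable[OF assms(1,2)] laplace_integrable[OF assms(3,4)]])

lemma laplace_mono:
  assumes "g \<in> borel_measurable borel" "\<And>s. \<bar>g s\<bar> \<le> C" "g' \<in> borel_measurable borel" "\<And>s. \<bar>g' s\<bar> \<le> C'"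
    and "\<And>s. g s \<le> g' s"
  shows "laplace l g \<le> laplace l g'"
  unfolding laplace_def
  by (rule set_integral_mono[OF laplace_integrable[OF assms(1,2)] laplace_integrable[OF assms(3,4)]])
     (use assms(5) in \<open>auto intro!: mult_left_mono\<close>)

lemma laplace_bound:
  assumes g: "g \<in> borel_measurable borel" "\<And>s. \<bar>g s\<bar> \<le> C"
  shows "\<bar>laplace l g\<bar> \<le> C / l"
proof -
  have "laplace l g \<le> laplace l (\<lambda>s. C)"
    by (rule laplace_mono[of _ C _ "\<bar>C\<bar>"]) (use g in \<open>auto simp: abs_le_iff\<close>)
  moreover have "laplace l (\<lambda>s. - C) \<le> laplace l g"
    by (rule laplace_mono[of _ "\<bar>C\<bar>" _ C]) (use g in \<open>auto simp: abs_le_iff minus_le_iff\<close>)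
  ultimately show ?thesis by (simp add: laplace_const abs_le_iff)
qed

lemma laplace_tendsto:
  assumes "\<And>n. g n \<in> borel_measurable borel" "\<And>n s. \<bar>g n s\<bar> \<le> C" "\<And>s. (\<lambda>n. g n s) \<longlonglongrightarrow> g' s"
  shows "(\<lambda>n. laplace l (g n)) \<longlonglongrightarrow> laplace l g'"
  unfolding laplace_def set_lebesgue_integral_def
proof (rule integral_dominated_convergence[where w = "\<lambda>s. indicator {0..} s *\<^sub>R (exp (- l * s) * C)"])
  have [measurable]: "\<And>n. g n \<in> borel_measurable borel" by fact
  have [measurable]: "g' \<in> borel_measurable borel"
    by (rule borel_measurable_LIMSEQ_real[OF assms(3,1)])
  show "(\<lambda>s. indicator {0..} s *\<^sub>R (exp (- l * s) * g' s)) \<in> borel_measurable lborel" by measurable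
  show "(\<lambda>s. indicator {0..} s *\<^sub>R (exp (- l * s) * g n s)) \<in> borel_measurable lborel" for n by measurable
  show "integrable lborel (\<lambda>s. indicator {0..} s *\<^sub>R (exp (- l * s) * C))"
    using laplace_integrable[of "\<lambda>_. C" "\<bar>C\<bar>"] by (simp add: set_integrable_def)
  show "AE s in lborel. norm (indicator {0..} s *\<^sub>R (exp (- l * s) * g n s)) \<le> indicator {0..} s *\<^sub>R (exp (- l * s) * C)" for n
    using assms(2) by (auto simp: indicator_def abs_mult)
  show "AE s in lborel. (\<lambda>n. indicator {0..} s *\<^sub>R (exp (- l * s) * g n s)) \<longlonglongrightarrow> indicator {0..} s *\<^sub>R (exp (- l * s) * g' s)"
    by (intro AE_I2 tendsto_intros assms(3))
qed

text \<open>
  The first part of the integral is kept and the remaining half-line is translated back to the origin.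
\<close>

lemma laplace_split:
  assumes g: "g \<in> borel_measurable borel" "\<And>s. \<bar>g s\<bar> \<le> C" and a: "0 \<le> a"
  shows "laplace l g = (LINT s:{0..a}|lborel. exp (- l * s) * g s) + exp (- l * a) * laplace l (\<lambda>s. g (s + a))"
proof -
  note i = laplace_integrable[OF g]
  have un: "{0..a} \<union> {a..} = {0..}" using a by auto
  have "AE s in lborel. \<not> (s \<in> {0..a} \<and> s \<in> {a..})"
    using AE_lborel_singleton[of a] by eventually_elim auto
  then have "(LINT s:{0..a} \<union> {a..}|lborel. exp (- l * s) * g s) = (LINT s:{0..a}|lborel. exp (- l * s) * g s) + (LINT s:{a..}|lborel. exp (- l * s) * g s)"
    by (rule set_integral_Un_AE) (rule set_integrable_subset[OF i] | use a in simp)+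
  moreover have "(LINT s:{a..}|lborel. exp (- l * s) * g s) = exp (- l * a) * laplace l (\<lambda>s. g (s + a))"
  proof -
    have "(LINT s:{a..}|lborel. exp (- l * s) * g s) = (LINT s|lborel. indicator {a..} (a + 1 * s) *\<^sub>R (exp (- l * (a + 1 * s)) * g (a + 1 * s)))"
      unfolding set_lebesgue_integral_def by (subst lborel_integral_real_affine[where c = 1 and t = a]) auto
    also have "\<dots> = (LINT s:{0..}|lborel. exp (- l * a) * (exp (- l * s) * g (s + a)))"
      unfolding set_lebesgue_integral_def
      by (rule Bochner_Integration.integral_cong) (auto simp: indicator_def algebra_simps exp_add[symmetric])
    finally show ?thesis unfolding laplace_def set_integral_mult_right .
  qed
  ultimately show ?thesis unfolding laplace_def un by simp
qed

text \<open>
  With the exponential factor pulled out, the transform of the shifted function is \<open>exp (l * s)\<close> times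
  the tail of a convergent integral, so the product rule applies.
\<close>

lemma laplace_primitive:
  assumes g: "g \<in> borel_measurable borel" "\<And>s. \<bar>g s\<bar> \<le> C"
  shows "primitive_from t (\<lambda>s. laplace l (\<lambda>r. g (r + s))) (\<lambda>s. l * laplace l (\<lambda>r. g (r + s)) - g s)"
proof -
  note [measurable] = g(1)
  have lin: "primitive_from t (\<lambda>s. 0 + (LINT r:{t..s}|lborel. l)) (\<lambda>s. l)"
    by (rule primitive_from_indefinite) (rule set_integrable_const_Icc)
  have lin': "primitive_from t (\<lambda>s. l * (s - t)) (\<lambda>s. l)"
    by (rule primitive_from_cong[OF lin]) (auto simp: set_lebesgue_integral_def)
  have e: "primitive_from t (\<lambda>s. exp (l * (s - t))) (\<lambda>s. l * exp (l * (s - t)))"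
    by (rule primitive_from_exp[OF lin'])
  have gi: "set_integrable lborel {t..s} (\<lambda>r. exp (- l * (r - t)) * g r)" for s
  proof -
    have "set_integrable lborel {t..s} g"
    proof (rule set_integrable_bound[where f = "\<lambda>s. C"])
      show "set_borel_measurable lborel {t..s} g" unfolding set_borel_measurable_def by measurable
      show "AE x in lborel. x \<in> {t..s} \<longrightarrow> norm (g x) \<le> norm C"
        using g(2) order_trans abs_ge_self by (metis (mono_tags, lifting) AE_I2 real_norm_def)
    qed (rule set_integrable_const_Icc)
    then have "set_integrable lborel {t..s} (\<lambda>r. g r * exp (- l * (r - t)))"
      by (rule set_integrable_times_continuous) (intro continuous_intros)
    then show ?thesis by (simp add: mult.commute)
  qed
  define L where "L = laplace l (\<lambda>r. g (r + t))"
  have "primitive_from t (\<lambda>s. L - (0 + (LINT r:{t..s}|lborel. exp (- l * (r - t)) * g r))) (\<lambda>s. 0 - exp (- l * (s - t)) * g s)"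
    by (intro primitive_from_minus primitive_from_const primitive_from_indefinite gi)
  note P = primitive_from_mult[OF e this]
  have eq: "exp (l * (s - t)) * (L - (0 + (LINT r:{t..s}|lborel. exp (- l * (r - t)) * g r))) = laplace l (\<lambda>r. g (r + s))"
    if s: "t \<le> s" for s
  proof -
    have "L = (LINT r:{0..s - t}|lborel. exp (- l * r) * g (r + t)) + exp (- l * (s - t)) * laplace l (\<lambda>r. g (r + (s - t) + t))"
      unfolding L_def by (rule laplace_split) (use g s in auto)
    also have "(LINT r:{0..s - t}|lborel. exp (- l * r) * g (r + t)) = (LINT r:{t..s}|lborel. exp (- l * (r - t)) * g r)"
      using set_integral_time_shift[of 0 t "s - t" "\<lambda>r. exp (- l * (r - t)) * g r"] by simp
    finally have "L - (LINT r:{t..s}|lborel. exp (- l * (r - t)) * g r) = exp (- l * (s - t)) * laplace l (\<lambda>r. g (r + s))"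
      by simp
    moreover have "exp (l * (s - t)) * exp (- l * (s - t)) = 1"
      by (simp flip: exp_add)
    ultimately show ?thesis by (simp flip: mult.assoc)
  qed
  show ?thesis
  proof (rule primitive_from_cong[OF P])
    fix s assume s: "t \<le> s"
    show "exp (l * (s - t)) * (L - (0 + (LINT r:{t..s}|lborel. exp (- l * (r - t)) * g r))) = laplace l (\<lambda>r. g (r + s))"
      by (rule eq[OF s])
    have "exp (l * (s - t)) * exp (- l * (s - t)) = 1"
      by (simp flip: exp_add)
    then have "exp (l * (s - t)) * (0 - exp (- l * (s - t)) * g s) = - g s"
      by (simp flip: mult.assoc)
    then show "l * exp (l * (s - t)) * (L - (0 + (LINT r:{t..s}|lborel. exp (- l * (r - t)) * g r))) + exp (l * (s - t)) * (0 - exp (- l * (s - t)) * g s)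
       = l * laplace l (\<lambda>r. g (r + s)) - g s"
      unfolding mult.assoc[of l] eq[OF s] by simp
  qed
qed

end

context dynamical_environment
begin

lemma integrable_bounded:
  fixes f :: "'a \<Rightarrow> real"
  assumes "f \<in> borel_measurable M" "\<And>\<omega>. \<omega> \<in> space M \<Longrightarrow> \<bar>f \<omega>\<bar> \<le> C"
  shows "integrable M f"
  by (rule integrable_const_bound[where B = C]) (use assms in \<open>auto intro!: AE_I2\<close>)

lemma measurable_time:
  assumes "f \<in> borel_measurable M" "\<omega> \<in> space M"
  shows "(\<lambda>s. f (\<tau> s x \<omega>)) \<in> borel_measurable borel"
proof -
  note [measurable] = assms(1)
  have [measurable]: "(\<lambda>s. \<omega>) \<in> measurable borel M" using assms(2) by simp
  show ?thesis by measurable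
qed

text \<open>
  Countably many shifts preserve an almost sure statement; continuity in time extends it from rational times to all
  times.
\<close>

lemma AE_nonneg_along_shifts:
  fixes f :: "'a \<Rightarrow> real"
  assumes nn: "AE \<omega> in M. 0 \<le> f \<omega>" and cont: "AE \<omega> in M. \<forall>x s. isCont (\<lambda>s. f (\<tau> s x \<omega>)) s"
  shows "AE \<omega> in M. \<forall>x s. 0 \<le> f (\<tau> s x \<omega>)"
proof -
  have "AE \<omega> in M. \<forall>x. \<forall>r\<in>\<rat>. 0 \<le> f (\<tau> r x \<omega>)"
    unfolding AE_all_countable AE_ball_countable[OF countable_rat]
    by (intro allI ballI AE_shift nn)
  with cont show ?thesis
  proof eventually_elim
    case (elim \<omega>)
    show ?case
    proof (intro allI, rule ccontr)
      fix x s assume "\<not> 0 \<le> f (\<tau> s x \<omega>)"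
      then have "\<forall>\<^sub>F r in at s. f (\<tau> r x \<omega>) < 0"
        using elim(1) unfolding continuous_at by (intro order_tendstoD(2)) auto
      then obtain d where d: "0 < d" "\<And>r. r \<noteq> s \<Longrightarrow> dist r s < d \<Longrightarrow> f (\<tau> r x \<omega>) < 0"
        unfolding eventually_at by blast
      obtain r where r: "r \<in> \<rat>" "s < r" "r < s + d" using Rats_dense_in_real[of s "s + d"] d(1) by auto
      then have "f (\<tau> r x \<omega>) < 0" by (intro d) (auto simp: dist_real_def)
      then show False using elim(2) r(1) by (meson not_less)
    qed
  qed
qed

lemma measurable_laplace:
  assumes [measurable]: "f \<in> borel_measurable M"
  shows "(\<lambda>\<omega>. laplace l (\<lambda>s. f (\<tau> s x \<omega>))) \<in> borel_measurable M"
  unfolding laplace_def set_lebesgue_integral_def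
  by (rule lborel.borel_measurable_lebesgue_integral) measurable

text \<open>
  Fubini's theorem and invariance under time shifts.
\<close>

lemma expected_laplace:
  assumes [measurable]: "f \<in> borel_measurable M" and bd: "\<And>\<omega>. \<omega> \<in> space M \<Longrightarrow> \<bar>f \<omega>\<bar> \<le> C" and l: "0 < l"
  shows "(LINT \<omega>|M. laplace l (\<lambda>s. f (\<tau> s x \<omega>))) = (LINT \<omega>|M. f \<omega>) / l"
proof -
  interpret pair_sigma_finite M lborel ..
  let ?F = "\<lambda>\<omega> s. indicator {0..} s *\<^sub>R (exp (- l * s) * f (\<tau> s x \<omega>))"
  have [measurable]: "(\<lambda>(\<omega>, s). ?F \<omega> s) \<in> borel_measurable (M \<Otimes>\<^sub>M lborel)" by measurable
  have C0: "integrable lborel (\<lambda>s. indicator {0..} s *\<^sub>R (exp (- l * s) * C))"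
    using laplace_integrable[OF l, of "\<lambda>_. C" "\<bar>C\<bar>"] by (simp add: set_integrable_def)
  have int: "integrable (M \<Otimes>\<^sub>M lborel) (\<lambda>(\<omega>, s). ?F \<omega> s)"
  proof (rule Bochner_Integration.integrable_bound)
    show "integrable (M \<Otimes>\<^sub>M lborel) (\<lambda>(\<omega>, s). indicator {0..} s *\<^sub>R (exp (- l * s) * C))"
    proof (rule Fubini_integrable)
      show "integrable M (\<lambda>\<omega>. LINT s|lborel. norm (case (\<omega>, s) of (\<omega>, s) \<Rightarrow> indicator {0..} s *\<^sub>R (exp (- l * s) * C)))"
        by simp
      show "AE \<omega> in M. integrable lborel (\<lambda>s. case (\<omega>, s) of (\<omega>, s) \<Rightarrow> indicator {0..} s *\<^sub>R (exp (- l * s) * C))"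
        using C0 by simp
    qed measurable
    show "AE p in M \<Otimes>\<^sub>M lborel. norm (case p of (\<omega>, s) \<Rightarrow> ?F \<omega> s) \<le> norm (case p of (\<omega>, s) \<Rightarrow> indicator {0..} s *\<^sub>R (exp (- l * s) * C))"
    proof (rule AE_I2)
      fix p :: "'a \<times> real" assume "p \<in> space (M \<Otimes>\<^sub>M lborel)"
      then have "\<bar>f (\<tau> (snd p) x (fst p))\<bar> \<le> \<bar>C\<bar>"
        using bd[of "\<tau> (snd p) x (fst p)"] by (auto simp: space_pair_measure shift_in_space)
      then show "norm (case p of (\<omega>, s) \<Rightarrow> ?F \<omega> s) \<le> norm (case p of (\<omega>, s) \<Rightarrow> indicator {0..} s *\<^sub>R (exp (- l * s) * C))"
        by (auto simp: split_beta' abs_mult indicator_def)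
    qed
  qed measurable
  have "(LINT \<omega>|M. laplace l (\<lambda>s. f (\<tau> s x \<omega>))) = (LINT s|lborel. LINT \<omega>|M. ?F \<omega> s)"
    unfolding laplace_def set_lebesgue_integral_def by (rule Fubini_integral[OF int, symmetric])
  also have "\<dots> = (LINT s|lborel. (indicator {0..} s *\<^sub>R exp (- l * s)) * (LINT \<omega>|M. f \<omega>))"
    by (rule Bochner_Integration.integral_cong) (auto simp: integral_shift)
  also have "\<dots> = (LINT s:{0..}|lborel. exp (- l * s)) * (LINT \<omega>|M. f \<omega>)"
    unfolding set_lebesgue_integral_def by (rule integral_mult_left_zero)
  finally show ?thesis using exp_half_line(2)[OF l] by simp
qed

end

section \<open>Time averages and their adjoints\<close>

lemma norm_mult_bounded: "\<bar>f\<bar> \<le> \<bar>c\<bar> \<Longrightarrow> norm (g * f) \<le> norm (c * (g::real))"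
  unfolding real_norm_def abs_mult mult.commute[of "\<bar>g\<bar>"] by (rule mult_right_mono) simp_all

context dynamical_environment
begin

text \<open>
  By invariance the expectation of \<open>\<bar>g (\<tau> s x \<omega>)\<bar>\<close> does not depend on
  \<open>s\<close>, so \<open>g\<close> along time is integrable on the product of a bounded interval with the
  probability space.
\<close>

lemma integrable_pair_shift:
  fixes g :: "'a \<Rightarrow> real"
  assumes g: "integrable M g" and F[measurable]: "F \<in> borel_measurable M" and FC: "\<And>\<omega>. \<omega> \<in> space M \<Longrightarrow> \<bar>F \<omega>\<bar> \<le> C"
  shows "integrable (lborel \<Otimes>\<^sub>M M) (\<lambda>(s, \<omega>). indicator {p..q::real} s *\<^sub>R (F \<omega> * g (\<tau> s x \<omega>)))"
proof -
  interpret pair_sigma_finite lborel M ..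
  have [measurable]: "g \<in> borel_measurable M" using g by auto
  have one: "integrable (lborel \<Otimes>\<^sub>M M) (\<lambda>(s, \<omega>). indicator {p..q} s *\<^sub>R g (\<tau> s x \<omega>))"
  proof (rule Fubini_integrable)
    show "(\<lambda>(s, \<omega>). indicator {p..q} s *\<^sub>R g (\<tau> s x \<omega>)) \<in> borel_measurable (lborel \<Otimes>\<^sub>M M)" by measurable
    have "(LINT \<omega>|M. norm (indicator {p..q} s *\<^sub>R g (\<tau> s x \<omega>))) = indicator {p..q} s * (LINT \<omega>|M. \<bar>g \<omega>\<bar>)" for s
      using integral_shift[of "\<lambda>\<omega>. \<bar>g \<omega>\<bar>" s x] by (simp add: abs_mult)
    moreover have "integrable lborel (\<lambda>s. indicator {p..q} s * (LINT \<omega>|M. \<bar>g \<omega>\<bar>))"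
      using set_integrable_const_Icc[of p q "LINT \<omega>|M. \<bar>g \<omega>\<bar>"] by (simp add: set_integrable_def)
    ultimately show "integrable lborel (\<lambda>s. LINT \<omega>|M. norm (case (s, \<omega>) of (s, \<omega>) \<Rightarrow> indicator {p..q} s *\<^sub>R g (\<tau> s x \<omega>)))"
      by simp
    show "AE s in lborel. integrable M (\<lambda>\<omega>. case (s, \<omega>) of (s, \<omega>) \<Rightarrow> indicator {p..q} s *\<^sub>R g (\<tau> s x \<omega>))"
      using integrable_shift[OF g] by auto
  qed
  show ?thesis
  proof (rule Bochner_Integration.integrable_bound)
    show "integrable (lborel \<Otimes>\<^sub>M M) (\<lambda>p'. C *\<^sub>R (case p' of (s, \<omega>) \<Rightarrow> indicator {p..q} s *\<^sub>R g (\<tau> s x \<omega>)))"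
      using one by simp
    show "AE p' in lborel \<Otimes>\<^sub>M M. norm (case p' of (s, \<omega>) \<Rightarrow> indicator {p..q} s *\<^sub>R (F \<omega> * g (\<tau> s x \<omega>)))
       \<le> norm (C *\<^sub>R (case p' of (s, \<omega>) \<Rightarrow> indicator {p..q} s *\<^sub>R g (\<tau> s x \<omega>)))"
    proof (rule AE_I2)
      fix p' :: "real \<times> 'a" assume "p' \<in> space (lborel \<Otimes>\<^sub>M M)"
      then have "\<bar>F (snd p')\<bar> \<le> \<bar>C\<bar>" using FC[of "snd p'"] by (auto simp: space_pair_measure)
      then show "norm (case p' of (s, \<omega>) \<Rightarrow> indicator {p..q} s *\<^sub>R (F \<omega> * g (\<tau> s x \<omega>)))
       \<le> norm (C *\<^sub>R (case p' of (s, \<omega>) \<Rightarrow> indicator {p..q} s *\<^sub>R g (\<tau> s x \<omega>)))"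
        by (auto simp: split_beta' abs_mult indicator_def intro!: mult_right_mono)
    qed
  qed measurable
qed

lemma AE_integrable_along_time:
  fixes g :: "'a \<Rightarrow> real"
  assumes g: "integrable M g"
  shows "AE \<omega> in M. set_integrable lborel {p..q} (\<lambda>s. g (\<tau> s x \<omega>))"
proof -
  interpret pair_sigma_finite lborel M ..
  have "integrable (lborel \<Otimes>\<^sub>M M) (\<lambda>(s, \<omega>). indicator {p..q} s *\<^sub>R (1 * g (\<tau> s x \<omega>)))"
    by (rule integrable_pair_shift[OF g, of "\<lambda>_. 1" 1]) auto
  from AE_integrable_snd[OF this] show ?thesis by (simp add: set_integrable_def)
qed

definition backward_average :: "real \<Rightarrow> int \<Rightarrow> ('a \<Rightarrow> real) \<Rightarrow> 'a \<Rightarrow> real" where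
  "backward_average t x F \<omega> = (LINT s:{0..t}|lborel. F (\<tau> (- s) (- x) \<omega>))"

lemma measurable_backward_average [measurable (raw)]:
  assumes [measurable]: "F \<in> borel_measurable M"
  shows "backward_average t x F \<in> borel_measurable M"
  unfolding backward_average_def[abs_def] set_lebesgue_integral_def
  by (rule lborel.borel_measurable_lebesgue_integral) measurable

lemma backward_average_bound:
  assumes F[measurable]: "F \<in> borel_measurable M" and FC: "\<And>\<omega>. \<omega> \<in> space M \<Longrightarrow> \<bar>F \<omega>\<bar> \<le> C" and t: "0 \<le> t" and \<omega>: "\<omega> \<in> space M"
  shows "\<bar>backward_average t x F \<omega>\<bar> \<le> t * C"
proof -
  have C: "0 \<le> C" using FC[OF \<omega>] by linarith
  have "\<bar>backward_average t x F \<omega>\<bar> \<le> (LINT s|lborel. norm (indicator {0..t} s *\<^sub>R F (\<tau> (- s) (- x) \<omega>)))"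
    unfolding backward_average_def set_lebesgue_integral_def real_norm_def[symmetric] by (rule integral_norm_bound)
  also have "\<dots> \<le> (LINT s|lborel. indicator {0..t} s *\<^sub>R C)"
  proof (rule integral_mono')
    show "integrable lborel (\<lambda>s. indicator {0..t} s *\<^sub>R C)"
      using set_integrable_const_Icc[of 0 t C] by (simp add: set_integrable_def)
    show "norm (indicator {0..t} s *\<^sub>R F (\<tau> (- s) (- x) \<omega>)) \<le> indicator {0..t} s *\<^sub>R C" for s
      using FC[OF shift_in_space[OF \<omega>]] by (auto simp: indicator_def)
    show "0 \<le> indicator {0..t} s *\<^sub>R C" for s using C by simp
  qed
  also have "\<dots> = t * C" using t by simp
  finally show ?thesis .
qed

text \<open>
  For every single time this is the invariance under shifts; Fubini's theorem integrates it over time.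
\<close>

lemma forward_average_adjoint:
  fixes g :: "'a \<Rightarrow> real"
  assumes g: "integrable M g" and F[measurable]: "F \<in> borel_measurable M" and FC: "\<And>\<omega>. \<omega> \<in> space M \<Longrightarrow> \<bar>F \<omega>\<bar> \<le> C"
  shows "integrable M (\<lambda>\<omega>. F \<omega> * (LINT s:{0..t}|lborel. g (\<tau> s x \<omega>)))"
    and "(LINT \<omega>|M. F \<omega> * (LINT s:{0..t}|lborel. g (\<tau> s x \<omega>))) = (LINT \<omega>|M. g \<omega> * backward_average t x F \<omega>)"
proof -
  note measurable_expectation = borel_measurable_lebesgue_integral
  interpret pair_sigma_finite lborel M ..
  have [measurable]: "g \<in> borel_measurable M" using g by auto
  have int: "integrable (lborel \<Otimes>\<^sub>M M) (\<lambda>(s, \<omega>). indicator {0..t} s *\<^sub>R (F \<omega> * g (\<tau> s x \<omega>)))"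
    by (rule integrable_pair_shift[OF g F FC])
  have eq: "(LINT s|lborel. indicator {0..t} s *\<^sub>R (F \<omega> * g (\<tau> s x \<omega>))) = F \<omega> * (LINT s:{0..t}|lborel. g (\<tau> s x \<omega>))" for \<omega>
    unfolding set_lebesgue_integral_def by (subst integral_mult_right_zero[symmetric]) (simp add: mult_ac)
  show "integrable M (\<lambda>\<omega>. F \<omega> * (LINT s:{0..t}|lborel. g (\<tau> s x \<omega>)))"
    using integrable_snd[OF int] by (simp only: eq prod.case)
  have int': "integrable (lborel \<Otimes>\<^sub>M M) (\<lambda>(s, \<omega>). indicator {-t..0} s *\<^sub>R (g \<omega> * F (\<tau> s (- x) \<omega>)))"
  proof (rule Fubini_integrable)
    show "(\<lambda>(s, \<omega>). indicator {-t..0} s *\<^sub>R (g \<omega> * F (\<tau> s (- x) \<omega>))) \<in> borel_measurable (lborel \<Otimes>\<^sub>M M)" by measurable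
    have gF: "integrable M (\<lambda>\<omega>. g \<omega> * F (\<tau> s (- x) \<omega>))" for s
    proof (rule Bochner_Integration.integrable_bound)
      show "integrable M (\<lambda>\<omega>. C * g \<omega>)" using g by simp
      show "AE \<omega> in M. norm (g \<omega> * F (\<tau> s (- x) \<omega>)) \<le> norm (C * g \<omega>)"
      proof (rule AE_I2)
        fix \<omega> assume "\<omega> \<in> space M"
        then have "\<bar>F (\<tau> s (- x) \<omega>)\<bar> \<le> \<bar>C\<bar>" by (intro order_trans[OF FC[OF shift_in_space] abs_ge_self])
        then show "norm (g \<omega> * F (\<tau> s (- x) \<omega>)) \<le> norm (C * g \<omega>)"
          by (rule norm_mult_bounded)
      qed
    qed measurable
    show "AE s in lborel. integrable M (\<lambda>\<omega>. case (s, \<omega>) of (s, \<omega>) \<Rightarrow> indicator {-t..0} s *\<^sub>R (g \<omega> * F (\<tau> s (- x) \<omega>)))"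
      using gF by auto
    show "integrable lborel (\<lambda>s. LINT \<omega>|M. norm (case (s, \<omega>) of (s, \<omega>) \<Rightarrow> indicator {-t..0} s *\<^sub>R (g \<omega> * F (\<tau> s (- x) \<omega>))))"
    proof (rule Bochner_Integration.integrable_bound)
      show "integrable lborel (\<lambda>s. indicator {-t..0} s *\<^sub>R (C * (LINT \<omega>|M. \<bar>g \<omega>\<bar>)))"
        using set_integrable_const_Icc[of "-t" 0 "C * (LINT \<omega>|M. \<bar>g \<omega>\<bar>)"] by (simp add: set_integrable_def)
      show "AE s in lborel. norm (LINT \<omega>|M. norm (case (s, \<omega>) of (s, \<omega>) \<Rightarrow> indicator {-t..0} s *\<^sub>R (g \<omega> * F (\<tau> s (- x) \<omega>))))
         \<le> norm (indicator {-t..0} s *\<^sub>R (C * (LINT \<omega>|M. \<bar>g \<omega>\<bar>)))"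
      proof (rule AE_I2)
        fix s
        have "(LINT \<omega>|M. \<bar>g \<omega> * F (\<tau> s (- x) \<omega>)\<bar>) \<le> (LINT \<omega>|M. C * \<bar>g \<omega>\<bar>)"
        proof (rule integral_mono)
          show "integrable M (\<lambda>\<omega>. \<bar>g \<omega> * F (\<tau> s (- x) \<omega>)\<bar>)" using gF by auto
          show "integrable M (\<lambda>\<omega>. C * \<bar>g \<omega>\<bar>)" using g by auto
          fix \<omega> assume "\<omega> \<in> space M"
          then have "\<bar>F (\<tau> s (- x) \<omega>)\<bar> \<le> C" by (rule FC[OF shift_in_space])
          then show "\<bar>g \<omega> * F (\<tau> s (- x) \<omega>)\<bar> \<le> C * \<bar>g \<omega>\<bar>"
            unfolding abs_mult by (subst mult.commute) (rule mult_right_mono, simp_all)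
        qed
        moreover have "0 \<le> (LINT \<omega>|M. \<bar>g \<omega> * F (\<tau> s (- x) \<omega>)\<bar>)" by (rule Bochner_Integration.integral_nonneg) simp
        ultimately show "norm (LINT \<omega>|M. norm (case (s, \<omega>) of (s, \<omega>) \<Rightarrow> indicator {-t..0} s *\<^sub>R (g \<omega> * F (\<tau> s (- x) \<omega>))))
         \<le> norm (indicator {-t..0} s *\<^sub>R (C * (LINT \<omega>|M. \<bar>g \<omega>\<bar>)))"
          by (auto simp: indicator_def)
      qed
      have "(\<lambda>(s, \<omega>). norm (indicator {-t..0} s *\<^sub>R (g \<omega> * F (\<tau> s (- x) \<omega>)))) \<in> borel_measurable (lborel \<Otimes>\<^sub>M M)"
        by measurable
      from measurable_expectation[OF this]
      show "(\<lambda>s. LINT \<omega>|M. norm (case (s, \<omega>) of (s, \<omega>) \<Rightarrow> indicator {-t..0} s *\<^sub>R (g \<omega> * F (\<tau> s (- x) \<omega>)))) \<in> borel_measurable lborel"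
        unfolding prod.case .
    qed
  qed
  have "(LINT \<omega>|M. F \<omega> * (LINT s:{0..t}|lborel. g (\<tau> s x \<omega>))) = (LINT \<omega>|M. (LINT s|lborel. indicator {0..t} s *\<^sub>R (F \<omega> * g (\<tau> s x \<omega>))))"
    by (simp only: eq)
  also have "\<dots> = (LINT s|lborel. (LINT \<omega>|M. indicator {0..t} s *\<^sub>R (F \<omega> * g (\<tau> s x \<omega>))))"
    by (rule Fubini_integral[OF int])
  also have "\<dots> = (LINT s|lborel. (LINT \<omega>|M. indicator {0..t} s *\<^sub>R (g \<omega> * F (\<tau> (- s) (- x) \<omega>))))"
  proof (rule Bochner_Integration.integral_cong[OF refl])
    fix s
    have "(LINT \<omega>|M. indicator {0..t} s *\<^sub>R (F \<omega> * g (\<tau> s x \<omega>))) = (LINT \<omega>|M. indicator {0..t} s *\<^sub>R (F (\<tau> (- s) (- x) \<omega>) * g (\<tau> s x (\<tau> (- s) (- x) \<omega>))))"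
      by (rule integral_shift[symmetric]) measurable
    also have "\<dots> = (LINT \<omega>|M. indicator {0..t} s *\<^sub>R (g \<omega> * F (\<tau> (- s) (- x) \<omega>)))"
      by (rule Bochner_Integration.integral_cong) (auto simp: shift_add shift_zero)
    finally show "(LINT \<omega>|M. indicator {0..t} s *\<^sub>R (F \<omega> * g (\<tau> s x \<omega>))) = \<dots>" .
  qed
  also have "\<dots> = (LINT s|lborel. (LINT \<omega>|M. indicator {-t..0} s *\<^sub>R (g \<omega> * F (\<tau> s (- x) \<omega>))))"
    by (subst lborel_integral_real_affine[where c = "-1" and t = 0]) (auto intro!: Bochner_Integration.integral_cong simp: indicator_def)
  also have "\<dots> = (LINT \<omega>|M. (LINT s|lborel. indicator {-t..0} s *\<^sub>R (g \<omega> * F (\<tau> s (- x) \<omega>))))"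
    by (rule Fubini_integral[OF int', symmetric])
  also have "\<dots> = (LINT \<omega>|M. g \<omega> * backward_average t x F \<omega>)"
  proof (rule Bochner_Integration.integral_cong[OF refl])
    fix \<omega>
    have "(LINT s|lborel. indicator {-t..0} s *\<^sub>R (g \<omega> * F (\<tau> s (- x) \<omega>)))
       = (LINT s|lborel. indicator {-t..0} (0 + - 1 * s) *\<^sub>R (g \<omega> * F (\<tau> (0 + - 1 * s) (- x) \<omega>)))"
      by (subst lborel_integral_real_affine[where c = "-1" and t = 0]) simp_all
    also have "\<dots> = (LINT s|lborel. g \<omega> * (indicator {0..t} s *\<^sub>R F (\<tau> (- s) (- x) \<omega>)))"
      by (rule Bochner_Integration.integral_cong) (auto simp: indicator_def)
    also have "\<dots> = g \<omega> * backward_average t x F \<omega>"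
      unfolding backward_average_def set_lebesgue_integral_def by (rule integral_mult_right_zero)
    finally show "(LINT s|lborel. indicator {-t..0} s *\<^sub>R (g \<omega> * F (\<tau> s (- x) \<omega>))) = g \<omega> * backward_average t x F \<omega>" .
  qed
  finally show "(LINT \<omega>|M. F \<omega> * (LINT s:{0..t}|lborel. g (\<tau> s x \<omega>))) = (LINT \<omega>|M. g \<omega> * backward_average t x F \<omega>)" .
qed

end

section \<open>The corrector for bounded conductances\<close>

text \<open>
  The constant \<open>\<epsilon>\<close> is the killing rate, that is, the parameter of \<open>varphi_eps\<close>.
\<close>

locale bounded_environment = dynamical_environment M b \<tau>
  for M :: "'a measure" and b \<tau> +
  fixes N \<epsilon> :: real
  assumes bounded: "\<And>t x \<omega>. \<omega> \<in> space M \<Longrightarrow> b t x \<omega> \<le> N"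
    and \<epsilon>_pos: "0 < \<epsilon>"
begin

lemma N_pos: "0 < N"
proof -
  obtain \<omega> where "\<omega> \<in> space M" using not_empty by blast
  then show ?thesis using bounded[of \<omega> 0 0] conductance_pos[of \<omega> 0 0] by linarith
qed

text \<open>
  The value \<open>\<epsilon> + 2 * N\<close> is large enough for all coefficients of the operator in the mild form of
  the corrector equation to be nonnegative.
\<close>

definition rate :: real where "rate = \<epsilon> + 2 * N"

lemma rate_pos: "0 < rate" using N_pos \<epsilon>_pos by (simp add: rate_def)

text \<open>
  The corrector solves \<open>\<partial>\<^sub>t X = rate * X - corrector_drift X\<close> along time. The term
  \<open>2 * N * X\<close> has been moved from the left to the right, so that only \<open>\<epsilon> * X\<close> and
  the difference of the fluxes \<open>b * (1 + \<nabla>X)\<close> remain after cancellation.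
\<close>

definition corrector_drift :: "('a \<Rightarrow> real) \<Rightarrow> 'a \<Rightarrow> real" where
  "corrector_drift X \<omega> = 2 * N * X \<omega> + b 0 1 \<omega> * (1 + X (\<tau> 0 1 \<omega>) - X \<omega>)
     - b 0 0 \<omega> * (1 + X \<omega> - X (\<tau> 0 (- 1) \<omega>))"

primrec corrector_iter :: "nat \<Rightarrow> 'a \<Rightarrow> real" where
  "corrector_iter 0 \<omega> = 0"
| "corrector_iter (Suc n) \<omega> = laplace rate (\<lambda>s. corrector_drift (corrector_iter n) (\<tau> s 0 \<omega>))"

definition corrector :: "'a \<Rightarrow> real" where
  "corrector \<omega> = lim (\<lambda>n. corrector_iter n \<omega>)"

text \<open>
  The gradient of the harmonic coordinate \<open>x + X\<close>, taken across the site \<open>0\<close> at which the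
  conductance \<open>b 0 0\<close> lives.
\<close>

definition gradient :: "'a \<Rightarrow> real" where
  "gradient \<omega> = 1 + corrector \<omega> - corrector (\<tau> 0 (- 1) \<omega>)"

lemma measurable_corrector_drift:
  assumes [measurable]: "X \<in> borel_measurable M"
  shows "corrector_drift X \<in> borel_measurable M"
  unfolding corrector_drift_def[abs_def] by measurable

lemma measurable_corrector_iter: "corrector_iter n \<in> borel_measurable M"
proof (induction n)
  case (Suc n)
  show ?case
    using measurable_laplace[OF measurable_corrector_drift[OF Suc]] by simp
qed (simp add: fun_eq_iff[symmetric])

text \<open>
  The drift depends on \<open>X\<close> through three values with nonnegative coefficients of sum \<open>2 *
  N\<close>.
\<close>

lemma corrector_drift_contraction:
  assumes d: "\<And>\<omega>. \<omega> \<in> space M \<Longrightarrow> \<bar>X \<omega> - Y \<omega>\<bar> \<le> d" and \<omega>: "\<omega> \<in> space M"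
  shows "\<bar>corrector_drift X \<omega> - corrector_drift Y \<omega>\<bar> \<le> 2 * N * d"
proof -
  define D where "D x = X (\<tau> 0 x \<omega>) - Y (\<tau> 0 x \<omega>)" for x
  have D: "\<bar>D x\<bar> \<le> d" for x unfolding D_def by (rule d[OF shift_in_space[OF \<omega>]])
  have D0: "X \<omega> - Y \<omega> = D 0" by (simp add: D_def shift_zero \<omega>)
  have b: "0 \<le> b 0 0 \<omega>" "0 \<le> b 0 1 \<omega>" "0 \<le> 2 * N - b 0 1 \<omega> - b 0 0 \<omega>"
    using conductance_pos[OF \<omega>, of 0 0] conductance_pos[OF \<omega>, of 0 1] bounded[OF \<omega>, of 0 0] bounded[OF \<omega>, of 0 1] by auto
  have "corrector_drift X \<omega> - corrector_drift Y \<omega> = (2 * N - b 0 1 \<omega> - b 0 0 \<omega>) * D 0 + b 0 1 \<omega> * D 1 + b 0 0 \<omega> * D (- 1)"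
    unfolding corrector_drift_def D0[symmetric] by (simp add: D_def algebra_simps)
  also have "\<bar>\<dots>\<bar> \<le> (2 * N - b 0 1 \<omega> - b 0 0 \<omega>) * \<bar>D 0\<bar> + b 0 1 \<omega> * \<bar>D 1\<bar> + b 0 0 \<omega> * \<bar>D (- 1)\<bar>"
    using b by (intro order_trans[OF abs_triangle_ineq] add_mono) (auto simp: abs_mult)
  also have "\<dots> \<le> (2 * N - b 0 1 \<omega> - b 0 0 \<omega>) * d + b 0 1 \<omega> * d + b 0 0 \<omega> * d"
    using b D by (intro add_mono mult_left_mono) auto
  also have "\<dots> = 2 * N * d" by (simp add: algebra_simps)
  finally show ?thesis .
qed

definition contraction_rate :: real where "contraction_rate = 2 * N / rate"
definition corrector_sup :: real where "corrector_sup = (N / rate) / (1 - contraction_rate)"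

lemma contraction_rate: "0 \<le> contraction_rate" "contraction_rate < 1"
  using N_pos \<epsilon>_pos rate_pos by (auto simp: contraction_rate_def rate_def field_simps)

lemma corrector_drift_0_bound:
  assumes \<omega>: "\<omega> \<in> space M"
  shows "\<bar>corrector_drift (\<lambda>_. 0) \<omega>\<bar> \<le> N"
  using conductance_pos[OF \<omega>, of 0 0] conductance_pos[OF \<omega>, of 0 1] bounded[OF \<omega>, of 0 0] bounded[OF \<omega>, of 0 1]
  by (auto simp: corrector_drift_def)

lemma corrector_drift_bound:
  assumes "\<And>\<omega>. \<omega> \<in> space M \<Longrightarrow> \<bar>X \<omega>\<bar> \<le> d" and \<omega>: "\<omega> \<in> space M"
  shows "\<bar>corrector_drift X \<omega>\<bar> \<le> 2 * N * d + N"
  using corrector_drift_contraction[of X "\<lambda>_. 0" d \<omega>] corrector_drift_0_bound[OF \<omega>] assms by auto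

lemma corrector_iter_0: "corrector_iter 0 = (\<lambda>_. 0)"
  by (simp add: fun_eq_iff)

lemma corrector_iter_bounded: "\<exists>C. \<forall>\<omega>\<in>space M. \<bar>corrector_iter n \<omega>\<bar> \<le> C"
proof (induction n)
  case (Suc n)
  then obtain C where C: "\<And>\<omega>. \<omega> \<in> space M \<Longrightarrow> \<bar>corrector_iter n \<omega>\<bar> \<le> C" by blast
  show ?case
  proof (intro exI ballI)
    fix \<omega> assume \<omega>: "\<omega> \<in> space M"
    show "\<bar>corrector_iter (Suc n) \<omega>\<bar> \<le> (2 * N * C + N) / rate"
      unfolding corrector_iter.simps
      by (rule laplace_bound[OF rate_pos measurable_time[OF measurable_corrector_drift[OF measurable_corrector_iter] \<omega>]])
         (rule corrector_drift_bound[OF C shift_in_space[OF \<omega>]])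
  qed
qed auto

lemma corrector_iter_diff:
  "\<omega> \<in> space M \<Longrightarrow> \<bar>corrector_iter (Suc n) \<omega> - corrector_iter n \<omega>\<bar> \<le> (N / rate) * contraction_rate ^ n"
proof (induction n arbitrary: \<omega>)
  case 0
  have "\<bar>laplace rate (\<lambda>s. corrector_drift (corrector_iter 0) (\<tau> s 0 \<omega>))\<bar> \<le> N / rate"
    by (rule laplace_bound[OF rate_pos measurable_time[OF measurable_corrector_drift[OF measurable_corrector_iter] 0]])
       (unfold corrector_iter_0, rule corrector_drift_0_bound[OF shift_in_space[OF 0]])
  then show ?case by simp
next
  case (Suc n)
  obtain C where C: "\<And>\<omega>. \<omega> \<in> space M \<Longrightarrow> \<bar>corrector_iter (Suc n) \<omega>\<bar> \<le> C"
    using corrector_iter_bounded by blast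
  obtain C' where C': "\<And>\<omega>. \<omega> \<in> space M \<Longrightarrow> \<bar>corrector_iter n \<omega>\<bar> \<le> C'"
    using corrector_iter_bounded by blast
  note m = measurable_time[OF measurable_corrector_drift[OF measurable_corrector_iter] Suc.prems]
  have "corrector_iter (Suc (Suc n)) \<omega> - corrector_iter (Suc n) \<omega>
     = laplace rate (\<lambda>s. corrector_drift (corrector_iter (Suc n)) (\<tau> s 0 \<omega>) - corrector_drift (corrector_iter n) (\<tau> s 0 \<omega>))"
    unfolding corrector_iter.simps(2)[of "Suc n"] corrector_iter.simps(2)[of n \<omega>]
    by (rule laplace_diff[OF rate_pos m _ m, symmetric])
       (rule corrector_drift_bound[OF _ shift_in_space[OF Suc.prems]], use C C' in blast)+
  also have "\<bar>\<dots>\<bar> \<le> (2 * N * ((N / rate) * contraction_rate ^ n)) / rate"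
    by (rule laplace_bound[OF rate_pos borel_measurable_diff[OF m m]])
       (rule corrector_drift_contraction[OF Suc.IH shift_in_space[OF Suc.prems]])
  also have "\<dots> = (N / rate) * contraction_rate ^ Suc n" by (simp add: contraction_rate_def)
  finally show ?case .
qed

lemma corrector_iter_bound:
  assumes \<omega>: "\<omega> \<in> space M"
  shows "\<bar>corrector_iter n \<omega>\<bar> \<le> corrector_sup"
proof -
  have "corrector_iter n \<omega> = (\<Sum>k<n. corrector_iter (Suc k) \<omega> - corrector_iter k \<omega>)"
    by (simp only: sum_lessThan_telescope[of "\<lambda>k. corrector_iter k \<omega>"]) simp
  also have "\<bar>\<dots>\<bar> \<le> (\<Sum>k<n. (N / rate) * contraction_rate ^ k)"
    by (rule order_trans[OF sum_abs sum_mono]) (rule corrector_iter_diff[OF \<omega>])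
  also have "\<dots> = (N / rate) * (\<Sum>k<n. contraction_rate ^ k)" by (simp add: sum_distrib_left)
  also have "\<dots> \<le> (N / rate) * (1 / (1 - contraction_rate))"
  proof (rule mult_left_mono)
    have "(\<Sum>k<n. contraction_rate ^ k) \<le> (\<Sum>k. contraction_rate ^ k)"
      using contraction_rate by (intro sum_le_suminf summable_geometric) auto
    also have "\<dots> = 1 / (1 - contraction_rate)" using contraction_rate by (intro suminf_geometric) auto
    finally show "(\<Sum>k<n. contraction_rate ^ k) \<le> 1 / (1 - contraction_rate)" .
  qed (use N_pos rate_pos in auto)
  finally show ?thesis by (simp add: corrector_sup_def)
qed

lemma corrector_iter_tendsto:
  assumes \<omega>: "\<omega> \<in> space M"
  shows "(\<lambda>n. corrector_iter n \<omega>) \<longlonglongrightarrow> corrector \<omega>"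
proof -
  have "summable (\<lambda>n. corrector_iter (Suc n) \<omega> - corrector_iter n \<omega>)"
  proof (rule summable_comparison_test')
    show "summable (\<lambda>n. (N / rate) * contraction_rate ^ n)"
      using contraction_rate by (intro summable_mult summable_geometric) auto
    show "norm (corrector_iter (Suc n) \<omega> - corrector_iter n \<omega>) \<le> (N / rate) * contraction_rate ^ n" if "0 \<le> n" for n
      unfolding real_norm_def by (rule corrector_iter_diff[OF \<omega>])
  qed
  then have "convergent (\<lambda>n. \<Sum>k<n. corrector_iter (Suc k) \<omega> - corrector_iter k \<omega>)"
    by (simp only: summable_iff_convergent)
  then have "convergent (\<lambda>n. corrector_iter n \<omega>)"
    by (simp only: sum_lessThan_telescope[of "\<lambda>k. corrector_iter k \<omega>"]) simp
  then show ?thesis by (simp add: corrector_def convergent_LIMSEQ_iff)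
qed

lemma measurable_corrector [measurable]: "corrector \<in> borel_measurable M"
  unfolding corrector_def[abs_def]
  by (rule borel_measurable_lim_metric) (rule measurable_corrector_iter)

lemma corrector_bound: "\<omega> \<in> space M \<Longrightarrow> \<bar>corrector \<omega>\<bar> \<le> corrector_sup"
  using LIMSEQ_le_const2[OF tendsto_rabs[OF corrector_iter_tendsto]] corrector_iter_bound by blast

lemma corrector_drift_corrector_bound:
  "\<omega> \<in> space M \<Longrightarrow> \<bar>corrector_drift corrector \<omega>\<bar> \<le> 2 * N * corrector_sup + N"
  by (rule corrector_drift_bound[OF corrector_bound])

text \<open>
  The iteration contracts in the supremum norm with factor \<open>2 * N / (\<epsilon> + 2 * N)\<close>, so the limit
  exists in every environment, is bounded, and is measurable.
\<close>

lemma corrector_fixed_point: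
  assumes \<omega>: "\<omega> \<in> space M"
  shows "corrector \<omega> = laplace rate (\<lambda>s. corrector_drift corrector (\<tau> s 0 \<omega>))"
proof -
  have "(\<lambda>n. laplace rate (\<lambda>s. corrector_drift (corrector_iter n) (\<tau> s 0 \<omega>)))
     \<longlonglongrightarrow> laplace rate (\<lambda>s. corrector_drift corrector (\<tau> s 0 \<omega>))"
  proof (rule laplace_tendsto[OF rate_pos])
    show "(\<lambda>s. corrector_drift (corrector_iter n) (\<tau> s 0 \<omega>)) \<in> borel_measurable borel" for n
      by (rule measurable_time[OF measurable_corrector_drift[OF measurable_corrector_iter] \<omega>])
    show "\<bar>corrector_drift (corrector_iter n) (\<tau> s 0 \<omega>)\<bar> \<le> 2 * N * corrector_sup + N" for n s
      by (rule corrector_drift_bound[OF corrector_iter_bound shift_in_space[OF \<omega>]])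
    show "(\<lambda>n. corrector_drift (corrector_iter n) (\<tau> s 0 \<omega>)) \<longlonglongrightarrow> corrector_drift corrector (\<tau> s 0 \<omega>)" for s
      unfolding corrector_drift_def by (intro tendsto_intros corrector_iter_tendsto shift_in_space \<omega>)
  qed
  then have "(\<lambda>n. corrector_iter (Suc n) \<omega>) \<longlonglongrightarrow> laplace rate (\<lambda>s. corrector_drift corrector (\<tau> s 0 \<omega>))"
    by simp
  then show ?thesis
    by (rule LIMSEQ_unique[OF LIMSEQ_Suc[OF corrector_iter_tendsto[OF \<omega>]]])
qed

lemma measurable_gradient [measurable]: "gradient \<in> borel_measurable M"
  unfolding gradient_def[abs_def] by measurable

lemma gradient_bound: "\<omega> \<in> space M \<Longrightarrow> \<bar>gradient \<omega>\<bar> \<le> 1 + 2 * corrector_sup"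
  using corrector_bound[of \<omega>] corrector_bound[OF shift_in_space, of \<omega> 0 "-1"] by (auto simp: gradient_def)

lemma corrector_drift_eq:
  assumes \<omega>: "\<omega> \<in> space M"
  shows "corrector_drift corrector \<omega> = 2 * N * corrector \<omega> + b 0 1 \<omega> * gradient (\<tau> 0 1 \<omega>) - b 0 0 \<omega> * gradient \<omega>"
  by (simp add: corrector_drift_def gradient_def shift_add shift_zero \<omega>)

text \<open>
  The operator \<open>f \<mapsto> 2 * N * f + \<Delta>(b f)\<close>, which preserves nonnegativity because \<open>b
  \<le> N\<close>.
\<close>

definition jump_operator :: "('a \<Rightarrow> real) \<Rightarrow> 'a \<Rightarrow> real" where
  "jump_operator f \<omega> = 2 * (N - b 0 0 \<omega>) * f \<omega> + b 0 1 \<omega> * f (\<tau> 0 1 \<omega>) + b 0 (- 1) \<omega> * f (\<tau> 0 (- 1) \<omega>)"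

lemma measurable_jump_operator [measurable (raw)]:
  assumes [measurable]: "f \<in> borel_measurable M"
  shows "jump_operator f \<in> borel_measurable M"
  unfolding jump_operator_def[abs_def] by measurable

lemma jump_operator_bound:
  assumes f: "\<And>\<omega>. \<omega> \<in> space M \<Longrightarrow> \<bar>f \<omega>\<bar> \<le> C" and \<omega>: "\<omega> \<in> space M"
  shows "\<bar>jump_operator f \<omega>\<bar> \<le> 4 * N * C"
proof -
  have b: "0 < b 0 x \<omega>" "b 0 x \<omega> \<le> N" for x
    using conductance_pos[OF \<omega>] bounded[OF \<omega>] by auto
  have C: "0 \<le> C" using f[OF \<omega>] by linarith
  have "\<bar>jump_operator f \<omega>\<bar> \<le> 2 * (N - b 0 0 \<omega>) * \<bar>f \<omega>\<bar> + b 0 1 \<omega> * \<bar>f (\<tau> 0 1 \<omega>)\<bar> + b 0 (- 1) \<omega> * \<bar>f (\<tau> 0 (- 1) \<omega>)\<bar>"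
    unfolding jump_operator_def using b less_imp_le[OF b(1)]
    by (intro order_trans[OF abs_triangle_ineq] add_mono) (auto simp: abs_mult)
  also have "\<dots> \<le> 2 * N * C + N * C + N * C"
    using b less_imp_le[OF b(1)] C N_pos by (intro add_mono mult_mono f shift_in_space \<omega>) (auto simp: algebra_simps)
  also have "\<dots> = 4 * N * C" by (simp add: algebra_simps)
  finally show ?thesis .
qed

text \<open>
  Taking the spatial difference of the fixed point equation for the corrector turns the difference of the fluxes into
  the Laplacian of \<open>b * gradient\<close>.
\<close>

lemma gradient_fixed_point:
  assumes \<omega>: "\<omega> \<in> space M"
  shows "gradient \<omega> = laplace rate (\<lambda>s. \<epsilon> + jump_operator gradient (\<tau> s 0 \<omega>))"
proof -
  let ?D = "corrector_drift corrector"
  define \<omega>' where "\<omega>' = \<tau> 0 (- 1) \<omega>"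
  have \<omega>': "\<omega>' \<in> space M" unfolding \<omega>'_def by (rule shift_in_space[OF \<omega>])
  note m = measurable_time[OF measurable_corrector_drift[OF measurable_corrector]]
  note bd = corrector_drift_corrector_bound[OF shift_in_space]
  have "gradient \<omega> = laplace rate (\<lambda>s. rate) + laplace rate (\<lambda>s. ?D (\<tau> s 0 \<omega>)) - laplace rate (\<lambda>s. ?D (\<tau> s 0 \<omega>'))"
    using corrector_fixed_point[OF \<omega>] corrector_fixed_point[OF \<omega>'] rate_pos
    by (simp add: laplace_const[OF rate_pos] gradient_def \<omega>'_def)
  also have "\<dots> = laplace rate (\<lambda>s. rate + ?D (\<tau> s 0 \<omega>)) - laplace rate (\<lambda>s. ?D (\<tau> s 0 \<omega>'))"
    using laplace_add[OF rate_pos _ _ m[OF \<omega>] bd[OF \<omega>], of "\<lambda>_. rate" "\<bar>rate\<bar>"] by simp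
  also have "\<dots> = laplace rate (\<lambda>s. (rate + ?D (\<tau> s 0 \<omega>)) - ?D (\<tau> s 0 \<omega>'))"
  proof (rule laplace_diff[OF rate_pos _ _ m[OF \<omega>'] bd[OF \<omega>'], symmetric])
    show "(\<lambda>s. rate + ?D (\<tau> s 0 \<omega>)) \<in> borel_measurable borel" using m[OF \<omega>, of 0] by simp
    show "\<bar>rate + ?D (\<tau> s 0 \<omega>)\<bar> \<le> \<bar>rate\<bar> + (2 * N * corrector_sup + N)" for s
      by (rule order_trans[OF abs_triangle_ineq add_left_mono[OF bd[OF \<omega>]]])
  qed
  also have "(\<lambda>s. (rate + ?D (\<tau> s 0 \<omega>)) - ?D (\<tau> s 0 \<omega>')) = (\<lambda>s. \<epsilon> + jump_operator gradient (\<tau> s 0 \<omega>))"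
  proof
    fix s
    have "?D (\<tau> s 0 \<omega>) - ?D (\<tau> s 0 \<omega>') = 2 * N * (gradient (\<tau> s 0 \<omega>) - 1) + b s 1 \<omega> * gradient (\<tau> s 1 \<omega>)
        - b s 0 \<omega> * gradient (\<tau> s 0 \<omega>) - (b s 0 \<omega> * gradient (\<tau> s 0 \<omega>) - b s (- 1) \<omega> * gradient (\<tau> s (- 1) \<omega>))"
      by (simp add: corrector_drift_eq shift_in_space \<omega> \<omega>'_def shift_add conductance_shift gradient_def algebra_simps)
    then show "(rate + ?D (\<tau> s 0 \<omega>)) - ?D (\<tau> s 0 \<omega>') = \<epsilon> + jump_operator gradient (\<tau> s 0 \<omega>)"
      by (simp add: rate_def jump_operator_def shift_add conductance_shift \<omega> algebra_simps)
  qed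
  finally show ?thesis .
qed

lemma expected_jump_operator:
  assumes [measurable]: "f \<in> borel_measurable M" and bd: "\<And>\<omega>. \<omega> \<in> space M \<Longrightarrow> \<bar>f \<omega>\<bar> \<le> C"
  shows "(LINT \<omega>|M. jump_operator f \<omega>) = 2 * N * (LINT \<omega>|M. f \<omega>)"
proof -
  have C: "0 \<le> C" using bd not_empty by force
  have int: "integrable M (\<lambda>\<omega>. b 0 0 \<omega> * f \<omega>)"
    by (rule integrable_bounded[where C = "N * C"])
       (auto simp: abs_mult less_imp_le[OF conductance_pos] C intro!: mult_mono bounded bd intro: less_imp_le[OF N_pos])
  have intf: "integrable M f" by (rule integrable_bounded[OF assms])
  have s: "b 0 x \<omega> * f (\<tau> 0 x \<omega>) = b 0 0 (\<tau> 0 x \<omega>) * f (\<tau> 0 x \<omega>)" if "\<omega> \<in> space M" for x \<omega>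
    by (simp add: conductance_shift that)
  have i: "integrable M (\<lambda>\<omega>. b 0 x \<omega> * f (\<tau> 0 x \<omega>))" "(LINT \<omega>|M. b 0 x \<omega> * f (\<tau> 0 x \<omega>)) = (LINT \<omega>|M. b 0 0 \<omega> * f \<omega>)" for x
  proof -
    show "integrable M (\<lambda>\<omega>. b 0 x \<omega> * f (\<tau> 0 x \<omega>))"
      using integrable_shift[OF int, of 0 x] by (simp add: s cong: Bochner_Integration.integrable_cong)
    show "(LINT \<omega>|M. b 0 x \<omega> * f (\<tau> 0 x \<omega>)) = (LINT \<omega>|M. b 0 0 \<omega> * f \<omega>)"
      using integral_shift[of "\<lambda>\<omega>. b 0 0 \<omega> * f \<omega>" 0 x] by (simp add: s cong: Bochner_Integration.integral_cong)
  qed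
  have "(LINT \<omega>|M. jump_operator f \<omega>) = (LINT \<omega>|M. 2 * N * f \<omega> - 2 * (b 0 0 \<omega> * f \<omega>) + b 0 1 \<omega> * f (\<tau> 0 1 \<omega>) + b 0 (- 1) \<omega> * f (\<tau> 0 (- 1) \<omega>))"
    by (rule Bochner_Integration.integral_cong) (auto simp: jump_operator_def algebra_simps)
  also have "\<dots> = 2 * N * (LINT \<omega>|M. f \<omega>)"
    using int intf i by simp
  finally show ?thesis .
qed

text \<open>
  The negative part \<open>u\<close> of the gradient satisfies \<open>u \<le> laplace rate (jump_operator u)\<close>,
  because the operators preserve order. In expectation the right-hand side is \<open>2 * N / rate < 1\<close> times
  the expectation of \<open>u\<close>, so \<open>u\<close> vanishes.
\<close>

lemma gradient_nonneg: "AE \<omega> in M. 0 \<le> gradient \<omega>"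
proof -
  define u where "u \<omega> = max 0 (- gradient \<omega>)" for \<omega>
  have [measurable]: "u \<in> borel_measurable M" unfolding u_def[abs_def] by measurable
  have u0: "0 \<le> u \<omega>" for \<omega> by (simp add: u_def)
  have ub: "\<bar>u \<omega>\<bar> \<le> 1 + 2 * corrector_sup" if "\<omega> \<in> space M" for \<omega>
    using gradient_bound[OF that] by (auto simp: u_def)
  have Ju0: "0 \<le> jump_operator u \<omega>" if "\<omega> \<in> space M" for \<omega>
    unfolding jump_operator_def
    using conductance_pos[OF that] bounded[OF that] u0 less_imp_le[OF conductance_pos[OF that]] by simp
  have le: "- jump_operator u \<omega> \<le> jump_operator gradient \<omega>" if "\<omega> \<in> space M" for \<omega>
  proof -
    have g: "- u \<omega> \<le> gradient \<omega>" for \<omega> by (simp add: u_def)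
    have "2 * (N - b 0 0 \<omega>) * - u \<omega> + b 0 1 \<omega> * - u (\<tau> 0 1 \<omega>) + b 0 (- 1) \<omega> * - u (\<tau> 0 (- 1) \<omega>) \<le> jump_operator gradient \<omega>"
      unfolding jump_operator_def
      using bounded[OF that] less_imp_le[OF conductance_pos[OF that]]
      by (intro add_mono mult_left_mono g) auto
    then show ?thesis by (simp add: jump_operator_def)
  qed
  note mt = measurable_time[OF measurable_jump_operator]
  have u_le: "u \<omega> \<le> laplace rate (\<lambda>s. jump_operator u (\<tau> s 0 \<omega>))" if \<omega>: "\<omega> \<in> space M" for \<omega>
  proof -
    have "laplace rate (\<lambda>s. 0) \<le> laplace rate (\<lambda>s. jump_operator u (\<tau> s 0 \<omega>))"
      by (rule laplace_mono[OF rate_pos, of _ 0 _ "4 * N * (1 + 2 * corrector_sup)"])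
         (auto intro!: mt Ju0 jump_operator_bound ub shift_in_space \<omega>)
    then have "0 \<le> laplace rate (\<lambda>s. jump_operator u (\<tau> s 0 \<omega>))"
      by (simp add: laplace_const[OF rate_pos])
    moreover have "laplace rate (\<lambda>s. 0 - jump_operator u (\<tau> s 0 \<omega>)) \<le> gradient \<omega>"
      unfolding gradient_fixed_point[OF \<omega>]
    proof (rule laplace_mono[OF rate_pos, of _ "4 * N * (1 + 2 * corrector_sup)" _ "\<epsilon> + 4 * N * (1 + 2 * corrector_sup)"])
      show "(\<lambda>s. 0 - jump_operator u (\<tau> s 0 \<omega>)) \<in> borel_measurable borel"
        by (intro borel_measurable_diff mt \<omega>) auto
      show "(\<lambda>s. \<epsilon> + jump_operator gradient (\<tau> s 0 \<omega>)) \<in> borel_measurable borel"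
        by (intro borel_measurable_add mt \<omega>) auto
      fix s
      have s: "\<tau> s 0 \<omega> \<in> space M" by (rule shift_in_space[OF \<omega>])
      show "\<bar>0 - jump_operator u (\<tau> s 0 \<omega>)\<bar> \<le> 4 * N * (1 + 2 * corrector_sup)"
        using jump_operator_bound[of u, OF ub s] by simp
      show "\<bar>\<epsilon> + jump_operator gradient (\<tau> s 0 \<omega>)\<bar> \<le> \<epsilon> + 4 * N * (1 + 2 * corrector_sup)"
        using jump_operator_bound[of gradient, OF gradient_bound s] \<epsilon>_pos by linarith
      show "0 - jump_operator u (\<tau> s 0 \<omega>) \<le> \<epsilon> + jump_operator gradient (\<tau> s 0 \<omega>)"
        using le[OF s] \<epsilon>_pos by linarith
    qed
    moreover have "laplace rate (\<lambda>s. 0 - jump_operator u (\<tau> s 0 \<omega>)) = laplace rate (\<lambda>s. 0) - laplace rate (\<lambda>s. jump_operator u (\<tau> s 0 \<omega>))"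
      by (rule laplace_diff[OF rate_pos, of _ 0 _ "4 * N * (1 + 2 * corrector_sup)"])
         (auto intro!: mt jump_operator_bound ub shift_in_space \<omega>)
    ultimately show ?thesis
      by (simp add: u_def laplace_const[OF rate_pos])
  qed
  have intu: "integrable M u" by (rule integrable_bounded[OF _ ub]) auto
  have "(LINT \<omega>|M. u \<omega>) \<le> (LINT \<omega>|M. laplace rate (\<lambda>s. jump_operator u (\<tau> s 0 \<omega>)))"
  proof (rule integral_mono[OF intu])
    show "integrable M (\<lambda>\<omega>. laplace rate (\<lambda>s. jump_operator u (\<tau> s 0 \<omega>)))"
    proof (rule integrable_bounded)
      show "(\<lambda>\<omega>. laplace rate (\<lambda>s. jump_operator u (\<tau> s 0 \<omega>))) \<in> borel_measurable M"
        by (rule measurable_laplace) measurable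
      show "\<bar>laplace rate (\<lambda>s. jump_operator u (\<tau> s 0 \<omega>))\<bar> \<le> 4 * N * (1 + 2 * corrector_sup) / rate" if "\<omega> \<in> space M" for \<omega>
        by (rule laplace_bound[OF rate_pos]) (auto intro!: mt jump_operator_bound ub shift_in_space that)
    qed
  qed (rule u_le)
  also have "\<dots> = (LINT \<omega>|M. jump_operator u \<omega>) / rate"
    by (rule expected_laplace[OF _ jump_operator_bound[OF ub] rate_pos]) auto
  also have "\<dots> = contraction_rate * (LINT \<omega>|M. u \<omega>)"
    by (subst expected_jump_operator[OF _ ub]) (auto simp: contraction_rate_def)
  finally have "(1 - contraction_rate) * (LINT \<omega>|M. u \<omega>) \<le> 0" by (simp add: algebra_simps)
  then have "(LINT \<omega>|M. u \<omega>) \<le> 0" using contraction_rate by (simp add: mult_le_0_iff)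
  moreover have "0 \<le> (LINT \<omega>|M. u \<omega>)" by (rule Bochner_Integration.integral_nonneg[OF u0])
  ultimately have "(LINT \<omega>|M. u \<omega>) = 0" by simp
  then have "AE \<omega> in M. u \<omega> = 0"
    using integral_nonneg_eq_0_iff_AE[OF intu] u0 by simp
  then show ?thesis by eventually_elim (auto simp: u_def max_def split: if_splits)
qed

lemma integrable_corrector: "integrable M corrector"
  by (rule integrable_bounded[OF measurable_corrector corrector_bound])

lemma integral_gradient: "(LINT \<omega>|M. gradient \<omega>) = 1"
  unfolding gradient_def
  using integral_shift[OF measurable_corrector, of 0 "-1"] integrable_corrector integrable_shift[OF integrable_corrector]
  by (simp add: prob_space)

lemma corrector_primitive:
  assumes \<omega>: "\<omega> \<in> space M"
  shows "primitive_from t (\<lambda>s. corrector (\<tau> s 0 \<omega>)) (\<lambda>s. rate * corrector (\<tau> s 0 \<omega>) - corrector_drift corrector (\<tau> s 0 \<omega>))"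
proof -
  have "primitive_from t (\<lambda>s. laplace rate (\<lambda>r. corrector_drift corrector (\<tau> (r + s) 0 \<omega>)))
     (\<lambda>s. rate * laplace rate (\<lambda>r. corrector_drift corrector (\<tau> (r + s) 0 \<omega>)) - corrector_drift corrector (\<tau> s 0 \<omega>))"
    by (rule laplace_primitive[OF rate_pos measurable_time[OF measurable_corrector_drift[OF measurable_corrector] \<omega>]
          corrector_drift_corrector_bound[OF shift_in_space[OF \<omega>]]])
  moreover have "laplace rate (\<lambda>r. corrector_drift corrector (\<tau> (r + s) 0 \<omega>)) = corrector (\<tau> s 0 \<omega>)" for s
    using corrector_fixed_point[OF shift_in_space[OF \<omega>], of s 0] by (simp add: shift_add \<omega>)
  ultimately show ?thesis by simp
qed

lemma gradient_primitive:
  assumes \<omega>: "\<omega> \<in> space M"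
  shows "primitive_from t (\<lambda>s. gradient (\<tau> s x \<omega>))
     (\<lambda>s. \<epsilon> * (gradient (\<tau> s x \<omega>) - 1) - (b s (x + 1) \<omega> * gradient (\<tau> s (x + 1) \<omega>)
        + b s (x - 1) \<omega> * gradient (\<tau> s (x - 1) \<omega>) - 2 * b s x \<omega> * gradient (\<tau> s x \<omega>)))"
proof -
  let ?g = "\<lambda>s. \<epsilon> + jump_operator gradient (\<tau> s x \<omega>)"
  have "primitive_from t (\<lambda>s. laplace rate (\<lambda>r. ?g (r + s))) (\<lambda>s. rate * laplace rate (\<lambda>r. ?g (r + s)) - ?g s)"
  proof (rule laplace_primitive[OF rate_pos])
    show "?g \<in> borel_measurable borel"
      by (intro borel_measurable_add measurable_time[OF measurable_jump_operator] \<omega>) auto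
    show "\<bar>?g s\<bar> \<le> \<epsilon> + 4 * N * (1 + 2 * corrector_sup)" for s
      using jump_operator_bound[of gradient, OF gradient_bound shift_in_space[OF \<omega>], of s x] \<epsilon>_pos by linarith
  qed
  moreover have "laplace rate (\<lambda>r. ?g (r + s)) = gradient (\<tau> s x \<omega>)" for s
    using gradient_fixed_point[OF shift_in_space[OF \<omega>], of s x] by (simp add: shift_add \<omega>)
  ultimately have "primitive_from t (\<lambda>s. gradient (\<tau> s x \<omega>)) (\<lambda>s. rate * gradient (\<tau> s x \<omega>) - ?g s)"
    by simp
  then show ?thesis
    by (rule primitive_from_cong)
       (simp_all add: jump_operator_def rate_def shift_add conductance_shift \<omega> algebra_simps)
qed

text \<open>
  By stationarity the expectation of \<open>X\<^sup>2\<close> does not change along time, so the expectation of its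
  time derivative vanishes.
\<close>

lemma energy_identity:
  "(LINT \<omega>|M. corrector \<omega> * (rate * corrector \<omega> - corrector_drift corrector \<omega>)) = 0"
proof -
  define D where "D \<omega> = rate * corrector \<omega> - corrector_drift corrector \<omega>" for \<omega>
  define g where "g \<omega> = 2 * (corrector \<omega> * D \<omega>)" for \<omega>
  have [measurable]: "D \<in> borel_measurable M"
    unfolding D_def[abs_def] using measurable_corrector_drift[OF measurable_corrector] by measurable
  have [measurable]: "g \<in> borel_measurable M" unfolding g_def[abs_def] by measurable
  define C where "C = 2 * (corrector_sup * (rate * corrector_sup + (2 * N * corrector_sup + N)))"
  have gb: "\<bar>g \<omega>\<bar> \<le> C" if "\<omega> \<in> space M" for \<omega>
  proof -
    have "\<bar>D \<omega>\<bar> \<le> rate * corrector_sup + (2 * N * corrector_sup + N)"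
      unfolding D_def
    proof (rule order_trans[OF abs_triangle_ineq4 add_mono[OF _ corrector_drift_corrector_bound[OF that]]])
      show "\<bar>rate * corrector \<omega>\<bar> \<le> rate * corrector_sup"
        using mult_left_mono[OF corrector_bound[OF that], of rate] rate_pos by (simp add: abs_mult)
    qed
    then have "\<bar>corrector \<omega>\<bar> * \<bar>D \<omega>\<bar> \<le> corrector_sup * (rate * corrector_sup + (2 * N * corrector_sup + N))"
      using corrector_bound[OF that] by (intro mult_mono) auto
    then show ?thesis by (simp add: g_def C_def abs_mult)
  qed
  have sq: "integrable M (\<lambda>\<omega>. corrector \<omega> * corrector \<omega>)"
  proof (rule integrable_bounded[where C = "corrector_sup * corrector_sup"])
    fix \<omega> assume "\<omega> \<in> space M"
    from corrector_bound[OF this] show "\<bar>corrector \<omega> * corrector \<omega>\<bar> \<le> corrector_sup * corrector_sup"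
      unfolding abs_mult by (intro mult_mono) auto
  qed measurable
  have eq: "(LINT s:{0..1}|lborel. g (\<tau> s 0 \<omega>)) = corrector (\<tau> 1 0 \<omega>) * corrector (\<tau> 1 0 \<omega>) - corrector \<omega> * corrector \<omega>"
    if \<omega>: "\<omega> \<in> space M" for \<omega>
  proof -
    note P = corrector_primitive[OF \<omega>, of 0, folded D_def]
    have "primitive_from 0 (\<lambda>s. corrector (\<tau> s 0 \<omega>) * corrector (\<tau> s 0 \<omega>)) (\<lambda>s. g (\<tau> s 0 \<omega>))"
      by (rule primitive_from_cong[OF primitive_from_mult[OF P P]]) (auto simp: g_def)
    from primitive_from_diff[OF this, of 0 1] show ?thesis by (simp add: shift_zero \<omega>)
  qed
  have "(LINT \<omega>|M. g \<omega>) = (LINT \<omega>|M. g \<omega> * backward_average 1 0 (\<lambda>_. 1) \<omega>)"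
    by (simp add: backward_average_def set_lebesgue_integral_def)
  also have "\<dots> = (LINT \<omega>|M. 1 * (LINT s:{0..1}|lborel. g (\<tau> s 0 \<omega>)))"
    by (rule forward_average_adjoint(2)[symmetric, of g "\<lambda>_. 1" 1])
       (use integrable_bounded[of g, OF _ gb] in auto)
  also have "\<dots> = (LINT \<omega>|M. corrector (\<tau> 1 0 \<omega>) * corrector (\<tau> 1 0 \<omega>) - corrector \<omega> * corrector \<omega>)"
    by (rule Bochner_Integration.integral_cong) (auto simp: eq)
  also have "\<dots> = 0"
    using integrable_shift[OF sq, of 1 0] sq integral_shift[of "\<lambda>\<omega>. corrector \<omega> * corrector \<omega>" 1 0] by simp
  finally show ?thesis unfolding g_def D_def by simp
qed

lemma integrable_conductance_times:
  assumes "f \<in> borel_measurable M" "\<And>\<omega>. \<omega> \<in> space M \<Longrightarrow> \<bar>f \<omega>\<bar> \<le> C"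
  shows "integrable M (\<lambda>\<omega>. b 0 0 \<omega> * f \<omega>)"
proof (rule integrable_bounded[where C = "N * C"])
  note [measurable] = assms(1)
  show "(\<lambda>\<omega>. b 0 0 \<omega> * f \<omega>) \<in> borel_measurable M" by measurable
  fix \<omega> assume \<omega>: "\<omega> \<in> space M"
  show "\<bar>b 0 0 \<omega> * f \<omega>\<bar> \<le> N * C"
    using assms(2)[OF \<omega>] bounded[OF \<omega>, of 0 0] conductance_pos[OF \<omega>, of 0 0]
    by (auto simp: abs_mult intro!: mult_mono)
qed

text \<open>
  The energy identity and summation by parts, in the form of invariance under the space shift, give \<open>E (b * h *
  (h - 1)) = - \<epsilon> * E (X\<^sup>2) \<le> 0\<close> for the gradient \<open>h\<close>. The elementary inequality
  \<open>h \<le> (1 + h\<^sup>2) / 2\<close> then yields the bound.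
\<close>

lemma gradient_energy: "(LINT \<omega>|M. b 0 0 \<omega> * (gradient \<omega>)\<^sup>2) \<le> (LINT \<omega>|M. b 0 0 \<omega>)"
proof -
  define C where "C = 1 + 2 * corrector_sup"
  have Cg: "\<bar>gradient \<omega>\<bar> \<le> C" if "\<omega> \<in> space M" for \<omega>
    using gradient_bound[OF that] by (simp add: C_def)
  have C0: "0 \<le> C" "0 \<le> corrector_sup"
    using Cg corrector_bound not_empty by force+
  let ?h = "\<lambda>\<omega>. corrector (\<tau> 0 (- 1) \<omega>) * gradient \<omega>"
  have int_bh: "integrable M (\<lambda>\<omega>. b 0 0 \<omega> * ?h \<omega>)"
    by (rule integrable_conductance_times[where C = "corrector_sup * C"])
       (auto simp: abs_mult C0 intro!: mult_mono Cg corrector_bound shift_in_space)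
  have int_bg: "integrable M (\<lambda>\<omega>. b 0 0 \<omega> * (corrector \<omega> * gradient \<omega>))"
    by (rule integrable_conductance_times[where C = "corrector_sup * C"])
       (auto simp: abs_mult C0 intro!: mult_mono Cg corrector_bound shift_in_space)
  have int_x2: "integrable M (\<lambda>\<omega>. (corrector \<omega>)\<^sup>2)"
    by (rule integrable_bounded[where C = "corrector_sup\<^sup>2"])
       (auto simp: intro!: abs_le_square_iff[THEN iffD1] corrector_bound order_trans[OF corrector_bound])
  have int_g2: "integrable M (\<lambda>\<omega>. b 0 0 \<omega> * (gradient \<omega>)\<^sup>2)"
    by (rule integrable_conductance_times[where C = "C\<^sup>2"])
       (auto simp: intro!: abs_le_square_iff[THEN iffD1] order_trans[OF Cg])
  have int_g: "integrable M (\<lambda>\<omega>. b 0 0 \<omega> * gradient \<omega>)"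
    by (rule integrable_conductance_times[OF measurable_gradient Cg])
  have int_b: "integrable M (b 0 0)"
    using integrable_conductance_times[of "\<lambda>_. 1" 1] by simp
  have shifted: "corrector \<omega> * (b 0 1 \<omega> * gradient (\<tau> 0 1 \<omega>)) = (\<lambda>\<omega>. b 0 0 \<omega> * ?h \<omega>) (\<tau> 0 1 \<omega>)" if "\<omega> \<in> space M" for \<omega>
    by (simp add: conductance_shift shift_add shift_zero that)
  have i1: "integrable M (\<lambda>\<omega>. corrector \<omega> * (b 0 1 \<omega> * gradient (\<tau> 0 1 \<omega>)))"
    using integrable_shift[OF int_bh, of 0 1] by (subst Bochner_Integration.integrable_cong[OF refl shifted])
  have e1: "(LINT \<omega>|M. corrector \<omega> * (b 0 1 \<omega> * gradient (\<tau> 0 1 \<omega>))) = (LINT \<omega>|M. b 0 0 \<omega> * ?h \<omega>)"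
    using integral_shift[of "\<lambda>\<omega>. b 0 0 \<omega> * ?h \<omega>" 0 1] by (subst Bochner_Integration.integral_cong[OF refl shifted]) auto
  have "0 = (LINT \<omega>|M. corrector \<omega> * (rate * corrector \<omega> - corrector_drift corrector \<omega>))"
    by (rule energy_identity[symmetric])
  also have "\<dots> = (LINT \<omega>|M. \<epsilon> * (corrector \<omega>)\<^sup>2 - corrector \<omega> * (b 0 1 \<omega> * gradient (\<tau> 0 1 \<omega>)) + b 0 0 \<omega> * (corrector \<omega> * gradient \<omega>))"
    by (rule Bochner_Integration.integral_cong)
       (auto simp: corrector_drift_eq rate_def power2_eq_square algebra_simps)
  also have "\<dots> = \<epsilon> * (LINT \<omega>|M. (corrector \<omega>)\<^sup>2) - (LINT \<omega>|M. b 0 0 \<omega> * ?h \<omega>) + (LINT \<omega>|M. b 0 0 \<omega> * (corrector \<omega> * gradient \<omega>))"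
    using int_x2 i1 int_bg e1 by simp
  finally have e2: "(LINT \<omega>|M. b 0 0 \<omega> * (corrector \<omega> * gradient \<omega>)) - (LINT \<omega>|M. b 0 0 \<omega> * ?h \<omega>) = - \<epsilon> * (LINT \<omega>|M. (corrector \<omega>)\<^sup>2)"
    by simp
  have "0 \<le> (LINT \<omega>|M. (corrector \<omega>)\<^sup>2)" by (rule Bochner_Integration.integral_nonneg) simp
  then have "0 \<le> \<epsilon> * (LINT \<omega>|M. (corrector \<omega>)\<^sup>2)" using \<epsilon>_pos by simp
  then have e3: "(LINT \<omega>|M. b 0 0 \<omega> * (corrector \<omega> * gradient \<omega>)) - (LINT \<omega>|M. b 0 0 \<omega> * ?h \<omega>) \<le> 0" using e2 by linarith
  have "(LINT \<omega>|M. b 0 0 \<omega> * (gradient \<omega>)\<^sup>2) = (LINT \<omega>|M. b 0 0 \<omega> * gradient \<omega> + b 0 0 \<omega> * (corrector \<omega> * gradient \<omega>) - b 0 0 \<omega> * ?h \<omega>)"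
    by (rule Bochner_Integration.integral_cong) (auto simp: gradient_def power2_eq_square algebra_simps)
  also have "\<dots> = (LINT \<omega>|M. b 0 0 \<omega> * gradient \<omega>) + (LINT \<omega>|M. b 0 0 \<omega> * (corrector \<omega> * gradient \<omega>)) - (LINT \<omega>|M. b 0 0 \<omega> * ?h \<omega>)"
    using int_g int_bg int_bh by simp
  also have "\<dots> \<le> (LINT \<omega>|M. b 0 0 \<omega> * gradient \<omega>)" using e3 by simp
  also have "\<dots> \<le> (LINT \<omega>|M. (b 0 0 \<omega> + b 0 0 \<omega> * (gradient \<omega>)\<^sup>2) / 2)"
  proof (rule integral_mono[OF int_g])
    show "integrable M (\<lambda>\<omega>. (b 0 0 \<omega> + b 0 0 \<omega> * (gradient \<omega>)\<^sup>2) / 2)"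
      using int_b int_g2 by simp
    fix \<omega> assume \<omega>: "\<omega> \<in> space M"
    have "0 \<le> b 0 0 \<omega> * (gradient \<omega> - 1)\<^sup>2" using conductance_pos[OF \<omega>, of 0 0] by simp
    then show "b 0 0 \<omega> * gradient \<omega> \<le> (b 0 0 \<omega> + b 0 0 \<omega> * (gradient \<omega>)\<^sup>2) / 2"
      by (simp add: power2_eq_square algebra_simps)
  qed
  also have "\<dots> = ((LINT \<omega>|M. b 0 0 \<omega>) + (LINT \<omega>|M. b 0 0 \<omega> * (gradient \<omega>)\<^sup>2)) / 2"
    using int_b int_g2 by simp
  finally show ?thesis by simp
qed

lemma gradient_nonneg_everywhere: "AE \<omega> in M. \<forall>x s. 0 \<le> gradient (\<tau> s x \<omega>)"
proof (rule AE_nonneg_along_shifts[OF gradient_nonneg AE_I2], intro allI)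
  fix \<omega> x and s :: real assume \<omega>: "\<omega> \<in> space M"
  have "continuous_on {s - 1..s + 1} (\<lambda>s. gradient (\<tau> s x \<omega>))"
    by (rule primitive_from_continuous_on[OF gradient_primitive[OF \<omega>]])
  then show "isCont (\<lambda>s. gradient (\<tau> s x \<omega>)) s"
    by (rule continuous_on_interior) simp
qed

text \<open>
  The discounted gradient \<open>exp (- \<epsilon> * s) * h\<close> solves the adjoint equation with source
  \<open>\<epsilon> * exp (- \<epsilon> * s)\<close>, so the duality inequality bounds the partial sums that define
  \<open>varphi_eps\<close>.
\<close>

lemma column_sum_le_gradient:
  "AE \<omega> in M. \<forall>n. \<forall>S\<ge>0. (LINT r:{0..S}|lborel. \<epsilon> * exp (- \<epsilon> * r) * (\<Sum>x\<in>{- int (Suc n)..int (Suc n)}. dual_kernel_n b n r x 0 0 \<omega>)) \<le> gradient \<omega>"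
  using gradient_nonneg_everywhere
proof (rule AE_mp, intro AE_I2 impI allI)
  fix \<omega> n and S :: real assume \<omega>: "\<omega> \<in> space M" and nn: "\<forall>x s. 0 \<le> gradient (\<tau> s x \<omega>)" and S: "0 \<le> S"
  interpret conductance_path b \<omega> by (rule path[OF \<omega>])
  define h where "h x s = exp (- \<epsilon> * s) * gradient (\<tau> s x \<omega>)" for x s
  have lin: "primitive_from 0 (\<lambda>s. - \<epsilon> * s) (\<lambda>s. - \<epsilon>)"
  proof (rule primitive_from_cong[OF primitive_from_indefinite[OF set_integrable_const_Icc, of _ 0]])
    show "0 + (LINT r:{0..s}|lborel. - \<epsilon>) = - \<epsilon> * s" if "0 \<le> s" for s
      using that by (simp add: set_lebesgue_integral_def)
  qed simp
  have h: "primitive_from 0 (h x) (\<lambda>s. - (\<epsilon> * exp (- \<epsilon> * s)) - (b s (x + 1) \<omega> * h (x + 1) s + b s (x - 1) \<omega> * h (x - 1) s - 2 * b s x \<omega> * h x s))" for x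
    unfolding h_def
    by (rule primitive_from_cong[OF primitive_from_mult[OF primitive_from_exp[OF lin] gradient_primitive[OF \<omega>]]])
       (auto simp: algebra_simps)
  have "(\<Sum>x\<in>{0 - int (Suc n)..0 + int (Suc n)}. h x S * Kn n S x 0 0) + (LINT r:{0..S}|lborel. \<epsilon> * exp (- \<epsilon> * r) * (\<Sum>x\<in>{0 - int (Suc n)..0 + int (Suc n)}. Kn n r x 0 0)) \<le> h 0 0"
  proof (rule duality_inequality[OF h])
    have "set_integrable lborel {0..s} (\<lambda>s. \<epsilon> * exp (- \<epsilon> * s))" for s
      by (intro set_integrable_times_continuous set_integrable_const_Icc continuous_intros)
    then show "set_integrable lborel {0..s} (\<lambda>s. \<epsilon> * exp (- \<epsilon> * s))" for s .
    show "0 \<le> h x s" if "0 \<le> s" for x s using nn by (simp add: h_def)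
  qed (use S in auto)
  moreover have "0 \<le> (\<Sum>x\<in>{0 - int (Suc n)..0 + int (Suc n)}. h x S * Kn n S x 0 0)"
    using nn Kn_nonneg[OF S] by (intro sum_nonneg mult_nonneg_nonneg) (auto simp: h_def)
  moreover have "h 0 0 = gradient \<omega>" by (simp add: h_def shift_zero \<omega>)
  ultimately show "(LINT r:{0..S}|lborel. \<epsilon> * exp (- \<epsilon> * r) * (\<Sum>x\<in>{- int (Suc n)..int (Suc n)}. Kn n r x 0 0)) \<le> gradient \<omega>"
    by (simp only: diff_0 add_0)
qed

end

section \<open>The equation in weak form\<close>

context dynamical_environment
begin

text \<open>
  The time average over \<open>{0..t}\<close> of the discrete Laplacian of a test function, seen backward along the
  shifts.
\<close>

definition backward_laplacian :: "real \<Rightarrow> ('a \<Rightarrow> real) \<Rightarrow> 'a \<Rightarrow> real" where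
  "backward_laplacian t F \<omega> = backward_average t 1 F \<omega> + backward_average t (- 1) F \<omega> - 2 * backward_average t 0 F \<omega>"

lemma measurable_backward_laplacian [measurable (raw)]:
  assumes [measurable]: "F \<in> borel_measurable M"
  shows "backward_laplacian t F \<in> borel_measurable M"
  unfolding backward_laplacian_def[abs_def] by measurable

lemma backward_laplacian_bound:
  assumes F: "F \<in> borel_measurable M" and FC: "\<And>\<omega>. \<omega> \<in> space M \<Longrightarrow> \<bar>F \<omega>\<bar> \<le> C" and t: "0 \<le> t" and \<omega>: "\<omega> \<in> space M"
  shows "\<bar>backward_laplacian t F \<omega>\<bar> \<le> 4 * (t * C)"
  using backward_average_bound[OF F FC t \<omega>, of 1] backward_average_bound[OF F FC t \<omega>, of "-1"] backward_average_bound[OF F FC t \<omega>, of 0]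
  unfolding backward_laplacian_def by linarith

lemma integrable_bounded_mult:
  fixes g F :: "'a \<Rightarrow> real"
  assumes g: "integrable M g" and F[measurable]: "F \<in> borel_measurable M" and FC: "\<And>\<omega>. \<omega> \<in> space M \<Longrightarrow> \<bar>F \<omega>\<bar> \<le> C"
  shows "integrable M (\<lambda>\<omega>. g \<omega> * F \<omega>)"
proof (rule Bochner_Integration.integrable_bound)
  have [measurable]: "g \<in> borel_measurable M" using g by auto
  show "(\<lambda>\<omega>. g \<omega> * F \<omega>) \<in> borel_measurable M" by measurable
  show "integrable M (\<lambda>\<omega>. C * g \<omega>)" using g by simp
  show "AE \<omega> in M. norm (g \<omega> * F \<omega>) \<le> norm (C * g \<omega>)"
  proof (rule AE_I2)
    fix \<omega> assume "\<omega> \<in> space M"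
    then have "\<bar>F \<omega>\<bar> \<le> \<bar>C\<bar>" by (intro order_trans[OF FC abs_ge_self])
    then show "norm (g \<omega> * F \<omega>) \<le> norm (C * g \<omega>)"
      by (rule norm_mult_bounded)
  qed
qed

text \<open>
  The expression on the left tests, against \<open>F\<close>, whether \<open>f\<close> along time has the density
  \<open>- L_plus b \<tau> f\<close>. Moving the shifts to \<open>F\<close> leaves expectations of \<open>f\<close>
  and \<open>b * f\<close> against fixed functions, which can pass to weak limits.
\<close>

lemma expected_increment:
  fixes f :: "'a \<Rightarrow> real"
  assumes f: "integrable M f" and bf: "integrable M (\<lambda>\<omega>. b 0 0 \<omega> * f \<omega>)"
    and F[measurable]: "F \<in> borel_measurable M" and FC: "\<And>\<omega>. \<omega> \<in> space M \<Longrightarrow> \<bar>F \<omega>\<bar> \<le> C"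
  shows "(LINT \<omega>|M. F \<omega> * (f (\<tau> t 0 \<omega>) - f \<omega> + (LINT s:{0..t}|lborel. L_plus b \<tau> f (\<tau> s 0 \<omega>))))
     = (LINT \<omega>|M. f \<omega> * F (\<tau> (- t) 0 \<omega>)) - (LINT \<omega>|M. f \<omega> * F \<omega>) + (LINT \<omega>|M. b 0 0 \<omega> * f \<omega> * backward_laplacian t F \<omega>)"
    and "integrable M (\<lambda>\<omega>. f (\<tau> t 0 \<omega>) - f \<omega> + (LINT s:{0..t}|lborel. L_plus b \<tau> f (\<tau> s 0 \<omega>)))"
proof -
  have [measurable]: "f \<in> borel_measurable M" using f by auto
  define g where "g \<omega> = b 0 0 \<omega> * f \<omega>" for \<omega>
  have g: "integrable M g" unfolding g_def[abs_def] by (rule bf)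
  have L: "L_plus b \<tau> f (\<tau> s 0 \<omega>) = g (\<tau> s 1 \<omega>) + g (\<tau> s (- 1) \<omega>) - 2 * g (\<tau> s 0 \<omega>)" if "\<omega> \<in> space M" for \<omega> s
    by (simp add: L_plus_def g_def conductance_shift shift_add that)
  define A where "A x \<omega> = (LINT s:{0..t}|lborel. g (\<tau> s x \<omega>))" for x \<omega>
  have AE: "AE \<omega> in M. (LINT s:{0..t}|lborel. L_plus b \<tau> f (\<tau> s 0 \<omega>)) = A 1 \<omega> + A (- 1) \<omega> - 2 * A 0 \<omega>"
    using AE_integrable_along_time[OF g, of 0 t 1] AE_integrable_along_time[OF g, of 0 t "-1"] AE_integrable_along_time[OF g, of 0 t 0] AE_space
  proof eventually_elim
    case (elim \<omega>)
    have "(LINT s:{0..t}|lborel. L_plus b \<tau> f (\<tau> s 0 \<omega>)) = (LINT s:{0..t}|lborel. g (\<tau> s 1 \<omega>) + g (\<tau> s (- 1) \<omega>) - 2 * g (\<tau> s 0 \<omega>))"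
      by (simp only: L[OF elim(4)])
    also have "\<dots> = A 1 \<omega> + A (- 1) \<omega> - 2 * A 0 \<omega>"
      unfolding A_def using elim by simp
    finally show ?case .
  qed
  have iA: "integrable M (A x)" for x
    using forward_average_adjoint(1)[OF g, of "\<lambda>_. 1" 1 t x] by (simp add: A_def[abs_def])
  have mL: "(\<lambda>\<omega>. LINT s:{0..t}|lborel. L_plus b \<tau> f (\<tau> s 0 \<omega>)) \<in> borel_measurable M"
    unfolding set_lebesgue_integral_def L_plus_def by (rule lborel.borel_measurable_lebesgue_integral) measurable
  have iL: "integrable M (\<lambda>\<omega>. LINT s:{0..t}|lborel. L_plus b \<tau> f (\<tau> s 0 \<omega>))"
    by (subst integrable_cong_AE[OF mL _ AE]) (use iA in auto)
  show int: "integrable M (\<lambda>\<omega>. f (\<tau> t 0 \<omega>) - f \<omega> + (LINT s:{0..t}|lborel. L_plus b \<tau> f (\<tau> s 0 \<omega>)))"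
    using f integrable_shift[OF f] iL by simp
  have e0: "(LINT \<omega>|M. F \<omega> * f (\<tau> t 0 \<omega>)) = (LINT \<omega>|M. f \<omega> * F (\<tau> (- t) 0 \<omega>))"
  proof -
    have "(LINT \<omega>|M. F \<omega> * f (\<tau> t 0 \<omega>)) = (LINT \<omega>|M. F (\<tau> (- t) 0 \<omega>) * f (\<tau> t 0 (\<tau> (- t) 0 \<omega>)))"
      by (rule integral_shift[symmetric]) measurable
    also have "\<dots> = (LINT \<omega>|M. f \<omega> * F (\<tau> (- t) 0 \<omega>))"
      by (rule Bochner_Integration.integral_cong) (auto simp: shift_add shift_zero)
    finally show ?thesis .
  qed
  have comm: "integrable M (\<lambda>\<omega>. F \<omega> * k \<omega>)" if "integrable M k" for k :: "'a \<Rightarrow> real"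
    using integrable_bounded_mult[OF that F FC] by (simp add: mult.commute)
  have fA: "(LINT \<omega>|M. F \<omega> * A x \<omega>) = (LINT \<omega>|M. g \<omega> * backward_average t x F \<omega>)" for x
    unfolding A_def by (rule forward_average_adjoint(2)[OF g F FC])
  have gB: "integrable M (\<lambda>\<omega>. g \<omega> * backward_average t x F \<omega>)" for x
  proof (cases "0 \<le> t")
    case True
    show ?thesis by (rule integrable_bounded_mult[OF g _ backward_average_bound[OF F FC True]]) auto
  qed (simp add: backward_average_def set_lebesgue_integral_def)
  have "(LINT \<omega>|M. F \<omega> * (f (\<tau> t 0 \<omega>) - f \<omega> + (LINT s:{0..t}|lborel. L_plus b \<tau> f (\<tau> s 0 \<omega>))))
    = (LINT \<omega>|M. F \<omega> * f (\<tau> t 0 \<omega>) - F \<omega> * f \<omega> + (F \<omega> * A 1 \<omega> + F \<omega> * A (- 1) \<omega> - 2 * (F \<omega> * A 0 \<omega>)))"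
  proof (rule integral_cong_AE)
    show "(\<lambda>\<omega>. F \<omega> * (f (\<tau> t 0 \<omega>) - f \<omega> + (LINT s:{0..t}|lborel. L_plus b \<tau> f (\<tau> s 0 \<omega>)))) \<in> borel_measurable M"
      using mL by measurable
    show "(\<lambda>\<omega>. F \<omega> * f (\<tau> t 0 \<omega>) - F \<omega> * f \<omega> + (F \<omega> * A 1 \<omega> + F \<omega> * A (- 1) \<omega> - 2 * (F \<omega> * A 0 \<omega>))) \<in> borel_measurable M"
      using borel_measurable_integrable[OF iA[of 1]] borel_measurable_integrable[OF iA[of "-1"]] borel_measurable_integrable[OF iA[of 0]] by measurable
    show "AE \<omega> in M. F \<omega> * (f (\<tau> t 0 \<omega>) - f \<omega> + (LINT s:{0..t}|lborel. L_plus b \<tau> f (\<tau> s 0 \<omega>)))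
       = F \<omega> * f (\<tau> t 0 \<omega>) - F \<omega> * f \<omega> + (F \<omega> * A 1 \<omega> + F \<omega> * A (- 1) \<omega> - 2 * (F \<omega> * A 0 \<omega>))"
      using AE by eventually_elim (simp only:, simp add: algebra_simps)
  qed
  also have "\<dots> = (LINT \<omega>|M. F \<omega> * f (\<tau> t 0 \<omega>)) - (LINT \<omega>|M. F \<omega> * f \<omega>) +
     ((LINT \<omega>|M. F \<omega> * A 1 \<omega>) + (LINT \<omega>|M. F \<omega> * A (- 1) \<omega>) - 2 * (LINT \<omega>|M. F \<omega> * A 0 \<omega>))"
    using comm[OF f] comm[OF integrable_shift[OF f]] comm[OF iA] by simp
  also have "(LINT \<omega>|M. F \<omega> * A 1 \<omega>) + (LINT \<omega>|M. F \<omega> * A (- 1) \<omega>) - 2 * (LINT \<omega>|M. F \<omega> * A 0 \<omega>)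
     = (LINT \<omega>|M. g \<omega> * backward_average t 1 F \<omega> + g \<omega> * backward_average t (- 1) F \<omega> - 2 * (g \<omega> * backward_average t 0 F \<omega>))"
    unfolding fA using gB by simp
  also have "\<dots> = (LINT \<omega>|M. b 0 0 \<omega> * f \<omega> * backward_laplacian t F \<omega>)"
    by (rule Bochner_Integration.integral_cong) (auto simp: g_def backward_laplacian_def algebra_simps)
  finally show "(LINT \<omega>|M. F \<omega> * (f (\<tau> t 0 \<omega>) - f \<omega> + (LINT s:{0..t}|lborel. L_plus b \<tau> f (\<tau> s 0 \<omega>))))
     = (LINT \<omega>|M. f \<omega> * F (\<tau> (- t) 0 \<omega>)) - (LINT \<omega>|M. f \<omega> * F \<omega>) + (LINT \<omega>|M. b 0 0 \<omega> * f \<omega> * backward_laplacian t F \<omega>)"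
    unfolding e0 by (simp add: mult.commute)
qed

end

context bounded_environment
begin

text \<open>
  The equation of the gradient at the origin, integrated over \<open>{0..t}\<close>.
\<close>

lemma gradient_increment:
  assumes \<omega>: "\<omega> \<in> space M" and t: "0 \<le> t"
  shows "gradient (\<tau> t 0 \<omega>) - gradient \<omega> + (LINT s:{0..t}|lborel. L_plus b \<tau> gradient (\<tau> s 0 \<omega>))
    = \<epsilon> * (LINT s:{0..t}|lborel. gradient (\<tau> s 0 \<omega>) - 1)"
proof -
  note P = gradient_primitive[OF \<omega>, of 0 0]
  interpret conductance_path b \<omega> by (rule path[OF \<omega>])
  have c: "continuous_on {0..t} (\<lambda>s. gradient (\<tau> s x \<omega>))" for x
    by (rule primitive_from_continuous_on[OF gradient_primitive[OF \<omega>]])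
  have i1: "set_integrable lborel {0..t} (\<lambda>s. 1 * (gradient (\<tau> s 0 \<omega>) - 1))"
    by (rule set_integrable_times_continuous[OF set_integrable_const_Icc]) (intro continuous_intros c)
  have i2: "set_integrable lborel {0..t} (\<lambda>s. b s x \<omega> * gradient (\<tau> s x \<omega>))" for x
    by (rule set_integrable_times_continuous[OF b_integrable c])
  have L: "L_plus b \<tau> gradient (\<tau> s 0 \<omega>) = b s 1 \<omega> * gradient (\<tau> s 1 \<omega>) + b s (- 1) \<omega> * gradient (\<tau> s (- 1) \<omega>) - 2 * (b s 0 \<omega> * gradient (\<tau> s 0 \<omega>))" for s
    by (simp add: L_plus_def conductance_shift shift_add \<omega>)
  have iL: "set_integrable lborel {0..t} (\<lambda>s. L_plus b \<tau> gradient (\<tau> s 0 \<omega>))"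
    unfolding L using i2 by simp
  have "gradient (\<tau> t 0 \<omega>) - gradient (\<tau> 0 0 \<omega>) = (LINT s:{0..t}|lborel. \<epsilon> * (gradient (\<tau> s 0 \<omega>) - 1) - L_plus b \<tau> gradient (\<tau> s 0 \<omega>))"
    unfolding L using primitive_from_diff[OF P order_refl t] by (simp add: mult.assoc)
  also have "\<dots> = \<epsilon> * (LINT s:{0..t}|lborel. gradient (\<tau> s 0 \<omega>) - 1) - (LINT s:{0..t}|lborel. L_plus b \<tau> gradient (\<tau> s 0 \<omega>))"
  proof -
    have "set_integrable lborel {0..t} (\<lambda>s. \<epsilon> * (gradient (\<tau> s 0 \<omega>) - 1))"
      using i1 by simp
    from set_integral_diff(2)[OF this iL] show ?thesis by simp
  qed
  finally show ?thesis by (simp add: shift_zero \<omega>)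
qed

lemma gradient_weak_equation:
  assumes F[measurable]: "F \<in> borel_measurable M" and FC: "\<And>\<omega>. \<omega> \<in> space M \<Longrightarrow> \<bar>F \<omega>\<bar> \<le> C" and t: "0 \<le> t"
  shows "(LINT \<omega>|M. gradient \<omega> * F (\<tau> (- t) 0 \<omega>)) - (LINT \<omega>|M. gradient \<omega> * F \<omega>)
       + (LINT \<omega>|M. b 0 0 \<omega> * gradient \<omega> * backward_laplacian t F \<omega>)
     = \<epsilon> * (LINT \<omega>|M. (gradient \<omega> - 1) * backward_average t 0 F \<omega>)"
proof -
  have g: "integrable M gradient" by (rule integrable_bounded[OF measurable_gradient gradient_bound])
  have bg: "integrable M (\<lambda>\<omega>. b 0 0 \<omega> * gradient \<omega>)"
    by (rule integrable_conductance_times[OF measurable_gradient gradient_bound])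
  have "(LINT \<omega>|M. gradient \<omega> * F (\<tau> (- t) 0 \<omega>)) - (LINT \<omega>|M. gradient \<omega> * F \<omega>)
       + (LINT \<omega>|M. b 0 0 \<omega> * gradient \<omega> * backward_laplacian t F \<omega>)
     = (LINT \<omega>|M. F \<omega> * (\<epsilon> * (LINT s:{0..t}|lborel. gradient (\<tau> s 0 \<omega>) - 1)))"
    by (rule trans[OF expected_increment(1)[OF g bg F FC, symmetric]])
      (auto intro!: Bochner_Integration.integral_cong simp: gradient_increment t)
  also have "\<dots> = \<epsilon> * (LINT \<omega>|M. F \<omega> * (LINT s:{0..t}|lborel. gradient (\<tau> s 0 \<omega>) - 1))"
    by (simp add: mult.left_commute)
  also have "(LINT \<omega>|M. F \<omega> * (LINT s:{0..t}|lborel. gradient (\<tau> s 0 \<omega>) - 1)) = (LINT \<omega>|M. (gradient \<omega> - 1) * backward_average t 0 F \<omega>)"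
    by (rule forward_average_adjoint(2)[of "\<lambda>\<omega>. gradient \<omega> - 1", OF _ F FC]) (use g in auto)
  finally show ?thesis .
qed

end

section \<open>Truncated conductances\<close>

lemma (in dynamical_environment) truncated_bounded_environment:
  assumes "0 < \<epsilon>"
  shows "bounded_environment M (\<lambda>t x \<omega>. min (b t x \<omega>) (real (Suc N))) \<tau> (real (Suc N)) \<epsilon>"
  by (intro bounded_environment.intro truncated_environment bounded_environment_axioms.intro) (use assms in auto)

text \<open>
  The two moment conditions of the theorem.
\<close>

locale integrable_environment = dynamical_environment M b \<tau>
  for M :: "'a measure" and b \<tau> +
  assumes integrable_b: "integrable M (b 0 0)"
    and integrable_inverse_b: "integrable M (\<lambda>\<omega>. inverse (b 0 0 \<omega>))"
begin

abbreviation trunc :: "nat \<Rightarrow> real \<Rightarrow> int \<Rightarrow> 'a \<Rightarrow> real" where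
  "trunc N \<equiv> \<lambda>t x \<omega>. min (b t x \<omega>) (real (Suc N))"

text \<open>
  The gradient for the conductances truncated at \<open>N + 1\<close>; the shift by one keeps the bound positive.
\<close>

definition approx :: "real \<Rightarrow> nat \<Rightarrow> 'a \<Rightarrow> real" where
  "approx \<epsilon> N = bounded_environment.gradient (trunc N) \<tau> (real (Suc N)) \<epsilon>"

lemma b_pos: "\<omega> \<in> space M \<Longrightarrow> 0 < b 0 0 \<omega>" "\<omega> \<in> space M \<Longrightarrow> 0 \<le> b 0 0 \<omega>"
  using conductance_pos less_imp_le by blast+

context
  fixes \<epsilon> :: real
  assumes \<epsilon>: "0 < \<epsilon>"
begin

lemma measurable_approx [measurable]: "approx \<epsilon> N \<in> borel_measurable M"
  unfolding approx_def
  by (rule bounded_environment.measurable_gradient[OF truncated_bounded_environment[OF \<epsilon>]])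

lemma approx_bounded: "\<exists>C. \<forall>\<omega>\<in>space M. \<bar>approx \<epsilon> N \<omega>\<bar> \<le> C"
  unfolding approx_def
  using bounded_environment.gradient_bound[OF truncated_bounded_environment[OF \<epsilon>]] by blast

lemma integrable_approx: "integrable M (approx \<epsilon> N)"
  using approx_bounded[of N] by (auto intro: integrable_bounded)

lemma integral_approx: "(LINT \<omega>|M. approx \<epsilon> N \<omega>) = 1"
  unfolding approx_def
  by (rule bounded_environment.integral_gradient[OF truncated_bounded_environment[OF \<epsilon>]])

lemma approx_nonneg: "AE \<omega> in M. 0 \<le> approx \<epsilon> N \<omega>"
  unfolding approx_def
  by (rule bounded_environment.gradient_nonneg[OF truncated_bounded_environment[OF \<epsilon>]])

lemma integrable_approx_energy: "integrable M (\<lambda>\<omega>. trunc N 0 0 \<omega> * (approx \<epsilon> N \<omega>)\<^sup>2)"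
proof -
  obtain C where C: "\<And>\<omega>. \<omega> \<in> space M \<Longrightarrow> \<bar>approx \<epsilon> N \<omega>\<bar> \<le> C" using approx_bounded by blast
  show ?thesis
  proof (rule bounded_environment.integrable_conductance_times[OF truncated_bounded_environment[OF \<epsilon>]])
    fix \<omega> assume "\<omega> \<in> space M"
    from C[OF this] show "\<bar>(approx \<epsilon> N \<omega>)\<^sup>2\<bar> \<le> C\<^sup>2"
      by (simp add: abs_le_square_iff[symmetric])
  qed measurable
qed

lemma integrable_trunc: "integrable M (trunc N 0 0)"
  using integrable_b by (intro integrable_min) auto

lemma integral_trunc_le: "(LINT \<omega>|M. trunc N 0 0 \<omega>) \<le> (LINT \<omega>|M. b 0 0 \<omega>)"
  by (rule integral_mono[OF integrable_trunc integrable_b]) simp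

lemma approx_energy: "(LINT \<omega>|M. trunc N 0 0 \<omega> * (approx \<epsilon> N \<omega>)\<^sup>2) \<le> (LINT \<omega>|M. b 0 0 \<omega>)"
proof (rule order_trans[OF _ integral_trunc_le])
  show "(LINT \<omega>|M. trunc N 0 0 \<omega> * (approx \<epsilon> N \<omega>)\<^sup>2) \<le> (LINT \<omega>|M. trunc N 0 0 \<omega>)"
    unfolding approx_def
    by (rule bounded_environment.gradient_energy[OF truncated_bounded_environment[OF \<epsilon>]])
qed

text \<open>
  The bound by the gradient holds for every truncation and involves one fixed iterate of the truncated kernel, which
  converges to the iterate of the original kernel.
\<close>

lemma partial_column_sum_le_liminf:
  "AE \<omega> in M. \<forall>n S. 0 \<le> S \<longrightarrow> ennreal (LINT r:{0..S}|lborel. \<epsilon> * exp (- \<epsilon> * r) *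
      (\<Sum>x\<in>{- int (Suc n)..int (Suc n)}. dual_kernel_n b n r x 0 0 \<omega>)) \<le> liminf (\<lambda>N. ennreal (approx \<epsilon> N \<omega>))"
proof -
  have "AE \<omega> in M. \<forall>N n. \<forall>S\<ge>0. (LINT r:{0..S}|lborel. \<epsilon> * exp (- \<epsilon> * r) *
      (\<Sum>x\<in>{- int (Suc n)..int (Suc n)}. dual_kernel_n (trunc N) n r x 0 0 \<omega>)) \<le> approx \<epsilon> N \<omega>"
    unfolding AE_all_countable approx_def
    using bounded_environment.column_sum_le_gradient[OF truncated_bounded_environment[OF \<epsilon>]]
    by (auto simp: AE_all_countable)
  then show ?thesis
  proof (rule AE_mp, intro AE_I2 impI allI)
    fix \<omega> n and S :: real
    assume \<omega>: "\<omega> \<in> space M" and S: "0 \<le> S"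
      and le: "\<forall>N n. \<forall>S\<ge>0. (LINT r:{0..S}|lborel. \<epsilon> * exp (- \<epsilon> * r) *
      (\<Sum>x\<in>{- int (Suc n)..int (Suc n)}. dual_kernel_n (trunc N) n r x 0 0 \<omega>)) \<le> approx \<epsilon> N \<omega>"
    interpret conductance_path b \<omega> by (rule path[OF \<omega>])
    interpret t: conductance_path "trunc N" \<omega> for N by (rule truncation_path) simp
    let ?I = "{- int (Suc n)..int (Suc n)}"
    have lim: "(\<lambda>N. LINT r:{0..S}|lborel. \<epsilon> * exp (- \<epsilon> * r) * (\<Sum>x\<in>?I. dual_kernel_n (trunc N) n r x 0 0 \<omega>))
       \<longlonglongrightarrow> (LINT r:{0..S}|lborel. \<epsilon> * exp (- \<epsilon> * r) * (\<Sum>x\<in>?I. dual_kernel_n b n r x 0 0 \<omega>))"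
    proof (rule set_integral_dominated_convergence(2)[OF set_integrable_const_Icc])
      fix N
      have "set_integrable lborel {0..S} (\<lambda>r. 1 * (\<epsilon> * exp (- \<epsilon> * r) * (\<Sum>x\<in>?I. dual_kernel_n (trunc N) n r x 0 0 \<omega>)))"
        by (intro set_integrable_times_continuous set_integrable_const_Icc continuous_intros t.Kn_continuous)
      then show "set_integrable lborel {0..S} (\<lambda>r. \<epsilon> * exp (- \<epsilon> * r) * (\<Sum>x\<in>?I. dual_kernel_n (trunc N) n r x 0 0 \<omega>))"
        by simp
      fix r assume r: "r \<in> {0..S}"
      have s: "0 \<le> (\<Sum>x\<in>?I. dual_kernel_n (trunc N) n r x 0 0 \<omega>)" "(\<Sum>x\<in>?I. dual_kernel_n (trunc N) n r x 0 0 \<omega>) \<le> (\<Sum>x\<in>?I. 1)"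
        using r by (intro sum_nonneg sum_mono t.Kn_nonneg t.Kn_le_1; simp)+
      have e: "\<epsilon> * exp (- \<epsilon> * r) \<le> \<epsilon>" "0 \<le> \<epsilon> * exp (- \<epsilon> * r)" using r \<epsilon> by (auto simp: mult_le_cancel_left1)
      have "\<epsilon> * exp (- \<epsilon> * r) * (\<Sum>x\<in>?I. dual_kernel_n (trunc N) n r x 0 0 \<omega>) \<le> \<epsilon> * (\<Sum>x\<in>?I. 1)"
        by (rule mult_mono[OF e(1) s(2) _ s(1)]) (use \<epsilon> in simp)
      moreover have "0 \<le> \<epsilon> * exp (- \<epsilon> * r) * (\<Sum>x\<in>?I. dual_kernel_n (trunc N) n r x 0 0 \<omega>)"
        by (rule mult_nonneg_nonneg[OF e(2) s(1)])
      ultimately show "\<bar>\<epsilon> * exp (- \<epsilon> * r) * (\<Sum>x\<in>?I. dual_kernel_n (trunc N) n r x 0 0 \<omega>)\<bar> \<le> \<epsilon> * (\<Sum>x\<in>?I. 1)"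
        by (simp only: abs_of_nonneg)
    next
      fix r assume "r \<in> {0..S}"
      then show "(\<lambda>N. \<epsilon> * exp (- \<epsilon> * r) * (\<Sum>x\<in>?I. dual_kernel_n (trunc N) n r x 0 0 \<omega>)) \<longlonglongrightarrow> \<epsilon> * exp (- \<epsilon> * r) * (\<Sum>x\<in>?I. dual_kernel_n b n r x 0 0 \<omega>)"
        by (intro tendsto_intros Kn_truncation_limit) auto
    qed
    have "ennreal (LINT r:{0..S}|lborel. \<epsilon> * exp (- \<epsilon> * r) * (\<Sum>x\<in>?I. dual_kernel_n b n r x 0 0 \<omega>))
       = liminf (\<lambda>N. ennreal (LINT r:{0..S}|lborel. \<epsilon> * exp (- \<epsilon> * r) * (\<Sum>x\<in>?I. dual_kernel_n (trunc N) n r x 0 0 \<omega>)))"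
      by (rule lim_imp_Liminf[symmetric, OF _ tendsto_ennrealI[OF lim]]) simp
    also have "\<dots> \<le> liminf (\<lambda>N. ennreal (approx \<epsilon> N \<omega>))"
      by (rule Liminf_mono, rule always_eventually, intro allI ennreal_leI, rule le[rule_format, OF S])
    finally show "ennreal (LINT r:{0..S}|lborel. \<epsilon> * exp (- \<epsilon> * r) * (\<Sum>x\<in>?I. dual_kernel_n b n r x 0 0 \<omega>)) \<le> liminf (\<lambda>N. ennreal (approx \<epsilon> N \<omega>))" .
  qed
qed

text \<open>
  The iterates increase and their supports grow, so one sequence of finite sums over growing boxes and growing time
  intervals exhausts \<open>resolvent_density\<close>.
\<close>

lemma resolvent_density_eq_SUP:
  assumes \<omega>: "\<omega> \<in> space M"
  shows "resolvent_density \<epsilon> \<omega> = (SUP n::nat. ennreal (LINT r:{0..real n}|lborel. \<epsilon> * exp (- \<epsilon> * r) *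
      (\<Sum>x\<in>{- int (Suc n)..int (Suc n)}. dual_kernel_n b n r x 0 0 \<omega>)))"
proof -
  interpret conductance_path b \<omega> by (rule path[OF \<omega>])
  define s where "s n r = (\<Sum>x\<in>{- int (Suc n)..int (Suc n)}. dual_kernel_n b n r x 0 0 \<omega>)" for n r
  have s0: "0 \<le> s n r" if "0 \<le> r" for n r
    unfolding s_def by (intro sum_nonneg Kn_nonneg that)
  have s_mono: "s m r \<le> s n r" if "0 \<le> r" "m \<le> n" for m n r
  proof -
    have "s m r \<le> (\<Sum>x\<in>{- int (Suc m)..int (Suc m)}. dual_kernel_n b n r x 0 0 \<omega>)"
      unfolding s_def by (intro sum_mono Kn_mono that)
    also have "\<dots> \<le> s n r"
      unfolding s_def by (intro sum_mono2) (use that in \<open>auto intro: Kn_nonneg\<close>)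
    finally show ?thesis .
  qed
  define F where "F n r = ennreal (\<epsilon> * exp (- \<epsilon> * r) * s n r) * indicator {0..real n} r" for n r
  have cont: "continuous_on {0..real n} (\<lambda>r. \<epsilon> * exp (- \<epsilon> * r) * s n r)" for n
    unfolding s_def by (intro continuous_intros Kn_continuous)
  have int: "set_integrable lborel {0..real n} (\<lambda>r. \<epsilon> * exp (- \<epsilon> * r) * s n r)" for n
    using set_integrable_times_continuous[OF set_integrable_const_Icc[of _ _ 1] cont[of n]] by (simp only: mult_1)
  have Fm: "F n \<in> borel_measurable lborel" for n
  proof -
    have "(\<lambda>r. ennreal (indicator {0..real n} r *\<^sub>R (\<epsilon> * exp (- \<epsilon> * r) * s n r))) \<in> borel_measurable lborel"
      using int[of n] by (auto simp: set_integrable_def)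
    also have "(\<lambda>r. ennreal (indicator {0..real n} r *\<^sub>R (\<epsilon> * exp (- \<epsilon> * r) * s n r))) = F n"
      by (auto simp: F_def indicator_def fun_eq_iff)
    finally show ?thesis .
  qed
  have Fint: "(\<integral>\<^sup>+r. F n r \<partial>lborel) = ennreal (LINT r:{0..real n}|lborel. \<epsilon> * exp (- \<epsilon> * r) * s n r)" for n
  proof -
    have "(\<integral>\<^sup>+r. F n r \<partial>lborel) = (\<integral>\<^sup>+r. ennreal (indicator {0..real n} r *\<^sub>R (\<epsilon> * exp (- \<epsilon> * r) * s n r)) \<partial>lborel)"
      by (rule nn_integral_cong) (auto simp: F_def indicator_def)
    also have "\<dots> = ennreal (LINT r:{0..real n}|lborel. \<epsilon> * exp (- \<epsilon> * r) * s n r)"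
      unfolding set_lebesgue_integral_def
      by (rule nn_integral_eq_integral[OF int[unfolded set_integrable_def]])
         (use \<epsilon> s0 in \<open>auto simp: indicator_def\<close>)
    finally show ?thesis .
  qed
  have Finc: "incseq F"
    unfolding incseq_def le_fun_def F_def
    using s_mono \<epsilon> by (auto simp: indicator_def intro!: ennreal_leI mult_left_mono)
  have SUPs: "(SUP n. F n r) = ennreal \<epsilon> * (ennreal (exp (- \<epsilon> * r)) * (\<integral>\<^sup>+x. ennreal (K r x 0 0) \<partial>count_space UNIV) * indicator {0..} r)" for r
  proof (cases "0 \<le> r")
    case True
    have e: "ennreal (s n r) = (\<Sum>x\<in>{- int (Suc n)..int (Suc n)}. ennreal (dual_kernel_n b n r x 0 0 \<omega>))" for n
      unfolding s_def by (rule sum_ennreal[symmetric]) (rule Kn_nonneg[OF True])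
    have "(SUP n. ennreal (s n r) * indicator {0..real n} r) = (SUP m::nat. \<Sum>x\<in>{- int m..int m}. ennreal (K r x 0 0))"
    proof (rule antisym; rule SUP_least)
      fix n :: nat
      have "ennreal (s n r) * indicator {0..real n} r \<le> ennreal (s n r)" by (auto simp: indicator_def)
      also have "\<dots> \<le> (\<Sum>x\<in>{- int (Suc n)..int (Suc n)}. ennreal (K r x 0 0))"
        unfolding e by (intro sum_mono ennreal_leI Kn_le_K True)
      also have "\<dots> \<le> (SUP m::nat. \<Sum>x\<in>{- int m..int m}. ennreal (K r x 0 0))"
        by (rule SUP_upper2[of "Suc n"]) auto
      finally show "ennreal (s n r) * indicator {0..real n} r \<le> \<dots>" .
    next
      fix m :: nat
      have "(\<lambda>n. \<Sum>x\<in>{- int m..int m}. ennreal (dual_kernel_n b n r x 0 0 \<omega>)) \<longlonglongrightarrow> (\<Sum>x\<in>{- int m..int m}. ennreal (K r x 0 0))"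
        by (intro tendsto_sum tendsto_ennrealI Kn_tendsto_K True)
      then show "(\<Sum>x\<in>{- int m..int m}. ennreal (K r x 0 0)) \<le> (SUP n. ennreal (s n r) * indicator {0..real n} r)"
      proof (rule LIMSEQ_le_const2, intro exI allI impI)
        fix n assume n: "max m (nat \<lceil>r\<rceil>) \<le> n"
        have "(\<Sum>x\<in>{- int m..int m}. ennreal (dual_kernel_n b n r x 0 0 \<omega>)) \<le> ennreal (s n r)"
          unfolding e by (intro sum_mono2) (use n in auto)
        also have "\<dots> = ennreal (s n r) * indicator {0..real n} r"
          using n True by (auto simp: indicator_def)
        also have "\<dots> \<le> (SUP n. ennreal (s n r) * indicator {0..real n} r)"
          by (rule SUP_upper) simp
        finally show "(\<Sum>x\<in>{- int m..int m}. ennreal (dual_kernel_n b n r x 0 0 \<omega>)) \<le> \<dots>" .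
      qed
    qed
    moreover have "(SUP n. F n r) = ennreal (\<epsilon> * exp (- \<epsilon> * r)) * (SUP n. ennreal (s n r) * indicator {0..real n} r)"
      unfolding F_def using \<epsilon> s0[OF True] by (subst SUP_mult_left_ennreal) (simp add: ennreal_mult' mult.assoc)
    ultimately show ?thesis
      using True \<epsilon> by (simp add: nn_integral_int_SUP ennreal_mult' mult.assoc)
  qed (auto simp: F_def indicator_def)
  have "resolvent_density \<epsilon> \<omega> = (\<integral>\<^sup>+r. ennreal \<epsilon> * (ennreal (exp (- \<epsilon> * r)) * (\<integral>\<^sup>+x. ennreal (K r x 0 0) \<partial>count_space UNIV) * indicator {0..} r) \<partial>lborel)"
    unfolding resolvent_density_def
  proof (rule nn_integral_cmult[symmetric])
    have [measurable]: "(\<lambda>r. dual_kernel b r x 0 0 \<omega>) \<in> borel_measurable borel" for x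
      by (rule measurable_dual_kernel_raw) (use \<omega> in auto)
    show "(\<lambda>r. ennreal (exp (- \<epsilon> * r)) * (\<integral>\<^sup>+x. ennreal (K r x 0 0) \<partial>count_space UNIV) * indicator {0..} r) \<in> borel_measurable lborel"
      by measurable
  qed
  also have "\<dots> = (\<integral>\<^sup>+r. (SUP n. F n r) \<partial>lborel)"
    unfolding SUPs ..
  also have "\<dots> = (SUP n. \<integral>\<^sup>+r. F n r \<partial>lborel)"
    by (rule nn_integral_monotone_convergence_SUP[OF Finc Fm])
  finally show ?thesis unfolding Fint s_def .
qed

lemma varphi_eps_le_liminf: "AE \<omega> in M. ennreal (varphi_eps b \<epsilon> \<omega>) \<le> liminf (\<lambda>N. ennreal (approx \<epsilon> N \<omega>))"
  using partial_column_sum_le_liminf resolvent_density_AE[OF \<epsilon>] AE_space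
proof eventually_elim
  case (elim \<omega>)
  show ?case unfolding elim(2) resolvent_density_eq_SUP[OF elim(3)]
    by (rule SUP_least) (use elim(1) in simp)
qed

lemma eventually_approx_gt:
  "AE \<omega> in M. \<forall>y<varphi_eps b \<epsilon> \<omega>. eventually (\<lambda>N. y < approx \<epsilon> N \<omega>) sequentially"
proof -
  have "AE \<omega> in M. \<forall>N. 0 \<le> approx \<epsilon> N \<omega>" unfolding AE_all_countable by (intro allI approx_nonneg)
  with varphi_eps_le_liminf show ?thesis
  proof eventually_elim
    case (elim \<omega>)
    show ?case
    proof (intro allI impI)
      fix y assume y: "y < varphi_eps b \<epsilon> \<omega>"
      show "eventually (\<lambda>N. y < approx \<epsilon> N \<omega>) sequentially"
      proof (cases "0 \<le> y")
        case True
        then have "ennreal y < ennreal (varphi_eps b \<epsilon> \<omega>)" using y by (simp add: ennreal_less_iff)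
        also have "\<dots> \<le> liminf (\<lambda>N. ennreal (approx \<epsilon> N \<omega>))" by (rule elim(1))
        finally have "eventually (\<lambda>N. ennreal y < ennreal (approx \<epsilon> N \<omega>)) sequentially"
          by (rule less_LiminfD)
        then show ?thesis by eventually_elim (use True in \<open>simp add: ennreal_less_iff\<close>)
      next
        case False
        then have "y < approx \<epsilon> N \<omega>" for N using elim(2) by (meson not_le order.strict_trans2)
        then show ?thesis by simp
      qed
    qed
  qed
qed

text \<open>
  The positive part of \<open>varphi_eps - approx\<close> tends to 0 by dominated convergence. Since both functions
  have expectation 1, the negative part has the same expectation as the positive part.
\<close>

lemma approx_tendsto_L1: "(\<lambda>N. LINT \<omega>|M. \<bar>approx \<epsilon> N \<omega> - varphi_eps b \<epsilon> \<omega>\<bar>) \<longlonglongrightarrow> 0"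
proof -
  note \<phi> = integral_varphi_eps[OF \<epsilon>]
  have "(\<lambda>N. LINT \<omega>|M. max 0 (varphi_eps b \<epsilon> \<omega> - approx \<epsilon> N \<omega>)) \<longlonglongrightarrow> (LINT \<omega>|M. 0)"
  proof (rule integral_dominated_convergence[where w = "varphi_eps b \<epsilon>"])
    show "AE \<omega> in M. (\<lambda>N. max 0 (varphi_eps b \<epsilon> \<omega> - approx \<epsilon> N \<omega>)) \<longlonglongrightarrow> 0"
      using eventually_approx_gt
    proof eventually_elim
      case (elim \<omega>)
      show ?case
      proof (rule tendstoI)
        fix e :: real assume "0 < e"
        then have "eventually (\<lambda>N. varphi_eps b \<epsilon> \<omega> - e < approx \<epsilon> N \<omega>) sequentially" using elim by simp
        then show "eventually (\<lambda>N. dist (max 0 (varphi_eps b \<epsilon> \<omega> - approx \<epsilon> N \<omega>)) 0 < e) sequentially"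
          by eventually_elim (use \<open>0 < e\<close> in \<open>auto simp: max_def\<close>)
      qed
    qed
    show "AE \<omega> in M. norm (max 0 (varphi_eps b \<epsilon> \<omega> - approx \<epsilon> N \<omega>)) \<le> varphi_eps b \<epsilon> \<omega>" for N
      using approx_nonneg[of N] by eventually_elim (use varphi_eps_nonneg in \<open>auto simp: max_def\<close>)
  qed (use \<phi> in auto)
  then have "(\<lambda>N. 2 * (LINT \<omega>|M. max 0 (varphi_eps b \<epsilon> \<omega> - approx \<epsilon> N \<omega>))) \<longlonglongrightarrow> 2 * 0"
    by (intro tendsto_intros) simp
  moreover have "(LINT \<omega>|M. \<bar>approx \<epsilon> N \<omega> - varphi_eps b \<epsilon> \<omega>\<bar>) = 2 * (LINT \<omega>|M. max 0 (varphi_eps b \<epsilon> \<omega> - approx \<epsilon> N \<omega>))" for N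
  proof -
    have i: "integrable M (\<lambda>\<omega>. max 0 (varphi_eps b \<epsilon> \<omega> - approx \<epsilon> N \<omega>))"
      using \<phi>(1) integrable_approx[of N] by (intro integrable_max) auto
    have "(LINT \<omega>|M. \<bar>approx \<epsilon> N \<omega> - varphi_eps b \<epsilon> \<omega>\<bar>) = (LINT \<omega>|M. 2 * max 0 (varphi_eps b \<epsilon> \<omega> - approx \<epsilon> N \<omega>) + (approx \<epsilon> N \<omega> - varphi_eps b \<epsilon> \<omega>))"
      by (rule Bochner_Integration.integral_cong) (auto simp: max_def)
    also have "\<dots> = 2 * (LINT \<omega>|M. max 0 (varphi_eps b \<epsilon> \<omega> - approx \<epsilon> N \<omega>)) + (1 - 1)"
      using i \<phi> integrable_approx[of N] integral_approx[of N] by simp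
    finally show ?thesis by simp
  qed
  ultimately show ?thesis by simp
qed

text \<open>
  Fatou's lemma applied to the uniform energy bound for the truncated environments.
\<close>

lemma varphi_eps_energy:
  shows "integrable M (\<lambda>\<omega>. b 0 0 \<omega> * (varphi_eps b \<epsilon> \<omega>)\<^sup>2)"
    and "(LINT \<omega>|M. b 0 0 \<omega> * (varphi_eps b \<epsilon> \<omega>)\<^sup>2) \<le> (LINT \<omega>|M. b 0 0 \<omega>)"
proof -
  let ?\<phi> = "varphi_eps b \<epsilon>"
  have le: "AE \<omega> in M. ennreal (b 0 0 \<omega> * (?\<phi> \<omega>)\<^sup>2) \<le> liminf (\<lambda>N. ennreal (trunc N 0 0 \<omega> * (approx \<epsilon> N \<omega>)\<^sup>2))"
    using eventually_approx_gt AE_space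
  proof eventually_elim
    case (elim \<omega>)
    show ?case
    proof (cases "?\<phi> \<omega> = 0")
      case False
      then have pos: "0 < ?\<phi> \<omega>" using varphi_eps_nonneg[of \<epsilon> \<omega>] by simp
      have step: "ennreal (b 0 0 \<omega> * y\<^sup>2) \<le> liminf (\<lambda>N. ennreal (trunc N 0 0 \<omega> * (approx \<epsilon> N \<omega>)\<^sup>2))" if y: "0 \<le> y" "y < ?\<phi> \<omega>" for y
      proof (rule Liminf_bounded)
        obtain k where k: "b 0 0 \<omega> \<le> real k" using real_arch_simple by blast
        have "eventually (\<lambda>N. y < approx \<epsilon> N \<omega>) sequentially" using elim(1) y by blast
        then show "eventually (\<lambda>N. ennreal (b 0 0 \<omega> * y\<^sup>2) \<le> ennreal (trunc N 0 0 \<omega> * (approx \<epsilon> N \<omega>)\<^sup>2)) sequentially"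
          using eventually_ge_at_top[of k]
        proof eventually_elim
          case (elim N)
          then have "trunc N 0 0 \<omega> = b 0 0 \<omega>" using k by auto
          then show ?case
            using elim y b_pos(2)[OF \<open>\<omega> \<in> space M\<close>] by (auto intro!: ennreal_leI mult_left_mono power_mono)
        qed
      qed
      have lim: "(\<lambda>n. ennreal (b 0 0 \<omega> * (?\<phi> \<omega> * (1 - 1 / real (Suc n)))\<^sup>2)) \<longlonglongrightarrow> ennreal (b 0 0 \<omega> * (?\<phi> \<omega> * (1 - 0))\<^sup>2)"
        by (intro tendsto_ennrealI tendsto_intros LIMSEQ_Suc[OF lim_const_over_n])
      have "ennreal (b 0 0 \<omega> * (?\<phi> \<omega> * (1 - 0))\<^sup>2) \<le> liminf (\<lambda>N. ennreal (trunc N 0 0 \<omega> * (approx \<epsilon> N \<omega>)\<^sup>2))"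
      proof (rule LIMSEQ_le_const2[OF lim], intro exI allI impI)
        fix n :: nat
        have "0 \<le> ?\<phi> \<omega> * (1 - 1 / real (Suc n))" using pos by simp
        moreover have "?\<phi> \<omega> * (1 - 1 / real (Suc n)) < ?\<phi> \<omega>" using pos by (simp add: mult_less_cancel_left2)
        ultimately show "ennreal (b 0 0 \<omega> * (?\<phi> \<omega> * (1 - 1 / real (Suc n)))\<^sup>2) \<le> liminf (\<lambda>N. ennreal (trunc N 0 0 \<omega> * (approx \<epsilon> N \<omega>)\<^sup>2))"
          by (rule step)
      qed
      then show ?thesis by simp
    qed simp
  qed
  have nn: "AE \<omega> in M. 0 \<le> b 0 0 \<omega> * (?\<phi> \<omega>)\<^sup>2"
    using b_pos(2) by (intro AE_I2) simp
  have "(\<integral>\<^sup>+\<omega>. ennreal (b 0 0 \<omega> * (?\<phi> \<omega>)\<^sup>2) \<partial>M) \<le> (\<integral>\<^sup>+\<omega>. liminf (\<lambda>N. ennreal (trunc N 0 0 \<omega> * (approx \<epsilon> N \<omega>)\<^sup>2)) \<partial>M)"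
    by (rule nn_integral_mono_AE[OF le])
  also have "\<dots> \<le> liminf (\<lambda>N. \<integral>\<^sup>+\<omega>. ennreal (trunc N 0 0 \<omega> * (approx \<epsilon> N \<omega>)\<^sup>2) \<partial>M)"
    by (rule nn_integral_liminf) measurable
  also have "\<dots> \<le> liminf (\<lambda>N. ennreal (LINT \<omega>|M. b 0 0 \<omega>))"
  proof (rule Liminf_mono, rule always_eventually, rule allI)
    fix N
    have "(\<integral>\<^sup>+\<omega>. ennreal (trunc N 0 0 \<omega> * (approx \<epsilon> N \<omega>)\<^sup>2) \<partial>M) = ennreal (LINT \<omega>|M. trunc N 0 0 \<omega> * (approx \<epsilon> N \<omega>)\<^sup>2)"
      by (rule nn_integral_eq_integral[OF integrable_approx_energy]) (use b_pos(2) in \<open>auto intro!: AE_I2\<close>)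
    then show "(\<integral>\<^sup>+\<omega>. ennreal (trunc N 0 0 \<omega> * (approx \<epsilon> N \<omega>)\<^sup>2) \<partial>M) \<le> ennreal (LINT \<omega>|M. b 0 0 \<omega>)"
      using approx_energy[of N] by (simp add: ennreal_leI)
  qed
  also have "\<dots> = ennreal (LINT \<omega>|M. b 0 0 \<omega>)" by (simp add: Liminf_const)
  finally have fin: "(\<integral>\<^sup>+\<omega>. ennreal (b 0 0 \<omega> * (?\<phi> \<omega>)\<^sup>2) \<partial>M) \<le> ennreal (LINT \<omega>|M. b 0 0 \<omega>)" .
  show int: "integrable M (\<lambda>\<omega>. b 0 0 \<omega> * (?\<phi> \<omega>)\<^sup>2)"
    by (rule integrableI_nonneg[OF _ nn]) (use fin in \<open>auto intro: le_less_trans\<close>)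
  have "0 \<le> (LINT \<omega>|M. b 0 0 \<omega>)" by (rule integral_nonneg_AE) (use b_pos(2) in \<open>auto intro!: AE_I2\<close>)
  then show "(LINT \<omega>|M. b 0 0 \<omega> * (?\<phi> \<omega>)\<^sup>2) \<le> (LINT \<omega>|M. b 0 0 \<omega>)"
    using fin unfolding nn_integral_eq_integral[OF int nn] by (simp add: ennreal_le_iff)
qed

end

end

section \<open>Weak compactness in the energy space\<close>

text \<open>
  The discriminant of a quadratic polynomial that is bounded from below; it serves for the Cauchy-Schwarz inequality
  and for almost minimal distances in the proof of weak compactness.
\<close>

lemma square_le_of_quadratic_bound:
  fixes B V e :: real
  assumes V: "0 \<le> V" and le: "\<And>s. 2 * s * B \<le> e + s\<^sup>2 * V"
  shows "B\<^sup>2 \<le> e * V"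
proof (cases "V = 0")
  case True
  have "B = 0"
  proof (rule ccontr)
    assume "B \<noteq> 0"
    then have "2 * ((e + 1) / (2 * B)) * B = e + 1" by simp
    then show False using le[of "(e + 1) / (2 * B)"] True by simp
  qed
  then show ?thesis using True by simp
next
  case False
  then have V: "0 < V" using V by simp
  have "2 * (B / V) * B \<le> e + (B / V)\<^sup>2 * V" by (rule le)
  then have "2 * (B\<^sup>2 / V) \<le> e + B\<^sup>2 / V" using V by (simp add: power2_eq_square)
  then have "B\<^sup>2 / V \<le> e" by simp
  then show ?thesis using V by (simp add: divide_le_eq)
qed

context integrable_environment
begin

lemma b_nonzero: "\<omega> \<in> space M \<Longrightarrow> b 0 0 \<omega> \<noteq> 0"
  using b_pos(1)[of \<omega>] by simp

text \<open>
  Densities are paired with test functions \<open>f\<close> of \<open>H_space M b\<close>, and \<open>f \<mapsto> f /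
  b\<close> maps these isometrically into the space of functions with \<open>E (b * u\<^sup>2) < \<infinity>\<close>.
  Everything Hilbertian is done in the latter.
\<close>

definition energy_space :: "('a \<Rightarrow> real) set" where
  "energy_space = {u \<in> borel_measurable M. integrable M (\<lambda>\<omega>. b 0 0 \<omega> * (u \<omega>)\<^sup>2)}"

definition energy_inner :: "('a \<Rightarrow> real) \<Rightarrow> ('a \<Rightarrow> real) \<Rightarrow> real" where
  "energy_inner u v = (LINT \<omega>|M. b 0 0 \<omega> * (u \<omega> * v \<omega>))"

lemma energy_space_measurable: "u \<in> energy_space \<Longrightarrow> u \<in> borel_measurable M"
  by (simp add: energy_space_def)

lemma integrable_energy_inner:
  assumes "u \<in> energy_space" "v \<in> energy_space"
  shows "integrable M (\<lambda>\<omega>. b 0 0 \<omega> * (u \<omega> * v \<omega>))"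
proof (rule Bochner_Integration.integrable_bound)
  note [measurable] = energy_space_measurable[OF assms(1)] energy_space_measurable[OF assms(2)]
  show "(\<lambda>\<omega>. b 0 0 \<omega> * (u \<omega> * v \<omega>)) \<in> borel_measurable M" by measurable
  show "integrable M (\<lambda>\<omega>. b 0 0 \<omega> * (u \<omega>)\<^sup>2 + b 0 0 \<omega> * (v \<omega>)\<^sup>2)"
    using assms by (auto simp: energy_space_def)
  show "AE \<omega> in M. norm (b 0 0 \<omega> * (u \<omega> * v \<omega>)) \<le> norm (b 0 0 \<omega> * (u \<omega>)\<^sup>2 + b 0 0 \<omega> * (v \<omega>)\<^sup>2)"
  proof (rule AE_I2)
    fix \<omega> assume "\<omega> \<in> space M"
    note b = b_pos(2)[OF this]
    have "2 * (\<bar>u \<omega>\<bar> * \<bar>v \<omega>\<bar>) \<le> (u \<omega>)\<^sup>2 + (v \<omega>)\<^sup>2"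
      using sum_squares_bound[of "\<bar>u \<omega>\<bar>" "\<bar>v \<omega>\<bar>"] by simp
    then have "\<bar>u \<omega>\<bar> * \<bar>v \<omega>\<bar> \<le> (u \<omega>)\<^sup>2 + (v \<omega>)\<^sup>2"
      using mult_nonneg_nonneg[OF abs_ge_zero abs_ge_zero, of "u \<omega>" "v \<omega>"] by linarith
    then have "b 0 0 \<omega> * (\<bar>u \<omega>\<bar> * \<bar>v \<omega>\<bar>) \<le> b 0 0 \<omega> * ((u \<omega>)\<^sup>2 + (v \<omega>)\<^sup>2)"
      by (rule mult_left_mono[OF _ b])
    then show "norm (b 0 0 \<omega> * (u \<omega> * v \<omega>)) \<le> norm (b 0 0 \<omega> * (u \<omega>)\<^sup>2 + b 0 0 \<omega> * (v \<omega>)\<^sup>2)"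
      using b by (simp add: abs_mult distrib_left)
  qed
qed

lemma energy_inner_commute: "energy_inner u v = energy_inner v u"
  by (simp add: energy_inner_def mult.commute)

lemma energy_space_add_scaled:
  assumes "u \<in> energy_space" "v \<in> energy_space"
  shows "(\<lambda>\<omega>. u \<omega> + s * v \<omega>) \<in> energy_space"
proof -
  note [measurable] = energy_space_measurable[OF assms(1)] energy_space_measurable[OF assms(2)]
  have "integrable M (\<lambda>\<omega>. b 0 0 \<omega> * (u \<omega> * u \<omega>) + 2 * s * (b 0 0 \<omega> * (u \<omega> * v \<omega>)) + s\<^sup>2 * (b 0 0 \<omega> * (v \<omega> * v \<omega>)))"
    using integrable_energy_inner assms by auto
  also have "(\<lambda>\<omega>. b 0 0 \<omega> * (u \<omega> * u \<omega>) + 2 * s * (b 0 0 \<omega> * (u \<omega> * v \<omega>)) + s\<^sup>2 * (b 0 0 \<omega> * (v \<omega> * v \<omega>)))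
     = (\<lambda>\<omega>. b 0 0 \<omega> * (u \<omega> + s * v \<omega>)\<^sup>2)"
    by (auto simp: power2_eq_square algebra_simps)
  finally show ?thesis by (simp add: energy_space_def)
qed

lemma energy_inner_add_scaled_left:
  assumes "u \<in> energy_space" "v \<in> energy_space" "w \<in> energy_space"
  shows "energy_inner (\<lambda>\<omega>. u \<omega> + s * v \<omega>) w = energy_inner u w + s * energy_inner v w"
proof -
  have "energy_inner (\<lambda>\<omega>. u \<omega> + s * v \<omega>) w = (LINT \<omega>|M. b 0 0 \<omega> * (u \<omega> * w \<omega>) + s * (b 0 0 \<omega> * (v \<omega> * w \<omega>)))"
    unfolding energy_inner_def by (rule Bochner_Integration.integral_cong) (auto simp: algebra_simps)
  then show ?thesis using integrable_energy_inner assms by (simp add: energy_inner_def)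
qed

lemma energy_inner_add_scaled_right:
  assumes "u \<in> energy_space" "v \<in> energy_space" "w \<in> energy_space"
  shows "energy_inner w (\<lambda>\<omega>. u \<omega> + s * v \<omega>) = energy_inner w u + s * energy_inner w v"
  using energy_inner_add_scaled_left[OF assms, of s] by (simp add: energy_inner_commute)

lemma energy_inner_nonneg: "0 \<le> energy_inner u u"
  unfolding energy_inner_def by (rule integral_nonneg_AE) (use b_pos(2) in \<open>auto intro!: AE_I2\<close>)

lemma energy_inner_square_expand:
  assumes "u \<in> energy_space" "v \<in> energy_space"
  shows "energy_inner (\<lambda>\<omega>. u \<omega> + s * v \<omega>) (\<lambda>\<omega>. u \<omega> + s * v \<omega>) = energy_inner u u + 2 * s * energy_inner u v + s\<^sup>2 * energy_inner v v"
  using assms by (simp add: energy_inner_add_scaled_left energy_inner_add_scaled_right energy_space_add_scaled energy_inner_commute[of v u]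
      power2_eq_square algebra_simps)

lemma energy_inner_Cauchy_Schwarz:
  assumes "u \<in> energy_space" "v \<in> energy_space"
  shows "\<bar>energy_inner u v\<bar> \<le> sqrt (energy_inner u u) * sqrt (energy_inner v v)"
proof -
  have "(energy_inner u v)\<^sup>2 \<le> energy_inner u u * energy_inner v v"
  proof (rule square_le_of_quadratic_bound[OF energy_inner_nonneg])
    fix s
    show "2 * s * energy_inner u v \<le> energy_inner u u + s\<^sup>2 * energy_inner v v"
      using energy_inner_nonneg[of "\<lambda>\<omega>. u \<omega> + (- s) * v \<omega>"] energy_inner_square_expand[OF assms, of "- s"] by simp
  qed
  then have "sqrt ((energy_inner u v)\<^sup>2) \<le> sqrt (energy_inner u u * energy_inner v v)" by (rule real_sqrt_le_mono)
  then show ?thesis by (simp add: real_sqrt_mult)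
qed

text \<open>
  A diagonal argument makes the inner products with all members of the sequence converge. The vectors \<open>u\<close>
  for which the inner products converge then form a subspace \<open>S\<close> that contains the sequence. For
  arbitrary \<open>F\<close>, a vector \<open>u\<close> of \<open>S\<close> that almost minimizes the distance to
  \<open>F\<close> leaves a remainder that is almost orthogonal to the whole sequence, so the inner products with
  \<open>F\<close> form a Cauchy sequence.
\<close>

lemma weakly_convergent_subsequence:
  assumes g: "\<And>k::nat. g k \<in> energy_space" and m: "\<And>k. energy_inner (g k) (g k) \<le> m"
  shows "\<exists>r. strict_mono r \<and> (\<forall>F\<in>energy_space. convergent (\<lambda>k. energy_inner (g (r k)) F))"
proof -
  have bound: "\<bar>energy_inner (g k) F\<bar> \<le> sqrt m * sqrt (energy_inner F F)" if "F \<in> energy_space" for k F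
    using energy_inner_Cauchy_Schwarz[OF g that, of k] mult_right_mono[OF real_sqrt_le_mono[OF m, of k], of "sqrt (energy_inner F F)"] energy_inner_nonneg[of F]
    by simp
  define P where "P n s \<longleftrightarrow> convergent (\<lambda>k. energy_inner (g (s k)) (g n))" for n :: nat and s :: "nat \<Rightarrow> nat"
  interpret subseqs P
  proof
    fix n s assume "strict_mono (s :: nat \<Rightarrow> nat)"
    have "bounded (range (\<lambda>k. energy_inner (g (s k)) (g n)))"
      unfolding bounded_iff using bound[OF g] by auto
    then obtain l r where "strict_mono r" "((\<lambda>k. energy_inner (g (s k)) (g n)) \<circ> r) \<longlonglongrightarrow> l"
      using bounded_imp_convergent_subsequence by blast
    then show "\<exists>r'. strict_mono r' \<and> P n (s \<circ> r')"
      unfolding P_def convergent_def by (auto simp: o_def)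
  qed
  define r where "r = diagseq"
  have r: "strict_mono r" unfolding r_def by (rule subseq_diagseq)
  have conv: "convergent (\<lambda>k. energy_inner (g (r k)) (g n))" for n
  proof -
    have "P n (diagseq \<circ> ((+) (Suc n)))"
    proof (rule diagseq_holds)
      fix r s n assume "strict_mono (r :: nat \<Rightarrow> nat)" "P n s"
      then show "P n (s \<circ> r)"
        unfolding P_def using convergent_subseq_convergent by (auto simp: o_def)
    qed
    then have "convergent (\<lambda>k. energy_inner (g (r (k + Suc n))) (g n))" by (simp add: P_def r_def o_def add.commute)
    then show ?thesis by (rule convergent_ignore_initial_segment[THEN iffD1])
  qed
  define S where "S = {u \<in> energy_space. convergent (\<lambda>k. energy_inner (g (r k)) u)}"
  have Sg: "g n \<in> S" for n using g conv by (simp add: S_def)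
  have Sadd: "(\<lambda>\<omega>. u \<omega> + s * v \<omega>) \<in> S" if "u \<in> S" "v \<in> S" for u v s
    using that by (auto simp: S_def energy_inner_add_scaled_right g energy_space_add_scaled intro!: convergent_add convergent_mult convergent_const)
  have "convergent (\<lambda>k. energy_inner (g (r k)) F)" if F: "F \<in> energy_space" for F
  proof -
    define D where "D u = energy_inner (\<lambda>\<omega>. F \<omega> + (- 1) * u \<omega>) (\<lambda>\<omega>. F \<omega> + (- 1) * u \<omega>)" for u
    have D0: "0 \<le> D u" for u unfolding D_def by (rule energy_inner_nonneg)
    have bdd: "bdd_below (D ` S)" by (rule bdd_belowI2[OF D0])
    \<comment> \<open>Almost minimal distance to \<open>S\<close> implies almost orthogonality to every \<open>g k\<close>, since \<open>u + s * g k\<close> stays in \<open>S\<close>.\<close>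
    have near: "\<exists>u\<in>S. \<forall>k. \<bar>energy_inner (g k) (\<lambda>\<omega>. F \<omega> + (- 1) * u \<omega>)\<bar> \<le> \<eta> * sqrt m" if \<eta>: "0 < \<eta>" for \<eta>
    proof -
      have "(INF u\<in>S. D u) < (INF u\<in>S. D u) + \<eta>\<^sup>2" using \<eta> by simp
      then obtain u where u: "u \<in> S" "D u < (INF u\<in>S. D u) + \<eta>\<^sup>2"
        using cINF_less_iff[OF _ bdd] Sg by (metis empty_iff)
      let ?w = "\<lambda>\<omega>. F \<omega> + (- 1) * u \<omega>"
      have uE: "u \<in> energy_space" using u(1) by (simp add: S_def)
      have w: "?w \<in> energy_space" by (rule energy_space_add_scaled[OF F uE])
      have "\<bar>energy_inner (g k) ?w\<bar> \<le> \<eta> * sqrt m" for k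
      proof -
        have "(energy_inner ?w (g k))\<^sup>2 \<le> \<eta>\<^sup>2 * energy_inner (g k) (g k)"
        proof (rule square_le_of_quadratic_bound[OF energy_inner_nonneg])
          fix s
          have "(INF u\<in>S. D u) \<le> D (\<lambda>\<omega>. u \<omega> + s * g k \<omega>)"
            by (rule cINF_lower[OF bdd Sadd[OF u(1) Sg]])
          also have "\<dots> = energy_inner (\<lambda>\<omega>. ?w \<omega> + (- s) * g k \<omega>) (\<lambda>\<omega>. ?w \<omega> + (- s) * g k \<omega>)"
            unfolding D_def by (rule arg_cong2[where f = energy_inner]) (auto simp: algebra_simps)
          also have "\<dots> = D u + 2 * (- s) * energy_inner ?w (g k) + (- s)\<^sup>2 * energy_inner (g k) (g k)"
            unfolding energy_inner_square_expand[OF w g] D_def ..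
          finally show "2 * s * energy_inner ?w (g k) \<le> \<eta>\<^sup>2 + s\<^sup>2 * energy_inner (g k) (g k)" using u(2) by simp
        qed
        also have "\<dots> \<le> \<eta>\<^sup>2 * m" by (rule mult_left_mono[OF m]) simp
        finally have "sqrt ((energy_inner ?w (g k))\<^sup>2) \<le> sqrt (\<eta>\<^sup>2 * m)" by (rule real_sqrt_le_mono)
        then show ?thesis using \<eta> by (simp add: real_sqrt_mult energy_inner_commute)
      qed
      then show ?thesis using u(1) by blast
    qed
    have m0: "0 \<le> m" using order_trans[OF energy_inner_nonneg m] .
    show ?thesis
    proof (rule Cauchy_convergent, rule metric_CauchyI)
      fix e :: real assume e: "0 < e"
      define \<eta> where "\<eta> = e / (4 * (sqrt m + 1))"
      have \<eta>: "0 < \<eta>" "\<eta> * sqrt m \<le> e / 4"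
      proof -
        have "0 < sqrt m + 1" using m0 by (simp add: add_nonneg_pos)
        then show "0 < \<eta>" "\<eta> * sqrt m \<le> e / 4" using e m0 by (auto simp: \<eta>_def field_simps)
      qed
      obtain u where u: "u \<in> S" "\<And>k. \<bar>energy_inner (g k) (\<lambda>\<omega>. F \<omega> + (- 1) * u \<omega>)\<bar> \<le> \<eta> * sqrt m"
        using near[OF \<eta>(1)] by blast
      have uE: "u \<in> energy_space" using u(1) by (simp add: S_def)
      have "Cauchy (\<lambda>k. energy_inner (g (r k)) u)" using u(1) by (simp add: S_def convergent_Cauchy)
      then obtain n where n: "\<And>i j. n \<le> i \<Longrightarrow> n \<le> j \<Longrightarrow> dist (energy_inner (g (r i)) u) (energy_inner (g (r j)) u) < e / 4"
        using e by (metis metric_CauchyD zero_less_divide_iff zero_less_numeral)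
      have "dist (energy_inner (g (r i)) F) (energy_inner (g (r j)) F) < e" if "n \<le> i" "n \<le> j" for i j
      proof -
        have d: "\<bar>energy_inner (g (r i)) F - energy_inner (g (r i)) u\<bar> \<le> e / 4" for i
          using u(2)[of "r i"] \<eta>(2) energy_inner_add_scaled_right[OF F uE g[of "r i"], of "- 1"] by simp
        show ?thesis
          using d[of i] d[of j] n[OF that] e unfolding dist_real_def by linarith
      qed
      then show "\<exists>n. \<forall>i\<ge>n. \<forall>j\<ge>n. dist (energy_inner (g (r i)) F) (energy_inner (g (r j)) F) < e" by blast
    qed
  qed
  with r show ?thesis by blast
qed

section \<open>The space of test functions\<close>

abbreviation H where "H \<equiv> H_space M b"

lemma H_measurable: "f \<in> H \<Longrightarrow> f \<in> borel_measurable M"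
  by (simp add: H_space_def)

lemma weight_nonneg: "\<omega> \<in> space M \<Longrightarrow> 0 \<le> inverse (b 0 0 \<omega>) * (x::real)\<^sup>2"
  using b_pos(2) by simp

lemma H_norm_nonneg: "0 \<le> H_norm M b f"
  unfolding H_norm_def by (simp, rule integral_nonneg_AE) (use weight_nonneg in \<open>auto intro!: AE_I2\<close>)

lemma H_dominated:
  assumes w: "w \<in> H" and f[measurable]: "f \<in> borel_measurable M" and le: "\<And>\<omega>. \<omega> \<in> space M \<Longrightarrow> \<bar>f \<omega>\<bar> \<le> C * \<bar>w \<omega>\<bar>"
  shows "f \<in> H"
proof -
  have "integrable M (\<lambda>\<omega>. inverse (b 0 0 \<omega>) * (f \<omega>)\<^sup>2)"
  proof (rule Bochner_Integration.integrable_bound)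
    show "integrable M (\<lambda>\<omega>. C\<^sup>2 * (inverse (b 0 0 \<omega>) * (w \<omega>)\<^sup>2))"
      using w by (simp add: H_space_def)
    show "AE \<omega> in M. norm (inverse (b 0 0 \<omega>) * (f \<omega>)\<^sup>2) \<le> norm (C\<^sup>2 * (inverse (b 0 0 \<omega>) * (w \<omega>)\<^sup>2))"
    proof (rule AE_I2)
      fix \<omega> assume \<omega>: "\<omega> \<in> space M"
      have "\<bar>f \<omega>\<bar>\<^sup>2 \<le> (C * \<bar>w \<omega>\<bar>)\<^sup>2" by (rule power_mono[OF le[OF \<omega>]]) simp
      then have "(f \<omega>)\<^sup>2 \<le> C\<^sup>2 * (w \<omega>)\<^sup>2" by (simp add: power_mult_distrib)
      then have "inverse (b 0 0 \<omega>) * (f \<omega>)\<^sup>2 \<le> inverse (b 0 0 \<omega>) * (C\<^sup>2 * (w \<omega>)\<^sup>2)"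
        by (rule mult_left_mono) (use b_pos(2)[OF \<omega>] in simp)
      then show "norm (inverse (b 0 0 \<omega>) * (f \<omega>)\<^sup>2) \<le> norm (C\<^sup>2 * (inverse (b 0 0 \<omega>) * (w \<omega>)\<^sup>2))"
        using weight_nonneg[OF \<omega>] b_pos(2)[OF \<omega>] by (simp add: mult.left_commute)
    qed
  qed measurable
  then show ?thesis by (simp add: H_space_def)
qed

lemma H_add:
  assumes "f \<in> H" "g \<in> H"
  shows "(\<lambda>\<omega>. f \<omega> + g \<omega>) \<in> H"
proof -
  note [measurable] = assms[THEN H_measurable]
  have "(\<lambda>\<omega>. \<bar>f \<omega>\<bar> + \<bar>g \<omega>\<bar>) \<in> H"
  proof -
    have "integrable M (\<lambda>\<omega>. inverse (b 0 0 \<omega>) * (\<bar>f \<omega>\<bar> + \<bar>g \<omega>\<bar>)\<^sup>2)"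
    proof (rule Bochner_Integration.integrable_bound)
      show "integrable M (\<lambda>\<omega>. 2 * (inverse (b 0 0 \<omega>) * (f \<omega>)\<^sup>2) + 2 * (inverse (b 0 0 \<omega>) * (g \<omega>)\<^sup>2))"
        using assms by (simp add: H_space_def)
      show "AE \<omega> in M. norm (inverse (b 0 0 \<omega>) * (\<bar>f \<omega>\<bar> + \<bar>g \<omega>\<bar>)\<^sup>2) \<le> norm (2 * (inverse (b 0 0 \<omega>) * (f \<omega>)\<^sup>2) + 2 * (inverse (b 0 0 \<omega>) * (g \<omega>)\<^sup>2))"
      proof (rule AE_I2)
        fix \<omega> assume \<omega>: "\<omega> \<in> space M"
        have "(\<bar>f \<omega>\<bar> + \<bar>g \<omega>\<bar>)\<^sup>2 \<le> 2 * (f \<omega>)\<^sup>2 + 2 * (g \<omega>)\<^sup>2"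
          using sum_squares_bound[of "\<bar>f \<omega>\<bar>" "\<bar>g \<omega>\<bar>"] by (simp add: power2_sum)
        then have "inverse (b 0 0 \<omega>) * (\<bar>f \<omega>\<bar> + \<bar>g \<omega>\<bar>)\<^sup>2 \<le> inverse (b 0 0 \<omega>) * (2 * (f \<omega>)\<^sup>2 + 2 * (g \<omega>)\<^sup>2)"
          by (rule mult_left_mono) (use b_pos(2)[OF \<omega>] in simp)
        then show "norm (inverse (b 0 0 \<omega>) * (\<bar>f \<omega>\<bar> + \<bar>g \<omega>\<bar>)\<^sup>2) \<le> norm (2 * (inverse (b 0 0 \<omega>) * (f \<omega>)\<^sup>2) + 2 * (inverse (b 0 0 \<omega>) * (g \<omega>)\<^sup>2))"
          using weight_nonneg[OF \<omega>] by (simp add: distrib_left mult.left_commute)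
      qed
    qed measurable
    then show ?thesis by (simp add: H_space_def)
  qed
  then show ?thesis by (rule H_dominated[where C = 1]) auto
qed

lemma H_cmult: "f \<in> H \<Longrightarrow> (\<lambda>\<omega>. a * f \<omega>) \<in> H"
  by (rule H_dominated[where C = "\<bar>a\<bar>"]) (auto simp: abs_mult dest: H_measurable)

lemma H_const: "(\<lambda>_. a) \<in> H"
  using integrable_inverse_b by (simp add: H_space_def)

lemma H_bounded:
  assumes "f \<in> borel_measurable M" "\<And>\<omega>. \<omega> \<in> space M \<Longrightarrow> \<bar>f \<omega>\<bar> \<le> C"
  shows "f \<in> H"
  by (rule H_dominated[OF H_const[of 1], where C = C]) (use assms in auto)

lemma H_b_times:
  assumes [measurable]: "G \<in> borel_measurable M" and "\<And>\<omega>. \<omega> \<in> space M \<Longrightarrow> \<bar>G \<omega>\<bar> \<le> C"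
  shows "(\<lambda>\<omega>. b 0 0 \<omega> * G \<omega>) \<in> H"
proof -
  have "integrable M (\<lambda>\<omega>. inverse (b 0 0 \<omega>) * (b 0 0 \<omega>)\<^sup>2)"
  proof (rule Bochner_Integration.integrable_cong[THEN iffD1, OF refl _ integrable_b])
    fix \<omega> assume "\<omega> \<in> space M"
    then show "b 0 0 \<omega> = inverse (b 0 0 \<omega>) * (b 0 0 \<omega>)\<^sup>2"
      using b_nonzero by (simp add: power2_eq_square)
  qed
  then have "b 0 0 \<in> H" by (simp add: H_space_def)
  then show ?thesis
    by (rule H_dominated[where C = C]) (use assms b_pos(2) in \<open>auto simp: abs_mult mult.commute intro!: mult_right_mono\<close>)
qed

text \<open>
  The isometry between test functions and the energy space, and the identification of the pairings.
\<close>

lemma H_divided: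
  assumes "f \<in> H"
  shows "(\<lambda>\<omega>. f \<omega> / b 0 0 \<omega>) \<in> energy_space"
    and "energy_inner (\<lambda>\<omega>. f \<omega> / b 0 0 \<omega>) (\<lambda>\<omega>. f \<omega> / b 0 0 \<omega>) = (H_norm M b f)\<^sup>2"
    and "energy_inner u (\<lambda>\<omega>. f \<omega> / b 0 0 \<omega>) = (LINT \<omega>|M. u \<omega> * f \<omega>)"
proof -
  note [measurable] = H_measurable[OF assms]
  have e: "b 0 0 \<omega> * (f \<omega> / b 0 0 \<omega>)\<^sup>2 = inverse (b 0 0 \<omega>) * (f \<omega>)\<^sup>2" if "\<omega> \<in> space M" for \<omega>
    using b_pos(1)[OF that] by (simp add: power2_eq_square field_simps)
  show "(\<lambda>\<omega>. f \<omega> / b 0 0 \<omega>) \<in> energy_space"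
    using assms e by (simp add: energy_space_def H_space_def cong: Bochner_Integration.integrable_cong)
  have "0 \<le> (LINT \<omega>|M. inverse (b 0 0 \<omega>) * (f \<omega>)\<^sup>2)"
    by (rule integral_nonneg_AE) (use weight_nonneg in \<open>auto intro!: AE_I2\<close>)
  then show "energy_inner (\<lambda>\<omega>. f \<omega> / b 0 0 \<omega>) (\<lambda>\<omega>. f \<omega> / b 0 0 \<omega>) = (H_norm M b f)\<^sup>2"
    unfolding energy_inner_def H_norm_def power2_eq_square[symmetric]
    using e by (simp cong: Bochner_Integration.integral_cong)
  show "energy_inner u (\<lambda>\<omega>. f \<omega> / b 0 0 \<omega>) = (LINT \<omega>|M. u \<omega> * f \<omega>)"
    unfolding energy_inner_def using b_nonzero by (intro Bochner_Integration.integral_cong) auto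
qed

lemma energy_H_pairing:
  assumes u: "u \<in> energy_space" and f: "f \<in> H"
  shows "integrable M (\<lambda>\<omega>. u \<omega> * f \<omega>)"
    and "\<bar>LINT \<omega>|M. u \<omega> * f \<omega>\<bar> \<le> sqrt (energy_inner u u) * H_norm M b f"
proof -
  show "integrable M (\<lambda>\<omega>. u \<omega> * f \<omega>)"
    by (rule Bochner_Integration.integrable_cong[THEN iffD1, OF refl _ integrable_energy_inner[OF u H_divided(1)[OF f]]])
       (use b_nonzero in auto)
  show "\<bar>LINT \<omega>|M. u \<omega> * f \<omega>\<bar> \<le> sqrt (energy_inner u u) * H_norm M b f"
    using energy_inner_Cauchy_Schwarz[OF u H_divided(1)[OF f]] H_norm_nonneg[of f]
    unfolding H_divided(2)[OF f] H_divided(3)[OF f] by simp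
qed

text \<open>
  Dominated convergence in the weighted space.
\<close>

lemma H_norm_tendsto_0:
  assumes w: "w \<in> H" and f: "\<And>n. f n \<in> borel_measurable M"
    and le: "\<And>n \<omega>. \<omega> \<in> space M \<Longrightarrow> \<bar>f n \<omega>\<bar> \<le> \<bar>w \<omega>\<bar>"
    and lim: "\<And>\<omega>. \<omega> \<in> space M \<Longrightarrow> (\<lambda>n. f n \<omega>) \<longlonglongrightarrow> 0"
  shows "(\<lambda>n. H_norm M b (f n)) \<longlonglongrightarrow> 0"
proof -
  note [measurable] = f H_measurable[OF w]
  have "(\<lambda>n. LINT \<omega>|M. inverse (b 0 0 \<omega>) * (f n \<omega>)\<^sup>2) \<longlonglongrightarrow> (LINT \<omega>|M. 0)"
  proof (rule integral_dominated_convergence[where w = "\<lambda>\<omega>. inverse (b 0 0 \<omega>) * (w \<omega>)\<^sup>2"])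
    show "integrable M (\<lambda>\<omega>. inverse (b 0 0 \<omega>) * (w \<omega>)\<^sup>2)" using w by (simp add: H_space_def)
    show "AE \<omega> in M. (\<lambda>n. inverse (b 0 0 \<omega>) * (f n \<omega>)\<^sup>2) \<longlonglongrightarrow> 0"
    proof (rule AE_I2)
      fix \<omega> assume "\<omega> \<in> space M"
      from tendsto_mult[OF tendsto_const tendsto_power[OF lim[OF this], of 2], of "inverse (b 0 0 \<omega>)"]
      show "(\<lambda>n. inverse (b 0 0 \<omega>) * (f n \<omega>)\<^sup>2) \<longlonglongrightarrow> 0" by simp
    qed
    show "AE \<omega> in M. norm (inverse (b 0 0 \<omega>) * (f n \<omega>)\<^sup>2) \<le> inverse (b 0 0 \<omega>) * (w \<omega>)\<^sup>2" for n
    proof (rule AE_I2)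
      fix \<omega> assume \<omega>: "\<omega> \<in> space M"
      have "(f n \<omega>)\<^sup>2 \<le> (w \<omega>)\<^sup>2" using le[OF \<omega>] by (simp add: abs_le_square_iff)
      then show "norm (inverse (b 0 0 \<omega>) * (f n \<omega>)\<^sup>2) \<le> inverse (b 0 0 \<omega>) * (w \<omega>)\<^sup>2"
        using b_pos(2)[OF \<omega>] by (simp add: abs_mult mult_left_mono)
    qed
  qed measurable
  from tendsto_real_sqrt[OF this] show ?thesis by (simp add: H_norm_def)
qed

end

section \<open>Functionals given by densities\<close>

context integrable_environment
begin

lemma H_indicator: "A \<in> sets M \<Longrightarrow> indicator A \<in> H"
  by (rule H_bounded[where C = 1]) (auto simp: indicator_def)

lemma H_diff: "f \<in> H \<Longrightarrow> g \<in> H \<Longrightarrow> (\<lambda>\<omega>. f \<omega> - g \<omega>) \<in> H"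
  using H_add[OF _ H_cmult[of g "- 1"], of f] by simp

text \<open>
  Countable additivity of \<open>A \<mapsto> \<Lambda> (indicator A)\<close> is continuity of \<open>\<Lambda>\<close>
  along dominated sequences, and null sets have indicators of norm 0. So the Radon-Nikodym theorem provides a density;
  the representation extends from indicators by the usual induction over measurable functions.
\<close>

lemma functional_density:
  fixes \<Lambda> :: "('a \<Rightarrow> real) \<Rightarrow> real"
  assumes add: "\<And>f g. f \<in> H \<Longrightarrow> g \<in> H \<Longrightarrow> \<Lambda> (\<lambda>\<omega>. f \<omega> + g \<omega>) = \<Lambda> f + \<Lambda> g"
    and scale: "\<And>f a. f \<in> H \<Longrightarrow> \<Lambda> (\<lambda>\<omega>. a * f \<omega>) = a * \<Lambda> f"
    and bound: "\<And>f. f \<in> H \<Longrightarrow> \<bar>\<Lambda> f\<bar> \<le> C * H_norm M b f"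
    and pos: "\<And>f. f \<in> H \<Longrightarrow> (\<And>\<omega>. 0 \<le> f \<omega>) \<Longrightarrow> 0 \<le> \<Lambda> f"
  shows "\<exists>\<phi>\<in>borel_measurable M. (\<forall>\<omega>. 0 \<le> \<phi> \<omega>) \<and> (\<forall>f\<in>H. integrable M (\<lambda>\<omega>. \<phi> \<omega> * f \<omega>) \<and> \<Lambda> f = (LINT \<omega>|M. \<phi> \<omega> * f \<omega>))"
proof -
  have diff: "\<Lambda> (\<lambda>\<omega>. f \<omega> - g \<omega>) = \<Lambda> f - \<Lambda> g" if "f \<in> H" "g \<in> H" for f g
    using add[OF that(1) H_cmult[OF that(2), of "- 1"]] scale[OF that(2), of "- 1"] by simp
  have zero: "\<Lambda> (\<lambda>_. 0) = 0"
    using scale[OF H_const[of 0], of 0] by simp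
  have cont: "(\<lambda>n. \<Lambda> (f n)) \<longlonglongrightarrow> \<Lambda> g"
    if w: "w \<in> H" and g: "g \<in> H" and f: "\<And>n. f n \<in> H" and le: "\<And>n \<omega>. \<omega> \<in> space M \<Longrightarrow> \<bar>f n \<omega> - g \<omega>\<bar> \<le> \<bar>w \<omega>\<bar>"
      and lim: "\<And>\<omega>. \<omega> \<in> space M \<Longrightarrow> (\<lambda>n. f n \<omega>) \<longlonglongrightarrow> g \<omega>" for f :: "nat \<Rightarrow> 'a \<Rightarrow> real" and g w
  proof -
    have "(\<lambda>n. H_norm M b (\<lambda>\<omega>. f n \<omega> - g \<omega>)) \<longlonglongrightarrow> 0"
    proof (rule H_norm_tendsto_0[OF w _ le])
      show "(\<lambda>\<omega>. f n \<omega> - g \<omega>) \<in> borel_measurable M" for n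
        using H_measurable[OF f] H_measurable[OF g] by measurable
      show "(\<lambda>n. f n \<omega> - g \<omega>) \<longlonglongrightarrow> 0" if "\<omega> \<in> space M" for \<omega>
        using LIM_zero[OF lim[OF that]] .
    qed
    then have null: "(\<lambda>n. C * H_norm M b (\<lambda>\<omega>. f n \<omega> - g \<omega>)) \<longlonglongrightarrow> 0"
      by (rule tendsto_mult_right_zero)
    have "(\<lambda>n. \<Lambda> (\<lambda>\<omega>. f n \<omega> - g \<omega>)) \<longlonglongrightarrow> 0"
    proof (rule Lim_null_comparison[OF always_eventually null], rule allI)
      show "norm (\<Lambda> (\<lambda>\<omega>. f n \<omega> - g \<omega>)) \<le> C * H_norm M b (\<lambda>\<omega>. f n \<omega> - g \<omega>)" for n
        unfolding real_norm_def by (rule bound[OF H_diff[OF f g]])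
    qed
    then have "(\<lambda>n. \<Lambda> (f n) - \<Lambda> g) \<longlonglongrightarrow> 0"
      unfolding diff[OF f g] .
    then show ?thesis by (rule LIM_zero_cancel)
  qed
  define \<mu> where "\<mu> A = ennreal (\<Lambda> (indicator A))" for A
  have ind0: "0 \<le> \<Lambda> (indicator A)" if "A \<in> sets M" for A
    by (rule pos[OF H_indicator[OF that]]) simp
  have ca: "countably_additive (sets M) \<mu>"
  proof (rule countably_additiveI)
    fix A :: "nat \<Rightarrow> 'a set"
    assume A: "range A \<subseteq> sets M" and dis: "disjoint_family A" and un: "(\<Union>i. A i) \<in> sets M"
    have Ai: "A i \<in> sets M" for i using A by auto
    have part: "\<Lambda> (\<lambda>\<omega>. \<Sum>i<n. indicator (A i) \<omega>) = (\<Sum>i<n. \<Lambda> (indicator (A i))) \<and> (\<lambda>\<omega>. \<Sum>i<n. indicator (A i) \<omega> :: real) \<in> H" for n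
    proof (induction n)
      case (Suc n)
      then show ?case using add[OF conjunct2[OF Suc] H_indicator[OF Ai[of n]]] H_add[OF conjunct2[OF Suc] H_indicator[OF Ai[of n]]]
        by simp
    qed (simp add: zero H_const)
    have "(\<lambda>n. \<Lambda> (\<lambda>\<omega>. \<Sum>i<n. indicator (A i) \<omega>)) \<longlonglongrightarrow> \<Lambda> (indicator (\<Union>i. A i))"
    proof (rule cont[OF H_const[of 1] H_indicator[OF un]])
      fix n \<omega>
      have s: "(\<Sum>i<n. indicator (A i) \<omega> :: real) = indicator (\<Union>i<n. A i) \<omega>"
        by (rule indicator_UN_disjoint[symmetric]) (use dis in \<open>auto simp: disjoint_family_on_def\<close>)
      show "(\<lambda>\<omega>. \<Sum>i<n. indicator (A i) \<omega> :: real) \<in> H" using part by blast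
      show "\<bar>(\<Sum>i<n. indicator (A i) \<omega>) - indicator (\<Union>i. A i) \<omega>\<bar> \<le> \<bar>1 :: real\<bar>"
        unfolding s by (auto simp: indicator_def)
    next
      fix \<omega>
      have s: "(\<Sum>i<n. indicator (A i) \<omega> :: real) = indicator (\<Union>i<n. A i) \<omega>" for n
        by (rule indicator_UN_disjoint[symmetric]) (use dis in \<open>auto simp: disjoint_family_on_def\<close>)
      show "(\<lambda>n. \<Sum>i<n. indicator (A i) \<omega> :: real) \<longlonglongrightarrow> indicator (\<Union>i. A i) \<omega>"
        unfolding s by (rule LIMSEQ_indicator_UN)
    qed
    then have "(\<lambda>i. \<Lambda> (indicator (A i))) sums \<Lambda> (indicator (\<Union>i. A i))"
      using part by (simp add: sums_def)
    then show "(\<Sum>i. \<mu> (A i)) = \<mu> (\<Union>i. A i)"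
      unfolding \<mu>_def by (intro suminf_ennreal_eq ind0 Ai)
  qed
  have posit: "positive (sets M) \<mu>"
    using zero by (simp add: positive_def \<mu>_def indicator_def[abs_def] zero_ennreal_def[symmetric])
  define N where "N = measure_of (space M) (sets M) \<mu>"
  have setsN: "sets N = sets M" unfolding N_def by simp
  have emN: "emeasure N A = ennreal (\<Lambda> (indicator A))" if "A \<in> sets M" for A
    unfolding N_def by (subst emeasure_measure_of_sigma[OF _ posit ca that]) (auto simp: \<mu>_def sets.sigma_algebra_axioms)
  have ac: "absolutely_continuous M N"
    unfolding absolutely_continuous_def
  proof
    fix A assume "A \<in> null_sets M"
    then have A: "A \<in> sets M" and null: "AE \<omega> in M. \<omega> \<notin> A" by (auto intro: AE_not_in)
    have "H_norm M b (indicator A) = 0"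
      unfolding H_norm_def using null
      by (subst integral_eq_zero_AE) (auto elim!: eventually_mono simp: indicator_def)
    then have "\<Lambda> (indicator A) = 0" using bound[OF H_indicator[OF A]] by simp
    then show "A \<in> null_sets N" using emN[OF A] A setsN by (auto simp: null_sets_def)
  qed
  obtain f where f[measurable]: "f \<in> borel_measurable M" and dens: "density M f = N"
    using Radon_Nikodym[OF ac setsN] by blast
  have nnf: "(\<integral>\<^sup>+\<omega>. f \<omega> * indicator A \<omega> \<partial>M) = ennreal (\<Lambda> (indicator A))" if "A \<in> sets M" for A
    using emeasure_density[OF f that] emN[OF that] dens by simp
  have "(\<integral>\<^sup>+\<omega>. f \<omega> \<partial>M) = (\<integral>\<^sup>+\<omega>. f \<omega> * indicator (space M) \<omega> \<partial>M)"
    by (rule nn_integral_cong) simp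
  then have "(\<integral>\<^sup>+\<omega>. f \<omega> \<partial>M) \<noteq> \<infinity>" using nnf[of "space M"] by simp
  then have fin: "AE \<omega> in M. f \<omega> \<noteq> \<infinity>" by (intro nn_integral_PInf_AE) auto
  define \<phi> where "\<phi> \<omega> = enn2real (f \<omega>)" for \<omega>
  have \<phi>m[measurable]: "\<phi> \<in> borel_measurable M" unfolding \<phi>_def[abs_def] by measurable
  have \<phi>0: "0 \<le> \<phi> \<omega>" for \<omega> by (simp add: \<phi>_def)
  have key: "u \<in> H \<longrightarrow> integrable M (\<lambda>\<omega>. \<phi> \<omega> * u \<omega>) \<and> \<Lambda> u = (LINT \<omega>|M. \<phi> \<omega> * u \<omega>)"
    if "u \<in> borel_measurable M" "\<And>\<omega>. 0 \<le> u \<omega>" for u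
    using that
  proof (induction rule: borel_measurable_induct_real)
    case (set A)
    have "(\<integral>\<^sup>+\<omega>. ennreal (\<phi> \<omega> * indicator A \<omega>) \<partial>M) = (\<integral>\<^sup>+\<omega>. f \<omega> * indicator A \<omega> \<partial>M)"
      by (rule nn_integral_cong_AE) (use fin in \<open>eventually_elim, auto simp: \<phi>_def indicator_def less_top\<close>)
    then have "(\<integral>\<^sup>+\<omega>. ennreal (\<phi> \<omega> * indicator A \<omega>) \<partial>M) = ennreal (\<Lambda> (indicator A))"
      using nnf[OF set] by simp
    then have "has_bochner_integral M (\<lambda>\<omega>. \<phi> \<omega> * indicator A \<omega>) (\<Lambda> (indicator A))"
      by (intro has_bochner_integral_nn_integral) (use set \<phi>0 ind0 in auto)
    then show ?case by (auto simp: has_bochner_integral_iff)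
  next
    case (mult u a)
    show ?case
    proof (cases "a = 0")
      case False
      show ?thesis
      proof
        assume "(\<lambda>\<omega>. a * u \<omega>) \<in> H"
        from H_cmult[OF this, of "1 / a"] have u: "u \<in> H" using False by simp
        show "integrable M (\<lambda>\<omega>. \<phi> \<omega> * (a * u \<omega>)) \<and> \<Lambda> (\<lambda>\<omega>. a * u \<omega>) = (LINT \<omega>|M. \<phi> \<omega> * (a * u \<omega>))"
          using mult u scale[OF u, of a] by (simp add: mult.left_commute)
      qed
    qed (simp add: zero)
  next
    case (add u v)
    show ?case
    proof
      assume uv: "(\<lambda>\<omega>. v \<omega> + u \<omega>) \<in> H"
      have u: "u \<in> H" by (rule H_dominated[OF uv, where C = 1]) (use add in auto)
      have v: "v \<in> H" by (rule H_dominated[OF uv, where C = 1]) (use add in auto)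
      show "integrable M (\<lambda>\<omega>. \<phi> \<omega> * (v \<omega> + u \<omega>)) \<and> \<Lambda> (\<lambda>\<omega>. v \<omega> + u \<omega>) = (LINT \<omega>|M. \<phi> \<omega> * (v \<omega> + u \<omega>))"
        using add u v assms(1)[OF v u] by (simp add: distrib_left)
    qed
  next
    case (seq U)
    show ?case
    proof
      assume u: "u \<in> H"
      have le: "U i \<omega> \<le> u \<omega>" if "\<omega> \<in> space M" for i \<omega>
        by (rule incseq_le[OF _ seq.hyps(4)[OF that]]) (use seq.hyps(3) in \<open>auto simp: incseq_def le_fun_def\<close>)
      have UH: "U i \<in> H" for i by (rule H_dominated[OF u, where C = 1]) (use seq.hyps(1,2) le in \<open>auto intro: order_trans[OF le abs_ge_self]\<close>)
      have lim: "(\<lambda>i. \<Lambda> (U i)) \<longlonglongrightarrow> \<Lambda> u"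
      proof (rule cont[OF u u UH])
        fix i \<omega> assume \<omega>: "\<omega> \<in> space M"
        show "\<bar>U i \<omega> - u \<omega>\<bar> \<le> \<bar>u \<omega>\<bar>" using le[OF \<omega>, of i] seq.hyps(2)[of i \<omega>] by simp
      qed (rule seq.hyps(4))
      have "integrable M (\<lambda>\<omega>. \<phi> \<omega> * u \<omega>) \<and> integral\<^sup>L M (\<lambda>\<omega>. \<phi> \<omega> * u \<omega>) = \<Lambda> u"
      proof (intro conjI)
        have i: "\<And>i. integrable M (\<lambda>\<omega>. \<phi> \<omega> * U i \<omega>)" using seq.IH UH by blast
        have m: "AE \<omega> in M. mono (\<lambda>i. \<phi> \<omega> * U i \<omega>)"
          using seq.hyps(3) \<phi>0 by (auto simp: incseq_def le_fun_def intro!: AE_I2 monoI mult_left_mono)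
        have l: "AE \<omega> in M. (\<lambda>i. \<phi> \<omega> * U i \<omega>) \<longlonglongrightarrow> \<phi> \<omega> * u \<omega>"
          using seq.hyps(4) by (auto intro!: AE_I2 tendsto_mult tendsto_const)
        have il: "(\<lambda>i. integral\<^sup>L M (\<lambda>\<omega>. \<phi> \<omega> * U i \<omega>)) \<longlonglongrightarrow> \<Lambda> u"
          using lim seq.IH UH by simp
        have mm: "(\<lambda>\<omega>. \<phi> \<omega> * u \<omega>) \<in> borel_measurable M" using H_measurable[OF u] by measurable
        show "integrable M (\<lambda>\<omega>. \<phi> \<omega> * u \<omega>)" by (rule integrable_monotone_convergence[OF i m l il mm])
        show "integral\<^sup>L M (\<lambda>\<omega>. \<phi> \<omega> * u \<omega>) = \<Lambda> u" by (rule integral_monotone_convergence[OF i m l il mm])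
      qed
      then show "integrable M (\<lambda>\<omega>. \<phi> \<omega> * u \<omega>) \<and> \<Lambda> u = (LINT \<omega>|M. \<phi> \<omega> * u \<omega>)" by simp
    qed
  qed
  have "integrable M (\<lambda>\<omega>. \<phi> \<omega> * u \<omega>) \<and> \<Lambda> u = (LINT \<omega>|M. \<phi> \<omega> * u \<omega>)" if u: "u \<in> H" for u
  proof -
    note [measurable] = H_measurable[OF u]
    have p: "(\<lambda>\<omega>. max 0 (u \<omega>)) \<in> H" by (rule H_dominated[OF u, where C = 1]) auto
    have n: "(\<lambda>\<omega>. max 0 (- u \<omega>)) \<in> H" by (rule H_dominated[OF u, where C = 1]) auto
    have s: "max 0 (u \<omega>) - max 0 (- u \<omega>) = u \<omega>" for \<omega> by (auto simp: max_def)
    have P: "integrable M (\<lambda>\<omega>. \<phi> \<omega> * max 0 (u \<omega>)) \<and> \<Lambda> (\<lambda>\<omega>. max 0 (u \<omega>)) = (LINT \<omega>|M. \<phi> \<omega> * max 0 (u \<omega>))"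
      using key[of "\<lambda>\<omega>. max 0 (u \<omega>)"] p by simp
    have Nn: "integrable M (\<lambda>\<omega>. \<phi> \<omega> * max 0 (- u \<omega>)) \<and> \<Lambda> (\<lambda>\<omega>. max 0 (- u \<omega>)) = (LINT \<omega>|M. \<phi> \<omega> * max 0 (- u \<omega>))"
      using key[of "\<lambda>\<omega>. max 0 (- u \<omega>)"] n by simp
    have "integrable M (\<lambda>\<omega>. \<phi> \<omega> * (max 0 (u \<omega>) - max 0 (- u \<omega>))) \<and>
       \<Lambda> (\<lambda>\<omega>. max 0 (u \<omega>) - max 0 (- u \<omega>)) = (LINT \<omega>|M. \<phi> \<omega> * (max 0 (u \<omega>) - max 0 (- u \<omega>)))"
      using P Nn diff[OF p n] by (simp add: right_diff_distrib)
    then show ?thesis unfolding s .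
  qed
  then show ?thesis using \<phi>m \<phi>0 by blast
qed

lemma L_infty_subset_H: "L_infty M \<subseteq> H"
proof
  fix f assume "f \<in> L_infty M"
  then obtain C where f[measurable]: "f \<in> borel_measurable M" and C: "AE \<omega> in M. \<bar>f \<omega>\<bar> \<le> C"
    by (auto simp: L_infty_def)
  have "integrable M (\<lambda>\<omega>. inverse (b 0 0 \<omega>) * (f \<omega>)\<^sup>2)"
  proof (rule Bochner_Integration.integrable_bound)
    show "integrable M (\<lambda>\<omega>. C\<^sup>2 * inverse (b 0 0 \<omega>))" using integrable_inverse_b by simp
    show "AE \<omega> in M. norm (inverse (b 0 0 \<omega>) * (f \<omega>)\<^sup>2) \<le> norm (C\<^sup>2 * inverse (b 0 0 \<omega>))"
      using C AE_space
    proof eventually_elim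
      case (elim \<omega>)
      have "(f \<omega>)\<^sup>2 \<le> C\<^sup>2" using power_mono[OF elim(1) abs_ge_zero, of 2] by simp
      from mult_left_mono[OF this, of "inverse (b 0 0 \<omega>)"] show ?case
        using b_pos(2)[OF elim(2)] by (simp add: abs_mult mult.commute)
    qed
  qed measurable
  then show "f \<in> H" by (simp add: H_space_def)
qed

context
  fixes \<epsilon> :: real
  assumes \<epsilon>: "0 < \<epsilon>"
begin

lemma varphi_eps_energy_space: "varphi_eps b \<epsilon> \<in> energy_space"
  using varphi_eps_energy(1)[OF \<epsilon>] by (simp add: energy_space_def)

lemma varphi_eps_energy_inner: "energy_inner (varphi_eps b \<epsilon>) (varphi_eps b \<epsilon>) \<le> (LINT \<omega>|M. b 0 0 \<omega>)"
  using varphi_eps_energy(2)[OF \<epsilon>] by (simp add: energy_inner_def power2_eq_square)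

lemma varphi_eps_pairing:
  assumes "f \<in> H"
  shows "integrable M (\<lambda>\<omega>. varphi_eps b \<epsilon> \<omega> * f \<omega>)"
    and "\<bar>LINT \<omega>|M. varphi_eps b \<epsilon> \<omega> * f \<omega>\<bar> \<le> sqrt (LINT \<omega>|M. b 0 0 \<omega>) * H_norm M b f"
  using energy_H_pairing[OF varphi_eps_energy_space assms]
    mult_right_mono[OF real_sqrt_le_mono[OF varphi_eps_energy_inner] H_norm_nonneg[of f]] by auto

lemma varphi_eps_functional:
  defines "\<Phi> \<equiv> \<lambda>f. LINT \<omega>|M. varphi_eps b \<epsilon> \<omega> * f \<omega>"
  shows "continuous_linear_functional_H M b \<Phi>" "extends_phi_eps M b \<epsilon> \<Phi>"
proof -
  have "\<Phi> (\<lambda>\<omega>. f \<omega> + g \<omega>) = \<Phi> f + \<Phi> g" if "f \<in> H" "g \<in> H" for f g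
    using varphi_eps_pairing(1) that by (simp add: \<Phi>_def distrib_left)
  moreover have "\<Phi> (\<lambda>\<omega>. a * f \<omega>) = a * \<Phi> f" for f a
    by (simp add: \<Phi>_def mult.left_commute)
  moreover have "\<bar>\<Phi> f\<bar> \<le> sqrt (LINT \<omega>|M. b 0 0 \<omega>) * H_norm M b f" if "f \<in> H" for f
    unfolding \<Phi>_def by (rule varphi_eps_pairing(2)[OF that])
  ultimately show "continuous_linear_functional_H M b \<Phi>"
    unfolding continuous_linear_functional_H_def by blast
  show "extends_phi_eps M b \<epsilon> \<Phi>"
    unfolding extends_phi_eps_def \<Phi>_def using L_infty_subset_H varphi_eps_pairing(1) by auto
qed

text \<open>
  Bounded functions are dense: the truncation \<open>t n\<close> of \<open>f\<close> is bounded and the remainder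
  \<open>d n\<close> tends to 0 in norm.
\<close>

lemma extension_unique:
  assumes lin: "continuous_linear_functional_H M b \<Phi>" and ext: "extends_phi_eps M b \<epsilon> \<Phi>" and f: "f \<in> H"
  shows "\<Phi> f = (LINT \<omega>|M. varphi_eps b \<epsilon> \<omega> * f \<omega>)"
proof -
  note [measurable] = H_measurable[OF f]
  define \<Psi> where "\<Psi> f = (LINT \<omega>|M. varphi_eps b \<epsilon> \<omega> * f \<omega>)" for f
  obtain C where C: "\<And>f. f \<in> H \<Longrightarrow> \<bar>\<Phi> f\<bar> \<le> C * H_norm M b f"
    using lin unfolding continuous_linear_functional_H_def by blast
  have add: "\<Phi> (\<lambda>\<omega>. f \<omega> + g \<omega>) = \<Phi> f + \<Phi> g" if "f \<in> H" "g \<in> H" for f g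
    using lin that by (auto simp: continuous_linear_functional_H_def)
  define t where "t n \<omega> = (if \<bar>f \<omega>\<bar> \<le> real n then f \<omega> else 0)" for n \<omega>
  define d where "d n \<omega> = (if \<bar>f \<omega>\<bar> \<le> real n then 0 else f \<omega>)" for n \<omega>
  have tm[measurable]: "t n \<in> borel_measurable M" for n unfolding t_def[abs_def] by measurable
  have dm[measurable]: "d n \<in> borel_measurable M" for n unfolding d_def[abs_def] by measurable
  have tL: "t n \<in> L_infty M" for n
    unfolding L_infty_def by (auto simp: t_def intro!: exI[of _ "real n"] tm[unfolded t_def[abs_def]])
  have tH: "t n \<in> H" for n using tL L_infty_subset_H by blast
  have dH: "d n \<in> H" for n by (rule H_dominated[OF f, where C = 1]) (auto simp: d_def)
  have td: "(\<lambda>\<omega>. t n \<omega> + d n \<omega>) = f" for n by (auto simp: t_def d_def)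
  have eq: "\<Phi> (t n) = \<Psi> (t n)" for n
    using ext tL by (simp add: extends_phi_eps_def \<Psi>_def)
  have dn: "(\<lambda>n. H_norm M b (d n)) \<longlonglongrightarrow> 0"
  proof (rule H_norm_tendsto_0[OF f dm])
    fix \<omega>
    obtain k where k: "\<bar>f \<omega>\<bar> \<le> real k" using real_arch_simple by blast
    show "(\<lambda>n. d n \<omega>) \<longlonglongrightarrow> 0"
      by (rule tendsto_eventually, rule eventually_sequentiallyI[of k]) (use k in \<open>auto simp: d_def\<close>)
  qed (auto simp: d_def)
  have "\<bar>\<Phi> f - \<Psi> f\<bar> \<le> (C + sqrt (LINT \<omega>|M. b 0 0 \<omega>)) * H_norm M b (d n)" for n
  proof -
    have "\<Psi> f = \<Psi> (t n) + \<Psi> (d n)"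
      unfolding \<Psi>_def td[of n, symmetric] using varphi_eps_pairing(1)[OF tH] varphi_eps_pairing(1)[OF dH]
      by (simp add: distrib_left)
    moreover have "\<Phi> f = \<Phi> (t n) + \<Phi> (d n)" using add[OF tH dH, of n n] td by simp
    ultimately have "\<Phi> f - \<Psi> f = \<Phi> (d n) - \<Psi> (d n)" using eq by simp
    then show ?thesis
      using C[OF dH, of n] varphi_eps_pairing(2)[OF dH, of n] unfolding \<Psi>_def
      by (simp add: distrib_right abs_le_iff)
  qed
  moreover have "(\<lambda>n. (C + sqrt (LINT \<omega>|M. b 0 0 \<omega>)) * H_norm M b (d n)) \<longlonglongrightarrow> 0"
    using tendsto_mult_right_zero[OF dn] .
  ultimately have "\<bar>\<Phi> f - \<Psi> f\<bar> \<le> 0" by (intro LIMSEQ_le_const) auto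
  then show ?thesis by (simp add: \<Psi>_def)
qed

end

lemma convergent_subsequence_exists:
  "\<exists>e. decreases_to_0 e \<and> (\<forall>f\<in>H. convergent (\<lambda>k. LINT \<omega>|M. varphi_eps b (e k) \<omega> * f \<omega>))"
proof -
  define a where "a k = 1 / real (Suc k)" for k
  have a: "0 < a k" for k by (simp add: a_def)
  obtain r where r: "strict_mono r" and conv: "\<And>F. F \<in> energy_space \<Longrightarrow> convergent (\<lambda>k. energy_inner (varphi_eps b (a (r k))) F)"
    using weakly_convergent_subsequence[of "\<lambda>k. varphi_eps b (a k)", OF varphi_eps_energy_space[OF a] varphi_eps_energy_inner[OF a]] by blast
  have "decreases_to_0 (\<lambda>k. a (r k))"
    unfolding decreases_to_0_def
  proof (intro conjI allI a)
    show "decseq (\<lambda>k. a (r k))"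
      using strict_mono_less_eq[OF r] by (auto simp: decseq_def a_def field_simps)
    have "a \<longlonglongrightarrow> 0" unfolding a_def[abs_def] by (rule LIMSEQ_Suc[OF lim_const_over_n])
    from LIMSEQ_subseq_LIMSEQ[OF this r] show "(\<lambda>k. a (r k)) \<longlonglongrightarrow> 0" by (simp add: o_def)
  qed
  moreover have "convergent (\<lambda>k. LINT \<omega>|M. varphi_eps b (a (r k)) \<omega> * f \<omega>)" if "f \<in> H" for f
    using conv[OF H_divided(1)[OF that]] unfolding H_divided(3)[OF that] .
  ultimately show ?thesis by blast
qed

text \<open>
  The limit functional is bounded and positive, hence given by a density. Its energy bound is obtained by testing with
  \<open>b * t n\<close> for truncations \<open>t n\<close> of the density, which shows \<open>I \<le> sqrt (E b) *
  sqrt I\<close> for the energy \<open>I\<close> of \<open>t n\<close>.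
\<close>

lemma weak_limit_density:
  assumes e: "\<And>k. 0 < e k" and conv: "\<And>f. f \<in> H \<Longrightarrow> convergent (\<lambda>k. LINT \<omega>|M. varphi_eps b (e k) \<omega> * f \<omega>)"
  shows "\<exists>\<phi>\<in>borel_measurable M. (\<forall>\<omega>. 0 \<le> \<phi> \<omega>) \<and> \<phi> \<in> energy_space \<and> energy_inner \<phi> \<phi> \<le> (LINT \<omega>|M. b 0 0 \<omega>) \<and>
     (\<forall>f\<in>H. integrable M (\<lambda>\<omega>. \<phi> \<omega> * f \<omega>) \<and> (\<lambda>k. LINT \<omega>|M. varphi_eps b (e k) \<omega> * f \<omega>) \<longlonglongrightarrow> (LINT \<omega>|M. \<phi> \<omega> * f \<omega>))"
proof -
  define \<Lambda> where "\<Lambda> f = lim (\<lambda>k. LINT \<omega>|M. varphi_eps b (e k) \<omega> * f \<omega>)" for f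
  define m where "m = sqrt (LINT \<omega>|M. b 0 0 \<omega>)"
  have lim: "(\<lambda>k. LINT \<omega>|M. varphi_eps b (e k) \<omega> * f \<omega>) \<longlonglongrightarrow> \<Lambda> f" if "f \<in> H" for f
    using conv[OF that] by (simp add: \<Lambda>_def convergent_LIMSEQ_iff)
  note pair = varphi_eps_pairing[OF e]
  have bound: "\<bar>\<Lambda> f\<bar> \<le> m * H_norm M b f" if "f \<in> H" for f
    by (rule LIMSEQ_le_const2[OF tendsto_rabs[OF lim[OF that]]]) (use pair(2)[OF that] in \<open>auto simp: m_def\<close>)
  have "\<exists>\<phi>\<in>borel_measurable M. (\<forall>\<omega>. 0 \<le> \<phi> \<omega>) \<and> (\<forall>f\<in>H. integrable M (\<lambda>\<omega>. \<phi> \<omega> * f \<omega>) \<and> \<Lambda> f = (LINT \<omega>|M. \<phi> \<omega> * f \<omega>))"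
  proof (rule functional_density[OF _ _ bound])
    fix f g assume f: "f \<in> H" and g: "g \<in> H"
    have "(\<lambda>k. LINT \<omega>|M. varphi_eps b (e k) \<omega> * (f \<omega> + g \<omega>)) \<longlonglongrightarrow> \<Lambda> f + \<Lambda> g"
      using tendsto_add[OF lim[OF f] lim[OF g]] pair(1)[OF f] pair(1)[OF g] by (simp add: distrib_left)
    then show "\<Lambda> (\<lambda>\<omega>. f \<omega> + g \<omega>) = \<Lambda> f + \<Lambda> g" by (rule LIMSEQ_unique[OF lim[OF H_add[OF f g]]])
  next
    fix f a assume f: "f \<in> H"
    have "(\<lambda>k. LINT \<omega>|M. varphi_eps b (e k) \<omega> * (a * f \<omega>)) \<longlonglongrightarrow> a * \<Lambda> f"
      using tendsto_mult[OF tendsto_const lim[OF f], of a] by (simp add: mult.left_commute)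
    then show "\<Lambda> (\<lambda>\<omega>. a * f \<omega>) = a * \<Lambda> f" by (rule LIMSEQ_unique[OF lim[OF H_cmult[OF f]]])
  next
    fix f :: "'a \<Rightarrow> real" assume "f \<in> H" and "\<And>\<omega>. 0 \<le> f \<omega>"
    then show "0 \<le> \<Lambda> f"
      by (intro LIMSEQ_le_const[OF lim]) (auto intro!: exI Bochner_Integration.integral_nonneg mult_nonneg_nonneg varphi_eps_nonneg)
  qed
  then obtain \<phi> where \<phi>m[measurable]: "\<phi> \<in> borel_measurable M" and \<phi>0: "\<And>\<omega>. 0 \<le> \<phi> \<omega>"
    and rep: "\<And>f. f \<in> H \<Longrightarrow> integrable M (\<lambda>\<omega>. \<phi> \<omega> * f \<omega>)" "\<And>f. f \<in> H \<Longrightarrow> \<Lambda> f = (LINT \<omega>|M. \<phi> \<omega> * f \<omega>)"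
    by blast
  have m0: "0 \<le> (LINT \<omega>|M. b 0 0 \<omega>)" by (rule integral_nonneg_AE) (use b_pos(2) in \<open>auto intro!: AE_I2\<close>)
  define t where "t n \<omega> = (if \<phi> \<omega> \<le> real n then \<phi> \<omega> else 0)" for n \<omega>
  have tm[measurable]: "t n \<in> borel_measurable M" for n unfolding t_def[abs_def] by measurable
  have tb: "\<bar>t n \<omega>\<bar> \<le> real n" for n \<omega> using \<phi>0 by (auto simp: t_def)
  have bt: "(\<lambda>\<omega>. b 0 0 \<omega> * t n \<omega>) \<in> H" for n by (rule H_b_times[OF tm tb])
  have sq: "\<phi> \<omega> * (b 0 0 \<omega> * t n \<omega>) = b 0 0 \<omega> * (t n \<omega>)\<^sup>2" for n \<omega>
    by (simp add: t_def power2_eq_square)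
  have ti: "integrable M (\<lambda>\<omega>. b 0 0 \<omega> * (t n \<omega>)\<^sup>2)" for n
    using rep(1)[OF bt, of n] unfolding sq .
  have tle: "(LINT \<omega>|M. b 0 0 \<omega> * (t n \<omega>)\<^sup>2) \<le> (LINT \<omega>|M. b 0 0 \<omega>)" for n
  proof -
    define I where "I = (LINT \<omega>|M. b 0 0 \<omega> * (t n \<omega>)\<^sup>2)"
    have I0: "0 \<le> I" unfolding I_def by (rule integral_nonneg_AE) (use b_pos(2) in \<open>auto intro!: AE_I2\<close>)
    have "H_norm M b (\<lambda>\<omega>. b 0 0 \<omega> * t n \<omega>) = sqrt I"
      unfolding H_norm_def I_def
      by (rule arg_cong[where f = sqrt], rule Bochner_Integration.integral_cong)
         (use b_nonzero in \<open>auto simp: power2_eq_square field_simps\<close>)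
    then have "I \<le> m * sqrt I"
      using bound[OF bt, of n] rep(2)[OF bt, of n] unfolding sq I_def[symmetric] by simp
    then have "sqrt I * sqrt I \<le> m * sqrt I" using I0 by simp
    then have "sqrt I \<le> m"
    proof (cases "I = 0")
      case False
      then have "0 < sqrt I" using I0 by simp
      then show ?thesis using \<open>sqrt I * sqrt I \<le> m * sqrt I\<close> by (rule mult_right_le_imp_le[rotated])
    qed (simp add: m_def m0)
    then show ?thesis using I0 m0 unfolding I_def[symmetric] m_def by simp
  qed
  have mono: "mono (\<lambda>n. b 0 0 \<omega> * (t n \<omega>)\<^sup>2)" if "\<omega> \<in> space M" for \<omega>
    using b_pos(2)[OF that] \<phi>0[of \<omega>] by (auto simp: mono_def t_def intro!: mult_left_mono)
  have lim_t: "(\<lambda>n. b 0 0 \<omega> * (t n \<omega>)\<^sup>2) \<longlonglongrightarrow> b 0 0 \<omega> * (\<phi> \<omega>)\<^sup>2" for \<omega>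
  proof (rule tendsto_eventually)
    obtain k where "\<phi> \<omega> \<le> real k" using real_arch_simple by blast
    then show "\<forall>\<^sub>F n in sequentially. b 0 0 \<omega> * (t n \<omega>)\<^sup>2 = b 0 0 \<omega> * (\<phi> \<omega>)\<^sup>2"
      by (intro eventually_sequentiallyI[of k]) (auto simp: t_def)
  qed
  have "convergent (\<lambda>n. LINT \<omega>|M. b 0 0 \<omega> * (t n \<omega>)\<^sup>2)"
  proof (rule Bseq_mono_convergent)
    show "Bseq (\<lambda>n. LINT \<omega>|M. b 0 0 \<omega> * (t n \<omega>)\<^sup>2)"
    proof (rule BseqI')
      fix n
      have "0 \<le> (LINT \<omega>|M. b 0 0 \<omega> * (t n \<omega>)\<^sup>2)" by (rule integral_nonneg_AE) (use b_pos(2) in \<open>auto intro!: AE_I2\<close>)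
      then show "norm (LINT \<omega>|M. b 0 0 \<omega> * (t n \<omega>)\<^sup>2) \<le> (LINT \<omega>|M. b 0 0 \<omega>)" using tle[of n] by simp
    qed
    show "\<forall>i. \<forall>j\<ge>i. (LINT \<omega>|M. b 0 0 \<omega> * (t i \<omega>)\<^sup>2) \<le> (LINT \<omega>|M. b 0 0 \<omega> * (t j \<omega>)\<^sup>2)"
    proof (intro allI impI)
      fix i j :: nat assume that: "i \<le> j"
      show "(LINT \<omega>|M. b 0 0 \<omega> * (t i \<omega>)\<^sup>2) \<le> (LINT \<omega>|M. b 0 0 \<omega> * (t j \<omega>)\<^sup>2)"
      by (rule integral_mono[OF ti ti]) (use mono that in \<open>auto simp: mono_def\<close>)
    qed
  qed
  then obtain L where L: "(\<lambda>n. LINT \<omega>|M. b 0 0 \<omega> * (t n \<omega>)\<^sup>2) \<longlonglongrightarrow> L" by (auto simp: convergent_def)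
  have LL: "L \<le> (LINT \<omega>|M. b 0 0 \<omega>)" by (rule LIMSEQ_le_const2[OF L]) (use tle in auto)
  have mm: "(\<lambda>\<omega>. b 0 0 \<omega> * (\<phi> \<omega>)\<^sup>2) \<in> borel_measurable M" by measurable
  note mc = ti AE_I2[OF mono] AE_I2[OF lim_t] L mm
  have "integrable M (\<lambda>\<omega>. b 0 0 \<omega> * (\<phi> \<omega>)\<^sup>2)"
    by (rule integrable_monotone_convergence[OF mc])
  then have E: "\<phi> \<in> energy_space" by (simp add: energy_space_def)
  have "(LINT \<omega>|M. b 0 0 \<omega> * (\<phi> \<omega>)\<^sup>2) = L"
    by (rule integral_monotone_convergence[OF mc])
  then have "energy_inner \<phi> \<phi> \<le> (LINT \<omega>|M. b 0 0 \<omega>)" using LL by (simp add: energy_inner_def power2_eq_square)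
  with E \<phi>m \<phi>0 rep lim show ?thesis by (intro bexI[of _ \<phi>]) auto
qed

end

section \<open>Passing to the limit in the weak equation\<close>

context integrable_environment
begin

lemma integral_b_tail: "(\<lambda>k. LINT \<omega>|M. (if real k < b 0 0 \<omega> then b 0 0 \<omega> else 0)) \<longlonglongrightarrow> 0"
proof -
  have "(\<lambda>k. LINT \<omega>|M. (if real k < b 0 0 \<omega> then b 0 0 \<omega> else 0)) \<longlonglongrightarrow> (LINT \<omega>|M. 0)"
  proof (rule integral_dominated_convergence[where w = "b 0 0"])
    show "AE \<omega> in M. (\<lambda>k. if real k < b 0 0 \<omega> then b 0 0 \<omega> else 0) \<longlonglongrightarrow> 0"
    proof (rule AE_I2, rule tendsto_eventually)
      fix \<omega>
      obtain k where "b 0 0 \<omega> \<le> real k" using real_arch_simple by blast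
      then show "\<forall>\<^sub>F k in sequentially. (if real k < b 0 0 \<omega> then b 0 0 \<omega> else 0) = 0"
        by (intro eventually_sequentiallyI[of k]) auto
    qed
    show "AE \<omega> in M. norm (if real k < b 0 0 \<omega> then b 0 0 \<omega> else 0) \<le> b 0 0 \<omega>" for k
      using b_pos(2) by (intro AE_I2) auto
  qed (use integrable_b in auto)
  then show ?thesis by simp
qed

lemma integral_tendsto_of_L1:
  fixes u :: "nat \<Rightarrow> 'a \<Rightarrow> real"
  assumes u: "\<And>N. integrable M (u N)" and v: "integrable M v" and lim: "(\<lambda>N. LINT \<omega>|M. \<bar>u N \<omega> - v \<omega>\<bar>) \<longlonglongrightarrow> 0"
    and F[measurable]: "F \<in> borel_measurable M" and FC: "\<And>\<omega>. \<omega> \<in> space M \<Longrightarrow> \<bar>F \<omega>\<bar> \<le> C"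
  shows "(\<lambda>N. LINT \<omega>|M. u N \<omega> * F \<omega>) \<longlonglongrightarrow> (LINT \<omega>|M. v \<omega> * F \<omega>)"
proof (rule LIM_zero_cancel, rule Lim_null_comparison[OF always_eventually])
  show "\<forall>N. norm ((LINT \<omega>|M. u N \<omega> * F \<omega>) - (LINT \<omega>|M. v \<omega> * F \<omega>)) \<le> C * (LINT \<omega>|M. \<bar>u N \<omega> - v \<omega>\<bar>)"
  proof
    fix N
    have "(LINT \<omega>|M. u N \<omega> * F \<omega>) - (LINT \<omega>|M. v \<omega> * F \<omega>) = (LINT \<omega>|M. u N \<omega> * F \<omega> - v \<omega> * F \<omega>)"
      by (rule Bochner_Integration.integral_diff[symmetric]; rule integrable_bounded_mult[OF _ F FC]) (use u v in auto)
    also have "norm \<dots> \<le> (LINT \<omega>|M. norm (u N \<omega> * F \<omega> - v \<omega> * F \<omega>))"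
      by (rule integral_norm_bound)
    also have "\<dots> \<le> (LINT \<omega>|M. C * \<bar>u N \<omega> - v \<omega>\<bar>)"
    proof (rule integral_mono')
      show "integrable M (\<lambda>\<omega>. C * \<bar>u N \<omega> - v \<omega>\<bar>)" using u v by auto
      fix \<omega> assume \<omega>: "\<omega> \<in> space M"
      have "\<bar>F \<omega>\<bar> * \<bar>u N \<omega> - v \<omega>\<bar> \<le> C * \<bar>u N \<omega> - v \<omega>\<bar>" by (rule mult_right_mono[OF FC[OF \<omega>]]) simp
      then show "norm (u N \<omega> * F \<omega> - v \<omega> * F \<omega>) \<le> C * \<bar>u N \<omega> - v \<omega>\<bar>"
        unfolding left_diff_distrib[symmetric] real_norm_def abs_mult by (simp only: mult.commute)
      show "0 \<le> C * \<bar>u N \<omega> - v \<omega>\<bar>" using order_trans[OF abs_ge_zero FC[OF \<omega>]] by simp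
    qed
    also have "\<dots> = C * (LINT \<omega>|M. \<bar>u N \<omega> - v \<omega>\<bar>)" by simp
    finally show "norm ((LINT \<omega>|M. u N \<omega> * F \<omega>) - (LINT \<omega>|M. v \<omega> * F \<omega>)) \<le> C * (LINT \<omega>|M. \<bar>u N \<omega> - v \<omega>\<bar>)" .
  qed
  show "(\<lambda>N. C * (LINT \<omega>|M. \<bar>u N \<omega> - v \<omega>\<bar>)) \<longlonglongrightarrow> 0"
    by (rule tendsto_mult_right_zero[OF lim])
qed

lemma energy_space_integrable:
  assumes "u \<in> energy_space"
  shows "integrable M u" "integrable M (\<lambda>\<omega>. b 0 0 \<omega> * u \<omega>)"
proof -
  show "integrable M u"
    using energy_H_pairing(1)[OF assms H_const[of 1]] by simp
  have "(\<lambda>\<omega>. b 0 0 \<omega> * 1) \<in> H" by (rule H_b_times[where C = 1]) auto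
  from energy_H_pairing(1)[OF assms this] show "integrable M (\<lambda>\<omega>. b 0 0 \<omega> * u \<omega>)"
    by (simp add: mult.commute)
qed

context
  fixes \<epsilon> :: real
  assumes \<epsilon>: "0 < \<epsilon>"
begin

text \<open>
  The product of conductance and gradient converges because it is uniformly integrable: where \<open>b \<le> k\<close>
  the convergence in \<open>L\<^sup>1\<close> of the gradients suffices, and where \<open>b > k\<close> the inequality
  \<open>x * \<bar>y\<bar> \<le> \<theta> / 2 * (x * y\<^sup>2) + x / (2 * \<theta>)\<close> uses the energy bound and
  the tail of \<open>E b\<close>.
\<close>

lemma approx_flux_tendsto_L1:
  "(\<lambda>N. LINT \<omega>|M. \<bar>trunc N 0 0 \<omega> * approx \<epsilon> N \<omega> - b 0 0 \<omega> * varphi_eps b \<epsilon> \<omega>\<bar>) \<longlonglongrightarrow> 0"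
proof (rule tendstoI)
  fix \<eta> :: real assume \<eta>: "0 < \<eta>"
  let ?a = "approx \<epsilon>" and ?\<phi> = "varphi_eps b \<epsilon>"
  note meas[measurable] = measurable_approx[OF \<epsilon>]
  define B where "B = (LINT \<omega>|M. b 0 0 \<omega>)"
  have B: "0 \<le> B" unfolding B_def by (rule integral_nonneg_AE) (use b_pos(2) in \<open>auto intro!: AE_I2\<close>)
  \<comment> \<open>The energies contribute at most \<open>\<theta> * B\<close> in total, so this choice keeps them below \<open>\<eta> / 2\<close>.\<close>
  define \<theta> where "\<theta> = \<eta> / (2 * (B + 1))"
  have \<theta>: "0 < \<theta>" "\<theta> * B \<le> \<eta> / 2" using \<eta> B by (auto simp: \<theta>_def field_simps)
  define h where "h k \<omega> = (if real k < b 0 0 \<omega> then b 0 0 \<omega> else 0)" for k :: nat and \<omega>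
  have hi: "integrable M (h k)" for k
    by (rule Bochner_Integration.integrable_bound[OF integrable_b]) (auto simp: h_def[abs_def])
  have "\<forall>\<^sub>F k in sequentially. (LINT \<omega>|M. h k \<omega>) < \<theta> * (\<eta> / 4)"
    using order_tendstoD(2)[OF integral_b_tail, of "\<theta> * (\<eta> / 4)"] \<theta> \<eta> by (simp add: h_def)
  then obtain k where k: "(LINT \<omega>|M. h k \<omega>) < \<theta> * (\<eta> / 4)" by (auto simp: eventually_sequentially)
  have "(\<lambda>N. real k * (LINT \<omega>|M. \<bar>?a N \<omega> - ?\<phi> \<omega>\<bar>)) \<longlonglongrightarrow> 0"
    by (rule tendsto_mult_right_zero[OF approx_tendsto_L1[OF \<epsilon>]])
  then have "\<forall>\<^sub>F N in sequentially. real k * (LINT \<omega>|M. \<bar>?a N \<omega> - ?\<phi> \<omega>\<bar>) < \<eta> / 4"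
    by (rule order_tendstoD(2)) (use \<eta> in simp)
  then show "\<forall>\<^sub>F N in sequentially. dist (LINT \<omega>|M. \<bar>trunc N 0 0 \<omega> * ?a N \<omega> - b 0 0 \<omega> * ?\<phi> \<omega>\<bar>) 0 < \<eta>"
    using eventually_ge_at_top[of k]
  proof eventually_elim
    case (elim N)
    note e1 = integrable_approx_energy[OF \<epsilon>, of N] and e2 = varphi_eps_energy(1)[OF \<epsilon>]
    have ia: "integrable M (\<lambda>\<omega>. \<bar>?a N \<omega> - ?\<phi> \<omega>\<bar>)"
      using integrable_approx[OF \<epsilon>, of N] integral_varphi_eps(1)[OF \<epsilon>] by auto
    let ?R = "\<lambda>\<omega>. real k * \<bar>?a N \<omega> - ?\<phi> \<omega>\<bar> + \<theta> / 2 * (trunc N 0 0 \<omega> * (?a N \<omega>)\<^sup>2 + b 0 0 \<omega> * (?\<phi> \<omega>)\<^sup>2) + h k \<omega> / \<theta>"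
    have R: "integrable M ?R" using ia e1 e2 hi by simp
    have bound: "\<bar>trunc N 0 0 \<omega> * ?a N \<omega> - b 0 0 \<omega> * ?\<phi> \<omega>\<bar> \<le> ?R \<omega>" if \<omega>: "\<omega> \<in> space M" for \<omega>
    proof -
      have cN: "0 \<le> trunc N 0 0 \<omega>" "trunc N 0 0 \<omega> \<le> b 0 0 \<omega>" using b_pos(2)[OF \<omega>] by auto
      have sq: "x * \<bar>y\<bar> \<le> \<theta> / 2 * (x * y\<^sup>2) + x / (2 * \<theta>)" if "0 \<le> x" for x y :: real
      proof -
        have "0 \<le> x / (2 * \<theta>) * (\<theta> * \<bar>y\<bar> - 1)\<^sup>2" using that \<theta>(1) by simp
        also have "\<dots> = \<theta> / 2 * (x * y\<^sup>2) + x / (2 * \<theta>) - x * \<bar>y\<bar>"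
          using \<theta>(1) by (simp add: power2_diff power_mult_distrib field_simps power2_eq_square)
        finally show ?thesis by simp
      qed
      show ?thesis
      proof (cases "real k < b 0 0 \<omega>")
        case False
        then have "trunc N 0 0 \<omega> = b 0 0 \<omega>" using elim(2) by auto
        then have "\<bar>trunc N 0 0 \<omega> * ?a N \<omega> - b 0 0 \<omega> * ?\<phi> \<omega>\<bar> = b 0 0 \<omega> * \<bar>?a N \<omega> - ?\<phi> \<omega>\<bar>"
          using b_pos(2)[OF \<omega>] by (simp add: abs_mult flip: right_diff_distrib)
        also have "\<dots> \<le> real k * \<bar>?a N \<omega> - ?\<phi> \<omega>\<bar>" using False by (intro mult_right_mono) auto
        finally have "\<bar>trunc N 0 0 \<omega> * ?a N \<omega> - b 0 0 \<omega> * ?\<phi> \<omega>\<bar> \<le> real k * \<bar>?a N \<omega> - ?\<phi> \<omega>\<bar>" .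
        moreover have "0 \<le> \<theta> / 2 * (trunc N 0 0 \<omega> * (?a N \<omega>)\<^sup>2 + b 0 0 \<omega> * (?\<phi> \<omega>)\<^sup>2)"
          using \<theta>(1) cN b_pos(2)[OF \<omega>] by (intro mult_nonneg_nonneg add_nonneg_nonneg) auto
        ultimately show ?thesis using False by (simp add: h_def)
      next
        case True
        have "\<bar>trunc N 0 0 \<omega> * ?a N \<omega> - b 0 0 \<omega> * ?\<phi> \<omega>\<bar> \<le> trunc N 0 0 \<omega> * \<bar>?a N \<omega>\<bar> + b 0 0 \<omega> * \<bar>?\<phi> \<omega>\<bar>"
          using abs_triangle_ineq4[of "trunc N 0 0 \<omega> * ?a N \<omega>" "b 0 0 \<omega> * ?\<phi> \<omega>"] cN(1) b_pos(2)[OF \<omega>]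
          unfolding abs_mult by (simp only: abs_of_nonneg)
        also have "\<dots> \<le> (\<theta> / 2 * (trunc N 0 0 \<omega> * (?a N \<omega>)\<^sup>2) + trunc N 0 0 \<omega> / (2 * \<theta>)) + (\<theta> / 2 * (b 0 0 \<omega> * (?\<phi> \<omega>)\<^sup>2) + b 0 0 \<omega> / (2 * \<theta>))"
          by (intro add_mono sq cN b_pos(2) \<omega>)
        also have "\<dots> \<le> \<theta> / 2 * (trunc N 0 0 \<omega> * (?a N \<omega>)\<^sup>2 + b 0 0 \<omega> * (?\<phi> \<omega>)\<^sup>2) + h k \<omega> / \<theta>"
        proof -
          have "trunc N 0 0 \<omega> / (2 * \<theta>) + b 0 0 \<omega> / (2 * \<theta>) \<le> b 0 0 \<omega> / (2 * \<theta>) + b 0 0 \<omega> / (2 * \<theta>)"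
            using cN(2) \<theta>(1) by (intro add_right_mono divide_right_mono) auto
          also have "\<dots> = h k \<omega> / \<theta>" using True \<theta>(1) by (simp add: h_def)
          finally show ?thesis by (simp only: distrib_left)
        qed
        also have "\<dots> \<le> ?R \<omega>" by simp
        finally show ?thesis .
      qed
    qed
    have "(LINT \<omega>|M. \<bar>trunc N 0 0 \<omega> * ?a N \<omega> - b 0 0 \<omega> * ?\<phi> \<omega>\<bar>) \<le> (LINT \<omega>|M. ?R \<omega>)"
    proof (rule integral_mono'[OF R bound])
      show "0 \<le> ?R \<omega>" if "\<omega> \<in> space M" for \<omega> using order_trans[OF abs_ge_zero bound[OF that]] .
    qed
    also have "\<dots> = real k * (LINT \<omega>|M. \<bar>?a N \<omega> - ?\<phi> \<omega>\<bar>) + \<theta> / 2 * ((LINT \<omega>|M. trunc N 0 0 \<omega> * (?a N \<omega>)\<^sup>2) + (LINT \<omega>|M. b 0 0 \<omega> * (?\<phi> \<omega>)\<^sup>2)) + (LINT \<omega>|M. h k \<omega>) / \<theta>"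
      using ia e1 e2 hi by simp
    also have "\<dots> < \<eta> / 4 + \<eta> / 2 + \<eta> / 4"
    proof -
      have "real k * (LINT \<omega>|M. \<bar>?a N \<omega> - ?\<phi> \<omega>\<bar>) < \<eta> / 4" by (rule elim(1))
      have "\<theta> / 2 * ((LINT \<omega>|M. trunc N 0 0 \<omega> * (?a N \<omega>)\<^sup>2) + (LINT \<omega>|M. b 0 0 \<omega> * (?\<phi> \<omega>)\<^sup>2)) \<le> \<theta> / 2 * (B + B)"
        using \<theta>(1) approx_energy[OF \<epsilon>, of N] varphi_eps_energy(2)[OF \<epsilon>] unfolding B_def by (intro mult_left_mono add_mono) auto
      moreover have "\<theta> / 2 * (B + B) \<le> \<eta> / 2" using \<theta>(2) by simp
      moreover have "(LINT \<omega>|M. h k \<omega>) / \<theta> < \<eta> / 4" using k \<theta>(1) by (simp add: divide_less_eq mult.commute)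
      ultimately show ?thesis using \<open>real k * _ < _\<close> by linarith
    qed
    also have "\<dots> = \<eta>" by simp
    finally show ?case by (simp add: dist_real_def abs_of_nonneg)
  qed
qed

lemma varphi_eps_weak_equation:
  assumes F[measurable]: "F \<in> borel_measurable M" and FC: "\<And>\<omega>. \<omega> \<in> space M \<Longrightarrow> \<bar>F \<omega>\<bar> \<le> C" and t: "0 \<le> t"
  shows "(LINT \<omega>|M. varphi_eps b \<epsilon> \<omega> * F (\<tau> (- t) 0 \<omega>)) - (LINT \<omega>|M. varphi_eps b \<epsilon> \<omega> * F \<omega>)
       + (LINT \<omega>|M. b 0 0 \<omega> * varphi_eps b \<epsilon> \<omega> * backward_laplacian t F \<omega>)
     = \<epsilon> * (LINT \<omega>|M. (varphi_eps b \<epsilon> \<omega> - 1) * backward_average t 0 F \<omega>)"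
proof -
  let ?a = "approx \<epsilon>" and ?\<phi> = "varphi_eps b \<epsilon>"
  note ia = integrable_approx[OF \<epsilon>] and i\<phi> = integral_varphi_eps(1)[OF \<epsilon>]
  have l1: "(\<lambda>N. LINT \<omega>|M. ?a N \<omega> * G \<omega>) \<longlonglongrightarrow> (LINT \<omega>|M. ?\<phi> \<omega> * G \<omega>)"
    if "G \<in> borel_measurable M" "\<And>\<omega>. \<omega> \<in> space M \<Longrightarrow> \<bar>G \<omega>\<bar> \<le> D" for G D
    by (rule integral_tendsto_of_L1[OF ia i\<phi> approx_tendsto_L1[OF \<epsilon>] that])
  have ica: "integrable M (\<lambda>\<omega>. trunc N 0 0 \<omega> * ?a N \<omega>)" for N
    unfolding approx_def
    using bounded_environment.integrable_conductance_times[OF truncated_bounded_environment[OF \<epsilon>]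
        bounded_environment.measurable_gradient[OF truncated_bounded_environment[OF \<epsilon>]]
        bounded_environment.gradient_bound[OF truncated_bounded_environment[OF \<epsilon>]]] .
  have l2: "(\<lambda>N. LINT \<omega>|M. trunc N 0 0 \<omega> * ?a N \<omega> * G \<omega>) \<longlonglongrightarrow> (LINT \<omega>|M. b 0 0 \<omega> * ?\<phi> \<omega> * G \<omega>)"
    if "G \<in> borel_measurable M" "\<And>\<omega>. \<omega> \<in> space M \<Longrightarrow> \<bar>G \<omega>\<bar> \<le> D" for G D
    by (rule integral_tendsto_of_L1[OF ica energy_space_integrable(2)[OF varphi_eps_energy_space[OF \<epsilon>]] approx_flux_tendsto_L1 that])
  have l3: "(\<lambda>N. LINT \<omega>|M. (?a N \<omega> - 1) * G \<omega>) \<longlonglongrightarrow> (LINT \<omega>|M. (?\<phi> \<omega> - 1) * G \<omega>)"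
    if "G \<in> borel_measurable M" "\<And>\<omega>. \<omega> \<in> space M \<Longrightarrow> \<bar>G \<omega>\<bar> \<le> D" for G D
    by (rule integral_tendsto_of_L1[OF _ _ _ that]) (use ia i\<phi> approx_tendsto_L1[OF \<epsilon>] in auto)
  have eq: "(LINT \<omega>|M. ?a N \<omega> * F (\<tau> (- t) 0 \<omega>)) - (LINT \<omega>|M. ?a N \<omega> * F \<omega>)
       + (LINT \<omega>|M. trunc N 0 0 \<omega> * ?a N \<omega> * backward_laplacian t F \<omega>)
     = \<epsilon> * (LINT \<omega>|M. (?a N \<omega> - 1) * backward_average t 0 F \<omega>)" for N
    unfolding approx_def
    by (rule bounded_environment.gradient_weak_equation[OF truncated_bounded_environment[OF \<epsilon>] F FC t])
  have "(\<lambda>N. (LINT \<omega>|M. ?a N \<omega> * F (\<tau> (- t) 0 \<omega>)) - (LINT \<omega>|M. ?a N \<omega> * F \<omega>)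
       + (LINT \<omega>|M. trunc N 0 0 \<omega> * ?a N \<omega> * backward_laplacian t F \<omega>))
    \<longlonglongrightarrow> (LINT \<omega>|M. ?\<phi> \<omega> * F (\<tau> (- t) 0 \<omega>)) - (LINT \<omega>|M. ?\<phi> \<omega> * F \<omega>)
       + (LINT \<omega>|M. b 0 0 \<omega> * ?\<phi> \<omega> * backward_laplacian t F \<omega>)"
    by (intro tendsto_intros l1[OF _ FC[OF shift_in_space]] l1[OF F FC] l2[OF _ backward_laplacian_bound[OF F FC t]]) auto
  moreover have "(\<lambda>N. \<epsilon> * (LINT \<omega>|M. (?a N \<omega> - 1) * backward_average t 0 F \<omega>)) \<longlonglongrightarrow> \<epsilon> * (LINT \<omega>|M. (?\<phi> \<omega> - 1) * backward_average t 0 F \<omega>)"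
    by (intro tendsto_intros l3[OF _ backward_average_bound[OF F FC t]]) auto
  ultimately show ?thesis unfolding eq by (rule LIMSEQ_unique)
qed

end

text \<open>
  All test functions in the weak equation belong to \<open>H_space M b\<close>; for \<open>b * backward_laplacian t
  F\<close> this is the condition \<open>E b < \<infinity>\<close>. The killing term disappears since it carries the
  factor \<open>e k\<close>.
\<close>

lemma weak_limit_equation:
  assumes e: "\<And>k. 0 < e k" "e \<longlonglongrightarrow> 0"
    and lim: "\<And>f. f \<in> H \<Longrightarrow> (\<lambda>k. LINT \<omega>|M. varphi_eps b (e k) \<omega> * f \<omega>) \<longlonglongrightarrow> (LINT \<omega>|M. \<phi> \<omega> * f \<omega>)"
    and F[measurable]: "F \<in> borel_measurable M" and FC: "\<And>\<omega>. \<omega> \<in> space M \<Longrightarrow> \<bar>F \<omega>\<bar> \<le> C" and t: "0 \<le> t"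
  shows "(LINT \<omega>|M. \<phi> \<omega> * F (\<tau> (- t) 0 \<omega>)) - (LINT \<omega>|M. \<phi> \<omega> * F \<omega>)
       + (LINT \<omega>|M. b 0 0 \<omega> * \<phi> \<omega> * backward_laplacian t F \<omega>) = 0"
proof -
  let ?\<phi> = "\<lambda>k. varphi_eps b (e k)"
  have H1: "(\<lambda>\<omega>. F (\<tau> (- t) 0 \<omega>)) \<in> H" by (rule H_bounded[OF _ FC[OF shift_in_space]]) auto
  have H2: "F \<in> H" by (rule H_bounded[OF F FC])
  have H3: "(\<lambda>\<omega>. b 0 0 \<omega> * backward_laplacian t F \<omega>) \<in> H"
    by (rule H_b_times[OF _ backward_laplacian_bound[OF F FC t]]) auto
  have H4: "backward_average t 0 F \<in> H" by (rule H_bounded[OF _ backward_average_bound[OF F FC t]]) auto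
  have i4: "integrable M (backward_average t 0 F)" by (rule integrable_bounded[OF _ backward_average_bound[OF F FC t]]) auto
  have comm: "(LINT \<omega>|M. b 0 0 \<omega> * f \<omega> * backward_laplacian t F \<omega>) = (LINT \<omega>|M. f \<omega> * (b 0 0 \<omega> * backward_laplacian t F \<omega>))" for f
    by (rule Bochner_Integration.integral_cong) auto
  have r: "(LINT \<omega>|M. (?\<phi> k \<omega> - 1) * backward_average t 0 F \<omega>) = (LINT \<omega>|M. ?\<phi> k \<omega> * backward_average t 0 F \<omega>) - (LINT \<omega>|M. backward_average t 0 F \<omega>)" for k
    using varphi_eps_pairing(1)[OF e(1) H4] i4 by (simp add: left_diff_distrib)
  have eq: "(\<lambda>k. (LINT \<omega>|M. ?\<phi> k \<omega> * F (\<tau> (- t) 0 \<omega>)) - (LINT \<omega>|M. ?\<phi> k \<omega> * F \<omega>)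
       + (LINT \<omega>|M. b 0 0 \<omega> * ?\<phi> k \<omega> * backward_laplacian t F \<omega>))
     = (\<lambda>k. e k * ((LINT \<omega>|M. ?\<phi> k \<omega> * backward_average t 0 F \<omega>) - (LINT \<omega>|M. backward_average t 0 F \<omega>)))"
    unfolding r[symmetric] by (rule ext, rule varphi_eps_weak_equation[OF e(1) F FC t])
  have "(\<lambda>k. (LINT \<omega>|M. ?\<phi> k \<omega> * F (\<tau> (- t) 0 \<omega>)) - (LINT \<omega>|M. ?\<phi> k \<omega> * F \<omega>)
       + (LINT \<omega>|M. b 0 0 \<omega> * ?\<phi> k \<omega> * backward_laplacian t F \<omega>))
     \<longlonglongrightarrow> (LINT \<omega>|M. \<phi> \<omega> * F (\<tau> (- t) 0 \<omega>)) - (LINT \<omega>|M. \<phi> \<omega> * F \<omega>)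
       + (LINT \<omega>|M. b 0 0 \<omega> * \<phi> \<omega> * backward_laplacian t F \<omega>)"
    unfolding comm by (intro tendsto_intros lim H1 H2 H3)
  moreover have "(\<lambda>k. e k * ((LINT \<omega>|M. ?\<phi> k \<omega> * backward_average t 0 F \<omega>) - (LINT \<omega>|M. backward_average t 0 F \<omega>)))
     \<longlonglongrightarrow> 0 * ((LINT \<omega>|M. \<phi> \<omega> * backward_average t 0 F \<omega>) - (LINT \<omega>|M. backward_average t 0 F \<omega>))"
    by (intro tendsto_intros e(2) lim H4)
  ultimately have "(LINT \<omega>|M. \<phi> \<omega> * F (\<tau> (- t) 0 \<omega>)) - (LINT \<omega>|M. \<phi> \<omega> * F \<omega>)
       + (LINT \<omega>|M. b 0 0 \<omega> * \<phi> \<omega> * backward_laplacian t F \<omega>)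
     = 0 * ((LINT \<omega>|M. \<phi> \<omega> * backward_average t 0 F \<omega>) - (LINT \<omega>|M. backward_average t 0 F \<omega>))"
    unfolding eq by (rule LIMSEQ_unique)
  then show ?thesis by simp
qed

end

section \<open>A continuous version of the limit\<close>

text \<open>
  Written with a sequence of interval lengths, so that the limit is measurable in further parameters.
\<close>

lemma averages_tendsto:
  fixes J :: "real \<Rightarrow> real"
  assumes J: "continuous_on {v..v + 1} J"
  shows "(\<lambda>m. real (Suc m) * (LINT s:{v..v + 1 / real (Suc m)}|lborel. J s)) \<longlonglongrightarrow> J v"
proof (rule tendstoI)
  fix e :: real assume e: "0 < e"
  have "v \<in> {v..v + 1}" by simp
  with J e obtain d where d: "0 < d" "\<And>s. s \<in> {v..v + 1} \<Longrightarrow> dist s v < d \<Longrightarrow> dist (J s) (J v) < e / 2"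
    unfolding continuous_on_iff by (meson half_gt_zero)
  obtain k where k: "1 / real (Suc k) < d" using d(1) nat_approx_posE by blast
  show "\<forall>\<^sub>F m in sequentially. dist (real (Suc m) * (LINT s:{v..v + 1 / real (Suc m)}|lborel. J s)) (J v) < e"
  proof (rule eventually_sequentiallyI[of k])
    fix m assume m: "k \<le> m"
    define \<delta> where "\<delta> = 1 / real (Suc m)"
    have \<delta>: "0 < \<delta>" "\<delta> \<le> 1" "\<delta> < d" "real (Suc m) * \<delta> = 1"
    proof -
      have "1 / real (Suc m) \<le> 1 / real (Suc k)" using m by (intro divide_left_mono) auto
      then show "\<delta> < d" using k by (simp add: \<delta>_def)
    qed (auto simp: \<delta>_def)
    have c: "continuous_on {v..v + \<delta>} J" by (rule continuous_on_subset[OF J]) (use \<delta> in auto)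
    have i: "set_integrable lborel {v..v + \<delta>} J"
      using set_integrable_times_continuous[OF set_integrable_const_Icc[of _ _ 1] c] by (simp only: mult_1)
    have near: "\<bar>J s - J v\<bar> \<le> e / 2" if "s \<in> {v..v + \<delta>}" for s
      using d(2)[of s] that \<delta> by (auto simp: dist_real_def intro: less_imp_le)
    have const: "(LINT s:{v..v + \<delta>}|lborel. a) = \<delta> * a" for a
      using \<delta>(1) by (simp add: set_lebesgue_integral_def)
    have up: "(LINT s:{v..v + \<delta>}|lborel. J s) \<le> \<delta> * (J v + e / 2)"
      unfolding const[symmetric] by (rule set_integral_mono[OF i set_integrable_const_Icc]) (drule near, unfold abs_le_iff, linarith)
    have lo: "\<delta> * (J v - e / 2) \<le> (LINT s:{v..v + \<delta>}|lborel. J s)"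
      unfolding const[symmetric]
      by (rule set_integral_mono[OF set_integrable_const_Icc i]) (drule near, unfold abs_le_iff, linarith)
    have s1: "real (Suc m) * (\<delta> * x) = x" for x using \<delta>(4) by (simp flip: mult.assoc)
    have "real (Suc m) * (LINT s:{v..v + \<delta>}|lborel. J s) \<le> J v + e / 2"
      using mult_left_mono[OF up, of "real (Suc m)"] unfolding s1 by simp
    moreover have "J v - e / 2 \<le> real (Suc m) * (LINT s:{v..v + \<delta>}|lborel. J s)"
      using mult_left_mono[OF lo, of "real (Suc m)"] unfolding s1 by simp
    ultimately show "dist (real (Suc m) * (LINT s:{v..v + 1 / real (Suc m)}|lborel. J s)) (J v) < e"
      using e unfolding dist_real_def \<delta>_def[symmetric] abs_less_iff by linarith
  qed
qed

text \<open>
  The properties of a weak limit from which all remaining conclusions are derived.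
\<close>

locale stationary_density = integrable_environment M b \<tau>
  for M :: "'a measure" and b \<tau> +
  fixes \<phi> :: "'a \<Rightarrow> real"
  assumes \<phi>_measurable [measurable]: "\<phi> \<in> borel_measurable M"
    and \<phi>_nonneg: "\<And>\<omega>. 0 \<le> \<phi> \<omega>"
    and \<phi>_energy: "\<phi> \<in> energy_space"
    and \<phi>_integral: "(LINT \<omega>|M. \<phi> \<omega>) = 1"
    and weak_equation: "\<And>F C t. F \<in> borel_measurable M \<Longrightarrow> (\<And>\<omega>. \<omega> \<in> space M \<Longrightarrow> \<bar>F \<omega>\<bar> \<le> C) \<Longrightarrow> 0 \<le> t \<Longrightarrow>
       (LINT \<omega>|M. \<phi> \<omega> * F (\<tau> (- t) 0 \<omega>)) - (LINT \<omega>|M. \<phi> \<omega> * F \<omega>)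
       + (LINT \<omega>|M. b 0 0 \<omega> * \<phi> \<omega> * backward_laplacian t F \<omega>) = 0"
begin

definition drift :: "'a \<Rightarrow> real" where "drift = L_plus b \<tau> \<phi>"

lemma measurable_L_plus:
  assumes [measurable]: "f \<in> borel_measurable M"
  shows "L_plus b \<tau> f \<in> borel_measurable M"
  unfolding L_plus_def[abs_def] by measurable

lemma measurable_drift [measurable]: "drift \<in> borel_measurable M"
  unfolding drift_def by (rule measurable_L_plus[OF \<phi>_measurable])

lemma integrable_drift: "integrable M drift"
proof -
  note i = energy_space_integrable(2)[OF \<phi>_energy]
  have s: "drift \<omega> = (\<lambda>\<omega>. b 0 0 \<omega> * \<phi> \<omega>) (\<tau> 0 1 \<omega>) + (\<lambda>\<omega>. b 0 0 \<omega> * \<phi> \<omega>) (\<tau> 0 (- 1) \<omega>) - 2 * (b 0 0 \<omega> * \<phi> \<omega>)"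
    if "\<omega> \<in> space M" for \<omega>
    by (simp add: drift_def L_plus_def conductance_shift that)
  show ?thesis
    by (subst Bochner_Integration.integrable_cong[OF refl s])
       (use i integrable_shift[OF i, of 0 1] integrable_shift[OF i, of 0 "-1"] in auto)
qed

text \<open>
  The increment has expectation 0 against every bounded function, in particular against its own sign.
\<close>

lemma AE_increment:
  assumes t: "0 \<le> t"
  shows "AE \<omega> in M. \<phi> (\<tau> t 0 \<omega>) = \<phi> \<omega> - (LINT s:{0..t}|lborel. drift (\<tau> s 0 \<omega>))"
proof -
  define Z where "Z \<omega> = \<phi> (\<tau> t 0 \<omega>) - \<phi> \<omega> + (LINT s:{0..t}|lborel. drift (\<tau> s 0 \<omega>))" for \<omega>
  note inc = expected_increment[OF energy_space_integrable[OF \<phi>_energy], folded drift_def, folded Z_def]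
  have iZ: "integrable M Z"
    using inc(2)[of "\<lambda>_. 1" 1] unfolding Z_def[abs_def] by simp
  note [measurable] = borel_measurable_integrable[OF iZ]
  have sgn: "\<bar>sgn (Z \<omega>)\<bar> \<le> 1" for \<omega> by (simp add: sgn_if)
  have sm: "(\<lambda>\<omega>. sgn (Z \<omega>)) \<in> borel_measurable M" by measurable
  have "(LINT \<omega>|M. \<bar>Z \<omega>\<bar>) = (LINT \<omega>|M. sgn (Z \<omega>) * Z \<omega>)"
    by (rule Bochner_Integration.integral_cong) (auto simp: sgn_if)
  also have "\<dots> = 0"
    unfolding Z_def[of _]
    using inc(1)[OF sm sgn, of t] weak_equation[OF sm sgn t] by (simp add: Z_def)
  finally have "AE \<omega> in M. \<bar>Z \<omega>\<bar> = 0"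
    using integral_nonneg_eq_0_iff_AE[of M "\<lambda>\<omega>. \<bar>Z \<omega>\<bar>"] iZ by auto
  then show ?thesis by eventually_elim (simp add: Z_def)
qed

text \<open>
  In such an environment the field at the origin agrees after time 0 with an indefinite integral, up to a null set of
  times.
\<close>

definition good_time :: "'a \<Rightarrow> bool" where
  "good_time \<omega> \<longleftrightarrow> (AE t in lborel. 0 \<le> t \<longrightarrow> \<phi> (\<tau> t 0 \<omega>) = \<phi> \<omega> - (LINT s:{0..t}|lborel. drift (\<tau> s 0 \<omega>)))
     \<and> (\<forall>n::nat. set_integrable lborel {0..real n} (\<lambda>s. drift (\<tau> s 0 \<omega>)))"

lemma AE_time_commute:
  assumes "{p \<in> space (lborel \<Otimes>\<^sub>M M). P (fst p) (snd p)} \<in> sets (lborel \<Otimes>\<^sub>M M)"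
  shows "(AE t in lborel. AE \<omega> in M. P t \<omega>) \<longleftrightarrow> (AE \<omega> in M. AE t in lborel. P (t::real) \<omega>)"
proof -
  interpret pair_sigma_finite lborel M ..
  show ?thesis by (rule AE_commute[OF assms])
qed

lemma AE_good_time: "AE \<omega> in M. good_time \<omega>"
proof -
  have [measurable]: "(\<lambda>p. LINT s:{0..fst p}|lborel. drift (\<tau> s 0 (snd p))) \<in> borel_measurable (lborel \<Otimes>\<^sub>M M)"
    by (rule borel_measurable_set_integral_Icc) measurable
  have "AE t in lborel. AE \<omega> in M. 0 \<le> t \<longrightarrow> \<phi> (\<tau> t 0 \<omega>) = \<phi> \<omega> - (LINT s:{0..t}|lborel. drift (\<tau> s 0 \<omega>))"
  proof (rule AE_I2)
    fix t :: real
    show "AE \<omega> in M. 0 \<le> t \<longrightarrow> \<phi> (\<tau> t 0 \<omega>) = \<phi> \<omega> - (LINT s:{0..t}|lborel. drift (\<tau> s 0 \<omega>))"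
      by (rule AE_impI) (rule AE_increment)
  qed
  then have 1: "AE \<omega> in M. AE t in lborel. 0 \<le> t \<longrightarrow> \<phi> (\<tau> t 0 \<omega>) = \<phi> \<omega> - (LINT s:{0..t}|lborel. drift (\<tau> s 0 \<omega>))"
    by (subst (asm) AE_time_commute) measurable
  have 2: "AE \<omega> in M. \<forall>n::nat. set_integrable lborel {0..real n} (\<lambda>s. drift (\<tau> s 0 \<omega>))"
    unfolding AE_all_countable by (intro allI AE_integrable_along_time integrable_drift)
  show ?thesis using 1 2 by eventually_elim (simp add: good_time_def)
qed

text \<open>
  Right averages over vanishing time intervals. Changing the values of \<open>\<phi>\<close> on a null set of times
  does not affect them, and they recover the continuous representative along every time line.
\<close>

definition \<psi> :: "'a \<Rightarrow> real" where
  "\<psi> \<omega> = lim (\<lambda>m. real (Suc m) * (LINT s:{0..0 + 1 / real (Suc m)}|lborel. \<phi> (\<tau> s 0 \<omega>)))"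

lemma measurable_\<psi> [measurable]: "\<psi> \<in> borel_measurable M"
proof -
  have "(\<lambda>\<omega>. LINT s:{0..0 + 1 / real (Suc m)}|lborel. \<phi> (\<tau> s 0 \<omega>)) \<in> borel_measurable M" for m
    by (rule borel_measurable_set_integral_Icc) measurable
  then show ?thesis unfolding \<psi>_def[abs_def] by (intro borel_measurable_lim_metric) measurable
qed

lemma \<psi>_along_good_time:
  assumes \<omega>: "\<omega> \<in> space M" and good: "good_time \<omega>" and t: "0 \<le> t"
  shows "\<psi> (\<tau> t 0 \<omega>) = \<phi> \<omega> - (LINT s:{0..t}|lborel. drift (\<tau> s 0 \<omega>))"
proof -
  define J where "J t = \<phi> \<omega> - (LINT s:{0..t}|lborel. drift (\<tau> s 0 \<omega>))" for t
  have int: "set_integrable lborel {0..a} (\<lambda>s. drift (\<tau> s 0 \<omega>))" for a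
  proof -
    obtain n where "a \<le> real n" using real_arch_simple by blast
    then show ?thesis
      using good unfolding good_time_def by (auto intro: set_integrable_subset[of lborel "{0..real n}"])
  qed
  have "continuous_on {0..t + 1} J"
    unfolding J_def by (intro continuous_intros indefinite_integral_continuous int)
  then have cont: "continuous_on {t..t + 1} J" by (rule continuous_on_subset) (use t in auto)
  have av: "(LINT s:{0..0 + d}|lborel. \<phi> (\<tau> s 0 (\<tau> t 0 \<omega>))) = (LINT s:{t..t + d}|lborel. J s)" if "0 < d" for d
  proof -
    have "(LINT s:{0..0 + d}|lborel. \<phi> (\<tau> s 0 (\<tau> t 0 \<omega>))) = (LINT s:{0..d}|lborel. (\<lambda>s. \<phi> (\<tau> s 0 \<omega>)) (s + t))"
      by (simp add: shift_add \<omega>)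
    also have "\<dots> = (LINT s:{0 + t..d + t}|lborel. \<phi> (\<tau> s 0 \<omega>))"
      by (rule set_integral_time_shift[symmetric])
    also have "\<dots> = (LINT s:{t..t + d}|lborel. J s)"
      unfolding set_lebesgue_integral_def
    proof (rule integral_cong_AE)
      have "(\<lambda>s. \<phi> (\<tau> s 0 \<omega>)) \<in> borel_measurable borel" by (rule measurable_time[OF \<phi>_measurable \<omega>])
      then show "(\<lambda>s. indicator {0 + t..d + t} s *\<^sub>R \<phi> (\<tau> s 0 \<omega>)) \<in> borel_measurable lborel" by measurable
      have "continuous_on {t..t + d} J"
      proof (rule continuous_on_subset)
        show "continuous_on {0..t + d} J"
          unfolding J_def by (intro continuous_intros indefinite_integral_continuous int)
      qed (use t in auto)
      then show "(\<lambda>s. indicator {t..t + d} s *\<^sub>R J s) \<in> borel_measurable lborel"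
        using borel_measurable_continuous_on_indicator[of "{t..t + d}" J] by simp
      have "AE s in lborel. 0 \<le> s \<longrightarrow> \<phi> (\<tau> s 0 \<omega>) = J s"
        using good unfolding good_time_def J_def by blast
      then show "AE s in lborel. indicator {0 + t..d + t} s *\<^sub>R \<phi> (\<tau> s 0 \<omega>) = indicator {t..t + d} s *\<^sub>R J s"
        by eventually_elim (use t in \<open>auto simp: indicator_def add.commute\<close>)
    qed
    finally show ?thesis .
  qed
  have "(\<lambda>m. real (Suc m) * (LINT s:{0..0 + 1 / real (Suc m)}|lborel. \<phi> (\<tau> s 0 (\<tau> t 0 \<omega>)))) \<longlonglongrightarrow> J t"
  proof -
    have "(LINT s:{0..0 + 1 / real (Suc m)}|lborel. \<phi> (\<tau> s 0 (\<tau> t 0 \<omega>))) = (LINT s:{t..t + 1 / real (Suc m)}|lborel. J s)" for m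
      by (rule av) simp
    then show ?thesis using averages_tendsto[OF cont] by (simp only:)
  qed
  then show ?thesis unfolding \<psi>_def J_def[symmetric] by (rule limI)
qed

text \<open>
  The two functions agree along almost every time line at almost every time, hence at some fixed time almost surely,
  and the law of the environment is invariant.
\<close>

lemma \<psi>_eq_\<phi>: "AE \<omega> in M. \<psi> \<omega> = \<phi> \<omega>"
proof -
  have "AE \<omega> in M. AE t in lborel. 0 \<le> t \<longrightarrow> \<psi> (\<tau> t 0 \<omega>) = \<phi> (\<tau> t 0 \<omega>)"
    using AE_good_time AE_space
  proof eventually_elim
    case (elim \<omega>)
    have "AE t in lborel. 0 \<le> t \<longrightarrow> \<phi> (\<tau> t 0 \<omega>) = \<phi> \<omega> - (LINT s:{0..t}|lborel. drift (\<tau> s 0 \<omega>))"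
      using elim(1) by (simp add: good_time_def)
    then show ?case
      by eventually_elim (use \<psi>_along_good_time[OF elim(2,1)] in simp)
  qed
  then have "AE t in lborel. AE \<omega> in M. 0 \<le> t \<longrightarrow> \<psi> (\<tau> t 0 \<omega>) = \<phi> (\<tau> t 0 \<omega>)"
    by (subst AE_time_commute) measurable
  then have "\<exists>t\<ge>0. AE \<omega> in M. 0 \<le> t \<longrightarrow> \<psi> (\<tau> t 0 \<omega>) = \<phi> (\<tau> t 0 \<omega>)"
  proof (rule contrapos_pp)
    assume no: "\<not> (\<exists>t\<ge>0. AE \<omega> in M. 0 \<le> t \<longrightarrow> \<psi> (\<tau> t 0 \<omega>) = \<phi> (\<tau> t 0 \<omega>))"
    show "\<not> (AE t in lborel. AE \<omega> in M. 0 \<le> t \<longrightarrow> \<psi> (\<tau> t 0 \<omega>) = \<phi> (\<tau> t 0 \<omega>))"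
    proof
      assume "AE t in lborel. AE \<omega> in M. 0 \<le> t \<longrightarrow> \<psi> (\<tau> t 0 \<omega>) = \<phi> (\<tau> t 0 \<omega>)"
      then have "AE t in lborel. t \<notin> {0..1::real}" by eventually_elim (use no in auto)
      then have "emeasure lborel {0..1::real} = 0" by (subst (asm) AE_iff_measurable[of "{0..1}"]) auto
      then show False by simp
    qed
  qed
  then obtain t where "0 \<le> t" "AE \<omega> in M. \<psi> (\<tau> t 0 \<omega>) = \<phi> (\<tau> t 0 \<omega>)" by auto
  from AE_shift[OF this(2), of "- t" 0] AE_space show ?thesis
    by eventually_elim (simp add: shift_add shift_zero)
qed

definition good :: "'a \<Rightarrow> bool" where
  "good \<omega> \<longleftrightarrow> \<omega> \<in> space M \<and> (\<forall>(n::nat) x. good_time (\<tau> (- real n) x \<omega>)) \<and> (AE t in lborel. \<forall>x. \<psi> (\<tau> t x \<omega>) = \<phi> (\<tau> t x \<omega>))"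

lemma AE_good: "AE \<omega> in M. good \<omega>"
proof -
  have 1: "AE \<omega> in M. \<forall>(n::nat) x. good_time (\<tau> (- real n) x \<omega>)"
    unfolding AE_all_countable by (intro allI AE_shift AE_good_time)
  have "AE \<omega> in M. \<forall>x. \<psi> (\<tau> t x \<omega>) = \<phi> (\<tau> t x \<omega>)" for t
    unfolding AE_all_countable by (intro allI AE_shift \<psi>_eq_\<phi>)
  then have "AE t in lborel. AE \<omega> in M. \<forall>x. \<psi> (\<tau> t x \<omega>) = \<phi> (\<tau> t x \<omega>)" by (rule AE_I2)
  then have 2: "AE \<omega> in M. AE t in lborel. \<forall>x. \<psi> (\<tau> t x \<omega>) = \<phi> (\<tau> t x \<omega>)"
    by (subst (asm) AE_time_commute) measurable
  show ?thesis using 1 2 AE_space by eventually_elim (simp add: good_def)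
qed

text \<open>
  The identity from \<open>good_time\<close> is used for the environments shifted to the times \<open>- n\<close>, so
  that it covers all real times. Under the integral \<open>\<phi>\<close> may be replaced by \<open>\<psi>\<close>, as
  they differ only on a null set of times.
\<close>

lemma \<psi>_primitive:
  assumes good: "good \<omega>"
  shows "primitive_from t (\<lambda>s. \<psi> (\<tau> s x \<omega>)) (\<lambda>s. - L_plus b \<tau> \<psi> (\<tau> s x \<omega>))"
proof -
  have \<omega>: "\<omega> \<in> space M" using good by (simp add: good_def)
  obtain n :: nat where n: "- t \<le> real n" using real_arch_simple by blast
  define \<omega>' where "\<omega>' = \<tau> (- real n) x \<omega>"
  have \<omega>': "\<omega>' \<in> space M" unfolding \<omega>'_def by (rule shift_in_space[OF \<omega>])
  have gt: "good_time \<omega>'" using good by (simp add: good_def \<omega>'_def)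
  have sh: "\<tau> r 0 \<omega>' = \<tau> (r - real n) x \<omega>" for r by (simp add: \<omega>'_def shift_add \<omega>)
  have dr: "AE s in lborel. drift (\<tau> s x \<omega>) = L_plus b \<tau> \<psi> (\<tau> s x \<omega>)"
  proof -
    have "AE t in lborel. \<forall>x. \<psi> (\<tau> t x \<omega>) = \<phi> (\<tau> t x \<omega>)" using good by (simp add: good_def)
    then show ?thesis by eventually_elim (simp add: drift_def L_plus_def shift_add \<omega>)
  qed
  have m1: "(\<lambda>s. drift (\<tau> s x \<omega>)) \<in> borel_measurable borel" by (rule measurable_time[OF measurable_drift \<omega>])
  have m2: "(\<lambda>s. L_plus b \<tau> \<psi> (\<tau> s x \<omega>)) \<in> borel_measurable borel" by (rule measurable_time[OF measurable_L_plus[OF measurable_\<psi>] \<omega>])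
  have int': "set_integrable lborel {0..a} (\<lambda>s. drift (\<tau> s 0 \<omega>'))" for a
  proof -
    obtain k where "a \<le> real k" using real_arch_simple by blast
    then show ?thesis
      using gt unfolding good_time_def by (auto intro: set_integrable_subset[of lborel "{0..real k}"])
  qed
  have shift_int: "set_integrable lborel {- real n..a} (\<lambda>s. drift (\<tau> s x \<omega>))" for a
  proof -
    have "integrable lborel (\<lambda>s. (\<lambda>s. indicator {0..a + real n} s *\<^sub>R drift (\<tau> s 0 \<omega>')) (real n + 1 * s))"
      by (rule lborel_integrable_real_affine) (use int'[of "a + real n"] in \<open>auto simp: set_integrable_def\<close>)
    also have "(\<lambda>s. (\<lambda>s. indicator {0..a + real n} s *\<^sub>R drift (\<tau> s 0 \<omega>')) (real n + 1 * s)) = (\<lambda>s. indicator {- real n..a} s *\<^sub>R drift (\<tau> s x \<omega>))"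
      by (auto simp: sh indicator_def fun_eq_iff)
    finally show ?thesis by (simp add: set_integrable_def)
  qed
  have cong_int: "set_integrable lborel {- real n..a} (\<lambda>s. L_plus b \<tau> \<psi> (\<tau> s x \<omega>))" for a
    using shift_int[of a] unfolding set_integrable_def
    by (rule integrable_cong_AE_imp) (use m2 dr in \<open>auto elim!: eventually_mono\<close>)
  have cong_val: "(LINT s:{- real n..a}|lborel. L_plus b \<tau> \<psi> (\<tau> s x \<omega>)) = (LINT s:{- real n..a}|lborel. drift (\<tau> s x \<omega>))" for a
    unfolding set_lebesgue_integral_def
    by (rule integral_cong_AE) (use m1 m2 dr in \<open>auto elim!: eventually_mono\<close>)
  have val: "\<psi> (\<tau> s x \<omega>) = \<phi> \<omega>' - (LINT r:{- real n..s}|lborel. drift (\<tau> r x \<omega>))" if "- real n \<le> s" for s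
  proof -
    have "\<psi> (\<tau> (s + real n) 0 \<omega>') = \<phi> \<omega>' - (LINT r:{0..s + real n}|lborel. drift (\<tau> r 0 \<omega>'))"
      by (rule \<psi>_along_good_time[OF \<omega>' gt]) (use that in simp)
    also have "(LINT r:{0..s + real n}|lborel. drift (\<tau> r 0 \<omega>')) = (LINT r:{- real n..s}|lborel. drift (\<tau> r x \<omega>))"
      using set_integral_time_shift[of "- real n" "real n" s "\<lambda>r. drift (\<tau> r 0 \<omega>')"] by (simp add: sh)
    finally show ?thesis by (simp add: sh)
  qed
  have "primitive_from (- real n) (\<lambda>s. \<phi> \<omega>' + (LINT r:{- real n..s}|lborel. - L_plus b \<tau> \<psi> (\<tau> r x \<omega>))) (\<lambda>s. - L_plus b \<tau> \<psi> (\<tau> s x \<omega>))"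
  proof (rule primitive_from_indefinite)
    show "set_integrable lborel {- real n..s} (\<lambda>s. - L_plus b \<tau> \<psi> (\<tau> s x \<omega>))" for s
      using cong_int[of s] set_integrable_mult_right[of "- 1" lborel "{- real n..s}" "\<lambda>s. L_plus b \<tau> \<psi> (\<tau> s x \<omega>)"] by simp
  qed
  then have "primitive_from (- real n) (\<lambda>s. \<psi> (\<tau> s x \<omega>)) (\<lambda>s. - L_plus b \<tau> \<psi> (\<tau> s x \<omega>))"
  proof (rule primitive_from_cong)
    fix s assume "- real n \<le> s"
    then show "\<phi> \<omega>' + (LINT r:{- real n..s}|lborel. - L_plus b \<tau> \<psi> (\<tau> r x \<omega>)) = \<psi> (\<tau> s x \<omega>)"
      using val[of s] set_integral_uminus[OF cong_int[of s]] cong_val[of s] by simp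
  qed simp
  then show ?thesis by (rule primitive_from_later) (use n in simp)
qed

lemma \<psi>_isCont:
  assumes "good \<omega>"
  shows "isCont (\<lambda>s. \<psi> (\<tau> s x \<omega>)) s"
proof -
  have "continuous_on {s - 1..s + 1} (\<lambda>s. \<psi> (\<tau> s x \<omega>))"
    by (rule primitive_from_continuous_on[OF \<psi>_primitive[OF assms]])
  then show ?thesis by (rule continuous_on_interior) simp
qed

lemma \<psi>_path_properties:
  assumes good: "good \<omega>"
  shows "continuous_on UNIV (\<lambda>t. \<psi> (\<tau> t x \<omega>)) \<and>
    (\<forall>t1 t2. t1 \<le> t2 \<longrightarrow> set_integrable lborel {t1..t2} (\<lambda>s. L_plus b \<tau> \<psi> (\<tau> s x \<omega>)) \<and>
       \<psi> (\<tau> t2 x \<omega>) - \<psi> (\<tau> t1 x \<omega>) + (LINT s:{t1..t2}|lborel. L_plus b \<tau> \<psi> (\<tau> s x \<omega>)) = 0)"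
proof (intro conjI allI impI)
  show "continuous_on UNIV (\<lambda>t. \<psi> (\<tau> t x \<omega>))"
    by (simp add: continuous_on_eq_continuous_at \<psi>_isCont[OF good])
  fix t1 t2 :: real assume t: "t1 \<le> t2"
  note P = \<psi>_primitive[OF good, of t1 x]
  from primitive_from_integrable[OF P order_refl, of t2]
  show int: "set_integrable lborel {t1..t2} (\<lambda>s. L_plus b \<tau> \<psi> (\<tau> s x \<omega>))"
    using set_integrable_mult_right[of "- 1" lborel "{t1..t2}" "\<lambda>s. - L_plus b \<tau> \<psi> (\<tau> s x \<omega>)"] by simp
  show "\<psi> (\<tau> t2 x \<omega>) - \<psi> (\<tau> t1 x \<omega>) + (LINT s:{t1..t2}|lborel. L_plus b \<tau> \<psi> (\<tau> s x \<omega>)) = 0"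
    using primitive_from_diff[OF P order_refl t] set_integral_uminus[OF int] by simp
qed

lemma \<psi>_nonneg_everywhere: "AE \<omega> in M. \<forall>x s. 0 \<le> \<psi> (\<tau> s x \<omega>)"
proof (rule AE_nonneg_along_shifts)
  show "AE \<omega> in M. 0 \<le> \<psi> \<omega>" using \<psi>_eq_\<phi> by eventually_elim (simp add: \<phi>_nonneg)
  show "AE \<omega> in M. \<forall>x s. isCont (\<lambda>s. \<psi> (\<tau> s x \<omega>)) s"
    using AE_good by eventually_elim (simp add: \<psi>_isCont)
qed

end

section \<open>Events that are invariant forward in time\<close>

context dynamical_environment
begin

text \<open>
  An event that is mapped into itself by measure preserving maps is almost surely invariant under them, and the shifts
  by \<open>(- t, x)\<close> with \<open>t > 0\<close> and \<open>\<bar>x\<bar> \<le> 1\<close> generate all shifts.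
  The ergodicity assumption concerns strictly invariant events, so the event is replaced by the set of environments
  for which almost every time belongs to it at all sites; this set is strictly invariant by translation invariance of
  Lebesgue measure.
\<close>

lemma forward_invariant_trivial:
  assumes A[measurable]: "A \<in> sets M"
    and fwd: "\<And>t x. 0 < t \<Longrightarrow> \<bar>x\<bar> \<le> 1 \<Longrightarrow> AE \<omega> in M. \<omega> \<in> A \<longrightarrow> \<tau> (- t) x \<omega> \<in> A"
  shows "measure M A \<in> {0, 1}"
proof -
  define Inv where "Inv t x \<longleftrightarrow> (AE \<omega> in M. \<tau> t x \<omega> \<in> A \<longleftrightarrow> \<omega> \<in> A)" for t x
  have Inv_neg: "Inv (- t) (- x)" if "Inv t x" for t x
    using AE_shift[OF that[unfolded Inv_def], of "- t" "- x"] AE_space unfolding Inv_def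
    by eventually_elim (auto simp: shift_add shift_zero)
  have Inv_add: "Inv (s + t) (y + x)" if "Inv t x" "Inv s y" for s t x y
    using AE_shift[OF that(2)[unfolded Inv_def], of t x] that(1)[unfolded Inv_def] AE_space unfolding Inv_def
    by eventually_elim (auto simp: shift_add)
  have bwd: "Inv (- t) x" if t: "0 < t" "\<bar>x\<bar> \<le> 1" for t x
  proof -
    let ?u = "\<lambda>\<omega>. indicator A (\<tau> (- t) x \<omega>) - indicator A \<omega> :: real"
    have i: "integrable M (indicator A :: 'a \<Rightarrow> real)" by (rule integrable_bounded[where C = 1]) (auto simp: indicator_def)
    have nn: "AE \<omega> in M. 0 \<le> ?u \<omega>"
      using fwd[OF t] by eventually_elim (auto simp: indicator_def)
    have iu: "integrable M ?u" using integrable_shift[OF i] i by simp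
    have "(LINT \<omega>|M. ?u \<omega>) = 0"
      using integrable_shift[OF i, of "- t" x] i integral_shift[of "indicator A :: 'a \<Rightarrow> real" "- t" x] by simp
    then have "AE \<omega> in M. ?u \<omega> = 0" using integral_nonneg_eq_0_iff_AE[OF iu nn] by simp
    then show ?thesis unfolding Inv_def by eventually_elim (auto simp: indicator_def split: if_splits)
  qed
  have fwd0: "Inv t 0" if "0 < t" for t using Inv_neg[OF bwd[OF that, of 0]] by simp
  have Inv00: "Inv 0 0" using Inv_add[OF fwd0[of 1] bwd[of 1 0]] by simp
  have time: "Inv t 0" for t
    using fwd0[of t] bwd[of "- t" 0] Inv00 by (cases t "0 :: real" rule: linorder_cases) auto
  \<comment> \<open>A space shift is composed of a step forward in time and a step back to a neighbouring site.\<close>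
  have one: "Inv 0 d" if "\<bar>d\<bar> \<le> 1" for d
    using Inv_add[OF fwd0[of 1] bwd[of 1 d]] that by simp
  have space: "Inv 0 x" for x
  proof (induction x rule: int_induct[where k = 0])
    case base
    show ?case by (rule Inv00)
  next
    case (step1 i)
    show ?case using Inv_add[OF step1(2) one[of 1]] by (simp add: add.commute)
  next
    case (step2 i)
    show ?case using Inv_add[OF step2(2) one[of "- 1"]] by simp
  qed
  have Inv: "Inv t x" for t x using Inv_add[OF time[of t] space[of x]] by simp
  define F where "F t \<omega> = (if \<forall>x. \<tau> t x \<omega> \<in> A then 0 else 1 :: ennreal)" for t \<omega>
  have [measurable]: "(\<lambda>p. F (fst p) (snd p)) \<in> borel_measurable (lborel \<Otimes>\<^sub>M M)"
    unfolding F_def by measurable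
  \<comment> \<open>The Lebesgue measure of the times at which some site leaves the event; it is invariant under all shifts.\<close>
  define I where "I \<omega> = (\<integral>\<^sup>+t. F t \<omega> \<partial>lborel)" for \<omega>
  have [measurable]: "I \<in> borel_measurable M"
    unfolding I_def[abs_def] F_def by measurable
  define A' where "A' = {\<omega> \<in> space M. I \<omega> = 0}"
  have A'[measurable]: "A' \<in> sets M" unfolding A'_def by measurable
  have Fm: "(\<lambda>t. F t \<omega>) \<in> borel_measurable borel" if "\<omega> \<in> space M" for \<omega>
  proof -
    have "(\<lambda>t. (t, \<omega>)) \<in> measurable borel (lborel \<Otimes>\<^sub>M M)" using that by simp
    from measurable_compose[OF this \<open>(\<lambda>p. F (fst p) (snd p)) \<in> _\<close>] show ?thesis by simp
  qed
  have I_shift: "I (\<tau> s y \<omega>) = I \<omega>" if \<omega>: "\<omega> \<in> space M" for s y \<omega>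
  proof -
    have Fs: "F t (\<tau> s y \<omega>) = F (s + 1 * t) \<omega>" for t
    proof -
      have "(\<forall>x. \<tau> t x (\<tau> s y \<omega>) \<in> A) \<longleftrightarrow> (\<forall>x. \<tau> (s + t) x \<omega> \<in> A)"
        unfolding shift_add[OF \<omega>] by (metis add.commute diff_add_cancel)
      then show ?thesis by (simp add: F_def)
    qed
    have "I \<omega> = (\<integral>\<^sup>+t. F (s + 1 * t) \<omega> \<partial>lborel)"
      unfolding I_def using nn_integral_real_affine[OF Fm[OF \<omega>], of 1 s] by simp
    then show ?thesis unfolding I_def Fs by simp
  qed
  have "measure M A' \<in> {0, 1}"
  proof (rule shift_ergodic[OF A'])
    fix t x
    show "\<tau> t x -` A' \<inter> space M = A'"
      unfolding A'_def using I_shift shift_in_space by auto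
  qed
  moreover have "measure M A = measure M A'"
  proof (rule measure_eq_AE[OF _ A A'])
    interpret pair_sigma_finite lborel M ..
    have "AE t in lborel. AE \<omega> in M. \<forall>x. \<tau> t x \<omega> \<in> A \<longleftrightarrow> \<omega> \<in> A"
    proof (rule AE_I2)
      fix t :: real
      show "AE \<omega> in M. \<forall>x. \<tau> t x \<omega> \<in> A \<longleftrightarrow> \<omega> \<in> A"
        unfolding AE_all_countable using Inv by (simp add: Inv_def)
    qed
    then have "AE \<omega> in M. AE t in lborel. \<forall>x. \<tau> t x \<omega> \<in> A \<longleftrightarrow> \<omega> \<in> A"
      by (subst (asm) AE_commute) measurable
    then show "AE \<omega> in M. \<omega> \<in> A \<longleftrightarrow> \<omega> \<in> A'"
      using AE_space
    proof eventually_elim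
      case (elim \<omega>)
      have "AE t in lborel. F t \<omega> = (if \<omega> \<in> A then 0 else 1)"
        using elim(1) by eventually_elim (auto simp: F_def)
      then have "I \<omega> = (\<integral>\<^sup>+t. (if \<omega> \<in> A then 0 else 1) \<partial>(lborel :: real measure))"
        unfolding I_def by (rule nn_integral_cong_AE)
      then show ?case using elim(2) by (auto simp: A'_def)
    qed
  qed
  ultimately show ?thesis by simp
qed

end

section \<open>Stationarity, positivity and ergodicity\<close>

context stationary_density
begin

definition column_average :: "real \<Rightarrow> 'a \<Rightarrow> ennreal" where
  "column_average t \<omega> = (\<integral>\<^sup>+x. ennreal (\<phi> (\<tau> t x \<omega>)) * ennreal (dual_kernel b t x 0 0 \<omega>) \<partial>count_space UNIV)"

lemma measurable_column_average [measurable]: "column_average t \<in> borel_measurable M"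
  unfolding column_average_def[abs_def] by measurable

text \<open>
  The duality inequality without source, for the nonnegative solution given by \<open>\<psi>\<close> along the shifts.
\<close>

lemma \<psi>_column_sum_le:
  assumes good: "good \<omega>" and nn: "\<forall>x s. 0 \<le> \<psi> (\<tau> s x \<omega>)" and t: "0 \<le> t"
  shows "(\<Sum>x\<in>{- int m..int m}. \<psi> (\<tau> t x \<omega>) * dual_kernel b t x 0 0 \<omega>) \<le> \<psi> \<omega>"
proof -
  have \<omega>: "\<omega> \<in> space M" using good by (simp add: good_def)
  interpret conductance_path b \<omega> by (rule path[OF \<omega>])
  have h: "primitive_from 0 (\<lambda>s. \<psi> (\<tau> s x \<omega>)) (\<lambda>s. - 0 - (b s (x + 1) \<omega> * \<psi> (\<tau> s (x + 1) \<omega>)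
       + b s (x - 1) \<omega> * \<psi> (\<tau> s (x - 1) \<omega>) - 2 * b s x \<omega> * \<psi> (\<tau> s x \<omega>)))" for x
    by (rule primitive_from_cong[OF \<psi>_primitive[OF good]])
       (simp_all add: L_plus_def conductance_shift shift_add \<omega> add.commute)
  have le: "(\<Sum>x\<in>{- int m..int m}. \<psi> (\<tau> t x \<omega>) * dual_kernel_n b n t x 0 0 \<omega>) \<le> \<psi> \<omega>" if n: "m \<le> n" for n
  proof -
    have "(\<Sum>x\<in>{- int m..int m}. \<psi> (\<tau> t x \<omega>) * dual_kernel_n b n t x 0 0 \<omega>)
       \<le> (\<Sum>x\<in>{0 - int (Suc n)..0 + int (Suc n)}. \<psi> (\<tau> t x \<omega>) * dual_kernel_n b n t x 0 0 \<omega>)"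
      by (rule sum_mono2) (use n nn Kn_nonneg[OF t] in auto)
    moreover have "(\<Sum>x\<in>{0 - int (Suc n)..0 + int (Suc n)}. \<psi> (\<tau> t x \<omega>) * dual_kernel_n b n t x 0 0 \<omega>)
       + (LINT r:{0..t}|lborel. 0 * (\<Sum>x\<in>{0 - int (Suc n)..0 + int (Suc n)}. dual_kernel_n b n r x 0 0 \<omega>)) \<le> \<psi> (\<tau> 0 0 \<omega>)"
    proof (rule duality_inequality[OF h _ _ t])
      show "set_integrable lborel {0..s} (\<lambda>s. 0 :: real)" for s :: real by (rule set_integrable_const_Icc)
    qed (use nn in auto)
    ultimately show ?thesis by (simp only: mult_zero_left set_lebesgue_integral_zero add_0_right shift_zero[OF \<omega>])
  qed
  show ?thesis
  proof (rule LIMSEQ_le_const2)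
    show "(\<lambda>n. \<Sum>x\<in>{- int m..int m}. \<psi> (\<tau> t x \<omega>) * dual_kernel_n b n t x 0 0 \<omega>)
      \<longlonglongrightarrow> (\<Sum>x\<in>{- int m..int m}. \<psi> (\<tau> t x \<omega>) * dual_kernel b t x 0 0 \<omega>)"
      by (intro tendsto_sum tendsto_mult tendsto_const Kn_tendsto_K t)
    show "\<exists>k. \<forall>n\<ge>k. (\<Sum>x\<in>{- int m..int m}. \<psi> (\<tau> t x \<omega>) * dual_kernel_n b n t x 0 0 \<omega>) \<le> \<psi> \<omega>"
      using le by blast
  qed
qed

lemma column_average_le:
  assumes t: "0 \<le> t"
  shows "AE \<omega> in M. column_average t \<omega> \<le> ennreal (\<phi> \<omega>)"
proof -
  have "AE \<omega> in M. \<forall>x. \<psi> (\<tau> t x \<omega>) = \<phi> (\<tau> t x \<omega>)"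
    unfolding AE_all_countable by (intro allI AE_shift \<psi>_eq_\<phi>)
  then show ?thesis
    using \<psi>_eq_\<phi> AE_good \<psi>_nonneg_everywhere
  proof eventually_elim
    case (elim \<omega>)
    have \<omega>: "\<omega> \<in> space M" using elim(3) by (simp add: good_def)
    interpret conductance_path b \<omega> by (rule path[OF \<omega>])
    have "(\<Sum>x\<in>{- int m..int m}. ennreal (\<phi> (\<tau> t x \<omega>)) * ennreal (dual_kernel b t x 0 0 \<omega>)) \<le> ennreal (\<phi> \<omega>)" for m
    proof -
      have "(\<Sum>x\<in>{- int m..int m}. ennreal (\<phi> (\<tau> t x \<omega>)) * ennreal (dual_kernel b t x 0 0 \<omega>))
         = ennreal (\<Sum>x\<in>{- int m..int m}. \<psi> (\<tau> t x \<omega>) * dual_kernel b t x 0 0 \<omega>)"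
        using elim(1) \<phi>_nonneg K_nonneg[OF t] by (subst sum_ennreal[symmetric]) (auto simp: ennreal_mult)
      also have "\<dots> \<le> ennreal (\<phi> \<omega>)"
        using \<psi>_column_sum_le[OF elim(3,4) t, of m] elim(2) by (intro ennreal_leI) simp
      finally show ?thesis .
    qed
    then show ?case unfolding column_average_def nn_integral_int_SUP by (intro SUP_least)
  qed
qed

lemma nn_integral_\<phi>: "(\<integral>\<^sup>+\<omega>. ennreal (\<phi> \<omega>) \<partial>M) = 1"
  using nn_integral_eq_integral[OF energy_space_integrable(1)[OF \<phi>_energy]] \<phi>_nonneg \<phi>_integral by simp

text \<open>
  Duality with the constant test function and conservation of mass.
\<close>

lemma expected_column_average:
  assumes t: "0 \<le> t"
  shows "(\<integral>\<^sup>+\<omega>. column_average t \<omega> \<partial>M) = 1"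
proof -
  have "(\<integral>\<^sup>+\<omega>. column_average t \<omega> \<partial>M)
     = (\<integral>\<^sup>+\<omega>. ennreal (\<phi> \<omega>) * (\<integral>\<^sup>+y. ennreal (dual_kernel b 0 0 (- t) y \<omega>) \<partial>count_space UNIV) \<partial>M)"
    using dual_kernel_duality[of "\<lambda>_. 1" "\<lambda>\<omega>. ennreal (\<phi> \<omega>)" t] by (simp add: column_average_def)
  also have "\<dots> = (\<integral>\<^sup>+\<omega>. ennreal (\<phi> \<omega>) \<partial>M)"
  proof (rule nn_integral_cong)
    fix \<omega> assume "\<omega> \<in> space M"
    then interpret conductance_path b \<omega> by (rule path)
    show "ennreal (\<phi> \<omega>) * (\<integral>\<^sup>+y. ennreal (dual_kernel b 0 0 (- t) y \<omega>) \<partial>count_space UNIV) = ennreal (\<phi> \<omega>)"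
      using K_total_mass[of "- t" 0 0] t by simp
  qed
  finally show ?thesis unfolding nn_integral_\<phi> .
qed

text \<open>
  One inequality comes from duality with the continuous version; equality of the expectations makes it an identity.
\<close>

lemma column_average_eq:
  assumes t: "0 \<le> t"
  shows "AE \<omega> in M. column_average t \<omega> = ennreal (\<phi> \<omega>)"
proof -
  have "(\<integral>\<^sup>+\<omega>. ennreal (\<phi> \<omega>) - column_average t \<omega> \<partial>M) = (\<integral>\<^sup>+\<omega>. ennreal (\<phi> \<omega>) \<partial>M) - (\<integral>\<^sup>+\<omega>. column_average t \<omega> \<partial>M)"
    by (rule nn_integral_diff[OF _ _ _ column_average_le[OF t]]) (auto simp: expected_column_average[OF t])
  then have "(\<integral>\<^sup>+\<omega>. ennreal (\<phi> \<omega>) - column_average t \<omega> \<partial>M) = 0"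
    by (simp add: nn_integral_\<phi> expected_column_average[OF t])
  then have "AE \<omega> in M. ennreal (\<phi> \<omega>) - column_average t \<omega> = 0"
    by (subst (asm) nn_integral_0_iff_AE) auto
  with column_average_le[OF t] show ?thesis
    by eventually_elim (auto simp: diff_eq_0_iff_ennreal intro: antisym)
qed

lemma column_average_has_sum:
  assumes t: "0 < t"
  shows "AE \<omega> in M. ((\<lambda>x. \<phi> (\<tau> t x \<omega>) * dual_kernel b t x 0 0 \<omega>) has_sum \<phi> \<omega>) UNIV"
  using column_average_eq[OF less_imp_le[OF t]] AE_space
proof eventually_elim
  case (elim \<omega>)
  interpret conductance_path b \<omega> by (rule path[OF elim(2)])
  have K0: "0 \<le> dual_kernel b t x 0 0 \<omega>" for x by (rule K_nonneg) (use t in simp)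
  show ?case
  proof (rule has_sum_of_nn_integral_int)
    show "0 \<le> \<phi> (\<tau> t x \<omega>) * dual_kernel b t x 0 0 \<omega>" for x using K0 \<phi>_nonneg by simp
    show "(\<integral>\<^sup>+x. ennreal (\<phi> (\<tau> t x \<omega>) * dual_kernel b t x 0 0 \<omega>) \<partial>count_space UNIV) = ennreal (\<phi> \<omega>)"
      using elim(1) K0 \<phi>_nonneg by (simp add: column_average_def ennreal_mult)
  qed (rule \<phi>_nonneg)
qed

abbreviation Q :: "'a measure" where
  "Q \<equiv> density M (\<lambda>\<omega>. ennreal (\<phi> \<omega>))"

lemma emeasure_induced_kernel:
  assumes a: "a \<in> space M" and A: "A \<in> sets M"
  shows "emeasure (induced_kernel M b \<tau> t a) A
     = (\<integral>\<^sup>+y. ennreal (dual_kernel b 0 0 (- t) y a) * indicator A (\<tau> (- t) y a) \<partial>count_space UNIV)"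
proof -
  have m: "(\<lambda>y. \<tau> (- t) y a) \<in> measurable (dual_walk_law b t a) M"
    unfolding dual_walk_law_def by (auto simp: measurable_density_eq1 measurable_count_space_eq1 shift_in_space a)
  have "emeasure (induced_kernel M b \<tau> t a) A = emeasure (dual_walk_law b t a) ((\<lambda>y. \<tau> (- t) y a) -` A)"
    unfolding induced_kernel_def by (subst emeasure_distr[OF m A]) (simp add: dual_walk_law_def)
  also have "\<dots> = (\<integral>\<^sup>+y. ennreal (dual_kernel b 0 0 (- t) y a) * indicator ((\<lambda>y. \<tau> (- t) y a) -` A) y \<partial>count_space UNIV)"
    unfolding dual_walk_law_def by (rule emeasure_density) auto
  finally show ?thesis by (simp add: indicator_def vimage_def)
qed

text \<open>
  The adjoint of the transition operator fixes \<open>\<phi>\<close>.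
\<close>

lemma stationary: "induced_stationary M b \<tau> Q"
  unfolding induced_stationary_def
proof (intro allI impI ballI)
  fix t :: real and A assume t: "0 \<le> t" and A[measurable]: "A \<in> sets M"
  have "(\<integral>\<^sup>+a. emeasure (induced_kernel M b \<tau> t a) A \<partial>Q)
     = (\<integral>\<^sup>+a. (\<integral>\<^sup>+y. ennreal (dual_kernel b 0 0 (- t) y a) * indicator A (\<tau> (- t) y a) \<partial>count_space UNIV) \<partial>Q)"
    by (rule nn_integral_cong) (simp add: emeasure_induced_kernel)
  also have "\<dots> = (\<integral>\<^sup>+a. ennreal (\<phi> a) * (\<integral>\<^sup>+y. ennreal (dual_kernel b 0 0 (- t) y a) * indicator A (\<tau> (- t) y a) \<partial>count_space UNIV) \<partial>M)"
    by (rule nn_integral_density) measurable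
  also have "\<dots> = (\<integral>\<^sup>+\<omega>. column_average t \<omega> * indicator A \<omega> \<partial>M)"
    unfolding column_average_def by (rule dual_kernel_duality[symmetric]) measurable
  also have "\<dots> = (\<integral>\<^sup>+\<omega>. ennreal (\<phi> \<omega>) * indicator A \<omega> \<partial>M)"
    by (rule nn_integral_cong_AE) (use column_average_eq[OF t] in \<open>auto elim!: eventually_mono\<close>)
  also have "\<dots> = emeasure Q A" by (rule emeasure_density[symmetric]) auto
  finally show "(\<integral>\<^sup>+a. emeasure (induced_kernel M b \<tau> t a) A \<partial>Q) = emeasure Q A" .
qed

text \<open>
  If \<open>\<phi>\<close> is positive at a neighbouring space-time point in the future, then the column sum, and
  hence \<open>\<phi>\<close> itself, is positive here. So positivity propagates backward in time along the dual walk,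
  and the event is trivial; it has positive probability since \<open>\<phi>\<close> has expectation 1.
\<close>

lemma \<phi>_positive: "AE \<omega> in M. 0 < \<phi> \<omega>"
proof -
  define A where "A = {\<omega> \<in> space M. 0 < \<phi> \<omega>}"
  have A[measurable]: "A \<in> sets M" unfolding A_def by measurable
  have "measure M A \<in> {0, 1}"
  proof (rule forward_invariant_trivial[OF A])
    fix t :: real and x :: int assume t: "0 < t" and x: "\<bar>x\<bar> \<le> 1"
    have "AE \<omega> in M. 0 < \<phi> (\<tau> t (- x) \<omega>) \<longrightarrow> 0 < \<phi> \<omega>"
      using column_average_has_sum[OF t] AE_space
    proof eventually_elim
      case (elim \<omega>)
      interpret conductance_path b \<omega> by (rule path[OF elim(2)])
      show ?case
      proof
        assume "0 < \<phi> (\<tau> t (- x) \<omega>)"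
        then have "0 < \<phi> (\<tau> t (- x) \<omega>) * dual_kernel b t (- x) 0 0 \<omega>"
          using K_positive[OF t, of "- x" 0] x by simp
        also have "\<dots> \<le> \<phi> \<omega>"
        proof -
          have "(\<Sum>x\<in>{- x}. \<phi> (\<tau> t x \<omega>) * dual_kernel b t x 0 0 \<omega>) \<le> \<phi> \<omega>"
            using elim(1)
          proof (rule finite_sum_le_has_sum)
            show "0 \<le> \<phi> (\<tau> t y \<omega>) * dual_kernel b t y 0 0 \<omega>" for y
              using \<phi>_nonneg K_nonneg[of 0 t y 0] t by simp
          qed auto
          then show ?thesis by simp
        qed
        finally show "0 < \<phi> \<omega>" .
      qed
    qed
    from AE_shift[OF this, of "- t" x] AE_space
    show "AE \<omega> in M. \<omega> \<in> A \<longrightarrow> \<tau> (- t) x \<omega> \<in> A"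
      by eventually_elim (auto simp: A_def shift_add shift_zero shift_in_space)
  qed
  moreover have "measure M A \<noteq> 0"
  proof
    assume "measure M A = 0"
    then have "AE \<omega> in M. \<omega> \<notin> A"
      by (subst (asm) prob_eq_0[OF A])
    then have "AE \<omega> in M. \<phi> \<omega> = 0"
      using AE_space by eventually_elim (use \<phi>_nonneg in \<open>auto simp: A_def not_less intro: antisym\<close>)
    then have "(LINT \<omega>|M. \<phi> \<omega>) = 0" by (rule integral_eq_zero_AE)
    then show False using \<phi>_integral by simp
  qed
  ultimately have "AE \<omega> in M. \<omega> \<in> A" using prob_eq_1[OF A] by simp
  then show ?thesis by eventually_elim (simp add: A_def)
qed

text \<open>
  Since \<open>\<phi>\<close> is positive, the statement holds for almost every environment with respect to
  \<open>M\<close>; the walk reaches the neighbours of its starting point with positive probability, so the event is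
  forward invariant.
\<close>

lemma ergodic: "induced_ergodic M b \<tau> Q"
  unfolding induced_ergodic_def
proof (intro ballI impI)
  fix A assume A[measurable]: "A \<in> sets M"
    and inv: "AE a in Q. a \<in> A \<longrightarrow> (\<forall>t>0. AE y in dual_walk_law b t a. \<tau> (- t) y a \<in> A)"
  have "AE a in M. 0 < ennreal (\<phi> a) \<longrightarrow> a \<in> A \<longrightarrow> (\<forall>t>0. AE y in dual_walk_law b t a. \<tau> (- t) y a \<in> A)"
    using inv by (subst (asm) AE_density) auto
  then have step: "AE a in M. a \<in> A \<longrightarrow> (\<forall>t>0. \<forall>y. \<bar>y\<bar> \<le> 1 \<longrightarrow> \<tau> (- t) y a \<in> A)"
    using \<phi>_positive AE_space
  proof eventually_elim
    case (elim a)
    interpret conductance_path b a by (rule path[OF elim(3)])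
    show ?case
    proof (intro impI allI)
      fix t :: real and y :: int assume a: "a \<in> A" and t: "0 < t" and y: "\<bar>y\<bar> \<le> 1"
      have "AE y in dual_walk_law b t a. \<tau> (- t) y a \<in> A" using elim a t by simp
      then have "AE y in count_space UNIV. 0 < ennreal (dual_kernel b 0 0 (- t) y a) \<longrightarrow> \<tau> (- t) y a \<in> A"
        unfolding dual_walk_law_def by (subst (asm) AE_density) auto
      then show "\<tau> (- t) y a \<in> A"
        using K_positive[of "- t" 0 0 y] t y by (simp add: AE_count_space)
    qed
  qed
  have "measure M A \<in> {0, 1}"
  proof (rule forward_invariant_trivial[OF A])
    fix t :: real and x :: int assume "0 < t" "\<bar>x\<bar> \<le> 1"
    then show "AE \<omega> in M. \<omega> \<in> A \<longrightarrow> \<tau> (- t) x \<omega> \<in> A"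
      using step by (auto elim!: eventually_mono)
  qed
  then consider "AE \<omega> in M. \<omega> \<notin> A" | "AE \<omega> in M. \<omega> \<in> A"
    using prob_eq_0[OF A] prob_eq_1[OF A] by auto
  then show "measure Q A \<in> {0, 1}"
  proof cases
    case 1
    have "emeasure Q A = (\<integral>\<^sup>+\<omega>. ennreal (\<phi> \<omega>) * indicator A \<omega> \<partial>M)" by (rule emeasure_density) auto
    also have "\<dots> = (\<integral>\<^sup>+\<omega>. 0 \<partial>M)" by (rule nn_integral_cong_AE) (use 1 in \<open>auto elim!: eventually_mono\<close>)
    finally show ?thesis by (simp add: measure_def)
  next
    case 2
    have "emeasure Q A = (\<integral>\<^sup>+\<omega>. ennreal (\<phi> \<omega>) * indicator A \<omega> \<partial>M)" by (rule emeasure_density) auto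
    also have "\<dots> = (\<integral>\<^sup>+\<omega>. ennreal (\<phi> \<omega>) \<partial>M)" by (rule nn_integral_cong_AE) (use 2 in \<open>auto elim!: eventually_mono\<close>)
    finally show ?thesis by (simp add: measure_def nn_integral_\<phi>)
  qed
qed

end

section \<open>The limit theorem\<close>

theorem theorem5p5:
  fixes M :: "'a measure"
    and b :: "real \<Rightarrow> int \<Rightarrow> 'a \<Rightarrow> real"
    and \<tau> :: "real \<Rightarrow> int \<Rightarrow> 'a \<Rightarrow> 'a"
  assumes "dynamical_environment M b \<tau>"
    and "integrable M (b 0 0)"
    and "integrable M (\<lambda>\<omega>. inverse (b 0 0 \<omega>))"
  shows
    "(\<forall>\<epsilon>>0. \<exists>\<Phi>. continuous_linear_functional_H M b \<Phi> \<and> extends_phi_eps M b \<epsilon> \<Phi> \<and>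
        (\<forall>f\<in>H_space M b. \<bar>\<Phi> f\<bar> \<le> sqrt (LINT \<omega>|M. b 0 0 \<omega>) * H_norm M b f)) \<and>
     (\<forall>\<Phi>. (\<forall>\<epsilon>>0. continuous_linear_functional_H M b (\<Phi> \<epsilon>) \<and> extends_phi_eps M b \<epsilon> (\<Phi> \<epsilon>)) \<longrightarrow>
        (\<exists>e. decreases_to_0 e \<and> (\<forall>f\<in>H_space M b. convergent (\<lambda>k. \<Phi> (e k) f))) \<and>
        (\<forall>e. decreases_to_0 e \<and> (\<forall>f\<in>H_space M b. convergent (\<lambda>k. \<Phi> (e k) f)) \<longrightarrow>
          (\<exists>\<phi>\<in>borel_measurable M.
             (\<forall>f\<in>H_space M b. integrable M (\<lambda>\<omega>. \<phi> \<omega> * f \<omega>) \<and>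
                (\<lambda>k. \<Phi> (e k) f) \<longlonglongrightarrow> (LINT \<omega>|M. \<phi> \<omega> * f \<omega>)) \<and>
             (AE \<omega> in M. \<phi> \<omega> \<ge> 0) \<and>
             integrable M \<phi> \<and> (LINT \<omega>|M. \<phi> \<omega>) = 1 \<and>
             integrable M (\<lambda>\<omega>. b 0 0 \<omega> * (\<phi> \<omega>)\<^sup>2) \<and>
             (LINT \<omega>|M. b 0 0 \<omega> * (\<phi> \<omega>)\<^sup>2) \<le> (LINT \<omega>|M. b 0 0 \<omega>) \<and>
             (\<forall>t>0. AE \<omega> in M.
                ((\<lambda>x. \<phi> (\<tau> t x \<omega>) * dual_kernel b t x 0 0 \<omega>) has_sum \<phi> \<omega>) UNIV) \<and>
             (\<exists>\<psi>\<in>borel_measurable M.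
                (AE \<omega> in M. \<psi> \<omega> = \<phi> \<omega>) \<and>
                (AE \<omega> in M. \<psi> \<omega> > 0) \<and>
                (AE \<omega> in M. \<forall>x.
                   continuous_on UNIV (\<lambda>t. \<psi> (\<tau> t x \<omega>)) \<and>
                   (\<forall>t1 t2. t1 \<le> t2 \<longrightarrow>
                      set_integrable lborel {t1..t2} (\<lambda>s. L_plus b \<tau> \<psi> (\<tau> s x \<omega>)) \<and>
                      \<psi> (\<tau> t2 x \<omega>) - \<psi> (\<tau> t1 x \<omega>)
                        + (LINT s:{t1..t2}|lborel. L_plus b \<tau> \<psi> (\<tau> s x \<omega>)) = 0))) \<and>
             induced_stationary M b \<tau> (density M (\<lambda>\<omega>. ennreal (\<phi> \<omega>))) \<and>
             induced_ergodic M b \<tau> (density M (\<lambda>\<omega>. ennreal (\<phi> \<omega>))))))"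
proof -
  interpret integrable_environment M b \<tau>
    by (intro integrable_environment.intro integrable_environment_axioms.intro assms)
  have pairing: "\<Phi> \<epsilon> f = (LINT \<omega>|M. varphi_eps b \<epsilon> \<omega> * f \<omega>)"
    if "\<forall>\<epsilon>>0. continuous_linear_functional_H M b (\<Phi> \<epsilon>) \<and> extends_phi_eps M b \<epsilon> (\<Phi> \<epsilon>)" "0 < \<epsilon>" "f \<in> H_space M b"
    for \<Phi> \<epsilon> f
    using that by (intro extension_unique) auto
  have limit: "\<exists>\<phi>\<in>borel_measurable M.
             (\<forall>f\<in>H_space M b. integrable M (\<lambda>\<omega>. \<phi> \<omega> * f \<omega>) \<and>
                (\<lambda>k. \<Phi> (e k) f) \<longlonglongrightarrow> (LINT \<omega>|M. \<phi> \<omega> * f \<omega>)) \<and>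
             (AE \<omega> in M. \<phi> \<omega> \<ge> 0) \<and>
             integrable M \<phi> \<and> (LINT \<omega>|M. \<phi> \<omega>) = 1 \<and>
             integrable M (\<lambda>\<omega>. b 0 0 \<omega> * (\<phi> \<omega>)\<^sup>2) \<and>
             (LINT \<omega>|M. b 0 0 \<omega> * (\<phi> \<omega>)\<^sup>2) \<le> (LINT \<omega>|M. b 0 0 \<omega>) \<and>
             (\<forall>t>0. AE \<omega> in M.
                ((\<lambda>x. \<phi> (\<tau> t x \<omega>) * dual_kernel b t x 0 0 \<omega>) has_sum \<phi> \<omega>) UNIV) \<and>
             (\<exists>\<psi>\<in>borel_measurable M.
                (AE \<omega> in M. \<psi> \<omega> = \<phi> \<omega>) \<and>
                (AE \<omega> in M. \<psi> \<omega> > 0) \<and>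
                (AE \<omega> in M. \<forall>x.
                   continuous_on UNIV (\<lambda>t. \<psi> (\<tau> t x \<omega>)) \<and>
                   (\<forall>t1 t2. t1 \<le> t2 \<longrightarrow>
                      set_integrable lborel {t1..t2} (\<lambda>s. L_plus b \<tau> \<psi> (\<tau> s x \<omega>)) \<and>
                      \<psi> (\<tau> t2 x \<omega>) - \<psi> (\<tau> t1 x \<omega>)
                        + (LINT s:{t1..t2}|lborel. L_plus b \<tau> \<psi> (\<tau> s x \<omega>)) = 0))) \<and>
             induced_stationary M b \<tau> (density M (\<lambda>\<omega>. ennreal (\<phi> \<omega>))) \<and>
             induced_ergodic M b \<tau> (density M (\<lambda>\<omega>. ennreal (\<phi> \<omega>)))"
    if \<Phi>: "\<forall>\<epsilon>>0. continuous_linear_functional_H M b (\<Phi> \<epsilon>) \<and> extends_phi_eps M b \<epsilon> (\<Phi> \<epsilon>)"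
      and e: "decreases_to_0 e \<and> (\<forall>f\<in>H_space M b. convergent (\<lambda>k. \<Phi> (e k) f))" for \<Phi> e
  proof -
    have e0: "\<And>k. 0 < e k" and elim: "e \<longlonglongrightarrow> 0"
      using e by (auto simp: decreases_to_0_def)
    have eq: "\<Phi> (e k) f = (LINT \<omega>|M. varphi_eps b (e k) \<omega> * f \<omega>)" if "f \<in> H_space M b" for k f
      by (rule pairing[OF \<Phi> e0 that])
    have conv: "convergent (\<lambda>k. LINT \<omega>|M. varphi_eps b (e k) \<omega> * f \<omega>)" if "f \<in> H_space M b" for f
      using e that by (simp add: eq)
    obtain \<phi> where \<phi>: "\<phi> \<in> borel_measurable M" "\<And>\<omega>. 0 \<le> \<phi> \<omega>" "\<phi> \<in> energy_space" "energy_inner \<phi> \<phi> \<le> (LINT \<omega>|M. b 0 0 \<omega>)"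
      and \<phi>f: "\<And>f. f \<in> H_space M b \<Longrightarrow> integrable M (\<lambda>\<omega>. \<phi> \<omega> * f \<omega>)"
      and lim: "\<And>f. f \<in> H_space M b \<Longrightarrow> (\<lambda>k. LINT \<omega>|M. varphi_eps b (e k) \<omega> * f \<omega>) \<longlonglongrightarrow> (LINT \<omega>|M. \<phi> \<omega> * f \<omega>)"
      using weak_limit_density[OF e0 conv] by blast
    have "(\<lambda>k. LINT \<omega>|M. varphi_eps b (e k) \<omega> * 1) \<longlonglongrightarrow> (LINT \<omega>|M. \<phi> \<omega> * 1)"
      by (rule lim[OF H_const])
    then have one: "(LINT \<omega>|M. \<phi> \<omega>) = 1"
      using integral_varphi_eps(2)[OF e0] by (simp add: LIMSEQ_const_iff)
    interpret stationary_density M b \<tau> \<phi>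
    proof (unfold_locales, rule \<phi>(1), rule \<phi>(2), rule \<phi>(3), rule one)
      fix F :: "'a \<Rightarrow> real" and C t :: real
      assume F: "F \<in> borel_measurable M" "\<And>\<omega>. \<omega> \<in> space M \<Longrightarrow> \<bar>F \<omega>\<bar> \<le> C" "0 \<le> t"
      show "(LINT \<omega>|M. \<phi> \<omega> * F (\<tau> (- t) 0 \<omega>)) - (LINT \<omega>|M. \<phi> \<omega> * F \<omega>)
         + (LINT \<omega>|M. b 0 0 \<omega> * \<phi> \<omega> * backward_laplacian t F \<omega>) = 0"
        by (rule weak_limit_equation[OF e0 elim lim F])
    qed
    have pos: "AE \<omega> in M. 0 < \<psi> \<omega>"
      using \<psi>_eq_\<phi> \<phi>_positive by eventually_elim simp
    have paths: "AE \<omega> in M. \<forall>x. continuous_on UNIV (\<lambda>t. \<psi> (\<tau> t x \<omega>)) \<and>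
        (\<forall>t1 t2. t1 \<le> t2 \<longrightarrow> set_integrable lborel {t1..t2} (\<lambda>s. L_plus b \<tau> \<psi> (\<tau> s x \<omega>)) \<and>
           \<psi> (\<tau> t2 x \<omega>) - \<psi> (\<tau> t1 x \<omega>) + (LINT s:{t1..t2}|lborel. L_plus b \<tau> \<psi> (\<tau> s x \<omega>)) = 0)"
      using AE_good by eventually_elim (intro allI \<psi>_path_properties)
    show ?thesis
    proof (rule bexI[OF _ \<phi>(1)], intro conjI ballI allI impI)
      show "(\<lambda>k. \<Phi> (e k) f) \<longlonglongrightarrow> (LINT \<omega>|M. \<phi> \<omega> * f \<omega>)" if "f \<in> H_space M b" for f
        unfolding eq[OF that] by (rule lim[OF that])
      show "integrable M \<phi>" by (rule energy_space_integrable(1)[OF \<phi>(3)])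
      show "integrable M (\<lambda>\<omega>. b 0 0 \<omega> * (\<phi> \<omega>)\<^sup>2)" using \<phi>(3) by (simp add: energy_space_def)
      show "(LINT \<omega>|M. b 0 0 \<omega> * (\<phi> \<omega>)\<^sup>2) \<le> (LINT \<omega>|M. b 0 0 \<omega>)"
        using \<phi>(4) by (simp add: energy_inner_def power2_eq_square)
      show "\<exists>\<psi>\<in>borel_measurable M.
                (AE \<omega> in M. \<psi> \<omega> = \<phi> \<omega>) \<and>
                (AE \<omega> in M. \<psi> \<omega> > 0) \<and>
                (AE \<omega> in M. \<forall>x.
                   continuous_on UNIV (\<lambda>t. \<psi> (\<tau> t x \<omega>)) \<and>
                   (\<forall>t1 t2. t1 \<le> t2 \<longrightarrow>
                      set_integrable lborel {t1..t2} (\<lambda>s. L_plus b \<tau> \<psi> (\<tau> s x \<omega>)) \<and>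
                      \<psi> (\<tau> t2 x \<omega>) - \<psi> (\<tau> t1 x \<omega>)
                        + (LINT s:{t1..t2}|lborel. L_plus b \<tau> \<psi> (\<tau> s x \<omega>)) = 0))"
        by (rule bexI[OF _ measurable_\<psi>]) (intro conjI \<psi>_eq_\<phi> pos paths)
    qed (use \<phi>f lim one \<phi>(2) column_average_has_sum stationary ergodic in auto)
  qed
  show ?thesis
  proof (intro conjI allI impI)
    fix \<epsilon> :: real assume \<epsilon>: "0 < \<epsilon>"
    show "\<exists>\<Phi>. continuous_linear_functional_H M b \<Phi> \<and> extends_phi_eps M b \<epsilon> \<Phi> \<and>
        (\<forall>f\<in>H_space M b. \<bar>\<Phi> f\<bar> \<le> sqrt (LINT \<omega>|M. b 0 0 \<omega>) * H_norm M b f)"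
      using varphi_eps_functional[OF \<epsilon>] varphi_eps_pairing(2)[OF \<epsilon>]
      by (intro exI[of _ "\<lambda>f. LINT \<omega>|M. varphi_eps b \<epsilon> \<omega> * f \<omega>"]) auto
  next
    fix \<Phi> :: "real \<Rightarrow> ('a \<Rightarrow> real) \<Rightarrow> real"
    assume \<Phi>: "\<forall>\<epsilon>>0. continuous_linear_functional_H M b (\<Phi> \<epsilon>) \<and> extends_phi_eps M b \<epsilon> (\<Phi> \<epsilon>)"
    obtain e where e: "decreases_to_0 e" "\<forall>f\<in>H_space M b. convergent (\<lambda>k. LINT \<omega>|M. varphi_eps b (e k) \<omega> * f \<omega>)"
      using convergent_subsequence_exists by blast
    then have e0: "0 < e k" for k by (simp add: decreases_to_0_def)
    have "convergent (\<lambda>k. \<Phi> (e k) f)" if f: "f \<in> H_space M b" for f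
      unfolding pairing[OF \<Phi> e0 f] using e(2) f by blast
    with e(1) show "\<exists>e. decreases_to_0 e \<and> (\<forall>f\<in>H_space M b. convergent (\<lambda>k. \<Phi> (e k) f))"
      by blast
  qed (rule limit)
qed

end
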